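(* Let $\Phi$ be an indecomposable root system of rank $\ell>1$, $\Phi\neq\mathbf C_2$, let $R$ be an arbitrary commutative ring with $1$, and let $G$ be a large subgroup of $G_\pi(\Phi,R)$. Then for any root $\alpha\in\Phi$ the subgroup $X_\alpha=\{x_\alpha(t)\mid t\in R\}$ is Diophantine in $G$ (defined with constants from $\{x_\beta(1)\mid\beta\in\Phi\}$).
   Context: Root systems are reduced, and $\mathbf B_2$ is identified with $\mathbf C_2$. Let $\mathcal L$ be the complex semisimple Lie algebra with root system $\Phi$, with Chevalley basis $\{h_i;x_\alpha\}$, and let $\pi$ be a faithful finite-dimensional representation of $\mathcal L$ with weight lattice $\Lambda_\pi$ (a lattice between the root lattice and the lattice of all weights). $G_\pi(\Phi,R)$ denotes the Chevalley group of type $(\Phi,\Lambda_\pi)$ over $R$, i.e. the group of $R$-points of the Chevalley--Demazure group scheme, realized as the subgroup of $\mathrm{SL}_n(R)$, $n=\dim\pi$, given by polynomial equations with integer coefficients in the matrix entries. For $\alpha\in\Phi$, $t\in R$, $x_\alpha(t)=\exp(t\pi(x_\alpha))$ is the elementary root unipotent; $E_\pi(\Phi,R)$ is the subgroup generated by all $x_\alpha(t)$; a subgroup of $G_\pi(\Phi,R)$ is large if it contains $E_\pi(\Phi,R)$. A subset $H$ of a group $G$ is Diophantine in $G$ if it is definable in $G$ by a formula $\exists y_1\dots\exists y_n\bigwedge_{i=1}^k w_i(x,y_1,\dots,y_n)=1$, where each $w_i$ is a group word in $x,y_1,\dots,y_n$ and constants from $G$; "defined with constants from a set $C$" means all constants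 used belong to $C$. *)

theory Defs
  imports
    "HOL-Analysis.Analysis"
    "HOL-Algebra.Generated_Groups"
    "HOL-Library.Poly_Mapping"
begin

section \<open>Root systems\<close>

definition cartan_number :: "'e::euclidean_space \<Rightarrow> 'e \<Rightarrow> real" where
  "cartan_number \<beta> \<alpha> = 2 * (\<beta> \<bullet> \<alpha>) / (\<alpha> \<bullet> \<alpha>)"

definition coroot :: "'e::euclidean_space \<Rightarrow> 'e" where
  "coroot \<alpha> = (2 / (\<alpha> \<bullet> \<alpha>)) *\<^sub>R \<alpha>"

text \<open>Root systems are reduced and crystallographic, and span the ambient space, so that the rank
  is \<open>DIM('e)\<close>.\<close>

definition root_system :: "'e::euclidean_space set \<Rightarrow> bool" where
  "root_system \<Phi> \<longleftrightarrow>
     finite \<Phi> \<and> span \<Phi> = UNIV \<and> 0 \<notin> \<Phi> \<and>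
     (\<forall>\<alpha>\<in>\<Phi>. \<forall>c. c *\<^sub>R \<alpha> \<in> \<Phi> \<longleftrightarrow> c = 1 \<or> c = -1) \<and>
     (\<forall>\<alpha>\<in>\<Phi>. \<forall>\<beta>\<in>\<Phi>. \<beta> - cartan_number \<beta> \<alpha> *\<^sub>R \<alpha> \<in> \<Phi>) \<and>
     (\<forall>\<alpha>\<in>\<Phi>. \<forall>\<beta>\<in>\<Phi>. cartan_number \<beta> \<alpha> \<in> \<int>)"

definition indecomposable :: "'e::euclidean_space set \<Rightarrow> bool" where
  "indecomposable \<Phi> \<longleftrightarrow>
     \<Phi> \<noteq> {} \<and>
     (\<nexists>\<Phi>1 \<Phi>2. \<Phi>1 \<noteq> {} \<and> \<Phi>2 \<noteq> {} \<and> \<Phi> = \<Phi>1 \<union> \<Phi>2 \<and> (\<forall>\<alpha>\<in>\<Phi>1. \<forall>\<beta>\<in>\<Phi>2. \<alpha> \<bullet> \<beta> = 0))"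

definition simple_roots :: "'e::euclidean_space set \<Rightarrow> 'e set \<Rightarrow> bool" where
  "simple_roots \<Phi> \<Delta> \<longleftrightarrow>
     \<Delta> \<subseteq> \<Phi> \<and> independent \<Delta> \<and>
     (\<forall>\<beta>\<in>\<Phi>. \<exists>c :: 'e \<Rightarrow> int. \<beta> = (\<Sum>\<delta>\<in>\<Delta>. of_int (c \<delta>) *\<^sub>R \<delta>) \<and>
        ((\<forall>\<delta>\<in>\<Delta>. c \<delta> \<ge> 0) \<or> (\<forall>\<delta>\<in>\<Delta>. c \<delta> \<le> 0)))"

definition root_system_iso :: "'e::euclidean_space set \<Rightarrow> 'f::euclidean_space set \<Rightarrow> bool" where
  "root_system_iso \<Phi> \<Psi> \<longleftrightarrow>
     (\<exists>f. linear f \<and> bij f \<and> f ` \<Phi> = \<Psi> \<and>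
        (\<forall>\<alpha>\<in>\<Phi>. \<forall>\<beta>\<in>\<Phi>. cartan_number (f \<beta>) (f \<alpha>) = cartan_number \<beta> \<alpha>))"

text \<open>Also the isomorphism type of \<open>B\<^sub>2\<close>.\<close>

definition C2 :: "(real \<times> real) set" where
  "C2 = {(2, 0), (-2, 0), (0, 2), (0, -2), (1, 1), (1, -1), (-1, 1), (-1, -1)}"

section \<open>Semisimple Lie algebras, Chevalley bases, representations\<close>

locale complex_lie_algebra = vector_space scale
  for scale :: "complex \<Rightarrow> 'l::ab_group_add \<Rightarrow> 'l" +
  fixes bracket :: "'l \<Rightarrow> 'l \<Rightarrow> 'l"
  assumes bracket_add_left: "bracket (u + v) w = bracket u w + bracket v w"
    and bracket_add_right: "bracket u (v + w) = bracket u v + bracket u w"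
    and bracket_scale_left: "bracket (scale c u) v = scale c (bracket u v)"
    and bracket_scale_right: "bracket u (scale c v) = scale c (bracket u v)"
    and bracket_self: "bracket u u = 0"
    and jacobi: "bracket u (bracket v w) + bracket v (bracket w u) + bracket w (bracket u v) = 0"
begin

definition lie_ideal :: "'l set \<Rightarrow> bool" where
  "lie_ideal I \<longleftrightarrow> subspace I \<and> (\<forall>u. \<forall>v\<in>I. bracket u v \<in> I)"

fun derived_series :: "'l set \<Rightarrow> nat \<Rightarrow> 'l set" where
  "derived_series I 0 = I"
| "derived_series I (Suc k) =
     span {bracket u v | u v. u \<in> derived_series I k \<and> v \<in> derived_series I k}"

definition solvable :: "'l set \<Rightarrow> bool" where
  "solvable I \<longleftrightarrow> (\<exists>k. derived_series I k = {0})"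

definition semisimple :: bool where
  "semisimple \<longleftrightarrow>
     (\<exists>B. finite B \<and> span B = UNIV) \<and> (\<forall>I. lie_ideal I \<and> solvable I \<longrightarrow> I = {0})"

text \<open>\<open>h \<delta>\<close> (\<open>\<delta>\<close> a simple root) and \<open>x \<alpha>\<close> (\<open>\<alpha>\<close> a root) form a Chevalley basis.
  The element \<open>[x \<alpha>, x (-\<alpha>)]\<close> is the image of the coroot of \<open>\<alpha>\<close> under the linear map
  \<open>coroot \<delta> \<mapsto> h \<delta>\<close>.  In the last clause \<open>\<beta> - r\<alpha>, \<dots>, \<beta>, \<dots>\<close> is the \<open>\<alpha>\<close>-string
  through \<open>\<beta>\<close>.  These relations also express that the algebra has root system \<open>\<Phi>\<close> with
  respect to the Cartan subalgebra spanned by the \<open>h \<delta>\<close>.\<close>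

definition chevalley_basis :: "'e::euclidean_space set \<Rightarrow> 'e set \<Rightarrow> ('e \<Rightarrow> 'l) \<Rightarrow> ('e \<Rightarrow> 'l) \<Rightarrow> bool"
  where
  "chevalley_basis \<Phi> \<Delta> h x \<longleftrightarrow>
     inj_on h \<Delta> \<and> inj_on x \<Phi> \<and> h ` \<Delta> \<inter> x ` \<Phi> = {} \<and>
     \<not> dependent (h ` \<Delta> \<union> x ` \<Phi>) \<and> span (h ` \<Delta> \<union> x ` \<Phi>) = UNIV \<and>
     (\<forall>\<gamma>\<in>\<Delta>. \<forall>\<delta>\<in>\<Delta>. bracket (h \<gamma>) (h \<delta>) = 0) \<and>
     (\<forall>\<delta>\<in>\<Delta>. \<forall>\<alpha>\<in>\<Phi>. bracket (h \<delta>) (x \<alpha>) = scale (of_real (cartan_number \<alpha> \<delta>)) (x \<alpha>)) \<and>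
     (\<forall>\<alpha>\<in>\<Phi>. \<exists>c :: 'e \<Rightarrow> int.
        coroot \<alpha> = (\<Sum>\<delta>\<in>\<Delta>. of_int (c \<delta>) *\<^sub>R coroot \<delta>) \<and>
        bracket (x \<alpha>) (x (- \<alpha>)) = (\<Sum>\<delta>\<in>\<Delta>. scale (of_int (c \<delta>)) (h \<delta>))) \<and>
     (\<forall>\<alpha>\<in>\<Phi>. \<forall>\<beta>\<in>\<Phi>. \<alpha> + \<beta> \<noteq> 0 \<longrightarrow> \<alpha> + \<beta> \<notin> \<Phi> \<longrightarrow> bracket (x \<alpha>) (x \<beta>) = 0) \<and>
     (\<forall>\<alpha>\<in>\<Phi>. \<forall>\<beta>\<in>\<Phi>. \<alpha> + \<beta> \<in> \<Phi> \<longrightarrow>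
        (let r = Max {r :: nat. \<beta> - of_nat r *\<^sub>R \<alpha> \<in> \<Phi>} in
           bracket (x \<alpha>) (x \<beta>) = scale (of_nat (r + 1)) (x (\<alpha> + \<beta>)) \<or>
           bracket (x \<alpha>) (x \<beta>) = scale (- of_nat (r + 1)) (x (\<alpha> + \<beta>))))"

definition faithful_representation :: "('l \<Rightarrow> complex^'n^'n) \<Rightarrow> bool" where
  "faithful_representation \<pi> \<longleftrightarrow>
     (\<forall>u v. \<pi> (u + v) = \<pi> u + \<pi> v) \<and>
     (\<forall>c u. \<pi> (scale c u) = map_matrix ((*) c) (\<pi> u)) \<and>
     (\<forall>u v. \<pi> (bracket u v) = \<pi> u ** \<pi> v - \<pi> v ** \<pi> u) \<and>
     inj \<pi>"

end

section \<open>Chevalley groups\<close>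

definition divided_power :: "complex^'n^'n \<Rightarrow> nat \<Rightarrow> complex^'n^'n" where
  "divided_power N k = map_matrix (\<lambda>z. z / fact k) ((((**) N) ^^ k) (mat 1))"

text \<open>The coordinates of the representation space are taken with respect to a \<open>\<int>\<close>-basis of an
  admissible lattice, i.e. one stable under all \<open>\<pi> (x \<alpha>) ^ k / k!\<close>; this is what gives
  \<open>exp (t \<pi> (x \<alpha>))\<close> a meaning for \<open>t\<close> in an arbitrary commutative ring.\<close>

definition admissible_coordinates :: "'e set \<Rightarrow> ('e \<Rightarrow> complex^'n^'n) \<Rightarrow> bool" where
  "admissible_coordinates \<Phi> X \<longleftrightarrow> (\<forall>\<alpha>\<in>\<Phi>. \<forall>k i j. divided_power (X \<alpha>) k $ i $ j \<in> \<int>)"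

text \<open>\<open>exp (t N)\<close> for a nilpotent \<open>N\<close> with integral divided powers: \<open>N ^ k = 0\<close> for
  \<open>k \<ge> CARD('n)\<close>, and \<open>\<lfloor>Re z\<rfloor>\<close> reads the integer off an integral entry \<open>z\<close>.\<close>

definition exp_matrix :: "complex^'n^'n \<Rightarrow> 'r::comm_ring_1 \<Rightarrow> 'r^'n^'n" where
  "exp_matrix N t =
     (\<Sum>k<CARD('n). map_matrix (\<lambda>z. of_int \<lfloor>Re z\<rfloor> * t ^ k) (divided_power N k))"

definition SL :: "('r::comm_ring_1^'n^'n) monoid" where
  "SL = \<lparr>carrier = {A. det A = 1}, mult = (**), one = mat 1\<rparr>"

text \<open>In the following, \<open>X \<alpha>\<close> is the matrix \<open>\<pi> (x \<alpha>)\<close>.\<close>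

definition root_subgroup :: "('e \<Rightarrow> complex^'n^'n) \<Rightarrow> 'e \<Rightarrow> ('r::comm_ring_1^'n^'n) set" where
  "root_subgroup X \<alpha> = range (exp_matrix (X \<alpha>))"

definition elementary_subgroup ::
  "'e set \<Rightarrow> ('e \<Rightarrow> complex^'n^'n) \<Rightarrow> ('r::comm_ring_1^'n^'n) set" where
  "elementary_subgroup \<Phi> X = generate SL (\<Union>\<alpha>\<in>\<Phi>. root_subgroup X \<alpha>)"

text \<open>Elements of \<open>\<int>[X\<^sub>i\<^sub>j]\<close>: a monomial is the finitely supported map of its exponents, a
  polynomial the finitely supported map of its coefficients.\<close>

type_synonym 'n entry_poly = "(('n \<times> 'n) \<Rightarrow>\<^sub>0 nat) \<Rightarrow>\<^sub>0 int"

definition eval_entry_poly :: "'n entry_poly \<Rightarrow> 'r::comm_ring_1^'n^'n \<Rightarrow> 'r" where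
  "eval_entry_poly p A =
     (\<Sum>m\<in>Poly_Mapping.keys p. of_int (Poly_Mapping.lookup p m) *
        (\<Prod>(i, j)\<in>Poly_Mapping.keys m. (A $ i $ j) ^ Poly_Mapping.lookup m (i, j)))"

text \<open>The Chevalley--Demazure scheme is the closure over \<open>\<int>\<close> of the complex Chevalley group in
  \<open>SL\<^sub>n\<close>, and over \<open>\<complex>\<close> the latter is generated by its root unipotents.  So the defining
  equations are all integer polynomials vanishing on the complex elementary group.  Up to
  isomorphism the scheme depends only on \<open>\<Phi>\<close> and on the lattice spanned by the weights of
  \<open>\<pi>\<close>.\<close>

definition chevalley_equations :: "'e set \<Rightarrow> ('e \<Rightarrow> complex^'n^'n) \<Rightarrow> 'n entry_poly set" where
  "chevalley_equations \<Phi> X =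
     {p. \<forall>A \<in> (elementary_subgroup \<Phi> X :: (complex^'n^'n) set). eval_entry_poly p A = 0}"

definition chevalley_group ::
  "'e set \<Rightarrow> ('e \<Rightarrow> complex^'n^'n) \<Rightarrow> ('r::comm_ring_1^'n^'n) monoid" where
  "chevalley_group \<Phi> X =
     SL\<lparr>carrier := {A \<in> carrier SL. \<forall>p \<in> chevalley_equations \<Phi> X. eval_entry_poly p A = 0}\<rparr>"

definition large_subgroup ::
  "('r::comm_ring_1^'n^'n) set \<Rightarrow> 'e set \<Rightarrow> ('e \<Rightarrow> complex^'n^'n) \<Rightarrow> bool" where
  "large_subgroup G \<Phi> X \<longleftrightarrow>
     subgroup G (chevalley_group \<Phi> X) \<and> elementary_subgroup \<Phi> X \<subseteq> G"

section \<open>Diophantine sets in groups\<close>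

text \<open>Group words in the free variable \<open>x\<close>, the bound variables \<open>y\<^sub>i\<close> and constants; the Boolean
  marks the sign of the exponent, with \<^const>\<open>False\<close> standing for the inverse of a letter.\<close>

datatype 'g letter = Free_Var | Bound_Var nat | Constant 'g

type_synonym 'g word = "('g letter \<times> bool) list"

fun letter_value :: "'g \<Rightarrow> (nat \<Rightarrow> 'g) \<Rightarrow> 'g letter \<Rightarrow> 'g" where
  "letter_value x y Free_Var = x"
| "letter_value x y (Bound_Var i) = y i"
| "letter_value x y (Constant c) = c"

fun word_value :: "('g, 'b) monoid_scheme \<Rightarrow> 'g \<Rightarrow> (nat \<Rightarrow> 'g) \<Rightarrow> 'g word \<Rightarrow> 'g" where
  "word_value G x y [] = \<one>\<^bsub>G\<^esub>"
| "word_value G x y ((l, s) # w) =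
     (if s then letter_value x y l else inv\<^bsub>G\<^esub> (letter_value x y l)) \<otimes>\<^bsub>G\<^esub> word_value G x y w"

definition word_over :: "nat \<Rightarrow> 'g set \<Rightarrow> 'g word \<Rightarrow> bool" where
  "word_over n C w \<longleftrightarrow>
     fst ` set w \<subseteq> {Free_Var} \<union> Bound_Var ` {..<n} \<union> Constant ` C"

definition diophantine_with_constants ::
  "('g, 'b) monoid_scheme \<Rightarrow> 'g set \<Rightarrow> 'g set \<Rightarrow> bool" where
  "diophantine_with_constants G C H \<longleftrightarrow>
     C \<subseteq> carrier G \<and>
     (\<exists>n (ws :: 'g word list). (\<forall>w \<in> set ws. word_over n C w) \<and>
        H = {x \<in> carrier G. \<exists>y. (\<forall>i<n. y i \<in> carrier G) \<and>
                               (\<forall>w \<in> set ws. word_value G x y w = \<one>\<^bsub>G\<^esub>)})"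

end

theory Submission
  imports Defs "HOL-Computational_Algebra.Polynomial"
begin

text \<open>Let \<open>\<alpha>\<close> be a long root. The points \<open>z\<close> of the group scheme are the specializations of the complex
  elementary group, so polynomial identities that hold there hold for \<open>z\<close>. If \<open>z\<close> commutes with
  \<open>x\<^sub>\<gamma>(1)\<close> for all \<open>\<gamma>\<close> of degree \<open>\<langle>\<gamma>, \<alpha>\<rangle> \<ge> 0\<close>, then comparing coefficients shows that \<open>z X\<^sub>-\<^sub>\<alpha> z\<^sup>-\<^sup>1\<close> has
  coefficient 1 at \<open>X\<^sub>-\<^sub>\<alpha>\<close> and no terms of degree \<open>-1\<close>. Since \<open>X\<^sub>-\<^sub>\<alpha>\<close> is an extremal element of the Lie
  algebra, this forces \<open>z\<close> to act on \<open>x\<^sub>-\<^sub>\<alpha>(1)\<close>, and then on \<open>x\<^sub>\<beta>(1)\<close> for \<open>\<beta>\<close> of degree \<open>-1\<close>, like some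
  \<open>x\<^sub>\<alpha>(t)\<close>. So the commutators \<open>[z, x\<^sub>\<beta>(1)]\<close> are exactly the \<open>[x\<^sub>\<alpha>(t), x\<^sub>\<beta>(1)]\<close>, and images of this
  Diophantine set under words yield one root subgroup, from which Weyl elements and further
  commutators produce the others if \<open>\<Phi>\<close> is not \<open>G\<^sub>2\<close>.

  In \<open>G\<^sub>2\<close> a short root subgroup is the centralizer of five root elements: by the argument above an element \<open>z\<close>
  of the centralizer becomes an element fixing all \<open>X\<^sub>\<gamma>\<close> after multiplication by some \<open>x\<^sub>\<sigma>(s)\<close>. Such an
  element is trivial. Indeed Gaussian elimination writes it, up to an error fixing all \<open>X\<^sub>\<gamma>\<close>, as a product of root
  elements with regular parameters, and along a complex curve through 1 the error is constant, because its
  logarithmic derivative lies in the centre of the Lie algebra.\<close>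

section \<open>Square matrices as a ring\<close>

text \<open>Two features of an arbitrary ring shape the proof. The numbers 2 and 3 need not be
  cancellable, so coefficients are compared through structure constants 1 or -1, or through coprime
  pairs of them, and exponentials enter with their divided powers. And a point of the scheme need
  not be a product of root elements, so only identities reach it; they are read off with linear
  forms \<open>xi\<close> that have integer coefficients, which is possible because the matrix of a
  root vector has coprime entries.

  A centralizer contains everything that commutes with all root elements, and this has no influence
  on the commutators \<open>[z, x_\<beta>(1)]\<close>. For a long root a and a short root b in a
  plane of type B2, the commutator of x_a(t) with x_b(1) is a product of two root elements, both
  with parameter t up to sign. Separating them takes a pair of long roots at 120 degrees or a root
  outside the plane, and C2 has neither. In G2 the commutator with a short root element has further
  factors, but there only 1 fixes all root vectors, so a centralizer itself can be a root
  subgroup.\<close>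

text \<open>A copy of the type of square matrices, because multiplication of vectors is componentwise
  and an instance of \<open>ring_1\<close> needs the matrix product.\<close>

typedef (overloaded) ('a, 'n::finite) sqm = "UNIV :: ('a^'n^'n) set"
  morphisms rep mk by simp

definition ent :: "('a, 'n::finite) sqm \<Rightarrow> 'n \<Rightarrow> 'n \<Rightarrow> 'a" where
  "ent M i j = rep M $ i $ j"

lemma rep_mk [simp]: "rep (mk A) = A"
  by (simp add: mk_inverse)

lemma mk_rep [simp]: "mk (rep A) = A"
  by (simp add: rep_inverse)

lemma ent_mk [simp]: "ent (mk A) i j = A $ i $ j"
  by (simp add: ent_def)

lemma sqm_eqI: "(\<And>i j. ent A i j = ent B i j) \<Longrightarrow> A = B"
  by (metis ent_def mk_rep vec_eq_iff)

lemma sqm_eq_iff: "A = B \<longleftrightarrow> (\<forall>i j. ent A i j = ent B i j)"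
  using sqm_eqI by blast

instantiation sqm :: (comm_ring_1, finite) ring_1
begin

definition "0 = mk 0"
definition "1 = mk (mat 1)"
definition "A + B = mk (rep A + rep B)"
definition "A - B = mk (rep A - rep B)"
definition "- A = mk (- rep A)"
definition "A * B = mk (rep A ** rep B)"

instance
proof
  fix a b c :: "('a, 'b) sqm"
  show "a * b * c = a * (b * c)" by (simp add: times_sqm_def matrix_mul_assoc)
  show "(a + b) * c = a * c + b * c"
    by (simp add: times_sqm_def plus_sqm_def, rule arg_cong[of _ _ mk])
      (simp add: matrix_matrix_mult_def vec_eq_iff sum.distrib distrib_right)
  show "a * (b + c) = a * b + a * c" by (simp add: times_sqm_def plus_sqm_def matrix_add_ldistrib)
  show "(0 :: ('a, 'b) sqm) \<noteq> 1"
  proof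
    assume "(0 :: ('a, 'b) sqm) = 1"
    then have "ent (0 :: ('a, 'b) sqm) i i = ent 1 i i" for i by simp
    then show False by (simp add: zero_sqm_def one_sqm_def mat_def)
  qed
qed (simp_all add: times_sqm_def plus_sqm_def one_sqm_def minus_sqm_def uminus_sqm_def
      zero_sqm_def algebra_simps)

end

definition sm :: "'a::comm_ring_1 \<Rightarrow> ('a, 'n::finite) sqm \<Rightarrow> ('a, 'n) sqm" (infixr "\<odot>" 75) where
  "c \<odot> A = mk (\<chi> i j. c * rep A $ i $ j)"

lemma ent_zero [simp]: "ent 0 i j = 0"
  and ent_one: "ent 1 i j = (if i = j then 1 else 0)"
  and ent_add [simp]: "ent (A + B) i j = ent A i j + ent B i j"
  and ent_diff [simp]: "ent (A - B) i j = ent A i j - ent B i j"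
  and ent_minus [simp]: "ent (- A) i j = - ent A i j"
  and ent_mult: "ent (A * B) i j = (\<Sum>k\<in>UNIV. ent A i k * ent B k j)"
  and ent_sm [simp]: "ent (c \<odot> A) i j = c * ent A i j"
  by (simp_all add: ent_def zero_sqm_def one_sqm_def plus_sqm_def minus_sqm_def uminus_sqm_def
      times_sqm_def matrix_matrix_mult_def sm_def mat_def)

lemma ent_sum: "ent (sum f S) i j = (\<Sum>x\<in>S. ent (f x) i j)"
  by (induction S rule: infinite_finite_induct) auto

lemma mk_add: "mk (A + B) = mk A + mk B"
  by (simp add: plus_sqm_def)

lemma mk_sum: "mk (sum f S) = (\<Sum>x\<in>S. mk (f x))"
  by (induction S rule: infinite_finite_induct) (auto simp: mk_add zero_sqm_def)

lemma sm_add_right: "c \<odot> (A + B) = c \<odot> A + c \<odot> B"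
  and sm_diff_right: "c \<odot> (A - B) = c \<odot> A - c \<odot> B"
  and sm_add_left: "(c + d) \<odot> A = c \<odot> A + d \<odot> A"
  and sm_diff_left: "(c - d) \<odot> A = c \<odot> A - d \<odot> A"
  by (rule sqm_eqI, simp add: algebra_simps)+

lemma sm_sm [simp]: "c \<odot> (d \<odot> A) = (c * d) \<odot> A"
  and sm_one [simp]: "1 \<odot> A = A"
  and sm_zero_left [simp]: "0 \<odot> A = 0"
  and sm_zero_right [simp]: "c \<odot> 0 = 0"
  and sm_minus_right [simp]: "c \<odot> (- A) = - (c \<odot> A)"
  and sm_minus_left [simp]: "(- c) \<odot> A = - (c \<odot> A)"
  by (rule sqm_eqI, simp add: algebra_simps)+

lemma mult_sm_left [simp]: "(c \<odot> A) * B = c \<odot> (A * B)"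
  and mult_sm_right [simp]: "A * (c \<odot> B) = c \<odot> (A * B)"
  by (rule sqm_eqI, simp add: ent_mult sum_distrib_left algebra_simps)+

lemma sm_sum_right: "c \<odot> sum f S = (\<Sum>x\<in>S. c \<odot> f x)"
  by (induction S rule: infinite_finite_induct) (auto simp: sm_add_right)

lemma sm_sum_left: "sum f S \<odot> A = (\<Sum>x\<in>S. f x \<odot> A)"
  by (induction S rule: infinite_finite_induct) (auto simp: sm_add_left)

lemmas sm_simps = sm_add_right sm_diff_right sm_add_left sm_diff_left

definition br :: "'a::ring \<Rightarrow> 'a \<Rightarrow> 'a" where
  "br A B = A * B - B * A"

lemma br_add_left: "br (A + B) C = br A C + br B C"
  and br_add_right: "br A (B + C) = br A B + br A C"
  and br_diff_left: "br (A - B) C = br A C - br B C"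
  and br_diff_right: "br A (B - C) = br A B - br A C"
  and br_minus_left [simp]: "br (- A) C = - br A C"
  and br_minus_right [simp]: "br A (- C) = - br A C"
  and br_self [simp]: "br A A = 0"
  and br_zero_left [simp]: "br 0 C = 0"
  and br_zero_right [simp]: "br A 0 = 0"
  and br_swap: "br A C = - br C A"
  and br_jacobi: "br A (br B C) = br (br A B) C + br B (br A C)"
  by (simp_all add: br_def algebra_simps)

lemma br_sm_left [simp]: "br (c \<odot> A) B = c \<odot> br A B"
  and br_sm_right [simp]: "br A (c \<odot> B) = c \<odot> br A B"
  by (simp_all add: br_def sm_simps)

lemmas br_simps = br_add_left br_add_right br_diff_left br_diff_right

lemma br_sum_left: "br (sum f S) C = (\<Sum>x\<in>S. br (f x) C)"
  by (induction S rule: infinite_finite_induct) (auto simp: br_simps)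

lemma br_sum_right: "br C (sum f S) = (\<Sum>x\<in>S. br C (f x))"
  by (induction S rule: infinite_finite_induct) (auto simp: br_simps)

definition mp :: "('a \<Rightarrow> 'b) \<Rightarrow> ('a, 'n::finite) sqm \<Rightarrow> ('b, 'n) sqm" where
  "mp f M = mk (map_matrix f (rep M))"

lemma ent_mp [simp]: "ent (mp f M) i j = f (ent M i j)"
  by (simp add: mp_def ent_def map_matrix_def)

abbreviation imat :: "(int, 'n::finite) sqm \<Rightarrow> ('a::comm_ring_1, 'n) sqm" where
  "imat \<equiv> mp of_int"

lemma imat_zero [simp]: "imat 0 = 0"
  and imat_one [simp]: "imat 1 = 1"
  by (rule sqm_eqI, simp add: ent_mult ent_one)+

lemma imat_imat [simp]: "imat (imat A) = imat A"
  by (rule sqm_eqI) simp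

lemma imat_of_int_id [simp]: "mp of_int A = (A :: (int, 'n::finite) sqm)"
  by (rule sqm_eqI) simp

section \<open>Exponentials of nilpotent matrices\<close>

definition dpow :: "(complex, 'n::finite) sqm \<Rightarrow> nat \<Rightarrow> (complex, 'n) sqm" where
  "dpow N k = (1 / fact k) \<odot> N ^ k"

definition adp :: "(complex, 'n::finite) sqm \<Rightarrow> nat \<Rightarrow> (complex, 'n) sqm \<Rightarrow> (complex, 'n) sqm" where
  "adp N k Y = (1 / fact k) \<odot> ((br N ^^ k) Y)"

definition cexp :: "(complex, 'n::finite) sqm \<Rightarrow> complex \<Rightarrow> (complex, 'n) sqm" where
  "cexp N t = (\<Sum>k<CARD('n). t ^ k \<odot> dpow N k)"

lemma dpow_0 [simp]: "dpow N 0 = 1"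
  and dpow_1 [simp]: "dpow N (Suc 0) = N"
  by (simp_all add: dpow_def)

lemma adp_0 [simp]: "adp N 0 Y = Y"
  and adp_1 [simp]: "adp N (Suc 0) Y = br N Y"
  by (simp_all add: adp_def)

lemma of_nat_mult_inverse_fact: "of_nat (Suc k) * (1 / fact (Suc k)) = (1 / fact k :: complex)"
  by (simp add: fact_Suc del: of_nat_Suc)

lemma dpow_Suc: "of_nat (Suc k) \<odot> dpow N (Suc k) = N * dpow N k"
  by (simp add: dpow_def of_nat_mult_inverse_fact del: of_nat_Suc fact_Suc times_divide_eq_right)

lemma adp_Suc: "of_nat (Suc k) \<odot> adp N (Suc k) Y = br N (adp N k Y)"
  by (simp add: adp_def of_nat_mult_inverse_fact del: of_nat_Suc fact_Suc times_divide_eq_right)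

lemma adp_Suc': "adp N (Suc k) Y = (1 / of_nat (Suc k)) \<odot> br N (adp N k Y)"
  using arg_cong[OF adp_Suc, of "\<lambda>Z. (1 / of_nat (Suc k)) \<odot> Z" k N Y]
  by (simp del: of_nat_Suc)

lemma adp_add: "adp N k (Y + Z) = adp N k Y + adp N k Z"
  by (induction k) (simp_all add: adp_Suc' br_simps sm_simps del: of_nat_Suc)

lemma adp_sm [simp]: "adp N k (c \<odot> Y) = c \<odot> adp N k Y"
  by (induction k) (simp_all add: adp_Suc' mult.commute del: of_nat_Suc)

lemma adp_zero_le: "adp N k Y = 0 \<Longrightarrow> k \<le> l \<Longrightarrow> adp N l Y = 0"
  by (induction l) (auto simp: adp_Suc' le_Suc_eq simp del: of_nat_Suc)

lemma sm_cancel: "c \<noteq> 0 \<Longrightarrow> c \<odot> A = c \<odot> B \<Longrightarrow> A = (B :: ('a::field, 'n::finite) sqm)"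
  by (simp add: sqm_eq_iff)

text \<open>The degree k part of exp(N) Y = (exp(ad N) Y) exp(N), with divided powers in place of
  exponentials. In the induction the summand with index i of degree k + 1 arises i times from the
  first factor and k + 1 - i times from the second.\<close>

lemma dpow_mult_right: "dpow N k * Y = (\<Sum>i\<le>k. adp N i Y * dpow N (k - i))"
proof (induction k)
  case (Suc k)
  let ?f = "\<lambda>i. adp N i Y * dpow N (Suc k - i)"
  have "of_nat (Suc k) \<odot> (dpow N (Suc k) * Y) = N * (dpow N k * Y)"
    by (simp flip: mult_sm_left add: dpow_Suc mult.assoc del: of_nat_Suc)
  also have "\<dots> = (\<Sum>i\<le>k. N * adp N i Y * dpow N (k - i))"
    by (simp add: Suc.IH sum_distrib_left mult.assoc)
  also have "\<dots> = (\<Sum>i\<le>k. br N (adp N i Y) * dpow N (k - i) + adp N i Y * (N * dpow N (k - i)))"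
    by (rule sum.cong) (simp_all add: br_def algebra_simps)
  also have "\<dots> = (\<Sum>i\<le>k. of_nat (Suc i) \<odot> ?f (Suc i)) + (\<Sum>i\<le>k. of_nat (Suc k - i) \<odot> ?f i)"
    by (simp add: sum.distrib adp_Suc[symmetric] dpow_Suc[symmetric] Suc_diff_le del: of_nat_Suc)
  also have "(\<Sum>i\<le>k. of_nat (Suc i) \<odot> ?f (Suc i)) = (\<Sum>i\<le>Suc k. of_nat i \<odot> ?f i)"
    by (subst sum.atMost_Suc_shift) simp
  also have "(\<Sum>i\<le>k. of_nat (Suc k - i) \<odot> ?f i) = (\<Sum>i\<le>Suc k. of_nat (Suc k - i) \<odot> ?f i)"
    by simp
  also have "(\<Sum>i\<le>Suc k. of_nat i \<odot> ?f i) + (\<Sum>i\<le>Suc k. of_nat (Suc k - i) \<odot> ?f i)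
      = (\<Sum>i\<le>Suc k. of_nat (Suc k) \<odot> ?f i)"
    by (subst sum.distrib[symmetric], rule sum.cong)
      (simp_all flip: sm_add_left of_nat_add del: of_nat_Suc)
  also have "\<dots> = of_nat (Suc k) \<odot> (\<Sum>i\<le>Suc k. ?f i)"
    by (simp only: sm_sum_right)
  finally show ?case by (rule sm_cancel[rotated]) (simp del: of_nat_Suc)
qed simp

text \<open>The Cauchy product of truncated exponential series: the products off the triangle
  vanish, so truncation is compatible with multiplication.\<close>

lemma sum_mult_triangle:
  fixes a b :: "nat \<Rightarrow> 'a::ring"
  assumes "\<And>i j. i + j \<ge> n \<Longrightarrow> a i * b j = 0"
  shows "(\<Sum>i<n. a i) * (\<Sum>j<n. b j) = (\<Sum>k<n. \<Sum>i\<le>k. a i * b (k - i))"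
proof -
  have "(\<Sum>i<n. a i) * (\<Sum>j<n. b j) = (\<Sum>(i, j)\<in>{..<n} \<times> {..<n}. a i * b j)"
    by (simp add: sum_product sum.cartesian_product)
  also have "\<dots> = (\<Sum>(i, j)\<in>{(i, j). i + j < n}. a i * b j)"
    by (rule sum.mono_neutral_right) (auto, metis assms not_less)
  finally show ?thesis by (simp add: sum.triangle_reindex)
qed

definition nilp :: "(complex, 'n::finite) sqm \<Rightarrow> bool" where
  "nilp N \<longleftrightarrow> N ^ CARD('n) = 0"

lemma dpow_nilp:
  fixes N :: "(complex, 'n::finite) sqm"
  assumes "nilp N" "k \<ge> CARD('n)"
  shows "dpow N k = 0"
proof -
  have "N ^ k = N ^ CARD('n) * N ^ (k - CARD('n))" using assms(2) by (simp flip: power_add)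
  then show ?thesis using assms(1) by (simp add: dpow_def nilp_def)
qed

lemma cexp_eq_sum:
  fixes N :: "(complex, 'n::finite) sqm"
  assumes "nilp N" "m \<ge> CARD('n)"
  shows "cexp N t = (\<Sum>k<m. t ^ k \<odot> dpow N k)"
  unfolding cexp_def
  by (rule sum.mono_neutral_left) (use assms in \<open>auto simp: dpow_nilp\<close>)

lemma cexp_mult_right:
  fixes N :: "(complex, 'n::finite) sqm"
  assumes "nilp N" "adp N m Y = 0"
  shows "cexp N t * Y = (\<Sum>i<m. t ^ i \<odot> adp N i Y) * cexp N t"
proof -
  \<comment> \<open>Both sums are padded to this common length: \<open>?K \<le> i + j\<close> forces
    \<open>m \<le> i\<close> or \<open>CARD('n) \<le> j\<close>, so one factor is 0.\<close>
  let ?K = "CARD('n) + m"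
  have z: "adp N i Y = 0" if "m \<le> i" for i using adp_zero_le assms(2) that by blast
  have "cexp N t * Y = (\<Sum>k<?K. t ^ k \<odot> dpow N k) * Y"
    using assms(1) by (subst cexp_eq_sum[of N ?K]) auto
  also have "\<dots> = (\<Sum>k<?K. \<Sum>i\<le>k. (t ^ i \<odot> adp N i Y) * (t ^ (k - i) \<odot> dpow N (k - i)))"
    by (simp add: sum_distrib_right dpow_mult_right sm_sum_right flip: power_add)
  also have "\<dots> = (\<Sum>i<?K. t ^ i \<odot> adp N i Y) * (\<Sum>k<?K. t ^ k \<odot> dpow N k)"
  proof (rule sum_mult_triangle[symmetric])
    fix i j assume "?K \<le> i + j"
    then have "m \<le> i \<or> CARD('n) \<le> j" by linarith
    then show "(t ^ i \<odot> adp N i Y) * (t ^ j \<odot> dpow N j) = 0"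
      using z dpow_nilp[OF assms(1)] by auto
  qed
  also have "(\<Sum>i<?K. t ^ i \<odot> adp N i Y) = (\<Sum>i<m. t ^ i \<odot> adp N i Y)"
    by (rule sum.mono_neutral_right) (auto simp: z)
  finally show ?thesis using assms(1) by (subst (2) cexp_eq_sum[of N ?K]) auto
qed

lemma dpow_mult_dpow: "dpow N i * dpow N j = of_nat (i + j choose i) \<odot> dpow N (i + j)"
  by (simp add: dpow_def binomial_fact field_simps flip: power_add)

lemma cexp_add:
  assumes "nilp N"
  shows "cexp N s * cexp N t = cexp N (s + t)"
  unfolding cexp_def
proof (subst sum_mult_triangle)
  fix i j assume "CARD('a) \<le> i + j"
  then show "(s ^ i \<odot> dpow N i) * (t ^ j \<odot> dpow N j) = 0"
    by (simp add: dpow_mult_dpow dpow_nilp[OF assms])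
next
  show "(\<Sum>k<CARD('a). \<Sum>i\<le>k. (s ^ i \<odot> dpow N i) * (t ^ (k - i) \<odot> dpow N (k - i)))
      = (\<Sum>k<CARD('a). (s + t) ^ k \<odot> dpow N k)"
    by (rule sum.cong) (simp_all add: dpow_mult_dpow binomial_ring sm_sum_left algebra_simps)
qed

lemma cexp_0 [simp]: "cexp N 0 = 1"
proof -
  have "cexp N 0 = (\<Sum>k<CARD('a). (if k = 0 then 1 else 0) \<odot> dpow N k)"
    unfolding cexp_def by (rule sum.cong) (auto simp: power_0_left)
  also have "\<dots> = (\<Sum>k<CARD('a). if k = 0 then 1 else 0)" by (rule sum.cong) auto
  finally show ?thesis by simp
qed

lemma cexp_inverse:
  assumes "nilp N"
  shows "cexp N t * cexp N (- t) = 1" "cexp N (- t) * cexp N t = 1"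
  using cexp_add[OF assms, of t "- t"] cexp_add[OF assms, of "- t" t] by auto

lemma cexp_conj:
  assumes "nilp N" "adp N m Y = 0"
  shows "cexp N t * Y * cexp N (- t) = (\<Sum>i<m. t ^ i \<odot> adp N i Y)"
  by (simp add: cexp_mult_right[OF assms] mult.assoc cexp_inverse[OF assms(1)])

subsection \<open>Nilpotency from a grading element\<close>

text \<open>If \<open>[H, X] = 2X\<close> then the nonzero powers of \<open>X\<close> are eigenvectors of \<open>[H, _]\<close> with
  distinct eigenvalues.\<close>

lemma eigen_sum_zero:
  fixes f :: "('a::field, 'n::finite) sqm \<Rightarrow> ('a, 'n) sqm"
  assumes "finite S" and "inj_on c S"
    and add: "\<And>A B. f (A + B) = f A + f B" and sm: "\<And>k A. f (k \<odot> A) = k \<odot> f A"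
    and "\<And>k. k \<in> S \<Longrightarrow> f (M k) = c k \<odot> M k" and "(\<Sum>k\<in>S. M k) = 0" and "k \<in> S"
  shows "M k = 0"
  using assms(1,2,5,6,7)
proof (induction S arbitrary: M k rule: finite_induct)
  case (insert a S)
  have fsum: "f (sum g T) = (\<Sum>x\<in>T. f (g x))" for g :: "'b \<Rightarrow> ('a, 'n) sqm" and T
    using add sm[of 0 0] by (induction T rule: infinite_finite_induct) auto
  have 1: "M a = - (\<Sum>k\<in>S. M k)"
    using insert.prems(3) insert.hyps by (simp add: eq_neg_iff_add_eq_0)
  have "0 = f (\<Sum>k\<in>insert a S. M k) - c a \<odot> (\<Sum>k\<in>insert a S. M k)"
    using insert.prems(3) fsum[of _ "{}"] by simp
  also have "\<dots> = (\<Sum>k\<in>S. (c k - c a) \<odot> M k)" using insert.hyps insert.prems(2)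
    by (simp add: fsum sm_sum_right sum_subtractf sm_simps del: sum.insert)
      (simp add: sm_add_right sm_sum_right)
  finally have sum0: "(\<Sum>k\<in>S. (c k - c a) \<odot> M k) = 0" by simp
  have "(c k - c a) \<odot> M k = 0" if "k \<in> S" for k using insert.prems(1,2) sum0 that
    by (intro insert.IH[where M = "\<lambda>k. (c k - c a) \<odot> M k"])
      (auto simp: sm mult.commute)
  moreover have "c k \<noteq> c a" if "k \<in> S" for k
    using insert.prems(1) insert.hyps that by (auto simp: inj_on_def)
  ultimately have z: "M k = 0" if "k \<in> S" for k
    using that sm_cancel[of "c k - c a" "M k" 0] by auto
  with 1 have "M a = 0" by simp
  with z insert.prems(4) show ?case by auto
qed auto

lemma br_power_eigen:
  assumes "br H X = 2 \<odot> X"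
  shows "br H (X ^ k) = (2 * of_nat k) \<odot> X ^ k"
proof (induction k)
  case (Suc k)
  have "br H (X * X ^ k) = br H X * X ^ k + X * br H (X ^ k)" by (simp add: br_def algebra_simps)
  also have "\<dots> = (2 * of_nat (Suc k)) \<odot> X ^ Suc k"
    by (simp add: Suc.IH assms sm_simps algebra_simps)
  finally show ?case by simp
qed (simp add: br_def)

text \<open>If \<open>X ^ m'\<close> is the last nonzero power and does not kill the unit vector
  \<open>v\<close>, then v, X v, ..., X^m' v are linearly independent, and there are m' + 1 of
  them.\<close>

lemma power_eq_0_if_ge_card:
  fixes X :: "(complex, 'n::finite) sqm"
  assumes "X ^ k = 0"
  shows "X ^ CARD('n) = 0"
proof (rule ccontr)
  assume n0: "X ^ CARD('n) \<noteq> 0"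
  define m where "m = (LEAST k. X ^ k = 0)"
  have m: "X ^ m = 0" unfolding m_def using assms by (rule LeastI)
  have lt: "X ^ i \<noteq> 0" if "i < m" for i using that not_less_Least unfolding m_def by blast
  have "m > CARD('n)" by (metis m n0 not_less power_add le_Suc_ex mult_zero_left)
  then obtain m' where m': "m = Suc m'" "m' \<ge> CARD('n)" by (cases m) auto
  have "X ^ m' \<noteq> 0" using lt m' by simp
  then obtain i j where ij: "ent (X ^ m') i j \<noteq> 0" using sqm_eq_iff[of "X ^ m'" 0] by auto
  define v where "v = column j (rep (1 :: (complex, 'n) sqm))"
  define w where "w = (\<lambda>k. rep (X ^ k) *v v)"
  have w: "rep (X ^ k) *v (rep (X ^ l) *v v) = rep (X ^ (k + l)) *v v" for k l
    by (simp add: power_add times_sqm_def matrix_vector_mul_assoc)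
  have wnz: "w m' \<noteq> 0"
  proof
    assume "w m' = 0"
    then have "(rep (X ^ m') *v v) $ i = 0" by (simp add: w_def)
    moreover have "(rep (X ^ m') *v v) $ i = ent (X ^ m') i j"
      by (simp add: v_def column_def one_sqm_def mat_def matrix_vector_mult_def ent_def if_distrib cong: if_cong)
    ultimately show False using ij by simp
  qed
  have wz: "w k = 0" if "k > m'" for k
  proof -
    have "X ^ k = X ^ m * X ^ (k - m)" using that m'(1) by (simp flip: power_add del: power_Suc)
    with m have "X ^ k = 0" by simp
    then show ?thesis by (simp add: w_def zero_sqm_def)
  qed
  have coeff: "\<forall>k\<le>m'. u k = 0" if u: "(\<Sum>k\<le>m'. u k *s w k) = 0" for u :: "nat \<Rightarrow> complex"
  proof (intro allI impI)
    fix k show "k \<le> m' \<Longrightarrow> u k = 0"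
    proof (induction k rule: less_induct)
      case (less k)
      \<comment> \<open>Applying the power m' - k kills every vector with index above k, and those
        below k have coefficient 0 by induction.\<close>
      have mv: "rep (X ^ (m' - k)) *v (\<Sum>l\<le>m'. u l *s w l) = (\<Sum>l\<le>m'. u l *s w (m' - k + l))"
      proof -
        have "A *v sum g T = (\<Sum>l\<in>T. A *v g l)"
          for A :: "complex^'n^'n" and g :: "nat \<Rightarrow> complex^'n" and T
          by (induction T rule: infinite_finite_induct) (auto simp: matrix_vector_right_distrib)
        then show ?thesis by (simp add: vector_scalar_commute w w_def)
      qed
      have "0 = (\<Sum>l\<le>m'. u l *s w (m' - k + l))" using mv u by simp
      also have "\<dots> = (\<Sum>l\<in>{k}. u l *s w (m' - k + l))"
      proof (rule sum.mono_neutral_right)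
        show "\<forall>l\<in>{..m'} - {k}. u l *s w (m' - k + l) = 0"
        proof
          fix l assume "l \<in> {..m'} - {k}"
          then consider "l < k" | "l > k" by force
          then show "u l *s w (m' - k + l) = 0"
          proof cases
            case 1
            then show ?thesis using less by simp
          next
            case 2
            then show ?thesis using less.prems by (simp add: wz)
          qed
        qed
      qed (use less.prems in auto)
      finally have "u k *s w m' = 0" using less.prems by simp
      then show ?case using wnz by simp
    qed
  qed
  have inj: "inj_on w {..m'}"
  proof (rule inj_onI, rule ccontr)
    fix k l assume kl: "k \<in> {..m'}" "l \<in> {..m'}" "w k = w l" "k \<noteq> l"
    let ?u = "\<lambda>i. if i = k then 1 else if i = l then -1 else (0 :: complex)"
    have "(\<Sum>i\<le>m'. ?u i *s w i) = (\<Sum>i\<in>{k, l}. ?u i *s w i)"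
      by (rule sum.mono_neutral_right) (use kl in auto)
    then have "(\<Sum>i\<le>m'. ?u i *s w i) = 0" using kl by simp
    from coeff[OF this] kl show False by auto
  qed
  have "vec.independent (w ` {..m'})"
  proof (rule vec.independent_if_scalars_zero)
    fix f x assume f: "(\<Sum>x\<in>w ` {..m'}. f x *s x) = 0" and x: "x \<in> w ` {..m'}"
    have "(\<Sum>k\<le>m'. f (w k) *s w k) = 0" using f by (simp add: sum.reindex[OF inj])
    from coeff[OF this] x show "f x = 0" by auto
  qed simp
  then have "card (w ` {..m'}) \<le> vec.dim (UNIV :: (complex^'n) set)"
    by (intro vec.independent_card_le_dim) auto
  then show False using m'(2) by (simp add: card_image[OF inj] card_cart_basis)
qed

text \<open>In finite dimension only finitely many powers can be nonzero. The matrices are regarded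
  as a real Euclidean space, where independence over the reals already bounds the number.\<close>

lemma nilp_if_eigen:
  fixes X H :: "(complex, 'n::finite) sqm"
  assumes "br H X = 2 \<odot> X"
  shows "nilp X"
proof -
  have "\<exists>k. X ^ k = 0"
  proof (rule ccontr)
    assume nz: "\<nexists>k. X ^ k = 0"
    have inj: "inj (\<lambda>k. rep (X ^ k))"
    proof (rule injI, rule ccontr)
      fix k l assume kl: "rep (X ^ k) = rep (X ^ l)" "k \<noteq> l"
      then have "X ^ k = X ^ l" by (metis mk_rep)
      with br_power_eigen[OF assms, of k] br_power_eigen[OF assms, of l]
      have "(2 * of_nat k - 2 * of_nat l) \<odot> X ^ k = 0" by (simp add: sm_simps)
      moreover have "(2 * of_nat k - 2 * of_nat l :: complex) \<noteq> 0" using kl(2) by simp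
      ultimately have "X ^ k = 0"
        using sm_cancel[of "2 * of_nat k - 2 * of_nat l" "X ^ k" 0] by simp
      then show False using nz by blast
    qed
    have ind: "independent ((\<lambda>k. rep (X ^ k)) ` T)" if "finite T" for T
    proof (rule independent_if_scalars_zero)
      fix f :: "complex^'n^'n \<Rightarrow> real" and x
      assume f: "(\<Sum>x\<in>(\<lambda>k. rep (X ^ k)) ` T. f x *\<^sub>R x) = 0" and x: "x \<in> (\<lambda>k. rep (X ^ k)) ` T"
      let ?M = "\<lambda>k. complex_of_real (f (rep (X ^ k))) \<odot> X ^ k"
      have rsm: "mk (r *\<^sub>R A) = complex_of_real r \<odot> mk A" for r and A :: "complex^'n^'n"
        by (rule sqm_eqI, simp, simp add: scaleR_conv_of_real)
      have "(\<Sum>k\<in>T. ?M k) = mk (\<Sum>x\<in>(\<lambda>k. rep (X ^ k)) ` T. f x *\<^sub>R x)"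
        by (subst sum.reindex[OF inj_on_subset[OF inj]]) (simp_all add: mk_sum rsm)
      then have s0: "(\<Sum>k\<in>T. ?M k) = 0" using f by (simp add: zero_sqm_def)
      obtain k where k: "k \<in> T" "x = rep (X ^ k)" using x by auto
      have "?M k = 0"
      proof (rule eigen_sum_zero[OF that])
        show "inj_on (\<lambda>k. 2 * of_nat k :: complex) T" by (simp add: inj_on_def)
        show "br H (?M k) = (2 * of_nat k) \<odot> ?M k" for k
          by (simp add: br_power_eigen[OF assms] mult.commute)
      qed (fact br_add_right br_sm_right s0 k(1))+
      then show "f x = 0" using nz k sm_cancel[of "complex_of_real (f x)" "X ^ k" 0] by auto
    qed (use that in simp)
    let ?D = "DIM(complex^'n^'n)"
    have "card ((\<lambda>k. rep (X ^ k)) ` {..?D}) = Suc ?D"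
      by (subst card_image[OF inj_on_subset[OF inj]]) (auto simp del: DIM_cart)
    moreover have "card ((\<lambda>k. rep (X ^ k)) ` {..?D}) \<le> ?D"
      using independent_bound[OF ind[of "{..?D}"]] by blast
    ultimately show False by simp
  qed
  then show ?thesis unfolding nilp_def using power_eq_0_if_ge_card by blast
qed

section \<open>Root systems\<close>

abbreviation cn :: "'e::euclidean_space \<Rightarrow> 'e \<Rightarrow> real" where
  "cn \<equiv> cartan_number"

lemma cn_add [simp]: "cn (b + g) a = cn b a + cn g a"
  and cn_diff [simp]: "cn (b - g) a = cn b a - cn g a"
  and cn_minus [simp]: "cn (- b) a = - cn b a"
  and cn_minus_right [simp]: "cn b (- a) = - cn b a"
  and cn_scaleR [simp]: "cn (c *\<^sub>R b) a = c * cn b a"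
  and cn_zero [simp]: "cn 0 a = 0"
  by (simp_all add: cartan_number_def inner_add_left inner_diff_left add_divide_distrib
      diff_divide_distrib algebra_simps)

lemma cn_self [simp]: "a \<noteq> 0 \<Longrightarrow> cn a a = 2"
  by (simp add: cartan_number_def)

text \<open>The number r of the string through b, which makes the structure constant of a Chevalley
  basis r + 1 up to sign.\<close>

definition rstr :: "'e::euclidean_space set \<Rightarrow> 'e \<Rightarrow> 'e \<Rightarrow> nat" where
  "rstr \<Phi> a b = Max {r :: nat. b - of_nat r *\<^sub>R a \<in> \<Phi>}"

definition long :: "'e::euclidean_space set \<Rightarrow> 'e \<Rightarrow> bool" where
  "long \<Phi> a \<longleftrightarrow> a \<in> \<Phi> \<and> (\<forall>b\<in>\<Phi>. b \<bullet> b \<le> a \<bullet> a)"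

definition rfl :: "'e::euclidean_space \<Rightarrow> 'e \<Rightarrow> 'e" where
  "rfl b a = a - cn a b *\<^sub>R b"

locale roots =
  fixes \<Phi> :: "'e::euclidean_space set"
  assumes root_system: "root_system \<Phi>"
begin

lemma finite_roots: "finite \<Phi>"
  and span_roots: "span \<Phi> = UNIV"
  and zero_not_root [simp]: "0 \<notin> \<Phi>"
  using root_system by (auto simp: root_system_def)

lemma root_nz: "a \<in> \<Phi> \<Longrightarrow> a \<noteq> 0"
  by auto

lemma inner_pos: "a \<in> \<Phi> \<Longrightarrow> a \<bullet> a > 0"
  using root_nz by auto

lemma scaleR_root_iff: "a \<in> \<Phi> \<Longrightarrow> c *\<^sub>R a \<in> \<Phi> \<longleftrightarrow> c = 1 \<or> c = -1"
  using root_system by (auto simp: root_system_def)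

lemma neg_root: "a \<in> \<Phi> \<Longrightarrow> - a \<in> \<Phi>"
  using scaleR_root_iff[of a "-1"] by simp

lemma neg_root_iff [simp]: "- a \<in> \<Phi> \<longleftrightarrow> a \<in> \<Phi>"
  using neg_root[of a] neg_root[of "- a"] by auto

lemma double_not_root: "a \<in> \<Phi> \<Longrightarrow> a + a \<notin> \<Phi>"
  using scaleR_root_iff[of a 2] by (simp add: scaleR_2)

lemma cn_Ints: "a \<in> \<Phi> \<Longrightarrow> b \<in> \<Phi> \<Longrightarrow> cn b a \<in> \<int>"
  using root_system by (auto simp: root_system_def)

lemma rfl_root: "a \<in> \<Phi> \<Longrightarrow> b \<in> \<Phi> \<Longrightarrow> rfl b a \<in> \<Phi>"
  using root_system by (auto simp: root_system_def rfl_def)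

lemma rfl_inner: "b \<in> \<Phi> \<Longrightarrow> rfl b x \<bullet> rfl b y = x \<bullet> y"
  using root_nz[of b]
  by (simp add: rfl_def cartan_number_def inner_diff_left inner_diff_right inner_commute field_simps)

lemma cn_prod: "cn a b * cn b a = 4 * (a \<bullet> b)\<^sup>2 / ((a \<bullet> a) * (b \<bullet> b))"
  by (simp add: cartan_number_def inner_commute power2_eq_square)

text \<open>Strict Cauchy-Schwarz: the only roots proportional to \<open>a\<close> are
  \<open>a\<close> and \<open>- a\<close>, so \<open>b\<close> differs from its projection onto the
  line of \<open>a\<close>.\<close>

lemma inner_square_less:
  assumes "a \<in> \<Phi>" "b \<in> \<Phi>" "b \<noteq> a" "b \<noteq> - a"
  shows "(a \<bullet> b)\<^sup>2 < (a \<bullet> a) * (b \<bullet> b)"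
proof -
  let ?c = "(a \<bullet> b) / (a \<bullet> a)"
  have "b \<noteq> ?c *\<^sub>R a"
    using assms scaleR_root_iff[OF assms(1), of ?c] by (metis scaleR_minus1_left scaleR_one)
  then have "0 < (b - ?c *\<^sub>R a) \<bullet> (b - ?c *\<^sub>R a)" by simp
  also have "\<dots> = b \<bullet> b - (a \<bullet> b)\<^sup>2 / (a \<bullet> a)"
    using root_nz[OF assms(1)]
    by (simp add: inner_diff_left inner_diff_right inner_commute power2_eq_square field_simps)
  finally show ?thesis using inner_pos[OF assms(1)] by (simp add: field_simps)
qed

lemma cn_prod_less:
  assumes "a \<in> \<Phi>" "b \<in> \<Phi>" "b \<noteq> a" "b \<noteq> - a"
  shows "cn a b * cn b a < 4"
  using inner_square_less[OF assms] inner_pos[OF assms(1)] inner_pos[OF assms(2)]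
  unfolding cn_prod by (simp add: field_simps)

lemma cn_sgn: "a \<in> \<Phi> \<Longrightarrow> cn b a < 0 \<longleftrightarrow> b \<bullet> a < 0"
    "a \<in> \<Phi> \<Longrightarrow> cn b a > 0 \<longleftrightarrow> b \<bullet> a > 0"
    "a \<in> \<Phi> \<Longrightarrow> cn b a = 0 \<longleftrightarrow> b \<bullet> a = 0"
  using inner_pos[of a] by (auto simp: cartan_number_def divide_less_0_iff zero_less_divide_iff simp del: inner_gt_zero_iff)

text \<open>The two Cartan integers are negative with product below 4, so one of them is -1, and the
  corresponding reflection produces the sum.\<close>

lemma sum_root:
  assumes "a \<in> \<Phi>" "b \<in> \<Phi>" "a \<bullet> b < 0" "b \<noteq> - a"
  shows "a + b \<in> \<Phi>"
proof -
  have "b \<noteq> a" using assms(3) inner_ge_zero[of a] by force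
  then have lt: "cn a b * cn b a < 4" using cn_prod_less assms by blast
  obtain m where m: "cn a b = of_int m" using cn_Ints[OF assms(2,1)] by (auto elim: Ints_cases)
  obtain n where n: "cn b a = of_int n" using cn_Ints[OF assms(1,2)] by (auto elim: Ints_cases)
  have neg: "m < 0" "n < 0"
    using cn_sgn(1)[OF assms(2), of a] cn_sgn(1)[OF assms(1), of b] assms(3) m n
    by (simp_all add: inner_commute)
  have "m * n < 4" using lt unfolding m n by (simp flip: of_int_mult)
  have "m = -1 \<or> n = -1"
  proof (rule ccontr)
    assume "\<not> ?thesis"
    with neg have "- m \<ge> 2" "- n \<ge> 2" by auto
    then have "(- m) * (- n) \<ge> 2 * 2" by (intro mult_mono) auto
    with \<open>m * n < 4\<close> show False by simp
  qed
  then show ?thesis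
  proof
    assume "m = -1"
    then show ?thesis using rfl_root[OF assms(1,2)] m by (simp add: rfl_def)
  next
    assume "n = -1"
    then show ?thesis using rfl_root[OF assms(2,1)] n by (simp add: rfl_def add.commute)
  qed
qed

lemma diff_root:
  assumes "a \<in> \<Phi>" "b \<in> \<Phi>" "a \<bullet> b > 0" "b \<noteq> a"
  shows "a - b \<in> \<Phi>"
  using sum_root[of a "- b"] assms by auto

lemma cn_bound:
  assumes "a \<in> \<Phi>" "b \<in> \<Phi>"
  shows "\<bar>cn b a\<bar> \<le> 3"
proof (cases "b = a \<or> b = - a")
  case True
  then show ?thesis using root_nz[OF assms(1)] by auto
next
  case False
  obtain m where m: "cn a b = of_int m" using cn_Ints[OF assms(2,1)] by (auto elim: Ints_cases)
  obtain n where n: "cn b a = of_int n" using cn_Ints[OF assms(1,2)] by (auto elim: Ints_cases)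
  have "m * n < 4" using cn_prod_less[OF assms] False unfolding m n by (simp flip: of_int_mult)
  show ?thesis
  proof (cases "n = 0")
    case False
    have "n > 0 \<longleftrightarrow> m > 0" "n < 0 \<longleftrightarrow> m < 0"
      using cn_sgn[OF assms(2), of a] cn_sgn[OF assms(1), of b] m n by (simp_all add: inner_commute)
    with False have mn: "m * n = \<bar>m\<bar> * \<bar>n\<bar>" "\<bar>m\<bar> \<ge> 1"
      by (auto simp: abs_if split: if_splits)
    then have "1 * \<bar>n\<bar> \<le> \<bar>m\<bar> * \<bar>n\<bar>"
      by (intro mult_right_mono) auto
    then have "\<bar>n\<bar> \<le> 3" using \<open>m * n < 4\<close> mn by linarith
    then show ?thesis using n by linarith
  qed (use n in simp)
qed

text \<open>As \<open>b\<close> is not longer than \<open>a\<close>, strict Cauchy-Schwarz bounds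
  the square of the Cartan integer below 4. Thus a long root defines a grading with degrees -2 to 2
  in which 2 and -2 belong to \<open>a\<close> and \<open>- a\<close> alone.\<close>

lemma long_cn:
  assumes "long \<Phi> a" "b \<in> \<Phi>" "b \<noteq> a" "b \<noteq> - a"
  shows "cn b a = -1 \<or> cn b a = 0 \<or> cn b a = 1"
proof -
  have a: "a \<in> \<Phi>" "b \<bullet> b \<le> a \<bullet> a" using assms by (auto simp: long_def)
  obtain n where n: "cn b a = of_int n" using cn_Ints[OF a(1) assms(2)] by (auto elim: Ints_cases)
  have "(b \<bullet> a)\<^sup>2 < (a \<bullet> a) * (a \<bullet> a)"
    using inner_square_less[OF a(1) assms(2-4)] mult_left_mono[OF a(2), of "a \<bullet> a"]
    by (simp add: inner_commute)
  then have "(2 * (b \<bullet> a))\<^sup>2 / ((a \<bullet> a) * (a \<bullet> a)) < 4"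
    using inner_pos[OF a(1)] by (simp add: field_simps)
  then have "(cn b a)\<^sup>2 < 4" by (simp add: cartan_number_def power2_eq_square)
  then have "\<bar>real_of_int n\<bar> < 2"
    unfolding n using abs_le_square_iff[of 2 "real_of_int n"] by force
  then have "\<bar>n\<bar> < 2" by linarith
  then show ?thesis unfolding n by (auto simp: abs_if split: if_splits)
qed

lemma finite_string:
  assumes "a \<in> \<Phi>"
  shows "finite {r :: nat. b - of_nat r *\<^sub>R a \<in> \<Phi>}"
proof (rule finite_imageD)
  show "finite ((\<lambda>r :: nat. b - of_nat r *\<^sub>R a) ` {r. b - of_nat r *\<^sub>R a \<in> \<Phi>})"
    by (rule finite_subset[OF _ finite_roots]) auto
  show "inj_on (\<lambda>r :: nat. b - of_nat r *\<^sub>R a) {r. b - of_nat r *\<^sub>R a \<in> \<Phi>}"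
    using root_nz[OF assms] by (auto simp: inj_on_def)
qed

lemma rstr_eqI:
  assumes "a \<in> \<Phi>" "b - of_nat r *\<^sub>R a \<in> \<Phi>" "\<And>i. i > r \<Longrightarrow> b - of_nat i *\<^sub>R a \<notin> \<Phi>"
  shows "rstr \<Phi> a b = r"
  unfolding rstr_def
proof (rule Max_eqI[OF finite_string[OF assms(1)]])
  show "y \<le> r" if "y \<in> {r :: nat. b - of_nat r *\<^sub>R a \<in> \<Phi>}" for y
    using assms(3)[of y] that by (cases "y \<le> r") auto
qed (use assms in simp)

text \<open>From a root b - i a one would climb back to b - a by adding \<open>a\<close> repeatedly:
  the inner product with \<open>a\<close> stays negative, because that of \<open>b\<close> with
  \<open>a\<close> is at most 0.\<close>

lemma string_unbroken:
  assumes "a \<in> \<Phi>" "b \<in> \<Phi>" "b \<noteq> a" "b - a \<notin> \<Phi>" "i \<ge> 1"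
  shows "b - of_nat i *\<^sub>R a \<notin> \<Phi>"
proof
  assume p: "b - of_nat i *\<^sub>R a \<in> \<Phi>"
  have le0: "b \<bullet> a \<le> 0" using diff_root[OF assms(2,1)] assms by force
  have "b \<noteq> - a"
  proof
    assume "b = - a"
    with p have "(- 1 - of_nat i) *\<^sub>R a \<in> \<Phi>" by (simp add: scaleR_left_diff_distrib)
    then show False using scaleR_root_iff[OF assms(1), of "- 1 - of_nat i"] assms(5) by simp
  qed
  have "b - of_nat (i - j) *\<^sub>R a \<in> \<Phi>" if "j < i" for j using that
  proof (induction j)
    case (Suc j)
    let ?q = "b - of_nat (i - j) *\<^sub>R a"
    have q: "?q \<in> \<Phi>" using Suc by simp
    have e: "a + ?q = b - of_nat (i - Suc j) *\<^sub>R a"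
      using Suc.prems by (simp add: of_nat_diff algebra_simps)
    have "a \<bullet> ?q = b \<bullet> a - of_nat (i - j) * (a \<bullet> a)"
      by (simp add: inner_diff_right inner_commute)
    moreover have "of_nat (i - j) * (a \<bullet> a) > 0"
      using Suc.prems inner_pos[OF assms(1)] by simp
    ultimately have "a \<bullet> ?q < 0" using le0 by linarith
    moreover have "?q \<noteq> - a"
    proof
      assume "?q = - a"
      then have "b = (of_nat (i - j) - 1) *\<^sub>R a" by (simp add: algebra_simps)
      with scaleR_root_iff[OF assms(1)] assms(2,3) \<open>b \<noteq> - a\<close> show False
        by (metis scaleR_minus1_left scaleR_one)
    qed
    ultimately show ?case using sum_root[OF assms(1) q] e by simp
  qed (use p in simp)
  from this[of "i - 1"] assms show False by simp
qed

lemma rstr_eq_0: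
  assumes "a \<in> \<Phi>" "b \<in> \<Phi>" "b \<noteq> a" "b - a \<notin> \<Phi>"
  shows "rstr \<Phi> a b = 0"
  by (rule rstr_eqI) (use assms string_unbroken[OF assms] in auto)

lemma rstr_eq_1:
  assumes "a \<in> \<Phi>" "b \<in> \<Phi>" "b - a \<in> \<Phi>" "b - 2 *\<^sub>R a \<notin> \<Phi>"
  shows "rstr \<Phi> a b = 1"
proof (rule rstr_eqI[OF assms(1)])
  fix i :: nat assume i: "1 < i"
  have "b - a \<noteq> a" using assms(2) double_not_root[OF assms(1)] by (auto simp: algebra_simps)
  from string_unbroken[OF assms(1,3) this, of "i - 1"] assms(4) i
  show "b - of_nat i *\<^sub>R a \<notin> \<Phi>" by (auto simp: of_nat_diff scaleR_2 algebra_simps)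
qed (use assms in auto)

end

section \<open>Consequences of indecomposability\<close>

locale irreducible_roots = roots +
  assumes indecomposable: "indecomposable \<Phi>"
begin

lemma no_orthogonal_split:
  assumes "\<Phi> = A \<union> B" "\<And>a b. a \<in> A \<Longrightarrow> b \<in> B \<Longrightarrow> a \<bullet> b = 0" "A \<noteq> {}"
  shows "B = {}"
  using assms indecomposable unfolding indecomposable_def by blast

text \<open>The roots orthogonal to all of \<open>D\<close> and the remaining ones would decompose
  the system. For \<delta> in \<open>D\<close> and a root a not orthogonal to it, both \<delta> and
  its reflection at a are orthogonal to the first kind, hence so is a.\<close>

lemma rfl_closed_not_orthogonal:
  assumes "D \<subseteq> \<Phi>" "D \<noteq> {}" "\<And>\<beta> \<delta>. \<beta> \<in> \<Phi> \<Longrightarrow> \<delta> \<in> D \<Longrightarrow> rfl \<beta> \<delta> \<in> D" "\<sigma> \<in> \<Phi>"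
  shows "\<exists>\<delta>\<in>D. \<delta> \<bullet> \<sigma> \<noteq> 0"
proof -
  let ?B = "{\<beta> \<in> \<Phi>. \<forall>\<delta>\<in>D. \<delta> \<bullet> \<beta> = 0}"
  have "?B = {}"
  proof (rule no_orthogonal_split)
    show "\<Phi> = {\<beta> \<in> \<Phi>. \<exists>\<delta>\<in>D. \<delta> \<bullet> \<beta> \<noteq> 0} \<union> ?B"
      by auto
    show "{\<beta> \<in> \<Phi>. \<exists>\<delta>\<in>D. \<delta> \<bullet> \<beta> \<noteq> 0} \<noteq> {}"
      using assms(1,2) inner_pos by fastforce
    fix a b assume a: "a \<in> {\<beta> \<in> \<Phi>. \<exists>\<delta>\<in>D. \<delta> \<bullet> \<beta> \<noteq> 0}" and b: "b \<in> ?B"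
    then obtain \<delta> where d: "\<delta> \<in> D" "\<delta> \<bullet> a \<noteq> 0" "a \<in> \<Phi>"
      by auto
    have "rfl a \<delta> \<bullet> b = 0" "\<delta> \<bullet> b = 0" using b assms(3) d by auto
    then have "cn \<delta> a * (a \<bullet> b) = 0" by (simp add: rfl_def inner_diff_left)
    then show "a \<bullet> b = 0" using cn_sgn(3)[OF d(3), of \<delta>] d(2) by simp
  qed
  then show ?thesis using assms(4) by auto
qed

text \<open>Stands in for the transitivity of the Weyl group on roots of equal length. Two distinct
  such roots with positive inner product differ by a root, and the reflection at the difference
  exchanges them.\<close>

lemma rfl_closed_same_length:
  assumes "D \<subseteq> \<Phi>" "\<And>b \<delta>. b \<in> \<Phi> \<Longrightarrow> \<delta> \<in> D \<Longrightarrow> rfl b \<delta> \<in> D"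
    and "a \<in> D" "g \<in> \<Phi>" "g \<bullet> g = a \<bullet> a"
  shows "g \<in> D"
proof -
  have "\<exists>\<delta>\<in>{\<delta> \<in> D. \<delta> \<bullet> \<delta> = a \<bullet> a}. \<delta> \<bullet> g \<noteq> 0"
    by (rule rfl_closed_not_orthogonal) (use assms rfl_inner in auto)
  then obtain \<delta> where d: "\<delta> \<in> D" "\<delta> \<bullet> \<delta> = g \<bullet> g" "\<delta> \<bullet> g \<noteq> 0" "\<delta> \<in> \<Phi>"
    using assms(1,5) by auto
  have neg: "- \<delta> \<in> D"
    using assms(2)[OF d(4,1)] d(4) root_nz by (simp add: rfl_def scaleR_2)
  have step: "g \<in> D" if e: "\<epsilon> \<in> D" "\<epsilon> \<bullet> \<epsilon> = g \<bullet> g" "\<epsilon> \<bullet> g > 0" "\<epsilon> \<noteq> g" for \<epsilon>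
  proof -
    have E: "\<epsilon> \<in> \<Phi>" using e assms(1) by auto
    have "\<epsilon> - g \<in> \<Phi>" using diff_root[OF E assms(4) e(3)] e(4) by auto
    then have r: "rfl (\<epsilon> - g) \<epsilon> \<in> D" using assms(2) e(1) by blast
    have "(\<epsilon> - g) \<bullet> (\<epsilon> - g) = 2 * (\<epsilon> \<bullet> (\<epsilon> - g))"
      using e(2) by (simp add: inner_diff_left inner_diff_right inner_commute)
    moreover have "(\<epsilon> - g) \<bullet> (\<epsilon> - g) > 0" using e(4) by simp
    ultimately have "cn \<epsilon> (\<epsilon> - g) = 1" by (simp add: cartan_number_def)
    then show ?thesis using r by (simp add: rfl_def)
  qed
  have "g \<in> D" if "g \<noteq> \<delta>" "g \<noteq> - \<delta>"
    using step[of \<delta>] step[of "- \<delta>"] neg d that by (cases "\<delta> \<bullet> g > 0") (auto simp: not_less)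
  then show ?thesis using neg d(1) by auto
qed

text \<open>Otherwise \<open>{a, - a}\<close> would split off, and indecomposability would leave no
  other roots, which contradicts the rank.\<close>

lemma exists_neighbour:
  assumes "a \<in> \<Phi>" "DIM('a) > 1"
  obtains b where "b \<in> \<Phi>" "b \<noteq> a" "b \<noteq> - a" "b \<bullet> a \<noteq> 0"
proof (rule ccontr)
  assume "\<not> thesis"
  then have all: "\<forall>b\<in>\<Phi>. b = a \<or> b = - a \<or> b \<bullet> a = 0"
    using that by blast
  let ?B = "{b \<in> \<Phi>. b \<bullet> a = 0}"
  have "?B = {}"
    by (rule no_orthogonal_split[of "{a, - a}"]) (use all assms in \<open>auto simp: inner_commute\<close>)
  with all have "\<Phi> \<subseteq> span {a}" by (auto intro: span_base span_neg)
  then have "span \<Phi> \<subseteq> span {a}" using span_minimal subspace_span by blast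
  then have "dim (UNIV :: 'a set) \<le> dim {a}"
    using span_roots by (metis dim_span dim_subset top.extremum_uniqueI)
  also have "\<dots> \<le> card {a}" by (rule dim_le_card') simp
  finally show False using assms(2) by simp
qed

end

lemma (in roots) exists_long:
  assumes "\<Phi> \<noteq> {}"
  shows "\<exists>a. long \<Phi> a"
proof -
  let ?N = "(\<lambda>a. a \<bullet> a) ` \<Phi>"
  have "Max ?N \<in> ?N" using assms finite_roots by (intro Max_in) auto
  then obtain a where "a \<in> \<Phi>" "a \<bullet> a = Max ?N" by auto
  then show ?thesis unfolding long_def using finite_roots by (intro exI[of _ a]) auto
qed

section \<open>Root elements and weights\<close>

definition zint :: "(complex, 'n::finite) sqm \<Rightarrow> bool" where
  "zint M \<longleftrightarrow> (\<forall>i j. ent M i j \<in> \<int>)"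

definition fl :: "(complex, 'n::finite) sqm \<Rightarrow> (int, 'n) sqm" where
  "fl M = mp (\<lambda>z. \<lfloor>Re z\<rfloor>) M"

lemma imat_fl: "zint M \<Longrightarrow> imat (fl M) = M"
  unfolding zint_def fl_def
  by (rule sqm_eqI) (simp, metis Ints_cases Re_complex_of_real floor_of_int of_real_of_int_eq)

lemma zint_imat [simp]: "zint (imat M)"
  by (simp add: zint_def)

lemma zint_mult [simp]: "zint A \<Longrightarrow> zint B \<Longrightarrow> zint (A * B)"
  and zint_add [simp]: "zint A \<Longrightarrow> zint B \<Longrightarrow> zint (A + B)"
  and zint_diff [simp]: "zint A \<Longrightarrow> zint B \<Longrightarrow> zint (A - B)"
  and zint_minus [simp]: "zint A \<Longrightarrow> zint (- A)"
  and zint_minus_iff [simp]: "zint (- A) \<longleftrightarrow> zint A"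
  and zint_zero [simp]: "zint 0"
  and zint_one [simp]: "zint 1"
  by (auto simp: zint_def ent_mult ent_one intro!: Ints_sum Ints_mult)

lemma zint_sm [simp]: "c \<in> \<int> \<Longrightarrow> zint A \<Longrightarrow> zint (c \<odot> A)"
  by (auto simp: zint_def)

lemma zint_sum: "(\<And>x. x \<in> S \<Longrightarrow> zint (f x)) \<Longrightarrow> zint (sum f S)"
  by (induction S rule: infinite_finite_induct) auto

lemma zint_br [simp]: "zint A \<Longrightarrow> zint B \<Longrightarrow> zint (br A B)"
  by (simp add: br_def)

text \<open>Bezout: \<open>d\<close> is, up to sign, the greatest common divisor of the
  values.\<close>

lemma content_exists:
  fixes f :: "'a \<Rightarrow> int"
  assumes "finite I"
  shows "\<exists>w d. (\<Sum>i\<in>I. w i * f i) = d \<and> (\<forall>i\<in>I. d dvd f i)"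
  using assms
proof (induction I rule: finite_induct)
  case (insert a I)
  then obtain w d where wd: "(\<Sum>i\<in>I. w i * f i) = d" "\<forall>i\<in>I. d dvd f i" by auto
  obtain u v where uv: "u * f a + v * d = gcd (f a) d" using bezout_int by blast
  let ?w = "\<lambda>i. if i = a then u else v * w i"
  have "(\<Sum>i\<in>insert a I. ?w i * f i) = u * f a + (\<Sum>i\<in>I. v * w i * f i)"
    using insert.hyps by (auto intro!: sum.cong)
  also have "(\<Sum>i\<in>I. v * w i * f i) = v * d"
    unfolding wd(1)[symmetric] sum_distrib_left by (simp add: mult.assoc)
  also have "u * f a + v * d = gcd (f a) d" by (rule uv)
  finally show ?case
    using wd(2) by (intro exI[of _ ?w] exI[of _ "gcd (f a) d"]) (auto intro: dvd_trans[of _ d])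
qed simp

text \<open>A Vandermonde argument with matrix coefficients: subtracting \<open>c a\<close> times
  one relation from the next removes the term at \<open>a\<close>.\<close>

lemma power_sum_zero:
  fixes A :: "'b \<Rightarrow> ('a::field, 'n::finite) sqm"
  assumes "finite S" "inj_on c S" "\<And>k. (\<Sum>m\<in>S. c m ^ k \<odot> A m) = 0" "m \<in> S"
  shows "A m = 0"
  using assms
proof (induction S arbitrary: A m rule: finite_induct)
  case (insert a S)
  have "(\<Sum>m\<in>S. c m ^ k \<odot> ((c m - c a) \<odot> A m)) = 0" for k
  proof -
    have "0 = (\<Sum>m\<in>insert a S. c m ^ Suc k \<odot> A m) - c a \<odot> (\<Sum>m\<in>insert a S. c m ^ k \<odot> A m)"
      unfolding insert.prems(2) by simp
    also have "\<dots> = (\<Sum>m\<in>insert a S. c m ^ k \<odot> ((c m - c a) \<odot> A m))"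
      by (simp add: sm_sum_right sum_subtractf[symmetric] sm_simps[symmetric] algebra_simps
          del: sum.insert)
    also have "\<dots> = (\<Sum>m\<in>S. c m ^ k \<odot> ((c m - c a) \<odot> A m))"
      using insert.hyps by simp
    finally show ?thesis by simp
  qed
  then have "(c m - c a) \<odot> A m = 0" if "m \<in> S" for m
    using insert.IH[of "\<lambda>m. (c m - c a) \<odot> A m" m] insert.prems(1) that by auto
  moreover have "c m \<noteq> c a" if "m \<in> S" for m
    using insert.prems(1) insert.hyps that by (auto simp: inj_on_def)
  ultimately have z: "A m = 0" if "m \<in> S" for m
    using that sm_cancel[of "c m - c a" "A m" 0] by auto
  moreover have "A a = 0" using insert.prems(2)[of 0] insert.hyps z by simp
  ultimately show ?case using insert.prems(3) by auto
qed auto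

lemma sm_two: "2 \<odot> A = A + A"
  by (rule sqm_eqI) simp

text \<open>Only the matrices of the root vectors are kept; the Cartan elements are recovered as
  brackets of opposite ones. The last condition transports linear relations between coroots to these
  brackets; through it the Lie algebra is seen to have trivial centre.\<close>

locale chev = irreducible_roots \<Phi> for \<Phi> :: "'e::euclidean_space set" +
  fixes X :: "'e \<Rightarrow> (complex, 'n::finite) sqm"
  assumes X_nz: "\<alpha> \<in> \<Phi> \<Longrightarrow> X \<alpha> \<noteq> 0"
    and HX: "\<alpha> \<in> \<Phi> \<Longrightarrow> \<beta> \<in> \<Phi> \<Longrightarrow>
      br (br (X \<alpha>) (X (- \<alpha>))) (X \<beta>) = complex_of_real (cn \<beta> \<alpha>) \<odot> X \<beta>"
    and XX_zero: "\<alpha> \<in> \<Phi> \<Longrightarrow> \<beta> \<in> \<Phi> \<Longrightarrow> \<alpha> + \<beta> \<noteq> 0 \<Longrightarrow> \<alpha> + \<beta> \<notin> \<Phi> \<Longrightarrow> br (X \<alpha>) (X \<beta>) = 0"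
    and XX: "\<alpha> \<in> \<Phi> \<Longrightarrow> \<beta> \<in> \<Phi> \<Longrightarrow> \<alpha> + \<beta> \<in> \<Phi> \<Longrightarrow>
      br (X \<alpha>) (X \<beta>) = of_nat (rstr \<Phi> \<alpha> \<beta> + 1) \<odot> X (\<alpha> + \<beta>) \<or>
      br (X \<alpha>) (X \<beta>) = (- of_nat (rstr \<Phi> \<alpha> \<beta> + 1)) \<odot> X (\<alpha> + \<beta>)"
    and dpow_X_Ints: "\<alpha> \<in> \<Phi> \<Longrightarrow> zint (dpow (X \<alpha>) k)"
    and coroot_relation: "(\<And>\<beta>. \<beta> \<in> \<Phi> \<Longrightarrow> (\<Sum>\<gamma>\<in>\<Phi>. b \<gamma> * complex_of_real (cn \<beta> \<gamma>)) = 0) \<Longrightarrow>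
      (\<Sum>\<gamma>\<in>\<Phi>. b \<gamma> \<odot> br (X \<gamma>) (X (- \<gamma>))) = 0"
begin

definition H :: "'e \<Rightarrow> (complex, 'n) sqm" where
  "H a = br (X a) (X (- a))"

lemma br_H_X: "a \<in> \<Phi> \<Longrightarrow> b \<in> \<Phi> \<Longrightarrow> br (H a) (X b) = of_real (cn b a) \<odot> X b"
  unfolding H_def by (rule HX)

lemma br_X_H: "a \<in> \<Phi> \<Longrightarrow> b \<in> \<Phi> \<Longrightarrow> br (X b) (H a) = - (of_real (cn b a) \<odot> X b)"
  by (metis br_H_X br_swap)

lemma br_X_neg: "br (X a) (X (- a)) = H a"
  by (simp add: H_def)

lemma H_neg: "H (- a) = - H a"
  unfolding H_def using br_swap[of "X (- a)" "X a"] by simp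

lemma br_X_neg': "br (X (- a)) (X a) = - H a"
  using br_X_neg[of "- a"] by (simp add: H_neg)

lemma structure_constant:
  assumes "a \<in> \<Phi>" "b \<in> \<Phi>" "a + b \<in> \<Phi>"
  obtains N :: int where "br (X a) (X b) = of_int N \<odot> X (a + b)" "\<bar>N\<bar> = int (rstr \<Phi> a b) + 1"
  using XX[OF assms] that[of "int (rstr \<Phi> a b + 1)"] that[of "- int (rstr \<Phi> a b + 1)"]
  by auto

lemma nilp_X: "a \<in> \<Phi> \<Longrightarrow> nilp (X a)"
  using nilp_if_eigen[of "H a" "X a"] br_H_X[of a a] root_nz[of a] by simp

lemma br_H_H: "a \<in> \<Phi> \<Longrightarrow> b \<in> \<Phi> \<Longrightarrow> br (H a) (H b) = 0"
  unfolding H_def[of b] by (subst br_jacobi) (simp add: br_H_X)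

section \<open>Weight spaces and the Lie algebra of matrices\<close>

definition Wt :: "'e \<Rightarrow> (complex, 'n) sqm set" where
  "Wt \<mu> = {Y. \<forall>g\<in>\<Phi>. br (H g) Y = of_real (cn \<mu> g) \<odot> Y}"

lemma Wt_X: "b \<in> \<Phi> \<Longrightarrow> X b \<in> Wt b"
  by (simp add: Wt_def br_H_X)

lemma Wt_H: "b \<in> \<Phi> \<Longrightarrow> H b \<in> Wt 0"
  by (simp add: Wt_def br_H_H)

lemma Wt_add: "Y \<in> Wt \<mu> \<Longrightarrow> Z \<in> Wt \<mu> \<Longrightarrow> Y + Z \<in> Wt \<mu>"
  and Wt_sm: "Y \<in> Wt \<mu> \<Longrightarrow> c \<odot> Y \<in> Wt \<mu>"
  and Wt_zero: "0 \<in> Wt \<mu>"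
  by (auto simp: Wt_def br_simps sm_simps mult.commute)

lemma Wt_minus: "Y \<in> Wt \<mu> \<Longrightarrow> - Y \<in> Wt \<mu>"
  using Wt_sm[of Y \<mu> "-1"] by simp

lemma Wt_sum: "(\<And>x. x \<in> S \<Longrightarrow> f x \<in> Wt \<mu>) \<Longrightarrow> sum f S \<in> Wt \<mu>"
  by (induction S rule: infinite_finite_induct) (auto intro: Wt_add Wt_zero)

lemma Wt_br: "Y \<in> Wt \<mu> \<Longrightarrow> Z \<in> Wt \<nu> \<Longrightarrow> br Y Z \<in> Wt (\<mu> + \<nu>)"
  unfolding Wt_def by (auto simp: br_jacobi[of "H _" Y Z] sm_simps)

lemma Wt_adp: "d \<in> \<Phi> \<Longrightarrow> Y \<in> Wt \<mu> \<Longrightarrow> adp (X d) k Y \<in> Wt (\<mu> + of_nat k *\<^sub>R d)"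
proof (induction k)
  case (Suc k)
  then have "br (X d) (adp (X d) k Y) \<in> Wt (d + (\<mu> + of_nat k *\<^sub>R d))"
    by (intro Wt_br Wt_X) auto
  also have "d + (\<mu> + of_nat k *\<^sub>R d) = \<mu> + of_nat (Suc k) *\<^sub>R d"
    by (simp add: algebra_simps)
  finally show ?case unfolding adp_Suc' by (rule Wt_sm)
qed simp

lemma cn_separates:
  assumes "\<mu> \<noteq> \<nu>"
  obtains g where "g \<in> \<Phi>" "cn \<mu> g \<noteq> cn \<nu> g"
proof -
  have "\<exists>g\<in>\<Phi>. cn \<mu> g \<noteq> cn \<nu> g"
  proof (rule ccontr)
    assume c: "\<not> (\<exists>g\<in>\<Phi>. cn \<mu> g \<noteq> cn \<nu> g)"
    have o: "(\<mu> - \<nu>) \<bullet> g = 0" if "g \<in> \<Phi>" for g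
      using c that cn_sgn(3)[OF that, of "\<mu> - \<nu>"] by simp
    have "(\<mu> - \<nu>) \<bullet> x = 0" if "x \<in> span \<Phi>" for x
      using that by (induction rule: span_induct_alt) (auto simp: inner_add_right o)
    then have "(\<mu> - \<nu>) \<bullet> (\<mu> - \<nu>) = 0" using span_roots by blast
    then show False using assms by simp
  qed
  then show ?thesis using that by blast
qed

text \<open>As for eigenvectors with distinct eigenvalues, except that the operator depends on the
  pair of weights to be separated: a suitable \<open>H \<gamma>\<close> exists because the roots
  span the space.\<close>

lemma Wt_independent:
  assumes "finite S" "\<And>\<mu>. \<mu> \<in> S \<Longrightarrow> M \<mu> \<in> Wt \<mu>" "(\<Sum>\<mu>\<in>S. M \<mu>) = 0" "\<mu> \<in> S"
  shows "M \<mu> = 0"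
  using assms
proof (induction S arbitrary: M \<mu> rule: finite_induct)
  case (insert a S)
  have *: "(\<Sum>\<mu>\<in>S. of_real (cn \<mu> \<gamma> - cn a \<gamma>) \<odot> M \<mu>) = 0" if "\<gamma> \<in> \<Phi>" for \<gamma>
  proof -
    have "0 = br (H \<gamma>) (\<Sum>\<mu>\<in>insert a S. M \<mu>) - of_real (cn a \<gamma>) \<odot> (\<Sum>\<mu>\<in>insert a S. M \<mu>)"
      unfolding insert.prems(2) by simp
    also have "\<dots> = (\<Sum>\<mu>\<in>insert a S. br (H \<gamma>) (M \<mu>) - of_real (cn a \<gamma>) \<odot> M \<mu>)"
      unfolding br_sum_right sm_sum_right sum_subtractf ..
    also have "\<dots> = (\<Sum>\<mu>\<in>insert a S. of_real (cn \<mu> \<gamma> - cn a \<gamma>) \<odot> M \<mu>)"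
      by (rule sum.cong)
        (use insert.prems(1) that in \<open>auto simp: Wt_def sm_simps\<close>)
    finally show ?thesis using insert.hyps by simp
  qed
  have z: "M \<mu> = 0" if mu: "\<mu> \<in> S" for \<mu>
  proof -
    obtain \<gamma> where g: "\<gamma> \<in> \<Phi>" "cn \<mu> \<gamma> \<noteq> cn a \<gamma>"
      using cn_separates[of \<mu> a] mu insert.hyps by blast
    have "of_real (cn \<mu> \<gamma> - cn a \<gamma>) \<odot> M \<mu> = 0"
      using insert.IH[where M = "\<lambda>\<mu>. of_real (cn \<mu> \<gamma> - cn a \<gamma>) \<odot> M \<mu>", OF _ *[OF g(1)] mu]
        insert.prems(1) by (auto intro: Wt_sm)
    then show ?thesis
      using g sm_cancel[of "of_real (cn \<mu> \<gamma> - cn a \<gamma>)" "M \<mu>" 0] by auto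
  qed
  moreover have "M a = 0" using insert.prems(2) insert.hyps z by simp
  ultimately show ?case using insert.prems(3) by auto
qed auto

definition L :: "(complex, 'n) sqm set" where
  "L = {(\<Sum>g\<in>\<Phi>. a g \<odot> X g) + (\<Sum>g\<in>\<Phi>. b g \<odot> H g) | a b. True}"

lemma L_add: "Y \<in> L \<Longrightarrow> Z \<in> L \<Longrightarrow> Y + Z \<in> L"
proof -
  assume "Y \<in> L" "Z \<in> L"
  then obtain a b c d where "Y = (\<Sum>g\<in>\<Phi>. a g \<odot> X g) + (\<Sum>g\<in>\<Phi>. b g \<odot> H g)"
    "Z = (\<Sum>g\<in>\<Phi>. c g \<odot> X g) + (\<Sum>g\<in>\<Phi>. d g \<odot> H g)"
    unfolding L_def by blast
  then have "Y + Z = (\<Sum>g\<in>\<Phi>. (a g + c g) \<odot> X g) + (\<Sum>g\<in>\<Phi>. (b g + d g) \<odot> H g)"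
    by (simp add: sm_simps sum.distrib)
  then show ?thesis
    unfolding L_def by (intro CollectI exI[of _ "\<lambda>g. a g + c g"] exI[of _ "\<lambda>g. b g + d g"]) simp
qed

lemma L_sm: "Y \<in> L \<Longrightarrow> c \<odot> Y \<in> L"
proof -
  assume "Y \<in> L"
  then obtain a b where "Y = (\<Sum>g\<in>\<Phi>. a g \<odot> X g) + (\<Sum>g\<in>\<Phi>. b g \<odot> H g)"
    unfolding L_def by blast
  then have "c \<odot> Y = (\<Sum>g\<in>\<Phi>. (c * a g) \<odot> X g) + (\<Sum>g\<in>\<Phi>. (c * b g) \<odot> H g)"
    by (simp add: sm_simps sm_sum_right)
  then show ?thesis
    unfolding L_def by (intro CollectI exI[of _ "\<lambda>g. c * a g"] exI[of _ "\<lambda>g. c * b g"]) simp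
qed

lemma L_zero: "0 \<in> L"
  unfolding L_def by (intro CollectI exI[of _ "\<lambda>_. 0"]) simp

lemma L_minus: "Y \<in> L \<Longrightarrow> - Y \<in> L"
  using L_sm[of Y "-1"] by simp

lemma L_sum: "(\<And>x. x \<in> S \<Longrightarrow> f x \<in> L) \<Longrightarrow> sum f S \<in> L"
  by (induction S rule: infinite_finite_induct) (auto intro: L_add L_zero)

lemma sum_delta_sm:
  assumes "a \<in> \<Phi>"
  shows "(\<Sum>g\<in>\<Phi>. (if g = a then 1 else 0) \<odot> f g) = (f a :: (complex, 'n) sqm)"
proof -
  have "(\<Sum>g\<in>\<Phi>. (if g = a then 1 else 0) \<odot> f g) = (\<Sum>g\<in>\<Phi>. if g = a then f g else 0)"
    by (rule sum.cong) auto
  then show ?thesis using assms finite_roots by simp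
qed

lemma L_X: "a \<in> \<Phi> \<Longrightarrow> X a \<in> L"
  unfolding L_def
  by (intro CollectI exI[of _ "\<lambda>g. if g = a then 1 else 0"] exI[of _ "\<lambda>_. 0"])
    (simp add: sum_delta_sm)

lemma L_H: "a \<in> \<Phi> \<Longrightarrow> H a \<in> L"
  unfolding L_def
  by (intro CollectI exI[of _ "\<lambda>_. 0"] exI[of _ "\<lambda>g. if g = a then 1 else 0"])
    (simp add: sum_delta_sm)

lemma L_induct [consumes 1, case_names X H add sm]:
  assumes "Y \<in> L" "\<And>g. g \<in> \<Phi> \<Longrightarrow> P (X g)" "\<And>g. g \<in> \<Phi> \<Longrightarrow> P (H g)"
    and add: "\<And>Y Z. P Y \<Longrightarrow> P Z \<Longrightarrow> P (Y + Z)" and sm: "\<And>c Y. P Y \<Longrightarrow> P (c \<odot> Y)"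
  shows "P Y"
proof -
  obtain a b where Y: "Y = (\<Sum>g\<in>\<Phi>. a g \<odot> X g) + (\<Sum>g\<in>\<Phi>. b g \<odot> H g)"
    using assms(1) unfolding L_def by blast
  obtain \<alpha> where "\<alpha> \<in> \<Phi>"
    using indecomposable by (auto simp: indecomposable_def)
  then have P0: "P 0" using sm[of "X \<alpha>" 0] assms(2) by simp
  have psum: "P (sum f S)" if "\<And>x. x \<in> S \<Longrightarrow> P (f x)" for f and S :: "'e set"
    using that by (induction S rule: infinite_finite_induct) (auto intro: add P0)
  then show ?thesis unfolding Y by (intro add psum sm assms(2,3))
qed

lemma L_br_X:
  assumes "a \<in> \<Phi>" "Y \<in> L"
  shows "br (X a) Y \<in> L"
  using assms(2)
proof (induction Y rule: L_induct)
  case (X g)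
  show ?case
  proof (cases "a + g \<in> \<Phi>")
    case True
    from XX[OF assms(1) X this] L_sm[OF L_X[OF True]] show ?thesis by metis
  next
    case False
    show ?thesis
    proof (cases "a + g = 0")
      case True
      then have "g = - a" by (simp add: add_eq_0_iff)
      then show ?thesis using L_H[OF assms(1)] by (simp add: br_X_neg)
    qed (use XX_zero[OF assms(1) X] False L_zero in simp)
  qed
next
  case (H g)
  then show ?case using L_minus[OF L_sm[OF L_X[OF assms(1)]]] assms(1) by (simp add: br_X_H)
qed (auto simp: br_simps intro: L_add L_sm)

lemma L_adp: "a \<in> \<Phi> \<Longrightarrow> Y \<in> L \<Longrightarrow> adp (X a) k Y \<in> L"
  by (induction k) (auto simp: adp_Suc' intro: L_sm L_br_X simp del: of_nat_Suc)

text \<open>Moving \<open>Y\<close> to the other side of its expansion gives weight vectors with sum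
  0, so each vanishes; at the weight \<mu> this is the claim.\<close>

lemma L_Wt_decomp:
  assumes Y: "Y \<in> L" "Y \<in> Wt \<mu>"
  shows "\<exists>a b. Y = (if \<mu> \<in> \<Phi> then a \<odot> X \<mu> else 0) + (if \<mu> = 0 then \<Sum>g\<in>\<Phi>. b g \<odot> H g else 0)"
proof -
  obtain a b where ab: "Y = (\<Sum>g\<in>\<Phi>. a g \<odot> X g) + (\<Sum>g\<in>\<Phi>. b g \<odot> H g)"
    using Y(1) unfolding L_def by blast
  let ?S = "insert \<mu> (insert 0 \<Phi>)"
  define H' where "H' = (\<Sum>g\<in>\<Phi>. b g \<odot> H g)"
  define M1 where "M1 \<nu> = (if \<nu> \<in> \<Phi> then a \<nu> \<odot> X \<nu> else 0)" for \<nu>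
  define M2 where "M2 \<nu> = (if \<nu> = 0 then H' else 0)" for \<nu> :: 'e
  define M3 where "M3 \<nu> = (if \<nu> = \<mu> then Y else 0)" for \<nu>
  have fin: "finite ?S" using finite_roots by simp
  have H0: "H' \<in> Wt 0" unfolding H'_def by (intro Wt_sum Wt_sm Wt_H)
  have "M1 \<mu> + M2 \<mu> + - M3 \<mu> = 0"
  proof (rule Wt_independent[OF fin, where M = "\<lambda>\<nu>. M1 \<nu> + M2 \<nu> + - M3 \<nu>"])
    show "M1 \<nu> + M2 \<nu> + - M3 \<nu> \<in> Wt \<nu>" for \<nu>
      using Wt_sm[OF Wt_X, of \<nu>] Wt_zero H0 Y(2) Wt_minus[of Y \<mu>]
      by (intro Wt_add) (auto simp: M1_def M2_def M3_def)
    have "sum M1 ?S = (\<Sum>g\<in>\<Phi>. M1 g)"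
      by (rule sum.mono_neutral_right[OF fin]) (auto simp: M1_def)
    then have 1: "sum M1 ?S = (\<Sum>g\<in>\<Phi>. a g \<odot> X g)" by (simp add: M1_def)
    have 2: "sum M2 ?S = H'" unfolding M2_def by (subst sum.delta[OF fin]) simp
    have 3: "sum M3 ?S = Y" unfolding M3_def by (subst sum.delta[OF fin]) simp
    show "(\<Sum>\<nu>\<in>?S. M1 \<nu> + M2 \<nu> + - M3 \<nu>) = 0"
      unfolding sum.distrib sum_negf 1 2 3 ab H'_def by simp
  qed simp
  then have "Y = M1 \<mu> + M2 \<mu>" by (simp add: M3_def algebra_simps)
  then show ?thesis unfolding M1_def M2_def H'_def by blast
qed

lemma L_Wt_root: "Y \<in> L \<Longrightarrow> Y \<in> Wt \<mu> \<Longrightarrow> \<mu> \<in> \<Phi> \<Longrightarrow> \<exists>c. Y = c \<odot> X \<mu>"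
  using L_Wt_decomp[of Y \<mu>] by (auto split: if_splits)

lemma L_Wt_zero: "Y \<in> L \<Longrightarrow> Y \<in> Wt \<mu> \<Longrightarrow> \<mu> \<notin> \<Phi> \<Longrightarrow> \<mu> \<noteq> 0 \<Longrightarrow> Y = 0"
  using L_Wt_decomp[of Y \<mu>] by auto

text \<open>Adding 4 a raises the Cartan integer against \<open>a\<close> by 8, from at least -3 to
  at least 5, which no root attains. So conjugation by a root element needs divided powers up to the
  third only.\<close>

lemma adp4_zero:
  assumes "a \<in> \<Phi>" "Y \<in> L"
  shows "adp (X a) 4 Y = 0"
  using assms(2)
proof (induction Y rule: L_induct)
  case (X g)
  have w: "adp (X a) 4 (X g) \<in> Wt (g + 4 *\<^sub>R a)"
    using Wt_adp[OF assms(1) Wt_X[OF X], of 4] by simp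
  have "cn (g + 4 *\<^sub>R a) a = cn g a + 8" using root_nz[OF assms(1)] by simp
  then have "cn (g + 4 *\<^sub>R a) a \<ge> 5" using cn_bound[OF assms(1) X] by linarith
  then have "g + 4 *\<^sub>R a \<notin> \<Phi>" "g + 4 *\<^sub>R a \<noteq> 0"
    using cn_bound[OF assms(1), of "g + 4 *\<^sub>R a"] by (force simp del: cn_add)+
  then show ?case by (intro L_Wt_zero[OF L_adp[OF assms(1) L_X[OF X]] w])
next
  case (H g)
  have w: "adp (X a) 4 (H g) \<in> Wt (0 + 4 *\<^sub>R a)"
    using Wt_adp[OF assms(1) Wt_H[OF H], of 4] by simp
  have "4 *\<^sub>R a \<notin> \<Phi>" using scaleR_root_iff[OF assms(1), of 4] by simp
  then show ?case using root_nz[OF assms(1)] w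
    by (intro L_Wt_zero[OF L_adp[OF assms(1) L_H[OF H]] w]) auto
qed (simp_all add: adp_add)

lemma L_conj:
  assumes "a \<in> \<Phi>" "Y \<in> L"
  shows "cexp (X a) t * Y * cexp (X a) (- t) = (\<Sum>i<4. t ^ i \<odot> adp (X a) i Y)"
  by (rule cexp_conj[OF nilp_X[OF assms(1)] adp4_zero[OF assms]])

lemma L_conj_L: "a \<in> \<Phi> \<Longrightarrow> Y \<in> L \<Longrightarrow> cexp (X a) t * Y * cexp (X a) (- t) \<in> L"
  by (simp add: L_conj L_sum L_sm L_adp)

lemma adp_X_neg:
  assumes "a \<in> \<Phi>"
  shows "adp (X a) 2 (X (- a)) = - X a" "adp (X a) 3 (X (- a)) = 0"
proof -
  show 2: "adp (X a) 2 (X (- a)) = - X a"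
    using root_nz[OF assms] by (simp add: adp_def eval_nat_numeral br_X_neg br_X_H assms)
  show "adp (X a) 3 (X (- a)) = 0"
    using adp_Suc'[of "X a" 2 "X (- a)"] 2 by (simp add: eval_nat_numeral)
qed

subsection \<open>Integral weight projections\<close>

text \<open>The torus element \<open>tor g t\<close> below is a Laurent polynomial in \<open>t\<close>. Its coefficient \<open>Qm g m\<close> at \<open>t\<^sup>m\<close>
  is the projection onto the eigenspace of \<open>H g\<close> for \<open>m\<close>, in a form that is visibly integral.\<close>

definition Qm :: "'e \<Rightarrow> int \<Rightarrow> (complex, 'n) sqm" where
  "Qm g m = (\<Sum>i<CARD('n). \<Sum>j<CARD('n). \<Sum>k<CARD('n).
      (if int i - int j + int k = m then (-1) ^ j else 0) \<odot>
        (dpow (X g) i * dpow (X (- g)) j * dpow (X g) k)) *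
    (cexp (X g) (-1) * cexp (X (- g)) 1 * cexp (X g) (-1))"

text \<open>Contains every exponent i - j + k that occurs in \<open>Qm\<close>, as i, j and k are
  below \<open>CARD('n)\<close>.\<close>

definition mrange :: "int set" where
  "mrange = {- int CARD('n)..2 * int CARD('n)}"

lemma finite_mrange [simp]: "finite mrange"
  by (simp add: mrange_def)

lemma Qm_outside: "m \<notin> mrange \<Longrightarrow> Qm g m = 0"
proof -
  assume m: "m \<notin> mrange"
  have "(if int i - int j + int k = m then (-1) ^ j else (0 :: complex)) = 0"
    if "i < CARD('n)" "j < CARD('n)" "k < CARD('n)" for i j k
    using m that by (auto simp: mrange_def)
  then show ?thesis unfolding Qm_def by simp
qed

lemma zint_cexp_Ints:
  assumes "a \<in> \<Phi>" "t \<in> \<int>"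
  shows "zint (cexp (X a) t)"
  unfolding cexp_def by (intro zint_sum zint_sm dpow_X_Ints assms Ints_power)

lemma zint_Qm: "g \<in> \<Phi> \<Longrightarrow> zint (Qm g m)"
  unfolding Qm_def by (intro zint_mult zint_sum zint_sm dpow_X_Ints zint_cexp_Ints) auto

text \<open>The factor \<open>g m\<close> stays general because it is used twice: with 1 it gives
  the torus element, with m the result of applying t d/dt to it.\<close>

lemma sum_Qm_weighted:
  assumes "t \<noteq> 0"
  shows "(\<Sum>m\<in>mrange. (g m * t powi m) \<odot> Qm \<gamma> m) =
    (\<Sum>i<CARD('n). \<Sum>j<CARD('n). \<Sum>k<CARD('n).
      (g (int i - int j + int k) * (t ^ i * (- 1 / t) ^ j * t ^ k)) \<odot>
        (dpow (X \<gamma>) i * dpow (X (- \<gamma>)) j * dpow (X \<gamma>) k)) *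
    (cexp (X \<gamma>) (-1) * cexp (X (- \<gamma>)) 1 * cexp (X \<gamma>) (-1))"
proof -
  let ?W = "cexp (X \<gamma>) (-1) * cexp (X (- \<gamma>)) 1 * cexp (X \<gamma>) (-1)"
  let ?D = "\<lambda>i j k. dpow (X \<gamma>) i * dpow (X (- \<gamma>)) j * dpow (X \<gamma>) k"
  let ?c = "\<lambda>m i j k. (if int i - int j + int k = m then (-1) ^ j else 0 :: complex)"
  have "(\<Sum>m\<in>mrange. (g m * t powi m) \<odot> Qm \<gamma> m) =
      (\<Sum>m\<in>mrange. \<Sum>i<CARD('n). \<Sum>j<CARD('n). \<Sum>k<CARD('n).
        (g m * t powi m * ?c m i j k) \<odot> (?D i j k)) * ?W"
    unfolding Qm_def by (simp add: sm_sum_right sum_distrib_right mult.assoc)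
  also have "(\<Sum>m\<in>mrange. \<Sum>i<CARD('n). \<Sum>j<CARD('n). \<Sum>k<CARD('n).
        (g m * t powi m * ?c m i j k) \<odot> (?D i j k))
    = (\<Sum>i<CARD('n). \<Sum>j<CARD('n). \<Sum>k<CARD('n). \<Sum>m\<in>mrange.
        (g m * t powi m * ?c m i j k) \<odot> (?D i j k))"
    by (subst sum.swap, rule sum.cong[OF refl], subst sum.swap, rule sum.cong[OF refl], rule sum.swap)
  also have "\<dots> = (\<Sum>i<CARD('n). \<Sum>j<CARD('n). \<Sum>k<CARD('n).
      (g (int i - int j + int k) * (t ^ i * (- 1 / t) ^ j * t ^ k)) \<odot> (?D i j k))"
  proof (intro sum.cong[OF refl])
    fix i j k assume ijk: "i \<in> {..<CARD('n)}" "j \<in> {..<CARD('n)}" "k \<in> {..<CARD('n)}"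
    let ?m = "int i - int j + int k"
    have m: "?m \<in> mrange" using ijk by (auto simp: mrange_def)
    have "(\<Sum>m\<in>mrange. (g m * t powi m * ?c m i j k) \<odot> (?D i j k))
        = (\<Sum>m\<in>mrange. if m = ?m then (g m * t powi m * (-1) ^ j) \<odot> (?D i j k) else 0)"
      by (rule sum.cong) auto
    also have "\<dots> = (g ?m * (t powi ?m * (-1) ^ j)) \<odot> (?D i j k)"
      using m by (simp add: mult.assoc)
    also have "t powi ?m * (-1) ^ j = t ^ i * (- 1 / t) ^ j * t ^ k"
      unfolding power_divide using assms by (simp add: power_int_add power_int_diff)
    finally show "(\<Sum>m\<in>mrange. (g m * t powi m * ?c m i j k) \<odot> (?D i j k))
        = (g ?m * (t ^ i * (- 1 / t) ^ j * t ^ k)) \<odot> (?D i j k)" .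
  qed
  finally show ?thesis .
qed

lemma sum3_product:
  fixes f g h :: "nat \<Rightarrow> (complex, 'n) sqm"
  shows "(\<Sum>i<n. f i) * (\<Sum>j<n. g j) * (\<Sum>k<n. h k) = (\<Sum>i<n. \<Sum>j<n. \<Sum>k<n. f i * g j * h k)"
proof -
  have "(\<Sum>i<n. f i) * (\<Sum>j<n. g j) * (\<Sum>k<n. h k) = (\<Sum>i<n. \<Sum>j<n. f i * g j) * (\<Sum>k<n. h k)"
    by (simp only: sum_product)
  also have "\<dots> = (\<Sum>i<n. \<Sum>j<n. f i * g j * (\<Sum>k<n. h k))"
    by (simp only: sum_distrib_right)
  finally show ?thesis by (simp only: sum_distrib_left)
qed

text \<open>The usual h(t) = w(t) w(1)^-1 of the rank one subgroup belonging to
  \<open>g\<close>.\<close>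

definition tor :: "'e \<Rightarrow> complex \<Rightarrow> (complex, 'n) sqm" where
  "tor g t = cexp (X g) t * cexp (X (- g)) (- 1 / t) * cexp (X g) t *
    (cexp (X g) (-1) * cexp (X (- g)) 1 * cexp (X g) (-1))"

text \<open>The operator t d/dt applied to \<open>cexp N t\<close>.\<close>

definition dcexp :: "(complex, 'n) sqm \<Rightarrow> complex \<Rightarrow> (complex, 'n) sqm" where
  "dcexp N t = (\<Sum>k<CARD('n). (of_nat k * t ^ k) \<odot> dpow N k)"

lemma dcexp_eq:
  assumes "nilp N"
  shows "dcexp N t = t \<odot> (N * cexp N t)"
proof -
  have "dcexp N t = (\<Sum>k<Suc CARD('n). (of_nat k * t ^ k) \<odot> dpow N k)"
    unfolding dcexp_def using dpow_nilp[OF assms, of "CARD('n)"] by simp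
  also have "\<dots> = (\<Sum>k<CARD('n). (of_nat (Suc k) * t ^ Suc k) \<odot> dpow N (Suc k))"
    by (subst sum.lessThan_Suc_shift) simp
  also have "\<dots> = (\<Sum>k<CARD('n). t ^ Suc k \<odot> (N * dpow N k))"
    unfolding dpow_Suc[symmetric] by (simp add: mult.commute del: of_nat_Suc)
  finally show ?thesis by (simp add: cexp_def sm_sum_right sum_distrib_left)
qed

text \<open>The second equation says t d/dt tor = H tor. It is the product rule, after all root
  vectors are moved to the left through the exponentials; the middle exponential has parameter -1/t,
  of degree -1 in t, and therefore enters with a minus sign.\<close>

lemma sum_Qm:
  assumes "g \<in> \<Phi>" "t \<noteq> 0"
  shows "(\<Sum>m\<in>mrange. t powi m \<odot> Qm g m) = tor g t"
    and sum_m_Qm: "(\<Sum>m\<in>mrange. (of_int m * t powi m) \<odot> Qm g m) = H g * tor g t"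
proof -
  let ?W = "cexp (X g) (-1) * cexp (X (- g)) 1 * cexp (X g) (-1)"
  let ?D = "\<lambda>i j k. dpow (X g) i * dpow (X (- g)) j * dpow (X g) k"
  let ?e = "cexp (X g) t" and ?f = "cexp (X (- g)) (- 1 / t)"
  note N = nilp_X[OF assms(1)] nilp_X[OF neg_root[OF assms(1)]]
  show "(\<Sum>m\<in>mrange. t powi m \<odot> Qm g m) = tor g t"
    using sum_Qm_weighted[OF assms(2), of "\<lambda>_. 1" g]
    unfolding tor_def cexp_def[of _ t] cexp_def[of _ "- 1 / t"] sum3_product by (simp add: mult_ac)
  have "(\<Sum>m\<in>mrange. (of_int m * t powi m) \<odot> Qm g m) =
    (\<Sum>i<CARD('n). \<Sum>j<CARD('n). \<Sum>k<CARD('n).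
      (of_int (int i - int j + int k) * (t ^ i * (- 1 / t) ^ j * t ^ k)) \<odot> (?D i j k)) * ?W"
    by (rule sum_Qm_weighted[OF assms(2)])
  also have "(\<Sum>i<CARD('n). \<Sum>j<CARD('n). \<Sum>k<CARD('n).
      (of_int (int i - int j + int k) * (t ^ i * (- 1 / t) ^ j * t ^ k)) \<odot> (?D i j k))
    = dcexp (X g) t * ?f * ?e - ?e * dcexp (X (- g)) (- 1 / t) * ?e + ?e * ?f * dcexp (X g) t"
    unfolding dcexp_def cexp_def[of _ t] cexp_def[of _ "- 1 / t"] sum3_product
      sum_subtractf[symmetric] sum.distrib[symmetric]
    by (intro sum.cong[OF refl]) (simp add: sm_simps[symmetric] algebra_simps)
  also have "\<dots> = H g * (?e * ?f * ?e)"
  proof -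
    have eX: "?e * X g = X g * ?e" using cexp_mult_right[OF N(1), of 1 "X g" t] by simp
    have eH: "?e * H g = (H g - (2 * t) \<odot> X g) * ?e"
      using cexp_mult_right[OF N(1), of 2 "H g" t] root_nz[OF assms(1)]
      by (simp add: adp_def eval_nat_numeral br_X_H assms(1) mult.commute)
    have eX': "?e * X (- g) = (X (- g) + t \<odot> H g - t\<^sup>2 \<odot> X g) * ?e"
      using cexp_mult_right[OF N(1) adp_X_neg(2)[OF assms(1)], of t] adp_X_neg(1)[OF assms(1)]
      by (simp add: eval_nat_numeral br_X_neg)
    have fX: "?f * X g = (X g + (1 / t) \<odot> H g - (1 / t\<^sup>2) \<odot> X (- g)) * ?f"
      using cexp_mult_right[OF N(2), of 3 "X g" "- 1 / t"] adp_X_neg[OF neg_root[OF assms(1)]]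
      by (simp add: eval_nat_numeral br_X_neg')
    have "?e * ?f * (X g * ?e) = ?e * (?f * X g) * ?e" by (simp add: mult.assoc)
    also have "\<dots> = (?e * X g + (1 / t) \<odot> (?e * H g) - (1 / t\<^sup>2) \<odot> (?e * X (- g))) * ?f * ?e"
      unfolding fX by (simp add: algebra_simps)
    also have "\<dots> = - ((1 / t\<^sup>2) \<odot> (X (- g) * (?e * ?f * ?e)))"
      unfolding eX eH eX' using assms(2)
      by (simp add: algebra_simps sm_simps sm_two power2_eq_square)
    finally have 1: "?e * ?f * (X g * ?e) = - ((1 / t\<^sup>2) \<odot> (X (- g) * (?e * ?f * ?e)))" .
    have 2: "?e * (X (- g) * ?f) * ?e
        = X (- g) * (?e * ?f * ?e) + t \<odot> (H g * (?e * ?f * ?e)) - t\<^sup>2 \<odot> (X g * (?e * ?f * ?e))"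
      unfolding mult.assoc[symmetric] eX' by (simp add: algebra_simps sm_simps)
    have "dcexp (X g) t * ?f * ?e - ?e * dcexp (X (- g)) (- 1 / t) * ?e + ?e * ?f * dcexp (X g) t
      = t \<odot> (X g * (?e * ?f * ?e)) + (1 / t) \<odot> (?e * (X (- g) * ?f) * ?e)
        + t \<odot> (?e * ?f * (X g * ?e))"
      unfolding dcexp_eq[OF N(1)] dcexp_eq[OF N(2)] by (simp add: mult.assoc)
    also have "\<dots> = H g * (?e * ?f * ?e)"
      unfolding 1 2 using assms(2) by (simp add: sm_simps sm_two power2_eq_square field_simps)
    finally show ?thesis .
  qed
  finally show "(\<Sum>m\<in>mrange. (of_int m * t powi m) \<odot> Qm g m) = H g * tor g t"
    by (simp add: tor_def mult.assoc)
qed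

lemma sum_Qm_1:
  assumes "g \<in> \<Phi>"
  shows "(\<Sum>m\<in>mrange. Qm g m) = 1"
proof -
  note N = nilp_X[OF assms] nilp_X[OF neg_root[OF assms]]
  have c: "A * B = 1 \<Longrightarrow> A * (B * Z) = Z" for A B Z :: "(complex, 'n) sqm"
    by (simp flip: mult.assoc)
  have i: "cexp (X g) 1 * cexp (X g) (-1) = 1" "cexp (X (- g)) (-1) * cexp (X (- g)) 1 = 1"
    using cexp_inverse(1)[OF N(1), of 1] cexp_inverse(2)[OF N(2), of 1] by auto
  show ?thesis using sum_Qm[OF assms, of 1] by (simp add: tor_def mult.assoc i c)
qed

text \<open>Coefficients at the powers of t are compared in t d/dt tor = H tor. The values t = 2^k
  suffice for this, since the numbers 2^m are distinct.\<close>

lemma H_Qm: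
  assumes "g \<in> \<Phi>"
  shows "H g * Qm g m = of_int m \<odot> Qm g m"
proof (cases "m \<in> mrange")
  case True
  have "of_int m \<odot> Qm g m - H g * Qm g m = 0"
  proof (rule power_sum_zero[where S = mrange and c = "\<lambda>m. (2 :: complex) powi m"])
    show "inj_on (\<lambda>m. (2 :: complex) powi m) mrange"
    proof (rule inj_onI)
      fix a b :: int assume "(2 :: complex) powi a = 2 powi b"
      then have "norm ((2 :: complex) powi a) = norm ((2 :: complex) powi b)" by simp
      then have "(2 :: real) powi a = 2 powi b" by (simp add: norm_power_int)
      then show "a = b"
        using power_int_strict_increasing[of a b "2 :: real"] power_int_strict_increasing[of b a "2 :: real"]
        by (cases a b rule: linorder_cases) auto
    qed
    show "(\<Sum>m\<in>mrange. (2 powi m) ^ k \<odot> (of_int m \<odot> Qm g m - H g * Qm g m)) = 0" for k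
    proof -
      have e: "((2 :: complex) powi m) ^ k = (2 ^ k) powi m" for m
        by (simp add: power_int_power power_int_power' mult.commute flip: power_int_mult)
      have "(\<Sum>m\<in>mrange. (2 powi m) ^ k \<odot> (of_int m \<odot> Qm g m - H g * Qm g m))
        = (\<Sum>m\<in>mrange. (of_int m * (2 ^ k) powi m) \<odot> Qm g m)
          - H g * (\<Sum>m\<in>mrange. (2 ^ k) powi m \<odot> Qm g m)"
        unfolding e by (simp add: sm_simps sum_subtractf sum_distrib_left mult.commute)
      also have "\<dots> = 0"
        using sum_Qm[OF assms, of "2 ^ k"] sum_m_Qm[OF assms, of "2 ^ k"] by simp
      finally show ?thesis .
    qed
  qed (use True in auto)
  then show ?thesis by simp
qed (simp add: Qm_outside)

text \<open>\<open>M\<close> is the sum of all \<open>Qm g m * M\<close>, eigenvectors with distinct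
  eigenvalues, so only the one with the eigenvalue of \<open>M\<close> survives.\<close>

lemma Qm_eigen:
  assumes "g \<in> \<Phi>" "H g * M = a \<odot> M"
  shows "Qm g m * M = (if of_int m = a then M else 0)"
proof -
  have s: "(\<Sum>m\<in>mrange. Qm g m * M) = M"
    by (simp flip: sum_distrib_right add: sum_Qm_1[OF assms(1)])
  have z: "Qm g m * M = 0" if "of_int m \<noteq> a" for m
  proof (cases "m \<in> mrange")
    case True
    have "(of_int m - a) \<odot> (Qm g m * M) = 0"
    proof (rule eigen_sum_zero[where f = "\<lambda>Y. H g * Y" and S = mrange
          and M = "\<lambda>m. (of_int m - a) \<odot> (Qm g m * M)"])
      show "H g * ((of_int m - a) \<odot> (Qm g m * M)) = of_int m \<odot> ((of_int m - a) \<odot> (Qm g m * M))" for m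
        by (simp add: H_Qm[OF assms(1)] mult.commute flip: mult.assoc)
      have "(\<Sum>m\<in>mrange. (of_int m - a) \<odot> (Qm g m * M))
          = H g * (\<Sum>m\<in>mrange. Qm g m * M) - a \<odot> (\<Sum>m\<in>mrange. Qm g m * M)"
        by (simp add: sm_simps sum_subtractf sum_distrib_left sm_sum_right
            H_Qm[OF assms(1)] flip: mult.assoc)
      then show "(\<Sum>m\<in>mrange. (of_int m - a) \<odot> (Qm g m * M)) = 0"
        by (simp add: s assms(2))
    qed (use True in \<open>auto simp: algebra_simps inj_on_def\<close>)
    then show ?thesis using that sm_cancel[of "of_int m - a" "Qm g m * M" 0] by auto
  qed (simp add: Qm_outside)
  show ?thesis
  proof (cases "of_int m = a")
    case True
    have "M = (\<Sum>k\<in>mrange. if k = m then Qm g k * M else 0)"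
      by (subst s[symmetric], rule sum.cong) (use z True in auto)
    also have "\<dots> = Qm g m * M" by (simp add: Qm_outside)
    finally show ?thesis using True by simp
  qed (use z in simp)
qed

text \<open>The part of a matrix that raises eigenvalues of \<open>H g\<close> by m. As the matrices
  \<open>Qm\<close> are integral, the formula makes sense over every ring.\<close>

definition prj :: "'e \<Rightarrow> int \<Rightarrow> ('a::comm_ring_1, 'n) sqm \<Rightarrow> ('a, 'n) sqm" where
  "prj g m Z = (\<Sum>k\<in>mrange. imat (fl (Qm g (k + m))) * Z * imat (fl (Qm g k)))"

lemma prj_Wt:
  assumes "g \<in> \<Phi>" "Z \<in> Wt \<mu>"
  shows "prj g m Z = (if of_int m = cn \<mu> g then Z else 0)"
proof -
  have "Qm g (k + m) * (Z * Qm g k) = (if of_int m = cn \<mu> g then Z * Qm g k else 0)" for k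
  proof -
    have "H g * Z = Z * H g + of_real (cn \<mu> g) \<odot> Z"
      using assms by (auto simp: Wt_def br_def algebra_simps)
    then have "H g * (Z * Qm g k) = (Z * H g + of_real (cn \<mu> g) \<odot> Z) * Qm g k"
      by (simp flip: mult.assoc)
    also have "\<dots> = (of_int k + of_real (cn \<mu> g)) \<odot> (Z * Qm g k)"
      by (simp add: algebra_simps H_Qm[OF assms(1)] sm_simps)
    finally have "Qm g (k + m) * (Z * Qm g k)
        = (if of_int (k + m) = of_int k + complex_of_real (cn \<mu> g) then Z * Qm g k else 0)"
      by (rule Qm_eigen[OF assms(1)])
    also have "of_int (k + m) = of_int k + complex_of_real (cn \<mu> g) \<longleftrightarrow> of_int m = cn \<mu> g"
      by simp (metis of_real_eq_iff of_real_of_int_eq)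
    finally show ?thesis .
  qed
  then have "prj g m Z = (\<Sum>k\<in>mrange. if of_int m = cn \<mu> g then Z * Qm g k else 0)"
    by (simp add: prj_def imat_fl zint_Qm[OF assms(1)] mult.assoc)
  then show ?thesis by (simp add: sum_distrib_left[symmetric] sum_Qm_1[OF assms(1)])
qed

definition root_list :: "'e list" where
  "root_list = (SOME xs. set xs = \<Phi>)"

lemma set_root_list: "set root_list = \<Phi>"
  unfolding root_list_def by (rule someI_ex) (use finite_list[OF finite_roots] in blast)

text \<open>The Cartan integers against all roots determine a weight because the roots span;
  composing the projections for all roots isolates \<kappa>.\<close>

definition wprj :: "'e \<Rightarrow> ('a::comm_ring_1, 'n) sqm \<Rightarrow> ('a, 'n) sqm" where
  "wprj \<kappa> Z = foldr (\<lambda>g. prj g \<lfloor>cn \<kappa> g\<rfloor>) root_list Z"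

lemma wprj_Wt:
  assumes "\<kappa> \<in> \<Phi>" "Z \<in> Wt \<mu>"
  shows "wprj \<kappa> Z = (if \<mu> = \<kappa> then Z else 0)"
proof -
  have "foldr (\<lambda>g. prj g \<lfloor>cn \<kappa> g\<rfloor>) xs Z = (if \<forall>g\<in>set xs. cn \<kappa> g = cn \<mu> g then Z else 0)"
    if "set xs \<subseteq> \<Phi>" for xs using that
  proof (induction xs)
    case (Cons g xs)
    have "prj g \<lfloor>cn \<kappa> g\<rfloor> Z = (if cn \<kappa> g = cn \<mu> g then Z else 0)"
      using prj_Wt[of g Z \<mu> "\<lfloor>cn \<kappa> g\<rfloor>"] assms Cons.prems cn_Ints[of g \<kappa>]
      by (simp add: of_int_floor)
    moreover have "prj g m 0 = (0 :: (complex, 'n) sqm)" for m by (simp add: prj_def)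
    ultimately show ?case using Cons by (cases "cn \<kappa> g = cn \<mu> g") auto
  qed simp
  from this[of root_list] show ?thesis
    unfolding wprj_def set_root_list using cn_separates[of \<mu> \<kappa>] by fastforce
qed

text \<open>Let d be the content of \<open>X g\<close> and e = 1/d. Since \<open>X (- g)\<close> is
  a sum of terms containing \<open>X g\<close> once, beside integral factors, e X(-g) is integral as
  well, and so is [[e X(g), e X(-g)], e X(g)] = 2 e^3 X(g). Hence d^3 divides 2 d, and d is a
  unit.\<close>

lemma X_primitive:
  assumes "g \<in> \<Phi>"
  shows "\<exists>w. (\<Sum>i\<in>UNIV. \<Sum>j\<in>UNIV. w i j * ent (fl (X g)) i j) = 1"
proof -
  let ?x = "\<lambda>(i, j). ent (fl (X g)) i j"
  have zX: "zint (X a)" if "a \<in> \<Phi>" for a using dpow_X_Ints[OF that, of 1] by simp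
  obtain w d where wd: "(\<Sum>p\<in>UNIV. w p * ?x p) = d" "\<forall>p. d dvd ?x p"
    using content_exists[of UNIV ?x] by auto
  have ent: "ent (X g) i j = of_int (?x (i, j))" for i j
    by (subst imat_fl[OF zX[OF assms], symmetric]) simp
  have "d \<noteq> 0"
  proof
    assume "d = 0"
    then have "?x (i, j) = 0" for i j using wd(2) by (metis dvd_0_left)
    then have "X g = 0" by (intro sqm_eqI) (simp add: ent)
    then show False using X_nz[OF assms] by simp
  qed
  let ?e = "1 / of_int d :: complex"
  have z1: "zint (?e \<odot> X g)" unfolding zint_def
  proof (intro allI)
    fix i j
    obtain k where "?x (i, j) = d * k" using wd(2) by (metis dvdE)
    then show "ent (?e \<odot> X g) i j \<in> \<int>"
      using \<open>d \<noteq> 0\<close> by (simp add: ent)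
  qed
  have z2: "zint (?e \<odot> X (- g))"
  proof -
    \<comment> \<open>Written with the divided square of \<open>X (- g)\<close>, because the
      assumption on the lattice makes this matrix integral.\<close>
    have "adp (X (- g)) 2 (X g) = dpow (X (- g)) 2 * X g - X (- g) * X g * X (- g)
        + X g * dpow (X (- g)) 2"
      by (rule sm_cancel[of 2])
        (simp_all add: adp_def dpow_def eval_nat_numeral br_def algebra_simps sm_simps sm_two)
    then have "?e \<odot> X (- g) = - (dpow (X (- g)) 2 * (?e \<odot> X g) - X (- g) * (?e \<odot> X g) * X (- g)
        + (?e \<odot> X g) * dpow (X (- g)) 2)" using adp_X_neg(1)[OF neg_root[OF assms]]
      by (simp add: sm_simps[symmetric])
    moreover have "zint (dpow (X (- g)) 2)" "zint (X (- g))"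
      using assms by (auto intro: dpow_X_Ints zX)
    ultimately show ?thesis using z1 by (simp del: mult_sm_left mult_sm_right)
  qed
  have "zint (br (br (?e \<odot> X g) (?e \<odot> X (- g))) (?e \<odot> X g))"
    using z1 z2 by (intro zint_br)
  moreover have "br (br (?e \<odot> X g) (?e \<odot> X (- g))) (?e \<odot> X g) = (2 * ?e ^ 3) \<odot> X g"
    using root_nz[OF assms] by (simp add: br_X_neg br_H_X assms eval_nat_numeral mult_ac)
  ultimately have z3: "zint ((2 * ?e ^ 3) \<odot> X g)" by simp
  have dv: "d ^ 3 dvd 2 * ?x p" for p
  proof -
    obtain i j where p: "p = (i, j)" by fastforce
    have "2 * ?e ^ 3 * of_int (?x (i, j)) \<in> \<int>"
      using z3 unfolding zint_def by (simp add: ent)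
    then obtain k where "2 * ?e ^ 3 * of_int (?x (i, j)) = complex_of_int k"
      by (auto elim: Ints_cases)
    then have "complex_of_int (2 * ?x (i, j)) = of_int (k * d ^ 3)"
      using \<open>d \<noteq> 0\<close> by (simp add: field_simps)
    then show ?thesis unfolding p of_int_eq_iff by simp
  qed
  have "d ^ 3 dvd (\<Sum>p\<in>UNIV. w p * (2 * ?x p))" by (intro dvd_sum dvd_mult dv)
  also have "(\<Sum>p\<in>UNIV. w p * (2 * ?x p)) = 2 * d"
    unfolding wd(1)[symmetric] sum_distrib_left by (simp add: mult_ac)
  finally have "d * d dvd 2"
    using \<open>d \<noteq> 0\<close> by (simp add: eval_nat_numeral mult.commute mult.left_commute)
  have "\<bar>d\<bar> = 1"
  proof (rule ccontr)
    assume "\<bar>d\<bar> \<noteq> 1"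
    then have "\<bar>d\<bar> \<ge> 2" using \<open>d \<noteq> 0\<close> by auto
    then have "\<bar>d\<bar> * \<bar>d\<bar> \<ge> 2 * 2" by (intro mult_mono) auto
    moreover have "\<bar>d * d\<bar> \<le> 2"
      using dvd_imp_le_int[OF _ \<open>d * d dvd 2\<close>] by simp
    ultimately show False by (simp add: abs_mult)
  qed
  then have "d * d = 1" by (auto simp: abs_if split: if_splits)
  have "(\<Sum>i\<in>UNIV. \<Sum>j\<in>UNIV. (d * w (i, j)) * ent (fl (X g)) i j) = d * (\<Sum>p\<in>UNIV. w p * ?x p)"
    by (simp add: sum.cartesian_product sum_distrib_left mult.assoc split_def UNIV_Times_UNIV)
  then show ?thesis
    using wd(1) \<open>d * d = 1\<close> by (intro exI[of _ "\<lambda>i j. d * w (i, j)"]) simp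
qed

text \<open>The entries of \<open>X g\<close> are coprime integers, so such coefficients exist.\<close>

definition bez :: "'e \<Rightarrow> 'n \<Rightarrow> 'n \<Rightarrow> int" where
  "bez g = (SOME w. (\<Sum>i\<in>UNIV. \<Sum>j\<in>UNIV. w i j * ent (fl (X g)) i j) = 1)"

text \<open>The coordinate at \<open>g\<close>: a linear form with integer coefficients on all square matrices, hence
  available over every ring, that kills every weight space except that of \<open>g\<close>.\<close>

definition xi :: "'e \<Rightarrow> ('a::comm_ring_1, 'n) sqm \<Rightarrow> 'a" where
  "xi g Z = (\<Sum>i\<in>UNIV. \<Sum>j\<in>UNIV. of_int (bez g i j) * ent (wprj g Z) i j)"

lemma zint_X: "a \<in> \<Phi> \<Longrightarrow> zint (X a)"
  using dpow_X_Ints[of a 1] by simp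

lemma xi_Wt: "g \<in> \<Phi> \<Longrightarrow> Z \<in> Wt \<mu> \<Longrightarrow> \<mu> \<noteq> g \<Longrightarrow> xi g Z = 0"
  by (simp add: xi_def wprj_Wt)

lemma xi_X_same: "g \<in> \<Phi> \<Longrightarrow> xi g (X g) = 1"
proof -
  assume g: "g \<in> \<Phi>"
  have "xi g (X g) = of_int (\<Sum>i\<in>UNIV. \<Sum>j\<in>UNIV. bez g i j * ent (fl (X g)) i j)"
    unfolding xi_def wprj_Wt[OF g Wt_X[OF g]] by (subst imat_fl[OF zint_X[OF g], symmetric]) simp
  also have "\<dots> = 1" using someI_ex[OF X_primitive[OF g]] unfolding bez_def by simp
  finally show ?thesis .
qed

lemma xi_X: "g \<in> \<Phi> \<Longrightarrow> d \<in> \<Phi> \<Longrightarrow> xi g (X d) = (if d = g then 1 else 0)"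
  using xi_Wt[OF _ Wt_X] xi_X_same by auto

lemma xi_H: "g \<in> \<Phi> \<Longrightarrow> d \<in> \<Phi> \<Longrightarrow> xi g (H d) = 0"
  by (metis Wt_H xi_Wt zero_not_root)

end

lemma (in chev) prj_add: "prj g m (Y + Z) = prj g m Y + prj g m Z"
  and prj_sm: "prj g m (c \<odot> Y) = c \<odot> prj g m Y"
  by (simp_all add: prj_def algebra_simps sum.distrib sm_sum_right)

lemma (in chev) wprj_add: "wprj \<gamma> (Y + Z) = wprj \<gamma> Y + wprj \<gamma> Z"
  and wprj_sm: "wprj \<gamma> (c \<odot> Y) = c \<odot> wprj \<gamma> Y"
proof -
  have "foldr (\<lambda>\<gamma>. prj \<gamma> (g \<gamma>)) xs (Y + Z) =
      foldr (\<lambda>\<gamma>. prj \<gamma> (g \<gamma>)) xs Y + foldr (\<lambda>\<gamma>. prj \<gamma> (g \<gamma>)) xs Z"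
    "foldr (\<lambda>\<gamma>. prj \<gamma> (g \<gamma>)) xs (c \<odot> Y) = c \<odot> foldr (\<lambda>\<gamma>. prj \<gamma> (g \<gamma>)) xs Y" for xs g
    by (induction xs) (simp_all add: prj_add prj_sm)
  then show "wprj \<gamma> (Y + Z) = wprj \<gamma> Y + wprj \<gamma> Z" "wprj \<gamma> (c \<odot> Y) = c \<odot> wprj \<gamma> Y"
    by (simp_all add: wprj_def)
qed

lemma (in chev) xi_add [simp]: "xi g (Y + Z) = xi g Y + xi g Z"
  and xi_sm [simp]: "xi g (c \<odot> Y) = c * xi g Y"
  by (simp_all add: xi_def wprj_add wprj_sm algebra_simps sum.distrib sum_distrib_left)

lemma (in chev) xi_zero [simp]: "xi g 0 = 0"
  using xi_sm[of g 0 0] by simp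

lemma (in chev) xi_minus [simp]: "xi g (- Y) = - xi g Y"
  using xi_sm[of g "-1" Y] by simp

lemma (in chev) xi_diff [simp]: "xi g (Y - Z) = xi g Y - xi g Z"
  using xi_add[of g Y "- Z"] by simp

lemma (in chev) xi_sum: "xi g (sum f S) = (\<Sum>x\<in>S. xi g (f x))"
  by (induction S rule: infinite_finite_induct) auto

section \<open>Specialization of identities to a commutative ring\<close>

text \<open>\<open>S f r\<close> says that the function \<open>f\<close> is given on \<open>B\<close> by an expression with integer coefficients
  whose value over the ring is \<open>r\<close>; an identity between complex functions on \<open>B\<close> then holds between
  the corresponding values.\<close>

named_theorems specI

locale spcl =
  fixes S :: "('b \<Rightarrow> complex) \<Rightarrow> 'r::comm_ring_1 \<Rightarrow> bool" and B :: "'b set"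
  assumes S_of_int: "S (\<lambda>_. of_int k) (of_int k)"
    and S_add [specI]: "S f r \<Longrightarrow> S g s \<Longrightarrow> S (\<lambda>b. f b + g b) (r + s)"
    and S_mult [specI]: "S f r \<Longrightarrow> S g s \<Longrightarrow> S (\<lambda>b. f b * g b) (r * s)"
    and S_zero_if: "S f r \<Longrightarrow> (\<And>b. b \<in> B \<Longrightarrow> f b = 0) \<Longrightarrow> r = 0"
begin

lemma S_minus [specI]: "S f r \<Longrightarrow> S (\<lambda>b. - f b) (- r)"
  using S_mult[OF S_of_int[of "-1"], of f r] by simp

lemma S_diff [specI]: "S f r \<Longrightarrow> S g s \<Longrightarrow> S (\<lambda>b. f b - g b) (r - s)"
  using S_add[OF _ S_minus, of f r g s] by simp

lemma S_0 [specI]: "S (\<lambda>_. 0) 0"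
  and S_1 [specI]: "S (\<lambda>_. 1) 1"
  using S_of_int[of 0] S_of_int[of 1] by simp_all

lemma S_eq: "S f r \<Longrightarrow> S g s \<Longrightarrow> (\<And>b. b \<in> B \<Longrightarrow> f b = g b) \<Longrightarrow> r = s"
  using S_zero_if[OF S_diff, of f r g s] by simp

lemma S_sum: "(\<And>x. x \<in> I \<Longrightarrow> S (f x) (r x)) \<Longrightarrow> S (\<lambda>b. \<Sum>x\<in>I. f x b) (\<Sum>x\<in>I. r x)"
  by (induction I rule: infinite_finite_induct) (auto intro: S_0 S_add)

lemma S_prod: "(\<And>x. x \<in> I \<Longrightarrow> S (f x) (r x)) \<Longrightarrow> S (\<lambda>b. \<Prod>x\<in>I. f x b) (\<Prod>x\<in>I. r x)"
  by (induction I rule: infinite_finite_induct) (auto intro: S_1 S_mult)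

lemma S_power: "S f r \<Longrightarrow> S (\<lambda>b. f b ^ k) (r ^ k)"
  by (induction k) (auto intro: S_1 S_mult)

definition SM :: "('b \<Rightarrow> (complex, 'n::finite) sqm) \<Rightarrow> ('r, 'n) sqm \<Rightarrow> bool" where
  "SM F M \<longleftrightarrow> (\<forall>i j. S (\<lambda>b. ent (F b) i j) (ent M i j))"

lemma SM_add [specI]: "SM F M \<Longrightarrow> SM G N \<Longrightarrow> SM (\<lambda>b. F b + G b) (M + N)"
  and SM_diff [specI]: "SM F M \<Longrightarrow> SM G N \<Longrightarrow> SM (\<lambda>b. F b - G b) (M - N)"
  and SM_minus [specI]: "SM F M \<Longrightarrow> SM (\<lambda>b. - F b) (- M)"
  and SM_sm [specI]: "S f r \<Longrightarrow> SM F M \<Longrightarrow> SM (\<lambda>b. f b \<odot> F b) (r \<odot> M)"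
  by (simp_all add: SM_def S_add S_diff S_minus S_mult)

lemma SM_mult [specI]: "SM F M \<Longrightarrow> SM G N \<Longrightarrow> SM (\<lambda>b. F b * G b) (M * N)"
  by (auto simp: SM_def ent_mult intro!: S_sum S_mult)

lemma SM_br [specI]: "SM F M \<Longrightarrow> SM G N \<Longrightarrow> SM (\<lambda>b. br (F b) (G b)) (br M N)"
  unfolding br_def by (intro specI)

lemma SM_imat [specI]: "SM (\<lambda>_. imat A) (imat A)"
  by (simp add: SM_def S_of_int)

lemma SM_0 [specI]: "SM (\<lambda>_. 0) 0"
  and SM_1 [specI]: "SM (\<lambda>_. 1) 1"
  using SM_imat[of 0] SM_imat[of 1] by simp_all

lemma SM_sum: "(\<And>x. x \<in> I \<Longrightarrow> SM (F x) (M x)) \<Longrightarrow> SM (\<lambda>b. \<Sum>x\<in>I. F x b) (\<Sum>x\<in>I. M x)"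
  by (induction I rule: infinite_finite_induct) (auto intro: specI)

lemma SM_eq: "SM F M \<Longrightarrow> SM G N \<Longrightarrow> (\<And>b. b \<in> B \<Longrightarrow> F b = G b) \<Longrightarrow> M = N"
  unfolding SM_def
  by (rule sqm_eqI, rule S_eq[of "\<lambda>b. ent (F b) i j" _ "\<lambda>b. ent (G b) i j" for i j]) auto

lemma SM_zero_if: "SM F M \<Longrightarrow> (\<And>b. b \<in> B \<Longrightarrow> F b = 0) \<Longrightarrow> M = 0"
  using SM_eq[of F M "\<lambda>_. 0" 0] SM_0 by auto

lemma S_ent: "SM F M \<Longrightarrow> S (\<lambda>b. ent (F b) i j) (ent M i j)"
  by (simp add: SM_def)

lemma S_det: "SM F M \<Longrightarrow> S (\<lambda>b. det (rep (F b))) (det (rep M))"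
  unfolding det_def by (intro S_sum S_mult S_prod S_of_int) (simp add: SM_def ent_def)

end

subsection \<open>Integer polynomials in one parameter\<close>

abbreviation ipoly :: "int poly \<Rightarrow> 'a::comm_ring_1 \<Rightarrow> 'a" where
  "ipoly p \<equiv> poly (map_poly of_int p)"

lemma map_poly_of_int_add: "map_poly of_int (p + q) = map_poly of_int p + (map_poly of_int q :: 'a::comm_ring_1 poly)"
  by (rule poly_eqI) (simp add: coeff_map_poly)

lemma map_poly_of_int_smult:
  "map_poly of_int (smult c p) = smult (of_int c) (map_poly of_int p :: 'a::comm_ring_1 poly)"
  by (rule poly_eqI) (simp add: coeff_map_poly)

lemma map_poly_of_int_pCons:
  "map_poly of_int (pCons a p) = pCons (of_int a) (map_poly of_int p :: 'a::comm_ring_1 poly)"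
  by (rule poly_eqI) (simp add: coeff_map_poly coeff_pCons split: nat.split)

lemma ipoly_mult: "ipoly (p * q) x = ipoly p x * (ipoly q x :: 'a::comm_ring_1)"
  by (induction p)
    (simp_all add: map_poly_of_int_add map_poly_of_int_smult map_poly_of_int_pCons algebra_simps)

text \<open>A polynomial with integer coefficients in one complex parameter, evaluated at
  \<open>x\<close>. Relations without a parameter are transferred with x = 0.\<close>

definition tspec :: "'r::comm_ring_1 \<Rightarrow> (complex \<Rightarrow> complex) \<Rightarrow> 'r \<Rightarrow> bool" where
  "tspec x f r \<longleftrightarrow> (\<exists>p. (\<forall>t. f t = ipoly p t) \<and> r = ipoly p x)"

text \<open>An integer polynomial that vanishes at all complex numbers is 0, so it vanishes at
  \<open>x\<close> too.\<close>

lemma spcl_tspec: "spcl (tspec x) UNIV"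
proof
  show "tspec x (\<lambda>_. of_int k) (of_int k)" for k
    unfolding tspec_def by (intro exI[of _ "[:k:]"]) (simp add: map_poly_of_int_pCons)
  show "tspec x (\<lambda>b. f b + g b) (r + s)" if T: "tspec x f r" "tspec x g s" for f g r s
  proof -
    obtain p q where "\<forall>t. f t = ipoly p t" "r = ipoly p x" "\<forall>t. g t = ipoly q t" "s = ipoly q x"
      using T unfolding tspec_def by blast
    then show ?thesis
      unfolding tspec_def by (intro exI[of _ "p + q"]) (simp add: map_poly_of_int_add)
  qed
  show "tspec x (\<lambda>b. f b * g b) (r * s)" if T: "tspec x f r" "tspec x g s" for f g r s
  proof -
    obtain p q where "\<forall>t. f t = ipoly p t" "r = ipoly p x" "\<forall>t. g t = ipoly q t" "s = ipoly q x"
      using T unfolding tspec_def by blast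
    then show ?thesis unfolding tspec_def by (intro exI[of _ "p * q"]) (simp add: ipoly_mult)
  qed
  show "r = 0" if f: "tspec x f r" "\<And>b. b \<in> UNIV \<Longrightarrow> f b = 0" for f r
  proof -
    obtain p where p: "\<And>t. f t = ipoly p t" "r = ipoly p x"
      using f(1) by (auto simp: tspec_def)
    have "poly (map_poly of_int p) = poly (0 :: complex poly)" by (rule ext) (use f(2) p(1) in auto)
    then have "map_poly of_int p = (0 :: complex poly)" by (simp only: poly_eq_poly_eq_iff)
    then have "coeff p i = 0" for i by (metis coeff_0 coeff_map_poly of_int_0 of_int_eq_0_iff)
    then have "p = 0" by (intro poly_eqI) simp
    then show ?thesis using p(2) by simp
  qed
qed

lemma tspec_id: "tspec x (\<lambda>t. t) x"
  unfolding tspec_def by (intro exI[of _ "[:0, 1:]"]) (simp add: map_poly_of_int_pCons)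

subsection \<open>Integer polynomials in the matrix entries\<close>

definition mon_val :: "('n::finite \<times> 'n \<Rightarrow>\<^sub>0 nat) \<Rightarrow> 'r::comm_ring_1^'n^'n \<Rightarrow> 'r" where
  "mon_val m A = (\<Prod>(i, j)\<in>UNIV. (A $ i $ j) ^ Poly_Mapping.lookup m (i, j))"

lemma mon_val_keys:
  "(\<Prod>(i, j)\<in>Poly_Mapping.keys m. (A $ i $ j) ^ Poly_Mapping.lookup m (i, j)) = mon_val m A"
  unfolding mon_val_def by (rule prod.mono_neutral_left) (auto simp: in_keys_iff)

lemma mon_val_add: "mon_val (m + m') A = mon_val m A * mon_val m' A"
  unfolding mon_val_def by (simp add: split_def lookup_add power_add prod.distrib)

lemma mon_val_0: "mon_val 0 A = 1"
  by (simp add: mon_val_def split_def)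

lemma eval_entry_poly_superset:
  assumes "finite K" "Poly_Mapping.keys p \<subseteq> K"
  shows "eval_entry_poly p A = (\<Sum>m\<in>K. of_int (Poly_Mapping.lookup p m) * mon_val m A)"
  unfolding eval_entry_poly_def mon_val_keys
  by (rule sum.mono_neutral_left) (use assms in \<open>auto simp: in_keys_iff\<close>)

lemma eval_entry_poly_add: "eval_entry_poly (p + q) A = eval_entry_poly p A + eval_entry_poly q A"
proof -
  let ?K = "Poly_Mapping.keys p \<union> Poly_Mapping.keys q"
  have "Poly_Mapping.keys (p + q) \<subseteq> ?K" by (rule keys_add)
  then show ?thesis
    by (subst (1 2 3) eval_entry_poly_superset[of ?K])
      (auto simp: lookup_add algebra_simps sum.distrib)
qed

lemma eval_entry_poly_0 [simp]: "eval_entry_poly 0 A = 0"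
  by (simp add: eval_entry_poly_def)

lemma eval_entry_poly_sum: "eval_entry_poly (sum f I) A = (\<Sum>x\<in>I. eval_entry_poly (f x) A)"
  by (induction I rule: infinite_finite_induct) (auto simp: eval_entry_poly_add)

lemma eval_entry_poly_single: "eval_entry_poly (Poly_Mapping.single m c) A = of_int c * mon_val m A"
  by (subst eval_entry_poly_superset[of "{m}"]) auto

lemma sum_single_keys: "(\<Sum>m\<in>Poly_Mapping.keys p. Poly_Mapping.single m (Poly_Mapping.lookup p m)) = p"
proof (rule poly_mapping_eqI)
  fix k
  have "Poly_Mapping.lookup (\<Sum>m\<in>Poly_Mapping.keys p. Poly_Mapping.single m (Poly_Mapping.lookup p m)) k
      = (\<Sum>m\<in>Poly_Mapping.keys p. if m = k then Poly_Mapping.lookup p m else 0)"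
    by (simp add: lookup_sum lookup_single when_def)
  also have "\<dots> = Poly_Mapping.lookup p k" by (simp add: in_keys_iff)
  finally show "Poly_Mapping.lookup (\<Sum>m\<in>Poly_Mapping.keys p.
      Poly_Mapping.single m (Poly_Mapping.lookup p m)) k = Poly_Mapping.lookup p k" .
qed

lemma eval_entry_poly_mult:
  fixes p q :: "'n::finite entry_poly"
  shows "eval_entry_poly (p * q) A = eval_entry_poly p A * eval_entry_poly q A"
proof -
  let ?s = "\<lambda>p m. Poly_Mapping.single m (Poly_Mapping.lookup p m)"
  have "p * q = (\<Sum>m\<in>Poly_Mapping.keys p. ?s p m) * (\<Sum>m\<in>Poly_Mapping.keys q. ?s q m)"
    by (simp add: sum_single_keys)
  also have "eval_entry_poly \<dots> A =
      (\<Sum>m\<in>Poly_Mapping.keys p. eval_entry_poly (?s p m) A) *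
      (\<Sum>m\<in>Poly_Mapping.keys q. eval_entry_poly (?s q m) A)"
    unfolding sum_product eval_entry_poly_sum
    by (simp add: mult_single eval_entry_poly_single mon_val_add mult_ac)
  also have "\<dots> = eval_entry_poly p A * eval_entry_poly q A"
    by (simp add: sum_single_keys flip: eval_entry_poly_sum)
  finally show ?thesis .
qed

lemma eval_entry_poly_1 [simp]: "eval_entry_poly 1 A = 1"
  using eval_entry_poly_single[of 0 1 A] by (simp add: mon_val_0)

lemma eval_entry_poly_ent:
  "eval_entry_poly p (rep B) = (\<Sum>m\<in>Poly_Mapping.keys p. of_int (Poly_Mapping.lookup p m) *
    (\<Prod>q\<in>Poly_Mapping.keys m. ent B (fst q) (snd q) ^ Poly_Mapping.lookup m q))"
  by (simp add: eval_entry_poly_def split_def ent_def)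

lemma eval_entry_poly_var:
  "eval_entry_poly (Poly_Mapping.single (Poly_Mapping.single (i, j) 1) 1) A = A $ i $ j"
proof -
  have "mon_val (Poly_Mapping.single (i, j) 1) A
      = (\<Prod>p\<in>UNIV. if p = (i, j) then A $ i $ j else 1)"
    unfolding mon_val_def by (rule prod.cong) (auto simp: lookup_single when_def split: if_splits)
  then show ?thesis by (simp add: eval_entry_poly_single)
qed

text \<open>\<open>f\<close> is a quotient \<open>p / q\<close> on \<open>E\<close>, normalized so that \<open>q\<close> has the value 1 at \<open>z\<close>.\<close>

definition regular_spec ::
  "(complex, 'n::finite) sqm set \<Rightarrow> ('r::comm_ring_1, 'n) sqm \<Rightarrow> ((complex, 'n) sqm \<Rightarrow> complex) \<Rightarrow> 'r \<Rightarrow> bool"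
  where "regular_spec E z f r \<longleftrightarrow>
    (\<exists>p q. (\<forall>A\<in>E. f A * eval_entry_poly q (rep A) = eval_entry_poly p (rep A)) \<and>
       eval_entry_poly q (rep z) = 1 \<and> eval_entry_poly p (rep z) = r)"

definition points :: "(complex, 'n::finite) sqm set \<Rightarrow> ('r::comm_ring_1, 'n) sqm set" where
  "points E = {z. det (rep z) = 1 \<and>
     (\<forall>p. (\<forall>A\<in>E. eval_entry_poly p (rep A) = 0) \<longrightarrow> eval_entry_poly p (rep z) = 0)}"

text \<open>If \<open>f\<close> vanishes on \<open>E\<close> then so does its numerator
  \<open>p\<close>; being an integer polynomial, \<open>p\<close> vanishes at the point
  \<open>z\<close>. Denominators keep the value 1 at \<open>z\<close> when they are
  multiplied.\<close>

lemma spcl_regular_spec: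
  assumes z: "z \<in> points E"
  shows "spcl (regular_spec E z) E"
proof
  let ?e = "\<lambda>p A. eval_entry_poly p (rep A)"
  show "regular_spec E z (\<lambda>_. of_int k) (of_int k)" for k unfolding regular_spec_def
    by (rule exI[of _ "Poly_Mapping.single 0 k"], rule exI[of _ "Poly_Mapping.single 0 1"])
      (simp add: eval_entry_poly_single mon_val_0)
  fix f g r s assume "regular_spec E z f r"
  then obtain p q where f: "\<And>A. A \<in> E \<Longrightarrow> f A * ?e q A = ?e p A" "?e q z = 1" "?e p z = r"
    unfolding regular_spec_def by blast
  {
    assume "regular_spec E z g s"
    then obtain p' q' where g: "\<And>A. A \<in> E \<Longrightarrow> g A * ?e q' A = ?e p' A" "?e q' z = 1" "?e p' z = s"
      unfolding regular_spec_def by blast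
    show "regular_spec E z (\<lambda>A. f A + g A) (r + s)" unfolding regular_spec_def
      by (rule exI[of _ "p * q' + p' * q"], rule exI[of _ "q * q'"])
        (simp add: eval_entry_poly_add eval_entry_poly_mult f(2,3) g(2,3) algebra_simps
          flip: f(1) g(1))
    show "regular_spec E z (\<lambda>A. f A * g A) (r * s)" unfolding regular_spec_def
      by (rule exI[of _ "p * p'"], rule exI[of _ "q * q'"])
        (simp add: eval_entry_poly_mult f(2,3) g(2,3) algebra_simps flip: f(1) g(1))
  next
    assume "\<And>A. A \<in> E \<Longrightarrow> f A = 0"
    then have "\<forall>A\<in>E. ?e p A = 0" using f(1) by (metis mult_zero_left)
    then show "r = 0" using z f(3) unfolding points_def by blast
  }
qed

lemma regular_spec_ent: "regular_spec E z (\<lambda>A. ent A i j) (ent z i j)"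
  unfolding regular_spec_def
  by (rule exI[of _ "Poly_Mapping.single (Poly_Mapping.single (i, j) 1) 1"],
      rule exI[of _ "Poly_Mapping.single 0 1"])
    (simp only: eval_entry_poly_var, simp add: eval_entry_poly_single mon_val_0 ent_def)

text \<open>At a zero of \<open>f\<close> the junk value \<open>inverse 0 = 0\<close> is harmless: with \<open>f q = p\<close> the witness for
  \<open>inverse f\<close> is \<open>inverse f \<cdot> p\<^sup>2 = q p\<close>, and both sides vanish there.\<close>

lemma regular_spec_inverse:
  assumes "regular_spec E z f 1"
  shows "regular_spec E z (\<lambda>A. inverse (f A)) 1"
proof -
  let ?e = "\<lambda>p A. eval_entry_poly p (rep A)"
  obtain p q where f: "\<And>A. A \<in> E \<Longrightarrow> f A * ?e q A = ?e p A" "?e q z = 1" "?e p z = 1"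
    using assms unfolding regular_spec_def by blast
  have "inverse (f A) * (?e p A * ?e p A) = ?e q A * ?e p A" if "A \<in> E" for A
    by (cases "f A = 0") (simp_all flip: f(1)[OF that])
  then show ?thesis unfolding regular_spec_def
    by (intro exI[of _ "q * p"] exI[of _ "p * p"]) (simp add: eval_entry_poly_mult f)
qed

text \<open>The adjugate by Cramer's rule, which inverts a matrix of determinant 1. Unlike a general
  inverse it is an integer polynomial in the entries and can be specialized.\<close>

definition adj :: "('a::comm_ring_1, 'n::finite) sqm \<Rightarrow> ('a, 'n) sqm" where
  "adj A = mk (\<chi> i j. det (\<chi> r c. if c = i then (if r = j then 1 else 0) else ent A r c))"

lemma (in spcl) SM_adj [specI]: "SM F M \<Longrightarrow> SM (\<lambda>b. adj (F b)) (adj M)"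
  unfolding SM_def adj_def ent_mk vec_lambda_beta det_def
  by (intro allI S_sum S_mult S_prod S_of_int) (auto intro: S_0 S_1)

lemma adj_inverse_complex:
  fixes A :: "(complex, 'n::finite) sqm"
  assumes "det (rep A) = 1"
  shows "A * adj A = 1" "adj A * A = 1"
proof -
  have col: "rep A *v column j (rep (adj A)) = axis j 1" for j
  proof -
    have "rep A *v column j (rep (adj A)) = axis j 1 \<longleftrightarrow>
        column j (rep (adj A)) = (\<chi> k. det (\<chi> i l. if l = k then axis j 1 $ i else rep A $ i $ l) / det (rep A))"
      by (rule cramer) (simp add: assms)
    moreover have "column j (rep (adj A)) $ k =
        det (\<chi> i l. if l = k then axis j 1 $ i else rep A $ i $ l)" for k
      by (simp add: column_def adj_def ent_def axis_def cong: if_cong)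
    ultimately show ?thesis using assms by (simp add: vec_eq_iff)
  qed
  have "(rep A ** rep (adj A)) $ i $ j = mat 1 $ i $ j" for i j
  proof -
    have "(rep A ** rep (adj A)) $ i $ j = (rep A *v column j (rep (adj A))) $ i"
      by (simp add: matrix_matrix_mult_def matrix_vector_mult_def column_def)
    then show ?thesis unfolding col by (auto simp: axis_def mat_def)
  qed
  then have 1: "rep A ** rep (adj A) = mat 1" by (simp add: vec_eq_iff)
  then show "A * adj A = 1" by (simp add: times_sqm_def one_sqm_def)
  show "adj A * A = 1" using 1 matrix_left_right_inverse[of "rep A" "rep (adj A)"]
    by (simp add: times_sqm_def one_sqm_def)
qed

lemma left_right_inverse_unique: "A * B = 1 \<Longrightarrow> C * A = 1 \<Longrightarrow> B = (C :: 'a::monoid_mult)"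
  by (metis mult.assoc mult_1_left mult_1_right)

section \<open>The elementary group and its points\<close>

context chev
begin

definition XR :: "'e \<Rightarrow> nat \<Rightarrow> ('a::comm_ring_1, 'n) sqm" where
  "XR g k = imat (fl (dpow (X g) k))"

definition xx :: "'e \<Rightarrow> 'a::comm_ring_1 \<Rightarrow> ('a, 'n) sqm" where
  "xx g t = (\<Sum>k<CARD('n). t ^ k \<odot> XR g k)"

abbreviation Xr :: "'e \<Rightarrow> ('a::comm_ring_1, 'n) sqm" where
  "Xr g \<equiv> XR g (Suc 0)"

definition Hr :: "'e \<Rightarrow> ('a::comm_ring_1, 'n) sqm" where
  "Hr g = br (Xr g) (Xr (- g))"

lemma XR_complex: "g \<in> \<Phi> \<Longrightarrow> XR g k = dpow (X g) k"
  unfolding XR_def by (intro imat_fl dpow_X_Ints)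

lemma Xr_complex: "g \<in> \<Phi> \<Longrightarrow> Xr g = X g"
  by (simp add: XR_complex)

lemma xx_complex: "g \<in> \<Phi> \<Longrightarrow> xx g t = cexp (X g) t"
  by (simp add: xx_def cexp_def XR_complex)

lemma Hr_complex: "g \<in> \<Phi> \<Longrightarrow> Hr g = H g"
  by (simp add: Hr_def H_def Xr_complex)

lemma XR_0 [simp]: "XR g 0 = (1 :: ('a::comm_ring_1, 'n) sqm)"
proof -
  have "fl (1 :: (complex, 'n) sqm) = 1" by (rule sqm_eqI) (simp add: fl_def ent_one)
  then show ?thesis by (simp add: XR_def)
qed

lemma xx_0 [simp]: "xx g 0 = (1 :: ('a::comm_ring_1, 'n) sqm)"
proof -
  have "xx g 0 = (\<Sum>k<CARD('n). if k = 0 then 1 else (0 :: ('a, 'n) sqm))"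
    unfolding xx_def by (rule sum.cong) (auto simp: power_0_left)
  then show ?thesis by simp
qed

text \<open>\<open>EC\<close> is the complex elementary group, and \<open>GP\<close> are the points over the ring of its closure.\<close>

definition EC :: "(complex, 'n) sqm set" where
  "EC = {prod_list (map (\<lambda>(g, t). xx g t) l) | l. fst ` set l \<subseteq> \<Phi>}"

definition GP :: "('r::comm_ring_1, 'n) sqm set" where
  "GP = points EC"

end

locale chev_spcl = chev \<Phi> X + spcl S B
  for \<Phi> :: "'e::euclidean_space set" and X :: "'e \<Rightarrow> (complex, 'n::finite) sqm"
    and S :: "('b \<Rightarrow> complex) \<Rightarrow> 'r::comm_ring_1 \<Rightarrow> bool" and B :: "'b set"
begin

lemma SM_XR [specI]: "SM (\<lambda>_. XR g k) (XR g k)"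
  unfolding XR_def by (rule SM_imat)

lemma SM_Hr [specI]: "SM (\<lambda>_. Hr g) (Hr g)"
  unfolding Hr_def by (intro specI)

lemma SM_xx [specI]: "S f r \<Longrightarrow> SM (\<lambda>b. xx g (f b)) (xx g r)"
  unfolding xx_def by (intro SM_sum SM_sm S_power SM_XR)

lemma SM_prj: "SM F M \<Longrightarrow> SM (\<lambda>b. prj g m (F b)) (prj g m M)"
  unfolding prj_def by (intro SM_sum SM_mult SM_imat)

lemma SM_wprj: "SM F M \<Longrightarrow> SM (\<lambda>b. wprj \<gamma> (F b)) (wprj \<gamma> M)"
proof -
  assume "SM F M"
  then have "SM (\<lambda>b. foldr (\<lambda>\<gamma>. prj \<gamma> (g \<gamma>)) xs (F b)) (foldr (\<lambda>\<gamma>. prj \<gamma> (g \<gamma>)) xs M)" for xs g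
    by (induction xs) (auto intro: SM_prj)
  then show ?thesis unfolding wprj_def .
qed

lemma S_xi [specI]: "SM F M \<Longrightarrow> S (\<lambda>b. xi g (F b)) (xi g M)"
  unfolding xi_def by (intro S_sum S_mult S_of_int S_ent SM_wprj)

end

context chev
begin

lemma chev_spcl_tspec: "chev_spcl \<Phi> X (tspec x) UNIV"
  by (intro chev_spcl.intro chev_axioms spcl_tspec)

lemma chev_spcl_points: "z \<in> GP \<Longrightarrow> chev_spcl \<Phi> X (regular_spec EC z) EC"
  unfolding GP_def by (intro chev_spcl.intro chev_axioms spcl_regular_spec)

lemma EC_one: "1 \<in> EC"
  unfolding EC_def by (intro CollectI exI[of _ "[]"]) simp

lemma EC_xx: "g \<in> \<Phi> \<Longrightarrow> xx g t \<in> EC"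
  unfolding EC_def by (intro CollectI exI[of _ "[(g, t)]"]) simp

lemma EC_mult: "A \<in> EC \<Longrightarrow> B \<in> EC \<Longrightarrow> A * B \<in> EC"
proof -
  assume "A \<in> EC" "B \<in> EC"
  then obtain l l' where "A = prod_list (map (\<lambda>(g, t). xx g t) l)" "fst ` set l \<subseteq> \<Phi>"
    "B = prod_list (map (\<lambda>(g, t). xx g t) l')" "fst ` set l' \<subseteq> \<Phi>"
    unfolding EC_def by blast
  then show ?thesis unfolding EC_def by (intro CollectI exI[of _ "l @ l'"]) auto
qed

lemma EC_induct [consumes 1, case_names one mult]:
  assumes "A \<in> EC" "P 1" "\<And>g t A. g \<in> \<Phi> \<Longrightarrow> A \<in> EC \<Longrightarrow> P A \<Longrightarrow> P (xx g t * A)"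
  shows "P A"
proof -
  obtain l where l: "A = prod_list (map (\<lambda>(g, t). xx g t) l)" "fst ` set l \<subseteq> \<Phi>"
    using assms(1) unfolding EC_def by blast
  have "P (prod_list (map (\<lambda>(g, t). xx g t) l)) \<and> prod_list (map (\<lambda>(g, t). xx g t) l) \<in> EC"
    using l(2)
  proof (induction l)
    case (Cons a l)
    obtain g t where a: "a = (g, t)" by fastforce
    with Cons show ?case using assms(3)[of g _ t] EC_mult[OF EC_xx, of g] by auto
  qed (simp add: assms(2) EC_one)
  then show ?thesis using l(1) by simp
qed

lemma xx_inverse_complex:
  "g \<in> \<Phi> \<Longrightarrow> xx g t * xx g (- t) = (1 :: (complex, 'n) sqm)"
  using cexp_inverse[OF nilp_X] by (simp add: xx_complex)

lemma det_mult_sqm: "det (rep (A * B)) = det (rep A) * det (rep B)"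
  by (simp add: times_sqm_def det_mul)

text \<open>The determinant is a polynomial P(t) with P(t) P(-t) = 1, hence constant, and its value
  at t = 0 is 1.\<close>

lemma det_xx_complex:
  assumes "g \<in> \<Phi>"
  shows "det (rep (xx g t :: (complex, 'n) sqm)) = 1"
proof -
  interpret T: chev_spcl \<Phi> X "tspec (0 :: int)" UNIV by (rule chev_spcl_tspec)
  have "tspec (0 :: int) (\<lambda>t. det (rep (xx g t :: (complex, 'n) sqm))) (det (rep (xx g 0)))"
    by (intro T.S_det T.SM_xx tspec_id)
  then obtain p where p: "\<And>t. det (rep (xx g t :: (complex, 'n) sqm)) = ipoly p t"
    unfolding tspec_def by blast
  let ?P = "map_poly of_int p :: complex poly"
  have "poly (?P * pcompose ?P [:0, -1:]) t = poly 1 t" for t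
  proof -
    have "poly (?P * pcompose ?P [:0, -1:]) t
        = det (rep (xx g t :: (complex, 'n) sqm)) * det (rep (xx g (- t) :: (complex, 'n) sqm))"
      by (simp add: poly_pcompose p)
    also have "\<dots> = 1"
      unfolding det_mult_sqm[symmetric] xx_inverse_complex[OF assms] by (simp add: one_sqm_def)
    finally show ?thesis by simp
  qed
  then have "poly (?P * pcompose ?P [:0, -1:]) = poly 1" by (rule ext)
  then have "?P * pcompose ?P [:0, -1:] = 1" by (simp only: poly_eq_poly_eq_iff)
  then have "?P dvd 1" by (metis dvd_triv_left)
  then obtain c where "?P = [:c:]" using is_unit_polyE by blast
  then have "det (rep (xx g t :: (complex, 'n) sqm)) = det (rep (xx g 0 :: (complex, 'n) sqm))"
    unfolding p by simp
  then show ?thesis by (simp add: one_sqm_def)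
qed

lemma det_EC: "A \<in> EC \<Longrightarrow> det (rep A) = 1"
  by (induction A rule: EC_induct) (simp_all add: det_mult_sqm det_xx_complex, simp add: one_sqm_def)

lemma EC_adj: "A \<in> EC \<Longrightarrow> A * adj A = 1 \<and> adj A * A = 1 \<and> adj A \<in> EC"
proof (induction A rule: EC_induct)
  case one
  have "adj 1 = (1 :: (complex, 'n) sqm)" using adj_inverse_complex(1)[OF det_EC[OF EC_one]] by simp
  then show ?case by (simp add: EC_one)
next
  case (mult g t A)
  let ?B = "xx g t * A"
  have B: "?B * adj ?B = 1" "adj ?B * ?B = 1"
    using adj_inverse_complex[OF det_EC] mult EC_mult EC_xx by blast+
  have "?B * (adj A * xx g (- t)) = xx g t * (A * adj A) * xx g (- t)" by (simp add: mult.assoc)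
  also have "\<dots> = 1" using mult xx_inverse_complex by simp
  finally have "adj ?B = adj A * xx g (- t)" using B(2) left_right_inverse_unique by metis
  then show ?case using B mult by (simp add: EC_mult EC_xx)
qed

lemmas EC_inverse = EC_adj[THEN conjunct1] EC_adj[THEN conjunct2, THEN conjunct1]
lemmas EC_adj_EC = EC_adj[THEN conjunct2, THEN conjunct2]

lemma EC_conj_L: "A \<in> EC \<Longrightarrow> Y \<in> L \<Longrightarrow> A * Y * adj A \<in> L"
proof (induction A arbitrary: Y rule: EC_induct)
  case one
  have "adj 1 = (1 :: (complex, 'n) sqm)" using EC_inverse(1)[OF EC_one] by simp
  then show ?case using one by simp
next
  case (mult g t A)
  let ?B = "xx g t * A"
  have B: "?B \<in> EC" using mult EC_mult EC_xx by blast
  have "?B * (adj A * xx g (- t)) = xx g t * (A * adj A) * xx g (- t)" by (simp add: mult.assoc)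
  also have "\<dots> = 1" using mult xx_inverse_complex EC_inverse by simp
  finally have "adj ?B = adj A * xx g (- t)"
    using EC_inverse(2)[OF B] left_right_inverse_unique by metis
  then have "?B * Y * adj ?B = cexp (X g) t * (A * Y * adj A) * cexp (X g) (- t)"
    by (simp add: mult.assoc xx_complex mult)
  then show ?case using mult L_conj_L by simp
qed

text \<open>All three claims are specializations: the adjugate is polynomial, inverts on
  \<open>EC\<close>, and maps \<open>EC\<close> to itself, so an equation of \<open>EC\<close>
  composed with it is again one.\<close>

lemma points_adj:
  assumes "z \<in> GP"
  shows "z * adj z = 1" "adj z * z = 1" "adj z \<in> GP"
proof -
  interpret R: chev_spcl \<Phi> X "regular_spec EC z" EC by (rule chev_spcl_points[OF assms])
  have id: "R.SM (\<lambda>A. A) z" by (simp add: R.SM_def regular_spec_ent)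
  show 1: "z * adj z = 1"
    by (rule R.SM_eq[of "\<lambda>A. A * adj A" _ "\<lambda>_. 1"]) (intro R.SM_mult R.SM_adj R.SM_1 id | simp add: EC_inverse)+
  show 2: "adj z * z = 1"
    by (rule R.SM_eq[of "\<lambda>A. adj A * A" _ "\<lambda>_. 1"]) (intro R.SM_mult R.SM_adj R.SM_1 id | simp add: EC_inverse)+
  have "det (rep z) = 1" using assms by (simp add: GP_def points_def)
  then have "det (rep (adj z)) = 1"
    using arg_cong[OF 1, of "\<lambda>M. det (rep M)"] by (simp add: det_mult_sqm) (simp add: one_sqm_def)
  moreover have "eval_entry_poly p (rep (adj z)) = 0" if p: "\<forall>A\<in>EC. eval_entry_poly p (rep A) = 0" for p
  proof (rule R.S_zero_if)
    show "regular_spec EC z (\<lambda>A. eval_entry_poly p (rep (adj A))) (eval_entry_poly p (rep (adj z)))"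
      unfolding eval_entry_poly_ent by (intro R.S_sum R.S_mult R.S_of_int R.S_prod R.S_power R.S_ent R.SM_adj id)
  qed (use p EC_adj_EC in blast)
  ultimately show "adj z \<in> GP" unfolding GP_def points_def by simp
qed

lemma SM_id_points: "z \<in> GP \<Longrightarrow> spcl.SM (regular_spec EC z) (\<lambda>A. A) z"
  by (simp add: spcl.SM_def[OF chev_spcl.axioms(2)[OF chev_spcl_points]] regular_spec_ent)

end

section \<open>Centralizers of root elements\<close>

context chev
begin

text \<open>If \<open>z\<close> commutes with \<open>x\<^sub>d(1)\<close> then conjugation by \<open>z\<close> commutes with \<open>Nd d\<close>. Its terms of degree at least
  2 are divided powers, so \<open>Kd d\<close> need not vanish in characteristic 2 or 3.\<close>

definition Nd :: "'e \<Rightarrow> ('a::comm_ring_1, 'n) sqm \<Rightarrow> ('a, 'n) sqm" where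
  "Nd d Y = xx d 1 * Y * xx d (-1) - Y"

definition Kd :: "'e \<Rightarrow> ('a::comm_ring_1, 'n) sqm \<Rightarrow> ('a, 'n) sqm" where
  "Kd d Y = Nd d Y - br (Xr d) Y"

lemma Nd_add: "Nd d (Y + Z) = Nd d Y + Nd d Z"
  and Nd_sm: "Nd d (c \<odot> Y) = c \<odot> Nd d Y"
  by (simp_all add: Nd_def algebra_simps sm_simps)

lemma Nd_complex:
  assumes "d \<in> \<Phi>" "Y \<in> L"
  shows "Nd d Y = br (X d) Y + adp (X d) 2 Y + adp (X d) 3 Y"
  using L_conj[OF assms, of 1] assms(1)
  by (simp add: Nd_def xx_complex eval_nat_numeral algebra_simps)

lemma Kd_complex: "d \<in> \<Phi> \<Longrightarrow> Y \<in> L \<Longrightarrow> Kd d Y = adp (X d) 2 Y + adp (X d) 3 Y"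
  by (simp add: Kd_def Nd_complex Xr_complex)

lemma Kd_add: "Kd d (Y + Z) = Kd d Y + Kd d Z"
  and Kd_sm: "Kd d (c \<odot> Y) = c \<odot> Kd d Y"
  by (simp_all add: Kd_def Nd_add Nd_sm br_simps sm_simps)

lemma L_Kd: "d \<in> \<Phi> \<Longrightarrow> Y \<in> L \<Longrightarrow> Kd d Y \<in> L"
  by (simp add: Kd_complex L_add L_adp)

lemma L_br_X_right: "a \<in> \<Phi> \<Longrightarrow> Y \<in> L \<Longrightarrow> br Y (X a) \<in> L"
  by (subst br_swap) (simp add: L_minus L_br_X)

lemma Wt_br_X: "d \<in> \<Phi> \<Longrightarrow> Y \<in> Wt \<mu> \<Longrightarrow> br (X d) Y \<in> Wt (d + \<mu>)"
  by (intro Wt_br Wt_X)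

lemma Wt_br_X_right: "d \<in> \<Phi> \<Longrightarrow> Y \<in> Wt \<mu> \<Longrightarrow> br Y (X d) \<in> Wt (\<mu> + d)"
  by (intro Wt_br Wt_X)

text \<open>By weights only the component at \<nu> reaches \<kappa> when bracketed with
  \<open>X \<eta>\<close>; the Cartan part lands in the weight \<eta>, which differs from
  \<kappa>.\<close>

lemma xi_br_X:
  assumes "W \<in> L" "\<eta> \<in> \<Phi>" "\<kappa> \<in> \<Phi>" "\<nu> \<in> \<Phi>" "\<kappa> = \<nu> + \<eta>" "br (X \<nu>) (X \<eta>) = m \<odot> X \<kappa>"
  shows "xi \<kappa> (br W (X \<eta>)) = m * xi \<nu> W"
  using assms(1)
proof (induction W rule: L_induct)
  case (X g)
  then show ?case using assms xi_Wt[OF assms(3) Wt_br_X_right[OF assms(2) Wt_X[OF X]]]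
    by (cases "g = \<nu>") (auto simp: xi_X)
next
  case (H g)
  have "\<kappa> \<noteq> 0 + \<eta>" using assms root_nz[OF assms(4)] by auto
  then show ?case
    using xi_Wt[OF assms(3) Wt_br_X_right[OF assms(2) Wt_H[OF H]]] by (simp add: xi_H assms H)
qed (simp_all add: br_simps algebra_simps)

lemma exact_by_xi: "Y \<in> L \<Longrightarrow> Y \<in> Wt \<mu> \<Longrightarrow> \<mu> \<in> \<Phi> \<Longrightarrow> Y = xi \<mu> Y \<odot> X \<mu>"
  using L_Wt_root[of Y \<mu>] by (auto simp: xi_X)

lemma L_expand:
  assumes "Y \<in> L"
  shows "\<exists>b. Y = (\<Sum>g\<in>\<Phi>. xi g Y \<odot> X g) + (\<Sum>g\<in>\<Phi>. b g \<odot> H g)"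
proof -
  obtain a b where ab: "Y = (\<Sum>g\<in>\<Phi>. a g \<odot> X g) + (\<Sum>g\<in>\<Phi>. b g \<odot> H g)"
    using assms unfolding L_def by blast
  have "xi \<kappa> Y = a \<kappa>" if k: "\<kappa> \<in> \<Phi>" for \<kappa>
  proof -
    have "xi \<kappa> Y = (\<Sum>g\<in>\<Phi>. if g = \<kappa> then a g else 0)"
      unfolding ab by (simp add: xi_sum xi_X xi_H k if_distrib cong: sum.cong if_cong)
    then show ?thesis using k finite_roots by simp
  qed
  then show ?thesis using ab by (intro exI[of _ b]) (simp cong: sum.cong)
qed

lemma xx_inverse:
  fixes t :: "'a::comm_ring_1"
  assumes "g \<in> \<Phi>"
  shows "xx g t * xx g (- t) = (1 :: ('a, 'n) sqm)" "xx g (- t) * xx g t = (1 :: ('a, 'n) sqm)"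
proof -
  interpret T: chev_spcl \<Phi> X "tspec t" UNIV by (rule chev_spcl_tspec)
  show "xx g t * xx g (- t) = (1 :: ('a, 'n) sqm)"
    by (rule T.SM_eq[of "\<lambda>t. xx g t * xx g (- t)" _ "\<lambda>_. 1"])
      (intro specI tspec_id | simp add: xx_inverse_complex assms)+
  show "xx g (- t) * xx g t = (1 :: ('a, 'n) sqm)"
    by (rule T.SM_eq[of "\<lambda>t. xx g (- t) * xx g t" _ "\<lambda>_. 1"])
      (intro specI tspec_id | simp add: xx_inverse_complex[of _ "- _", simplified] assms)+
qed

text \<open>\<open>F a k\<close> is the part of \<open>L\<close> of degree at least \<open>k\<close> for the grading by the root \<open>a\<close>.\<close>

inductive_set F :: "'e \<Rightarrow> real \<Rightarrow> (complex, 'n) sqm set" for a k where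
  F_Wt: "Y \<in> L \<Longrightarrow> Y \<in> Wt \<mu> \<Longrightarrow> cn \<mu> a \<ge> k \<Longrightarrow> Y \<in> F a k"
| F_add: "Y \<in> F a k \<Longrightarrow> Z \<in> F a k \<Longrightarrow> Y + Z \<in> F a k"

lemma F_L: "Y \<in> F a k \<Longrightarrow> Y \<in> L"
  by (induction rule: F.induct) (auto intro: L_add)

lemma F_mono: "Y \<in> F a k \<Longrightarrow> l \<le> k \<Longrightarrow> Y \<in> F a l"
  by (induction rule: F.induct) (auto intro: F.intros)

lemma F_zero: "a \<in> \<Phi> \<Longrightarrow> 0 \<in> F a k"
  by (rule F_Wt[OF L_zero Wt_zero[of "(k / 2) *\<^sub>R a"]]) (simp add: root_nz)

lemma F_sm: "Y \<in> F a k \<Longrightarrow> c \<odot> Y \<in> F a k"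
  by (induction rule: F.induct) (auto simp: sm_simps intro: F.intros L_sm Wt_sm)

lemma F_X: "g \<in> \<Phi> \<Longrightarrow> F_k \<le> cn g a \<Longrightarrow> X g \<in> F a F_k"
  by (rule F_Wt[OF L_X Wt_X])

lemma F_H: "g \<in> \<Phi> \<Longrightarrow> k \<le> 0 \<Longrightarrow> H g \<in> F a k"
  by (rule F_Wt[OF L_H Wt_H]) simp_all

lemma F_adp:
  assumes "d \<in> \<Phi>" "Y \<in> F a k" "l \<le> k + of_nat j * cn d a"
  shows "adp (X d) j Y \<in> F a l"
  using assms(2)
proof (induction rule: F.induct)
  case (F_Wt Y \<mu>)
  then show ?case using assms(1,3) by (intro F.F_Wt[OF L_adp Wt_adp]) auto
qed (simp add: adp_add F_add)

lemma F_br: "d \<in> \<Phi> \<Longrightarrow> Y \<in> F a k \<Longrightarrow> l \<le> k + cn d a \<Longrightarrow> br (X d) Y \<in> F a l"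
  using F_adp[of d Y a k l "Suc 0"] by simp

lemma F_Nd: "d \<in> \<Phi> \<Longrightarrow> Y \<in> F a k \<Longrightarrow> cn d a \<ge> 0 \<Longrightarrow> l \<le> k + cn d a \<Longrightarrow> Nd d Y \<in> F a l"
  by (subst Nd_complex[OF _ F_L]) (auto intro!: F_add F_adp F_br)

lemma xi_F: "Y \<in> F a k \<Longrightarrow> g \<in> \<Phi> \<Longrightarrow> cn g a < k \<Longrightarrow> xi g Y = 0"
proof (induction rule: F.induct)
  case (F_Wt Y \<mu>)
  then show ?case using xi_Wt[OF F_Wt.prems(1) F_Wt.hyps(2)] by force
qed simp

text \<open>At the bottom of a string the structure constant is a sign, so it can be cancelled in
  every ring.\<close>

lemma unit_constant:
  assumes "g \<in> \<Phi>" "d \<in> \<Phi>" "g + d \<in> \<Phi>" "d - g \<notin> \<Phi>"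
  obtains N :: int where "br (X g) (X d) = of_int N \<odot> X (g + d)" "N * N = 1"
proof -
  have "d \<noteq> g" using assms(3) double_not_root[OF assms(1)] by auto
  then have "rstr \<Phi> g d = 0" using rstr_eq_0 assms by blast
  moreover obtain N :: int where N: "br (X g) (X d) = of_int N \<odot> X (g + d)" "\<bar>N\<bar> = int (rstr \<Phi> g d) + 1"
    using structure_constant[OF assms(1-3)] .
  ultimately have "N * N = 1" by (auto simp: abs_if split: if_splits)
  with N(1) that show ?thesis by blast
qed

end

section \<open>The grading by a long root\<close>

locale long_root = chev \<Phi> X
  for \<Phi> :: "'e::euclidean_space set" and X :: "'e \<Rightarrow> (complex, 'n::finite) sqm" +
  fixes \<alpha> :: 'e
  assumes long: "long \<Phi> \<alpha>"
begin

lemma alpha: "\<alpha> \<in> \<Phi>"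
  and alpha_max: "b \<in> \<Phi> \<Longrightarrow> b \<bullet> b \<le> \<alpha> \<bullet> \<alpha>"
  using long by (auto simp: long_def)

lemma cn_alpha: "cn \<alpha> \<alpha> = 2"
  using root_nz[OF alpha] by simp

lemma grade_cases:
  assumes "g \<in> \<Phi>"
  obtains "g = \<alpha>" "cn g \<alpha> = 2" | "g = - \<alpha>" "cn g \<alpha> = -2" | "cn g \<alpha> = -1" | "cn g \<alpha> = 0" | "cn g \<alpha> = 1"
  using long_cn[OF long assms] cn_alpha by force

lemma grade_le: "g \<in> \<Phi> \<Longrightarrow> cn g \<alpha> \<le> 2"
  and grade_ge: "g \<in> \<Phi> \<Longrightarrow> cn g \<alpha> \<ge> -2"
  by (erule grade_cases; simp)+

lemma grade_2: "g \<in> \<Phi> \<Longrightarrow> cn g \<alpha> > 1 \<Longrightarrow> g = \<alpha>"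
  and grade_m2: "g \<in> \<Phi> \<Longrightarrow> cn g \<alpha> < -1 \<Longrightarrow> g = - \<alpha>"
  by (erule grade_cases; simp)+

lemma F_top: "Y \<in> F \<alpha> 2 \<Longrightarrow> Y = xi \<alpha> Y \<odot> X \<alpha>"
proof (induction rule: F.induct)
  case (F_Wt Y \<mu>)
  show ?case
  proof (cases "\<mu> = \<alpha>")
    case True
    then show ?thesis using exact_by_xi[OF F_Wt(1,2)] alpha by simp
  next
    case False
    then have "Y = 0" using L_Wt_zero[OF F_Wt(1,2)] grade_2[of \<mu>] F_Wt(3) by fastforce
    then show ?thesis by simp
  qed
qed (simp add: sm_simps)

lemma F_above: "Y \<in> F \<alpha> k \<Longrightarrow> k > 2 \<Longrightarrow> Y = 0"
proof (induction rule: F.induct)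
  case (F_Wt Y \<mu>)
  then show ?case using L_Wt_zero[OF F_Wt(1,2)] grade_le[of \<mu>] by fastforce
qed simp

text \<open>The root vector of \<open>- \<alpha>\<close> is the only one of degree below -1.\<close>

lemma L_split: "Y \<in> L \<Longrightarrow> \<exists>Y'\<in>F \<alpha> (-1). Y = xi (- \<alpha>) Y \<odot> X (- \<alpha>) + Y'"
proof (induction Y rule: L_induct)
  case (X g)
  show ?case
  proof (cases "g = - \<alpha>")
    case False
    then have "cn g \<alpha> \<ge> -1" using X by (elim grade_cases) auto
    then show ?thesis using False X by (intro bexI[of _ "X g"] F_X) (auto simp: xi_X alpha)
  qed (use F_zero[OF alpha] X in \<open>auto simp: xi_X\<close>)
next
  case (H g)
  then show ?case by (intro bexI[of _ "H g"] F_H) (auto simp: xi_H alpha)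
next
  case (add Y Z)
  then obtain Y' Z' where Y': "Y' \<in> F \<alpha> (-1)" "Y = xi (- \<alpha>) Y \<odot> X (- \<alpha>) + Y'"
    and Z': "Z' \<in> F \<alpha> (-1)" "Z = xi (- \<alpha>) Z \<odot> X (- \<alpha>) + Z'" by blast
  have "Y + Z = xi (- \<alpha>) (Y + Z) \<odot> X (- \<alpha>) + (Y' + Z')"
    by (rule trans[OF arg_cong2[OF Y'(2) Z'(2), of "(+)"]]) (simp add: sm_simps)
  then show ?case using F_add[OF Y'(1) Z'(1)] by blast
next
  case (sm c Y)
  then obtain Y' where Y': "Y' \<in> F \<alpha> (-1)" "Y = xi (- \<alpha>) Y \<odot> X (- \<alpha>) + Y'"
    by blast
  have "c \<odot> Y = xi (- \<alpha>) (c \<odot> Y) \<odot> X (- \<alpha>) + c \<odot> Y'"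
    by (rule trans[OF arg_cong[OF Y'(2), of "\<lambda>W. c \<odot> W"]]) (simp add: sm_simps)
  then show ?case using F_sm[OF Y'(1)] by blast
qed

lemma L_F: "Y \<in> L \<Longrightarrow> Y \<in> F \<alpha> (-2)"
proof -
  assume "Y \<in> L"
  then obtain Y' where Y': "Y' \<in> F \<alpha> (-1)" "Y = xi (- \<alpha>) Y \<odot> X (- \<alpha>) + Y'"
    using L_split by blast
  have "xi (- \<alpha>) Y \<odot> X (- \<alpha>) + Y' \<in> F \<alpha> (-2)"
    using alpha cn_alpha by (intro F_add F_sm F_X F_mono[OF Y'(1)]) auto
  then show ?thesis using Y'(2) by simp
qed

text \<open>Roots of degree 1 come in pairs \<delta>, \<alpha> - \<delta>, the second being minus
  the reflection of the first at \<alpha>.\<close>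

lemma grade_1_roots:
  assumes "d \<in> \<Phi>" "cn d \<alpha> = 1"
  shows "d - \<alpha> \<in> \<Phi>" "\<alpha> - d \<in> \<Phi>" "cn (d - \<alpha>) \<alpha> = -1" "cn (\<alpha> - d) \<alpha> = 1" "\<alpha> - d \<noteq> d"
proof -
  show 1: "d - \<alpha> \<in> \<Phi>"
    using rfl_root[OF assms(1) alpha] assms(2) by (simp add: rfl_def)
  then show "\<alpha> - d \<in> \<Phi>" using neg_root_iff[of "d - \<alpha>"] by simp
  show "cn (d - \<alpha>) \<alpha> = -1" "cn (\<alpha> - d) \<alpha> = 1"
    using assms(2) cn_alpha by simp_all
  show "\<alpha> - d \<noteq> d" using double_not_root[OF assms(1)] alpha by (metis diff_add_cancel)
qed

context
  fixes \<delta> :: 'e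
  assumes \<delta>: "\<delta> \<in> \<Phi>" "cn \<delta> \<alpha> = 1"
begin

lemma kappa_exists:
  "\<exists>N :: int. br (X \<delta>) (X (- \<alpha>)) = of_int N \<odot> X (\<delta> - \<alpha>) \<and> N * N = 1"
proof -
  have "- \<alpha> - \<delta> \<notin> \<Phi>"
    using grade_ge[of "- \<alpha> - \<delta>"] \<delta>(2) cn_alpha by auto
  then show ?thesis
    using unit_constant[of \<delta> "- \<alpha>"] \<delta> alpha grade_1_roots[OF \<delta>] by (auto simp: algebra_simps)
qed

lemma kappa'_exists:
  "\<exists>N :: int. br (X \<alpha>) (X (\<delta> - \<alpha>)) = of_int N \<odot> X \<delta> \<and> N * N = 1"
proof -
  have "\<delta> - \<alpha> - \<alpha> \<notin> \<Phi>"
    using grade_ge[of "\<delta> - \<alpha> - \<alpha>"] \<delta>(2) cn_alpha by auto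
  then show ?thesis
    using unit_constant[of \<alpha> "\<delta> - \<alpha>"] \<delta> alpha grade_1_roots[OF \<delta>] by auto
qed

text \<open>Both structure constants, \<open>kap\<close> and \<open>kap'\<close>, are signs and thus
  their own inverses, which allows division by them over any ring.\<close>

definition kap :: int where
  "kap = (SOME N. br (X \<delta>) (X (- \<alpha>)) = of_int N \<odot> X (\<delta> - \<alpha>) \<and> N * N = 1)"

definition kap' :: int where
  "kap' = (SOME N. br (X \<alpha>) (X (\<delta> - \<alpha>)) = of_int N \<odot> X \<delta> \<and> N * N = 1)"

lemma kap: "br (X \<delta>) (X (- \<alpha>)) = of_int kap \<odot> X (\<delta> - \<alpha>)" "kap * kap = 1"
  using someI_ex[OF kappa_exists] unfolding kap_def[symmetric] by auto

lemma kap': "br (X \<alpha>) (X (\<delta> - \<alpha>)) = of_int kap' \<odot> X \<delta>" "kap' * kap' = 1"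
  using someI_ex[OF kappa'_exists] unfolding kap'_def[symmetric] by auto

lemma Nd_alpha_grade_m1: "Nd \<alpha> (X (\<delta> - \<alpha>)) = of_int kap' \<odot> X \<delta>"
proof -
  note b = grade_1_roots[OF \<delta>]
  have "adp (X \<alpha>) 2 (X (\<delta> - \<alpha>)) = 0" "adp (X \<alpha>) 3 (X (\<delta> - \<alpha>)) = 0"
    using b cn_alpha \<delta> by (auto intro!: F_above[of _ 3] F_adp[where k = "-1"] F_X alpha)
  then show ?thesis using Nd_complex[OF alpha L_X[OF b(1)]] kap' by simp
qed

text \<open>The higher terms of \<open>Nd \<delta> (X (- \<alpha>))\<close> have weight j \<delta> -
  \<alpha> with j = 2 or 3. Bracketing with \<open>X \<alpha>\<close> moves them to j \<delta>,
  which is not a root, so \<open>Nd \<alpha>\<close> kills them.\<close>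

lemma Nd_Nd_alpha: "Nd \<alpha> (Nd \<delta> (X (- \<alpha>))) = of_int (kap * kap') \<odot> X \<delta>"
proof -
  note b = grade_1_roots[OF \<delta>]
  have ma: "- \<alpha> \<in> \<Phi>" using alpha by simp
  have z: "Nd \<alpha> (adp (X \<delta>) j (X (- \<alpha>))) = 0" if j: "j = 2 \<or> j = 3" for j
  proof -
    let ?Y = "adp (X \<delta>) j (X (- \<alpha>))"
    have Y: "?Y \<in> L" "?Y \<in> Wt (- \<alpha> + of_nat j *\<^sub>R \<delta>)"
      by (intro L_adp Wt_adp L_X Wt_X ma \<delta>)+
    have "br (X \<alpha>) ?Y \<in> Wt (of_nat j *\<^sub>R \<delta>)"
      using Wt_br_X[OF alpha Y(2)] by simp
    then have 1: "br (X \<alpha>) ?Y = 0"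
      using j scaleR_root_iff[OF \<delta>(1), of "of_nat j"] root_nz[OF \<delta>(1)]
      by (intro L_Wt_zero[OF L_br_X[OF alpha Y(1)], of "of_nat j *\<^sub>R \<delta>"]) auto
    have 2: "adp (X \<alpha>) 2 ?Y = 0" "adp (X \<alpha>) 3 ?Y = 0"
      using 1 adp_zero_le[of "X \<alpha>" "Suc 0" ?Y] by auto
    show ?thesis using Nd_complex[OF alpha Y(1)] 1 2 by simp
  qed
  show ?thesis unfolding Nd_complex[OF \<delta>(1) L_X[OF ma]] Nd_add kap(1)
    by (simp add: z Nd_sm Nd_alpha_grade_m1)
qed

text \<open>\<open>Nd \<delta>\<close> raises degrees by at least 1 and \<open>Nd \<alpha>\<close>
  by at least 2. Everything in \<open>Y\<close> other than its multiple of
  \<open>X (- \<alpha>)\<close> therefore ends in degree 2, where only \<open>X \<alpha>\<close>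
  lives.\<close>

lemma Nd_Nd_L:
  assumes "Y \<in> L"
  shows "Nd \<alpha> (Nd \<delta> Y) = (of_int (kap * kap') * xi (- \<alpha>) Y) \<odot> X \<delta>
    + xi \<alpha> (Nd \<alpha> (Nd \<delta> Y)) \<odot> X \<alpha>"
proof -
  obtain Y' where Y': "Y' \<in> F \<alpha> (-1)" "Y = xi (- \<alpha>) Y \<odot> X (- \<alpha>) + Y'"
    using L_split[OF assms] by blast
  let ?W = "Nd \<alpha> (Nd \<delta> Y')"
  have W: "?W = xi \<alpha> ?W \<odot> X \<alpha>"
    by (rule F_top, rule F_Nd[OF alpha F_Nd[OF \<delta>(1) Y'(1)]]) (use \<delta> cn_alpha in auto)
  have e: "Nd \<alpha> (Nd \<delta> Y) = (of_int (kap * kap') * xi (- \<alpha>) Y) \<odot> X \<delta> + ?W"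
    by (subst Y'(2)) (simp add: Nd_add Nd_sm Nd_Nd_alpha mult.commute)
  have "xi \<alpha> (X \<delta>) = 0" using xi_X[OF alpha \<delta>(1)] \<delta>(2) cn_alpha by auto
  then have "xi \<alpha> (Nd \<alpha> (Nd \<delta> Y)) = xi \<alpha> ?W"
    unfolding e xi_add xi_sm by simp
  then show ?thesis by (simp only: W[symmetric] e)
qed

lemma xi_br_delta:
  assumes "Y \<in> L"
  shows "xi (\<delta> - \<alpha>) (br (X \<delta>) Y) = of_int kap * xi (- \<alpha>) Y"
proof -
  have "br (X (- \<alpha>)) (X \<delta>) = (- of_int kap) \<odot> X (\<delta> - \<alpha>)"
    by (subst br_swap) (simp add: kap(1))
  then have "xi (\<delta> - \<alpha>) (br Y (X \<delta>)) = - of_int kap * xi (- \<alpha>) Y"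
    using \<delta> alpha grade_1_roots[OF \<delta>] assms by (intro xi_br_X) auto
  then show ?thesis by (subst br_swap) simp
qed

lemma xi_br_alpha:
  assumes "Y \<in> L"
  shows "xi (\<delta> - \<alpha>) (br (X \<alpha>) Y) = 0"
  using grade_1_roots[OF \<delta>] cn_alpha L_F[OF assms]
  by (intro xi_F[OF F_br[OF alpha, of _ _ "-2" 0]]) auto

end

end

context chev
begin

lemma xi_adp_0: "d \<in> \<Phi> \<Longrightarrow> \<kappa> \<in> \<Phi> \<Longrightarrow> Y \<in> Wt \<mu> \<Longrightarrow> \<mu> + of_nat j *\<^sub>R d \<noteq> \<kappa> \<Longrightarrow> xi \<kappa> (adp (X d) j Y) = 0"
  using xi_Wt[OF _ Wt_adp] by blast

lemma xi_br_adp_0: "d \<in> \<Phi> \<Longrightarrow> \<kappa> \<in> \<Phi> \<Longrightarrow> \<eta> \<in> \<Phi> \<Longrightarrow> Y \<in> Wt \<mu> \<Longrightarrow> \<mu> + of_nat j *\<^sub>R d + \<eta> \<noteq> \<kappa> \<Longrightarrow>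
    xi \<kappa> (br (adp (X d) j Y) (X \<eta>)) = 0"
  using xi_Wt[OF _ Wt_br_X_right[OF _ Wt_adp]] by blast

lemma scaled_not_neg_root: "d \<in> \<Phi> \<Longrightarrow> g \<in> \<Phi> \<Longrightarrow> c > 1 \<Longrightarrow> g + c *\<^sub>R d \<noteq> 0"
  using scaleR_root_iff[of d "- c"] by (auto simp: add_eq_0_iff2)

text \<open>\<open>Kd d\<close> consists of the second and third divided powers. Among root vectors
  only that of -d can reach d: g + 2 d = d means g = -d, and g + 3 d = d would make -2 d a
  root.\<close>

lemma xi_Kd_same:
  assumes "d \<in> \<Phi>" "Y \<in> L"
  shows "xi d (Kd d Y) = - xi (- d) Y"
  using assms(2)
proof (induction Y rule: L_induct)
  case (X g)
  show ?case
  proof (cases "g = - d")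
    case True
    then show ?thesis
      using adp_X_neg[OF assms(1)] by (simp add: Kd_complex[OF assms(1) L_X] xi_X assms(1))
  next
    case False
    have "g + 2 *\<^sub>R d \<noteq> d" using False by (simp add: scaleR_2 add_eq_0_iff2)
    moreover have "g + 3 *\<^sub>R d \<noteq> d"
      using scaled_not_neg_root[OF assms(1) X, of 2] scaleR_left_distrib[of 2 1 d]
      by (auto simp flip: add.assoc)
    ultimately show ?thesis
      using False xi_adp_0[OF assms(1,1) Wt_X[OF X], of 2] xi_adp_0[OF assms(1,1) Wt_X[OF X], of 3]
      by (simp add: Kd_complex[OF assms(1) L_X[OF X]] xi_X X assms(1))
  qed
next
  case (H g)
  have "adp (X d) 2 (H g) = 0" "adp (X d) 3 (H g) = 0" using adp_zero_le[of "X d" 2 "H g" 3]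
    by (auto simp: adp_def eval_nat_numeral br_X_H H assms(1))
  then show ?case using H by (simp add: Kd_complex[OF assms(1) L_H] xi_H assms(1))
qed (simp_all add: Kd_add Kd_sm)

end

locale degree_one = long_root \<Phi> X \<alpha>
  for \<Phi> :: "'e::euclidean_space set" and X :: "'e \<Rightarrow> (complex, 'n::finite) sqm" and \<alpha> +
  fixes \<delta> :: 'e
  assumes \<delta>: "\<delta> \<in> \<Phi>" "cn \<delta> \<alpha> = 1"
begin

lemmas nb = grade_1_roots[OF \<delta>]

lemma xi_Nd_alpha:
  assumes "Y \<in> L"
  shows "xi \<delta> (Nd \<alpha> Y) = of_int (kap' \<delta>) * xi (\<delta> - \<alpha>) Y"
  using assms
proof (induction Y rule: L_induct)
  case (X g)
  show ?case
  proof (cases "g = \<delta> - \<alpha>")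
    case True
    then show ?thesis using Nd_alpha_grade_m1[OF \<delta>] nb \<delta> by (simp add: xi_X)
  next
    case False
    have "g + of_nat j *\<^sub>R \<alpha> \<noteq> \<delta>" if "j = 1 \<or> j = 2 \<or> j = 3" for j
    proof
      assume e: "g + of_nat j *\<^sub>R \<alpha> = \<delta>"
      have "cn g \<alpha> + of_nat j * 2 = 1"
        using arg_cong[OF e, of "\<lambda>v. cn v \<alpha>"] \<delta>(2) cn_alpha by simp
      then have "j = 1" using that grade_ge[OF X] by auto
      with e False show False by auto
    qed
    then have "xi \<delta> (adp (X \<alpha>) j (X g)) = 0" if "j = Suc 0 \<or> j = 2 \<or> j = 3" for j
      using xi_adp_0[OF alpha \<delta>(1) Wt_X[OF X]] that by auto
    from this[of "Suc 0"] this[of 2] this[of 3] show ?thesis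
      using False nb by (simp add: Nd_complex[OF alpha L_X[OF X]] xi_X X)
  qed
next
  case (H g)
  have "0 + of_nat j *\<^sub>R \<alpha> \<noteq> \<delta>" for j :: nat
  proof
    assume e: "0 + of_nat j *\<^sub>R \<alpha> = \<delta>"
    have "real (j * 2) = real 1"
      using arg_cong[OF e, of "\<lambda>v. cn v \<alpha>"] \<delta>(2) cn_alpha by simp
    then have "j * 2 = 1" by (simp only: of_nat_eq_iff)
    then show False by presburger
  qed
  then have "xi \<delta> (adp (X \<alpha>) j (H g)) = 0" for j
    using xi_adp_0[OF alpha \<delta>(1) Wt_H[OF H]] by auto
  from this[of "Suc 0"] this[of 2] this[of 3] show ?case
    using nb by (simp add: Nd_complex[OF alpha L_H[OF H]] xi_H H)
qed (simp_all add: Nd_add Nd_sm algebra_simps)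

lemma xi_br_Kd_1:
  assumes "Y \<in> L"
  shows "xi (\<alpha> - \<delta>) (br (Kd \<delta> Y) (X (\<alpha> - \<delta>))) = 0"
  using assms
proof (induction Y rule: L_induct)
  case (X g)
  then show ?case
    using xi_br_adp_0[OF \<delta>(1) nb(2) nb(2) Wt_X[OF X], of 2]
      xi_br_adp_0[OF \<delta>(1) nb(2) nb(2) Wt_X[OF X], of 3]
      scaled_not_neg_root[OF \<delta>(1) X, of 2] scaled_not_neg_root[OF \<delta>(1) X, of 3]
    by (simp add: Kd_complex[OF \<delta>(1) L_X[OF X]] br_simps)
next
  case (H g)
  then show ?case
    using xi_br_adp_0[OF \<delta>(1) nb(2) nb(2) Wt_H[OF H], of 2]
      xi_br_adp_0[OF \<delta>(1) nb(2) nb(2) Wt_H[OF H], of 3] root_nz[OF \<delta>(1)]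
    by (simp add: Kd_complex[OF \<delta>(1) L_H[OF H]] br_simps)
qed (simp_all add: Kd_add Kd_sm br_simps)

lemma xi_br_br_1:
  assumes "Y \<in> L"
  shows "xi (\<alpha> - \<delta>) (br (br (X \<alpha>) Y) (X (\<alpha> - \<delta>))) = xi (- \<alpha>) Y"
  using assms
proof (induction Y rule: L_induct)
  case (X g)
  show ?case
  proof (cases "g = - \<alpha>")
    case True
    then show ?thesis using nb alpha cn_alpha by (simp add: br_X_neg br_H_X xi_X)
  next
    case False
    then have "\<alpha> + g + (\<alpha> - \<delta>) \<noteq> \<alpha> - \<delta>"
      by (simp add: add_eq_0_iff)
    then show ?thesis
      using False xi_Wt[OF nb(2) Wt_br_X_right[OF nb(2) Wt_br_X[OF alpha Wt_X[OF X]]]]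
      by (simp add: xi_X X alpha)
  qed
next
  case (H g)
  then show ?case
    using xi_Wt[OF nb(2) Wt_br_X_right[OF nb(2) Wt_br_X[OF alpha Wt_H[OF H]]]] root_nz[OF alpha]
    by (simp add: xi_H alpha)
qed (simp_all add: br_simps)

lemma xi_br_Kd_2:
  assumes "Y \<in> L"
  shows "xi (\<alpha> - \<delta>) (br (Kd \<delta> Y) (X \<alpha>)) = 0"
  using assms
proof (induction Y rule: L_induct)
  case (X g)
  have "g + of_nat j *\<^sub>R \<delta> + \<alpha> \<noteq> \<alpha> - \<delta>" if "j > 0" for j :: nat
    using scaled_not_neg_root[OF \<delta>(1) X, of "of_nat j + 1"] that
    by (simp add: algebra_simps add_eq_0_iff2)
  from this[of 2] this[of 3] show ?case
    using xi_br_adp_0[OF \<delta>(1) nb(2) alpha Wt_X[OF X], of 2]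
      xi_br_adp_0[OF \<delta>(1) nb(2) alpha Wt_X[OF X], of 3]
    by (simp add: Kd_complex[OF \<delta>(1) L_X[OF X]] br_simps)
next
  case (H g)
  have "0 + of_nat j *\<^sub>R \<delta> + \<alpha> \<noteq> \<alpha> - \<delta>" for j :: nat
  proof
    assume "0 + of_nat j *\<^sub>R \<delta> + \<alpha> = \<alpha> - \<delta>"
    then have "(of_nat j + 1) *\<^sub>R \<delta> = 0" by (simp add: algebra_simps add_eq_0_iff2)
    then show False using root_nz[OF \<delta>(1)] by (simp add: add_eq_0_iff2)
  qed
  from this[of 2] this[of 3] show ?case
    using xi_br_adp_0[OF \<delta>(1) nb(2) alpha Wt_H[OF H], of 2]
      xi_br_adp_0[OF \<delta>(1) nb(2) alpha Wt_H[OF H], of 3]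
    by (simp add: Kd_complex[OF \<delta>(1) L_H[OF H]] br_simps)
qed (simp_all add: Kd_add Kd_sm br_simps)

lemma xi_br_br_2:
  assumes "Y \<in> L"
  shows "xi (\<alpha> - \<delta>) (br (br (X \<alpha>) Y) (X \<alpha>)) = 0"
proof -
  have "br (X \<alpha>) (br (X \<alpha>) Y) \<in> F \<alpha> 2"
    using cn_alpha by (intro F_br[OF alpha F_br[OF alpha L_F[OF assms]]]) auto
  then have "xi (\<alpha> - \<delta>) (br (X \<alpha>) (br (X \<alpha>) Y)) = 0"
    using nb by (intro xi_F) auto
  then show ?thesis by (subst br_swap) simp
qed

text \<open>The two terms have weights \<delta> and 2 \<delta>, and the latter is not a
  root.\<close>

lemma br_Kd_exact:
  "br (Kd \<delta> (X (- \<alpha>))) (X (\<alpha> - \<delta>)) = xi \<delta> (br (Kd \<delta> (X (- \<alpha>))) (X (\<alpha> - \<delta>))) \<odot> X \<delta>"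
proof -
  have ma: "- \<alpha> \<in> \<Phi>" using alpha by simp
  let ?A = "\<lambda>j. br (adp (X \<delta>) j (X (- \<alpha>))) (X (\<alpha> - \<delta>))"
  have A: "?A j \<in> L" "?A j \<in> Wt ((of_nat j - 1) *\<^sub>R \<delta>)" for j
  proof -
    show "?A j \<in> L" by (intro L_br_X_right L_adp L_X nb ma \<delta>)
    have "?A j \<in> Wt (- \<alpha> + of_nat j *\<^sub>R \<delta> + (\<alpha> - \<delta>))"
      by (intro Wt_br_X_right Wt_adp Wt_X nb ma \<delta>)
    then show "?A j \<in> Wt ((of_nat j - 1) *\<^sub>R \<delta>)" by (simp add: algebra_simps)
  qed
  have "?A 2 = xi \<delta> (?A 2) \<odot> X \<delta>" using exact_by_xi[OF A[of 2]] \<delta> by simp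
  moreover have "?A 3 = 0"
    using L_Wt_zero[OF A[of 3]] scaleR_root_iff[OF \<delta>(1), of 2] root_nz[OF \<delta>(1)] by auto
  ultimately show ?thesis by (simp add: Kd_complex[OF \<delta>(1) L_X[OF ma]] br_simps)
qed

lemma Kd_zero:
  assumes "2 *\<^sub>R \<delta> - \<alpha> \<notin> \<Phi>"
  shows "Kd \<delta> (X (- \<alpha>)) = 0"
proof -
  have ma: "- \<alpha> \<in> \<Phi>" using alpha by simp
  have "adp (X \<delta>) 2 (X (- \<alpha>)) \<in> Wt (2 *\<^sub>R \<delta> - \<alpha>)"
    using Wt_adp[OF \<delta>(1) Wt_X[OF ma], of 2] by simp
  moreover have "2 *\<^sub>R \<delta> - \<alpha> \<noteq> 0"
    using scaleR_root_iff[OF \<delta>(1), of 2] alpha by auto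
  ultimately have "adp (X \<delta>) 2 (X (- \<alpha>)) = 0"
    using L_Wt_zero[OF L_adp[OF \<delta>(1) L_X[OF ma]]] assms by blast
  then show ?thesis
    using adp_zero_le[of "X \<delta>" 2 _ 3] by (simp add: Kd_complex[OF \<delta>(1) L_X[OF ma]])
qed

end

context chev
begin

lemma xi_Xr: "g \<in> \<Phi> \<Longrightarrow> \<kappa> \<in> \<Phi> \<Longrightarrow> xi \<kappa> (Xr g :: ('r::comm_ring_1, 'n) sqm) = (if g = \<kappa> then 1 else 0)"
proof -
  assume a: "g \<in> \<Phi>" "\<kappa> \<in> \<Phi>"
  interpret T: chev_spcl \<Phi> X "tspec (0 :: 'r)" UNIV by (rule chev_spcl_tspec)
  show ?thesis
  proof (rule T.S_eq)
    show "tspec (0 :: 'r) (\<lambda>_. xi \<kappa> (Xr g :: (complex, 'n) sqm)) (xi \<kappa> (Xr g :: ('r, 'n) sqm))"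
      by (intro specI)
    show "tspec (0 :: 'r) (\<lambda>_. if g = \<kappa> then 1 else 0) (if g = \<kappa> then 1 else 0)"
      by (auto intro: specI)
  qed (simp add: Xr_complex xi_X a)
qed

lemma br_Xr_transfer:
  assumes "g \<in> \<Phi>" "d \<in> \<Phi>" "\<kappa> \<in> \<Phi>" "br (X g) (X d) = of_int N \<odot> X \<kappa>"
  shows "br (Xr g) (Xr d) = of_int N \<odot> (Xr \<kappa> :: ('r::comm_ring_1, 'n) sqm)"
proof -
  interpret T: chev_spcl \<Phi> X "tspec (0 :: 'r)" UNIV by (rule chev_spcl_tspec)
  show ?thesis
    by (rule T.SM_eq[of "\<lambda>_. br (Xr g) (Xr d)" _ "\<lambda>_. of_int N \<odot> Xr \<kappa>"])
      ((intro specI T.S_of_int)+ | simp add: Xr_complex assms)+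
qed

lemma br_Xr_zero:
  assumes "g \<in> \<Phi>" "d \<in> \<Phi>" "g + d \<notin> \<Phi>" "g + d \<noteq> 0"
  shows "br (Xr g) (Xr d) = (0 :: ('r::comm_ring_1, 'n) sqm)"
  using br_Xr_transfer[OF assms(1,2,1), of 0] XX_zero[OF assms(1,2,4,3)] by simp

end

section \<open>Conjugation by a point of the group scheme\<close>

locale point = chev \<Phi> X
  for \<Phi> :: "'e::euclidean_space set" and X :: "'e \<Rightarrow> (complex, 'n::finite) sqm" +
  fixes z :: "('r::comm_ring_1, 'n) sqm"
  assumes z: "z \<in> GP"
begin

sublocale chev_spcl \<Phi> X "regular_spec EC z" EC by (rule chev_spcl_points[OF z])

declare S_of_int [specI] SM_imat [specI]

lemma SM_id [specI]: "SM (\<lambda>A. A) z"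
  by (rule SM_id_points[OF z])

lemma SM_Nd [specI]: "SM G M \<Longrightarrow> SM (\<lambda>b. Nd d (G b)) (Nd d M)"
  unfolding Nd_def using S_of_int[of "-1"] by (auto intro!: specI)

lemma SM_Kd [specI]: "SM G M \<Longrightarrow> SM (\<lambda>b. Kd d (G b)) (Kd d M)"
  unfolding Kd_def by (intro specI)

definition Z :: "('r, 'n) sqm \<Rightarrow> ('r, 'n) sqm" where
  "Z Y = z * Y * adj z"

lemmas z_inv = points_adj(1,2)[OF z]

lemma z_inv_assoc [simp]: "z * (adj z * Y) = Y" "adj z * (z * Y) = Y"
  using z_inv by (simp_all flip: mult.assoc)

lemma Z_add: "Z (Y + W) = Z Y + Z W"
  and Z_diff: "Z (Y - W) = Z Y - Z W"
  and Z_sm: "Z (c \<odot> Y) = c \<odot> Z Y"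
  by (simp_all add: Z_def algebra_simps)

lemma Z_mult: "Z (Y * W) = Z Y * Z W"
  by (simp add: Z_def mult.assoc)

lemma Z_br: "Z (br Y W) = br (Z Y) (Z W)"
  by (simp add: br_def Z_diff Z_mult)

lemma Z_inj: "Z Y = Z W \<Longrightarrow> Y = W"
proof -
  assume "Z Y = Z W"
  then have "adj z * Z Y * z = adj z * Z W * z" by simp
  then show ?thesis using z_inv by (simp add: Z_def mult.assoc)
qed

lemma SM_Z [specI]: "SM G M \<Longrightarrow> SM (\<lambda>A. A * G A * adj A) (Z M)"
  unfolding Z_def by (intro specI)

definition comm :: "'e \<Rightarrow> bool" where
  "comm g \<longleftrightarrow> z * xx g 1 = xx g 1 * z"

lemma Z_Nd:
  assumes "g \<in> \<Phi>" "comm g"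
  shows "Z (Nd g Y) = Nd g (Z Y)"
proof -
  have c: "z * xx g 1 = xx g 1 * z" using assms(2) by (simp add: comm_def)
  have i: "xx g 1 * xx g (-1) = (1 :: ('r, 'n) sqm)" "xx g (-1) * xx g 1 = (1 :: ('r, 'n) sqm)"
    using xx_inverse[OF assms(1), of 1] by auto
  have "adj z * (z * xx g 1) * (adj z * xx g (-1)) = adj z * (xx g 1 * z) * (adj z * xx g (-1))"
    unfolding c ..
  then have c': "xx g 1 * (adj z * xx g (-1)) = adj z" by (simp add: mult.assoc i)
  have "xx g (-1) * adj z = xx g (-1) * (xx g 1 * (adj z * xx g (-1)))" unfolding c' ..
  also have "\<dots> = adj z * xx g (-1)" by (simp flip: mult.assoc add: i)
  finally have c2: "xx g (-1) * adj z = adj z * xx g (-1)" .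
  have "Z (xx g 1 * Y * xx g (-1)) = z * xx g 1 * Y * (xx g (-1) * adj z)"
    by (simp add: Z_def mult.assoc)
  also have "\<dots> = xx g 1 * Z Y * xx g (-1)" unfolding c c2 by (simp add: Z_def mult.assoc)
  finally show ?thesis by (simp add: Nd_def Z_diff)
qed

lemma L_Xr_conj: "A \<in> EC \<Longrightarrow> \<eta> \<in> \<Phi> \<Longrightarrow> A * Xr \<eta> * adj A \<in> L"
  by (simp add: Xr_complex EC_conj_L L_X)

lemma xi_br_Z:
  assumes "\<nu> \<in> \<Phi>" "\<eta> \<in> \<Phi>" "\<kappa> \<in> \<Phi>" "g \<in> \<Phi>" "\<kappa> = \<nu> + \<eta>" "br (X \<nu>) (X \<eta>) = of_int m \<odot> X \<kappa>"
  shows "xi \<kappa> (br (Z (Xr g)) (Xr \<eta>)) = of_int m * xi \<nu> (Z (Xr g))"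
  by (rule S_eq[of "\<lambda>A. xi \<kappa> (br (A * Xr g * adj A) (Xr \<eta>))" _ "\<lambda>A. of_int m * xi \<nu> (A * Xr g * adj A)"])
    (intro specI | simp add: Xr_complex[OF assms(2)] xi_br_X[OF L_Xr_conj assms(2,3,1,5,6)] assms(4))+

lemma Nd_alpha_zero:
  assumes "g \<in> \<Phi>" "d \<in> \<Phi>" "g + d \<notin> \<Phi>" "g + d \<noteq> 0"
  shows "Nd g (Xr d) = (0 :: ('r, 'n) sqm)"
proof (rule SM_zero_if[of "\<lambda>_. Nd g (Xr d)"])
  have "adp (X g) (Suc 0) (X d) = 0" using XX_zero assms by simp
  then show "Nd g (Xr d) = (0 :: (complex, 'n) sqm)" using adp_zero_le[of "X g" "Suc 0" "X d"] assms
    by (simp add: Nd_complex[OF assms(1) L_X] Xr_complex)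
qed (intro specI)

end

locale long_point = long_root \<Phi> X \<alpha> + point \<Phi> X z
  for \<Phi> :: "'e::euclidean_space set" and X :: "'e \<Rightarrow> (complex, 'n::finite) sqm" and \<alpha>
    and z :: "('r::comm_ring_1, 'n) sqm"
begin

definition Y0 :: "('r, 'n) sqm" where
  "Y0 = Z (Xr (- \<alpha>))"

abbreviation c0 :: 'r where
  "c0 \<equiv> xi (- \<alpha>) Y0"

lemma minus_alpha: "- \<alpha> \<in> \<Phi>"
  using alpha by simp

lemma SM_Y0 [specI]: "SM (\<lambda>A. A * Xr (- \<alpha>) * adj A) Y0"
  unfolding Y0_def by (intro specI)

lemma L_Y0: "A \<in> EC \<Longrightarrow> A * Xr (- \<alpha>) * adj A \<in> L"
  by (rule L_Xr_conj) (simp_all add: alpha)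

end

locale degree_one_point = degree_one \<Phi> X \<alpha> \<delta> + long_point \<Phi> X \<alpha> z
  for \<Phi> :: "'e::euclidean_space set" and X :: "'e \<Rightarrow> (complex, 'n::finite) sqm" and \<alpha> \<delta>
    and z :: "('r::comm_ring_1, 'n) sqm" +
  assumes comm_alpha: "comm \<alpha>" and comm_delta: "comm \<delta>"
begin

lemma r1: "br (Xr \<delta>) (Xr (- \<alpha>)) = of_int (kap \<delta>) \<odot> (Xr (\<delta> - \<alpha>) :: ('r, 'n) sqm)"
  by (rule br_Xr_transfer) (use kap[OF \<delta>] nb \<delta> alpha in auto)

lemma r2: "Nd \<alpha> (Nd \<delta> (Xr (- \<alpha>))) = of_int (kap \<delta> * kap' \<delta>) \<odot> (Xr \<delta> :: ('r, 'n) sqm)"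
  by (rule SM_eq[of "\<lambda>_. Nd \<alpha> (Nd \<delta> (Xr (- \<alpha>)))" _ "\<lambda>_. of_int (kap \<delta> * kap' \<delta>) \<odot> Xr \<delta>"])
    (intro specI | simp add: Xr_complex alpha \<delta> Nd_Nd_alpha[OF \<delta>] del: of_int_mult)+

lemma r3: "Nd \<alpha> (Xr (\<delta> - \<alpha>)) = of_int (kap' \<delta>) \<odot> (Xr \<delta> :: ('r, 'n) sqm)"
  by (rule SM_eq[of "\<lambda>_. Nd \<alpha> (Xr (\<delta> - \<alpha>))" _ "\<lambda>_. of_int (kap' \<delta>) \<odot> Xr \<delta>"])
    (intro specI | simp add: Xr_complex nb \<delta> Nd_alpha_grade_m1[OF \<delta>])+

lemma t1: "Nd \<alpha> (Nd \<delta> Y0) = (of_int (kap \<delta> * kap' \<delta>) * c0) \<odot> Xr \<delta> + xi \<alpha> (Nd \<alpha> (Nd \<delta> Y0)) \<odot> Xr \<alpha>"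
proof -
  let ?Y = "\<lambda>A. A * Xr (- \<alpha>) * adj A"
  show ?thesis
    by (rule SM_eq[of "\<lambda>A. Nd \<alpha> (Nd \<delta> (?Y A))" _ "\<lambda>A. (of_int (kap \<delta> * kap' \<delta>) * xi (- \<alpha>) (?Y A)) \<odot> Xr \<delta>
        + xi \<alpha> (Nd \<alpha> (Nd \<delta> (?Y A))) \<odot> Xr \<alpha>"])
      (intro specI | unfold Xr_complex[OF \<delta>(1)] Xr_complex[OF alpha], intro Nd_Nd_L[OF \<delta>] L_Y0)+
qed

lemma t2: "xi (\<delta> - \<alpha>) (br (Xr \<delta>) Y0) = of_int (kap \<delta>) * c0"
proof -
  let ?Y = "\<lambda>A. A * Xr (- \<alpha>) * adj A"
  show ?thesis
    by (rule S_eq[of "\<lambda>A. xi (\<delta> - \<alpha>) (br (Xr \<delta>) (?Y A))" _ "\<lambda>A. of_int (kap \<delta>) * xi (- \<alpha>) (?Y A)"])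
      (intro specI | unfold Xr_complex[OF \<delta>(1)], intro xi_br_delta[OF \<delta>] L_Y0)+
qed

lemma t2': "xi (\<delta> - \<alpha>) (br (Xr \<alpha>) Y0) = 0"
proof -
  let ?Y = "\<lambda>A. A * Xr (- \<alpha>) * adj A"
  show ?thesis
    by (rule S_zero_if[of "\<lambda>A. xi (\<delta> - \<alpha>) (br (Xr \<alpha>) (?Y A))"])
      (intro specI | unfold Xr_complex[OF alpha], intro xi_br_alpha[OF \<delta>] L_Y0)+
qed

lemma t3: "xi \<delta> (Nd \<alpha> (Z (Xr (\<delta> - \<alpha>)))) = of_int (kap' \<delta>) * xi (\<delta> - \<alpha>) (Z (Xr (\<delta> - \<alpha>)))"
proof -
  let ?Y = "\<lambda>A. A * Xr (\<delta> - \<alpha>) * adj A"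
  show ?thesis
    by (rule S_eq[of "\<lambda>A. xi \<delta> (Nd \<alpha> (?Y A))" _ "\<lambda>A. of_int (kap' \<delta>) * xi (\<delta> - \<alpha>) (?Y A)"])
      (intro specI | intro xi_Nd_alpha L_Xr_conj nb)+
qed

lemma sign_cancel: "(m :: int) * m = 1 \<Longrightarrow> of_int m * a = of_int m * b \<Longrightarrow> a = (b :: 'r)"
  by (metis mult.assoc mult_1_left of_int_1 of_int_mult)

lemma sign_cancel_sm: "(m :: int) * m = 1 \<Longrightarrow> of_int m \<odot> A = B \<Longrightarrow> A = of_int m \<odot> (B :: ('r, 'n) sqm)"
  by (metis of_int_1 of_int_mult sm_one sm_sm)

text \<open>\<open>Nd \<alpha>\<close> and \<open>Nd \<delta>\<close> commute with \<open>Z\<close>,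
  so \<open>Z\<close> applied to \<open>r2\<close> expresses the image of \<open>Xr \<delta>\<close>
  through \<open>Y0\<close>, and \<open>t1\<close> evaluates the result.\<close>

lemma Z_delta: "\<exists>e. Z (Xr \<delta>) = c0 \<odot> Xr \<delta> + e \<odot> Xr \<alpha>"
proof -
  let ?m = "kap \<delta> * kap' \<delta>"
  have m: "?m * ?m = 1" using kap(2)[OF \<delta>] kap'(2)[OF \<delta>] by (simp add: mult_ac)
  have "of_int ?m \<odot> Z (Xr \<delta>) = Nd \<alpha> (Nd \<delta> Y0)"
    unfolding Z_sm[symmetric] r2[symmetric] Y0_def
    by (simp add: Z_Nd alpha comm_alpha comm_delta \<delta>)
  then have "Z (Xr \<delta>) = of_int ?m \<odot> Nd \<alpha> (Nd \<delta> Y0)"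
    by (rule sign_cancel_sm[OF m])
  also have "\<dots> = (of_int (?m * ?m) * c0) \<odot> Xr \<delta> + (of_int ?m * xi \<alpha> (Nd \<alpha> (Nd \<delta> Y0))) \<odot> Xr \<alpha>"
    by (subst t1) (simp add: sm_simps mult.assoc)
  finally show ?thesis unfolding m by auto
qed

text \<open>The coefficient at \<delta> - \<alpha> of the image of
  \<open>Xr (\<delta> - \<alpha>)\<close> is computed twice: \<open>r3\<close> gives
  \<open>c0\<close>, and \<open>r1\<close>, which presents this vector as a bracket of
  \<open>Xr \<delta>\<close> and \<open>Xr (- \<alpha>)\<close>, gives the square of
  \<open>c0\<close>.\<close>

lemma c0_idem: "c0 * c0 = c0"
proof -
  obtain e where e: "Z (Xr \<delta>) = c0 \<odot> Xr \<delta> + e \<odot> Xr \<alpha>"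
    using Z_delta by blast
  have "xi \<delta> (Nd \<alpha> (Z (Xr (\<delta> - \<alpha>)))) = xi \<delta> (Z (Nd \<alpha> (Xr (\<delta> - \<alpha>))))"
    by (simp add: Z_Nd alpha comm_alpha)
  also have "\<dots> = of_int (kap' \<delta>) * c0"
    using \<delta> cn_alpha by (simp add: r3 Z_sm e xi_Xr alpha) auto
  finally have 1: "xi (\<delta> - \<alpha>) (Z (Xr (\<delta> - \<alpha>))) = c0"
    unfolding t3 using sign_cancel[OF kap'(2)[OF \<delta>]] by blast
  have "of_int (kap \<delta>) * c0 = xi (\<delta> - \<alpha>) (Z (br (Xr \<delta>) (Xr (- \<alpha>))))"
    by (simp add: r1 Z_sm 1)
  also have "\<dots> = of_int (kap \<delta>) * (c0 * c0)"
    unfolding Z_br Y0_def[symmetric] e by (simp add: br_simps t2 t2' mult_ac)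
  finally show ?thesis using sign_cancel[OF kap(2)[OF \<delta>]] by simp
qed

end

locale degree_one_pair = degree_one_point \<Phi> X \<alpha> \<delta> z
  for \<Phi> :: "'e::euclidean_space set" and X :: "'e \<Rightarrow> (complex, 'n::finite) sqm" and \<alpha> \<delta>
    and z :: "('r::comm_ring_1, 'n) sqm" +
  assumes comm_delta': "comm (\<alpha> - \<delta>)"
begin

sublocale D': degree_one_point \<Phi> X \<alpha> "\<alpha> - \<delta>" z
  by unfold_locales (use nb comm_alpha comm_delta' in auto)

text \<open>The ring may have idempotents besides 0 and 1. Multiplied by e = 1 - c0, the images of
  \<open>Xr \<delta>\<close> and \<open>Xr (\<alpha> - \<delta>)\<close> both become multiples of
  \<open>Xr \<alpha>\<close> and so satisfy a linear relation, which the injectivity of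
  \<open>Z\<close> turns into e = 0.\<close>

lemma c0_eq_1: "c0 = 1"
proof -
  obtain a where a: "Z (Xr \<delta>) = c0 \<odot> Xr \<delta> + a \<odot> Xr \<alpha>"
    using Z_delta by blast
  obtain b where b: "Z (Xr (\<alpha> - \<delta>)) = c0 \<odot> Xr (\<alpha> - \<delta>) + b \<odot> Xr \<alpha>"
    using D'.Z_delta by blast
  define e where "e = 1 - c0"
  have ec: "e * c0 = 0" using c0_idem by (simp add: e_def algebra_simps)
  have ea: "e \<odot> Z (Xr \<delta>) = (e * a) \<odot> Xr \<alpha>"
    and eb: "e \<odot> Z (Xr (\<alpha> - \<delta>)) = (e * b) \<odot> Xr \<alpha>"
    unfolding a b by (simp_all add: sm_simps ec)
  have "Z ((e * b) \<odot> Xr \<delta>) = b \<odot> (e \<odot> Z (Xr \<delta>))"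
    by (simp add: Z_sm mult.commute)
  also have "\<dots> = a \<odot> (e \<odot> Z (Xr (\<alpha> - \<delta>)))"
    unfolding ea eb by (simp add: mult_ac)
  also have "\<dots> = Z ((e * a) \<odot> Xr (\<alpha> - \<delta>))"
    by (simp add: Z_sm mult.commute)
  finally have "(e * b) \<odot> Xr \<delta> = (e * a) \<odot> Xr (\<alpha> - \<delta>)"
    by (rule Z_inj)
  from arg_cong[OF this, of "xi (\<alpha> - \<delta>)"] have "e * a = 0"
    using nb \<delta> by (simp add: xi_Xr)
  then have "Z (e \<odot> Xr \<delta>) = Z 0" using ea by (simp add: Z_sm) (simp add: Z_def)
  from arg_cong[OF Z_inj[OF this], of "xi \<delta>"] have "e = 0"
    using \<delta> by (simp add: xi_Xr)
  then show ?thesis by (simp add: e_def)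
qed

lemma t4:
  shows "xi (\<alpha> - \<delta>) (br (Kd \<delta> Y0) (Xr (\<alpha> - \<delta>))) = 0"
    and "xi (\<alpha> - \<delta>) (br (br (Xr \<alpha>) Y0) (Xr (\<alpha> - \<delta>))) = c0"
    and "xi (\<alpha> - \<delta>) (br (Kd \<delta> Y0) (Xr \<alpha>)) = 0"
    and "xi (\<alpha> - \<delta>) (br (br (Xr \<alpha>) Y0) (Xr \<alpha>)) = 0"
    and "xi \<delta> (Kd \<delta> Y0) = - xi (- \<delta>) Y0"
proof -
  let ?Y = "\<lambda>A. A * Xr (- \<alpha>) * adj A"
  note C = Xr_complex[OF alpha] Xr_complex[OF nb(2)]
  show "xi (\<alpha> - \<delta>) (br (Kd \<delta> Y0) (Xr (\<alpha> - \<delta>))) = 0"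
    by (rule S_zero_if[of "\<lambda>A. xi (\<alpha> - \<delta>) (br (Kd \<delta> (?Y A)) (Xr (\<alpha> - \<delta>)))"])
      (intro specI | unfold C, intro xi_br_Kd_1 L_Y0)+
  show "xi (\<alpha> - \<delta>) (br (br (Xr \<alpha>) Y0) (Xr (\<alpha> - \<delta>))) = c0"
    by (rule S_eq[of "\<lambda>A. xi (\<alpha> - \<delta>) (br (br (Xr \<alpha>) (?Y A)) (Xr (\<alpha> - \<delta>)))" _ "\<lambda>A. xi (- \<alpha>) (?Y A)"])
      (intro specI | unfold C, intro xi_br_br_1 L_Y0)+
  show "xi (\<alpha> - \<delta>) (br (Kd \<delta> Y0) (Xr \<alpha>)) = 0"
    by (rule S_zero_if[of "\<lambda>A. xi (\<alpha> - \<delta>) (br (Kd \<delta> (?Y A)) (Xr \<alpha>))"])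
      (intro specI | unfold C, intro xi_br_Kd_2 L_Y0)+
  show "xi (\<alpha> - \<delta>) (br (br (Xr \<alpha>) Y0) (Xr \<alpha>)) = 0"
    by (rule S_zero_if[of "\<lambda>A. xi (\<alpha> - \<delta>) (br (br (Xr \<alpha>) (?Y A)) (Xr \<alpha>))"])
      (intro specI | unfold C, intro xi_br_br_2 L_Y0)+
  show "xi \<delta> (Kd \<delta> Y0) = - xi (- \<delta>) Y0"
    by (rule S_eq[of "\<lambda>A. xi \<delta> (Kd \<delta> (?Y A))" _ "\<lambda>A. - xi (- \<delta>) (?Y A)"])
      (intro specI | intro xi_Kd_same L_Y0 \<delta>)+
qed

lemma r5: "br (Kd \<delta> (Xr (- \<alpha>))) (Xr (\<alpha> - \<delta>))
    = xi \<delta> (br (Kd \<delta> (Xr (- \<alpha>))) (Xr (\<alpha> - \<delta>))) \<odot> (Xr \<delta> :: ('r, 'n) sqm)"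
  by (rule SM_eq[of "\<lambda>_. br (Kd \<delta> (Xr (- \<alpha>))) (Xr (\<alpha> - \<delta>))" _
      "\<lambda>_. xi \<delta> (br (Kd \<delta> (Xr (- \<alpha>))) (Xr (\<alpha> - \<delta>))) \<odot> Xr \<delta>"])
    (intro specI | unfold Xr_complex[OF nb(2)] Xr_complex[OF \<delta>(1)] Xr_complex[OF minus_alpha], rule br_Kd_exact)+

text \<open>\<open>Z\<close> is applied to \<open>r5\<close> and coefficients at \<alpha> - \<delta>
  are compared: the right side contributes 0, and on the left only the correction term -e
  [X \<alpha>, Y0] contributes, with the value -e.\<close>

lemma Z_delta_eq: "Z (Xr \<delta>) = Xr \<delta>"
  and Z_Kd: "Z (Kd \<delta> (Xr (- \<alpha>))) = Kd \<delta> Y0"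
proof -
  obtain e where e: "Z (Xr \<delta>) = Xr \<delta> + e \<odot> Xr \<alpha>"
    using Z_delta c0_eq_1 by auto
  obtain e' where e': "Z (Xr (\<alpha> - \<delta>)) = Xr (\<alpha> - \<delta>) + e' \<odot> Xr \<alpha>"
    using D'.Z_delta c0_eq_1 by auto
  have ZK: "Z (Kd \<delta> (Xr (- \<alpha>))) = Kd \<delta> Y0 - e \<odot> br (Xr \<alpha>) Y0"
    unfolding Kd_def Z_diff Z_br Y0_def[symmetric] e
    by (simp add: Z_Nd \<delta> comm_delta Y0_def[symmetric] br_simps)
  have "0 = xi (\<alpha> - \<delta>) (Z (br (Kd \<delta> (Xr (- \<alpha>))) (Xr (\<alpha> - \<delta>))))"
    by (subst r5) (use nb \<delta> alpha cn_alpha in \<open>auto simp: Z_sm e xi_Xr\<close>)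
  also have "\<dots> = - e" unfolding Z_br ZK e' by (simp add: br_simps t4 c0_eq_1)
  finally have "e = 0" by simp
  with e ZK show "Z (Xr \<delta>) = Xr \<delta>" "Z (Kd \<delta> (Xr (- \<alpha>))) = Kd \<delta> Y0"
    by simp_all
qed

text \<open>Here \<open>Kd \<delta>\<close> kills \<open>Xr (- \<alpha>)\<close>, hence also its
  image \<open>Y0\<close>, whose coefficient at -\<delta> it would carry to \<delta> with a
  sign.\<close>

lemma Y0_coeff_zero_if_no_root:
  assumes "2 *\<^sub>R \<delta> - \<alpha> \<notin> \<Phi>"
  shows "xi (- \<delta>) Y0 = 0"
proof -
  have "Kd \<delta> (Xr (- \<alpha>)) = (0 :: ('r, 'n) sqm)"
    by (rule SM_zero_if[of "\<lambda>_. Kd \<delta> (Xr (- \<alpha>))"])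
      (intro specI | simp add: Xr_complex alpha Kd_zero[OF assms])+
  then have "Kd \<delta> Y0 = 0" using Z_Kd by (simp add: Z_def)
  then show ?thesis using t4(5) by simp
qed

end

text \<open>Turns identities between linear combinations of vectors into real arithmetic.\<close>

lemma inner_ext: "(\<And>v. x \<bullet> v = y \<bullet> v) \<Longrightarrow> x = (y :: 'a::real_inner)"
  by (metis inner_commute vector_eq_ldot)

section \<open>Vanishing of the coefficients of degree -1\<close>

context degree_one
begin

lemma inner_alpha_delta: "\<alpha> \<bullet> \<delta> = (\<alpha> \<bullet> \<alpha>) / 2"
  using \<delta>(2) root_nz[OF alpha] by (simp add: cartan_number_def inner_commute field_simps)

text \<open>The root \<alpha> - 3 \<delta> is not longer than \<alpha>, so the Cartan integer of
  \<alpha> against \<delta> is at least 3; it is below 4 because the opposite one is 1.\<close>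

lemma ratio_3:
  assumes "\<alpha> - 3 *\<^sub>R \<delta> \<in> \<Phi>"
  shows "\<alpha> \<bullet> \<alpha> = 3 * (\<delta> \<bullet> \<delta>)"
proof -
  have "(\<alpha> - 3 *\<^sub>R \<delta>) \<bullet> (\<alpha> - 3 *\<^sub>R \<delta>) = 9 * (\<delta> \<bullet> \<delta>) - 2 * (\<alpha> \<bullet> \<alpha>)"
    using inner_alpha_delta by (simp add: inner_diff_left inner_diff_right inner_commute)
  then have le: "3 * (\<delta> \<bullet> \<delta>) \<le> \<alpha> \<bullet> \<alpha>"
    using alpha_max[OF assms] by linarith
  have d: "\<delta> \<bullet> \<delta> > 0" by (rule inner_pos[OF \<delta>(1)])
  have e: "cn \<alpha> \<delta> = (\<alpha> \<bullet> \<alpha>) / (\<delta> \<bullet> \<delta>)"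
    using inner_alpha_delta by (simp add: cartan_number_def)
  have "\<delta> \<noteq> \<alpha>" "\<delta> \<noteq> - \<alpha>"
    using \<delta>(2) cn_alpha by auto
  then have "cn \<alpha> \<delta> < 4" using cn_prod_less[OF alpha \<delta>(1)] \<delta>(2) by simp
  moreover have "cn \<alpha> \<delta> \<ge> 3" unfolding e using le d by (simp add: field_simps)
  moreover obtain m where "cn \<alpha> \<delta> = of_int m"
    using cn_Ints[OF \<delta>(1) alpha] by (auto elim: Ints_cases)
  ultimately have "cn \<alpha> \<delta> = 3" by auto
  then show ?thesis unfolding e using d by (simp add: field_simps)
qed

lemma norm_combination:
  "(p *\<^sub>R \<alpha> - q *\<^sub>R \<delta>) \<bullet> (p *\<^sub>R \<alpha> - q *\<^sub>R \<delta>) = (p * p - p * q) * (\<alpha> \<bullet> \<alpha>) + q * q * (\<delta> \<bullet> \<delta>)"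
  using inner_alpha_delta
  by (simp add: inner_diff_left inner_diff_right inner_commute algebra_simps)

lemma ratio_3_not_roots:
  assumes "\<alpha> - 3 *\<^sub>R \<delta> \<in> \<Phi>"
  shows "2 *\<^sub>R \<alpha> - 5 *\<^sub>R \<delta> \<notin> \<Phi>" "q > 3 \<Longrightarrow> \<alpha> - q *\<^sub>R \<delta> \<notin> \<Phi>"
proof -
  note r = ratio_3[OF assms]
  have d: "\<delta> \<bullet> \<delta> > 0" by (rule inner_pos[OF \<delta>(1)])
  show "2 *\<^sub>R \<alpha> - 5 *\<^sub>R \<delta> \<notin> \<Phi>"
    using alpha_max[of "2 *\<^sub>R \<alpha> - 5 *\<^sub>R \<delta>"] norm_combination[of 2 5] r d by auto
  assume q: "q > 3"
  have "(q - 3) * q * (\<delta> \<bullet> \<delta>) > 0" using q d by (intro mult_pos_pos) auto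
  then show "\<alpha> - q *\<^sub>R \<delta> \<notin> \<Phi>"
    using alpha_max[of "\<alpha> - q *\<^sub>R \<delta>"] norm_combination[of 1 q] r by (auto simp: algebra_simps)
qed

text \<open>The vector of degree 0 leading from -\<delta> to \<delta> - \<alpha>.\<close>

definition eps :: 'e where "eps = 2 *\<^sub>R \<delta> - \<alpha>"

lemma cn_eps: "cn eps \<alpha> = 0"
  using \<delta>(2) cn_alpha by (simp add: eps_def)

lemma eps_minus_alpha: "eps - \<alpha> \<notin> \<Phi>" "eps - \<alpha> \<noteq> 0"
proof -
  have "eps \<noteq> 0" using scaleR_root_iff[OF \<delta>(1), of 2] alpha by (auto simp: eps_def)
  moreover have "cn (eps - \<alpha>) \<alpha> = -2" using cn_eps cn_alpha by simp
  ultimately show "eps - \<alpha> \<notin> \<Phi>" using grade_m2[of "eps - \<alpha>"] by auto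
  show "eps - \<alpha> \<noteq> 0" using cn_eps cn_alpha by auto
qed

text \<open>The weight \<delta> - \<alpha> is reached from -\<delta>, \<alpha> - 3 \<delta> and 2
  \<alpha> - 5 \<delta> by adding \<open>eps\<close> once, twice and three times.\<close>

lemma xi_Nd_eps:
  assumes e: "eps \<in> \<Phi>" and k: "br (X eps) (X (- \<delta>)) = of_int k \<odot> X (\<delta> - \<alpha>)"
    and no: "2 *\<^sub>R \<alpha> - 5 *\<^sub>R \<delta> \<notin> \<Phi>" and "Y \<in> L"
  shows "xi (\<delta> - \<alpha>) (Nd eps Y) = of_int k * xi (- \<delta>) Y +
    (if \<alpha> - 3 *\<^sub>R \<delta> \<in> \<Phi> then xi (\<delta> - \<alpha>) (Nd eps (X (\<alpha> - 3 *\<^sub>R \<delta>))) * xi (\<alpha> - 3 *\<^sub>R \<delta>) Y else 0)"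
  using assms(4)
proof (induction Y rule: L_induct)
  case (X g)
  have md: "- \<delta> \<in> \<Phi>" using \<delta> by simp
  have ne: "\<alpha> - 3 *\<^sub>R \<delta> \<noteq> - \<delta>"
  proof
    assume "\<alpha> - 3 *\<^sub>R \<delta> = - \<delta>"
    then have "\<alpha> = 2 *\<^sub>R \<delta>"
      using scaleR_left_distrib[of 2 1 \<delta>] by (simp add: algebra_simps)
    then show False using alpha scaleR_root_iff[OF \<delta>(1), of 2] by simp
  qed
  have w: "xi (\<delta> - \<alpha>) (adp (X eps) j (X g)) = 0" if "g \<noteq> \<delta> - \<alpha> - of_nat j *\<^sub>R eps" for j
    using that by (intro xi_adp_0[OF e nb(1) Wt_X[OF X]]) (auto simp: algebra_simps)
  have v: "\<delta> - \<alpha> - of_nat (Suc 0) *\<^sub>R eps = - \<delta>" "\<delta> - \<alpha> - of_nat 2 *\<^sub>R eps = \<alpha> - 3 *\<^sub>R \<delta>"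
    "\<delta> - \<alpha> - of_nat 3 *\<^sub>R eps = 2 *\<^sub>R \<alpha> - 5 *\<^sub>R \<delta>"
    by (rule inner_ext, simp add: eps_def inner_simps)+
  consider "g = - \<delta>" | "g = \<alpha> - 3 *\<^sub>R \<delta>" | "g \<noteq> - \<delta>" "g \<noteq> \<alpha> - 3 *\<^sub>R \<delta>"
    by blast
  then show ?case
  proof cases
    case 1
    have "xi (\<delta> - \<alpha>) (adp (X eps) 2 (X g)) = 0" "xi (\<delta> - \<alpha>) (adp (X eps) 3 (X g)) = 0"
      using w[of 2] w[of 3] v ne no md 1 by metis+
    then show ?thesis using 1 k ne nb md by (simp add: Nd_complex[OF e L_X[OF md]] xi_X)
  next
    case 2
    then show ?thesis using X ne md by (simp add: xi_X)
  next
    case 3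
    have "xi (\<delta> - \<alpha>) (adp (X eps) (Suc 0) (X g)) = 0" "xi (\<delta> - \<alpha>) (adp (X eps) 2 (X g)) = 0"
      "xi (\<delta> - \<alpha>) (adp (X eps) 3 (X g)) = 0"
      using w[of "Suc 0"] w[of 2] w[of 3] v no 3 X by auto
    then show ?thesis using 3 X md by (simp add: Nd_complex[OF e L_X[OF X]] xi_X)
  qed
next
  case (H g)
  have "0 + of_nat j *\<^sub>R eps \<noteq> \<delta> - \<alpha>" for j :: nat
  proof
    assume "0 + of_nat j *\<^sub>R eps = \<delta> - \<alpha>"
    from arg_cong[OF this, of "\<lambda>v. cn v \<alpha>"] show False using cn_eps nb(3) by simp
  qed
  then have "xi (\<delta> - \<alpha>) (adp (X eps) j (H g)) = 0" for j
    using xi_adp_0[OF e nb(1) Wt_H[OF H]] by blast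
  from this[of "Suc 0"] this[of 2] this[of 3] show ?case
    using \<delta> H by (simp add: Nd_complex[OF e L_H[OF H]] xi_H)
qed (simp_all add: Nd_add Nd_sm algebra_simps)

end

context degree_one_pair
begin

text \<open>The coefficient is annihilated by two structure constants: by m through
  \<open>Kd \<delta>\<close> and a bracket with \<open>Xr (\<alpha> - \<delta>)\<close>, and by k
  because z commutes with the root element of \<open>eps\<close>. If \<alpha> - 3 \<delta> is not a
  root, k is a sign; otherwise |k| = 2 and |m| = 3.\<close>

lemma Y0_coeff_zero:
  assumes ceps: "eps \<in> \<Phi> \<Longrightarrow> comm eps"
    and y3: "\<alpha> - 3 *\<^sub>R \<delta> \<in> \<Phi> \<Longrightarrow> xi (\<alpha> - 3 *\<^sub>R \<delta>) Y0 = 0"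
  shows "xi (- \<delta>) Y0 = 0"
proof (cases "eps \<in> \<Phi>")
  case False
  then show ?thesis using Y0_coeff_zero_if_no_root by (simp add: eps_def)
next
  case e: True
  interpret D2: degree_one_pair \<Phi> X \<alpha> "\<alpha> - \<delta>" z
    by unfold_locales (use comm_delta in simp)
  have md: "- \<delta> \<in> \<Phi>" using \<delta> by simp
  have ed: "eps + - \<delta> = \<delta> - \<alpha>" "- \<delta> - eps = \<alpha> - 3 *\<^sub>R \<delta>" "- \<delta> - 2 *\<^sub>R eps = 2 *\<^sub>R \<alpha> - 5 *\<^sub>R \<delta>"
    by (rule inner_ext, simp add: eps_def inner_simps)+
  obtain m where m: "br (X \<delta>) (X (\<alpha> - \<delta>)) = of_int m \<odot> X \<alpha>" "\<bar>m\<bar> = int (rstr \<Phi> \<delta> (\<alpha> - \<delta>)) + 1"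
    using structure_constant[OF \<delta>(1) nb(2)] alpha by auto
  obtain k where k: "br (X eps) (X (- \<delta>)) = of_int k \<odot> X (\<delta> - \<alpha>)" "\<bar>k\<bar> = int (rstr \<Phi> eps (- \<delta>)) + 1"
    using structure_constant[OF e md] nb(1) ed(1) by auto
  let ?y = "xi (- \<delta>) Y0"
  let ?Y = "\<lambda>A. A * Xr (- \<alpha>) * adj A"
  have "of_int m * xi \<delta> (Kd \<delta> Y0) = xi \<alpha> (br (Kd \<delta> Y0) (Xr (\<alpha> - \<delta>)))"
    by (rule S_eq[of "\<lambda>A. of_int m * xi \<delta> (Kd \<delta> (?Y A))" _ "\<lambda>A. xi \<alpha> (br (Kd \<delta> (?Y A)) (Xr (\<alpha> - \<delta>)))"])
      (intro specI | unfold Xr_complex[OF nb(2)],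
        rule xi_br_X[OF _ nb(2) alpha \<delta>(1) _ m(1), symmetric], auto intro!: L_Kd \<delta> L_Y0)+
  also have "\<dots> = xi \<alpha> (Z (br (Kd \<delta> (Xr (- \<alpha>))) (Xr (\<alpha> - \<delta>))))"
    by (simp add: Z_br Z_Kd D2.Z_delta_eq)
  also have "\<dots> = 0"
    by (subst r5) (use \<delta> alpha cn_alpha in \<open>auto simp: Z_sm Z_delta_eq xi_Xr\<close>)
  finally have my: "of_int m * ?y = 0" by (simp add: t4)
  have "Nd eps Y0 = Z (Nd eps (Xr (- \<alpha>)))" by (simp add: Y0_def Z_Nd e ceps)
  also have "Nd eps (Xr (- \<alpha>)) = (0 :: ('r, 'n) sqm)"
    using eps_minus_alpha e alpha by (intro Nd_alpha_zero) auto
  finally have N0: "Nd eps Y0 = 0" by (simp add: Z_def)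
  show ?thesis
  proof (cases "\<alpha> - 3 *\<^sub>R \<delta> \<in> \<Phi>")
    case False
    have "- \<delta> \<noteq> eps" using e ed(1) nb(1) double_not_root[of eps] by (metis)
    then have "rstr \<Phi> eps (- \<delta>) = 0" using False ed by (intro rstr_eq_0[OF e md]) auto
    then have k1: "k * k = 1" using k(2) by (auto simp: abs_if split: if_splits)
    have no: "2 *\<^sub>R \<alpha> - 5 *\<^sub>R \<delta> \<notin> \<Phi>"
      using string_unbroken[OF e md \<open>- \<delta> \<noteq> eps\<close>, of 2] False ed by simp
    have "of_int k * ?y = xi (\<delta> - \<alpha>) (Nd eps Y0)"
      by (rule S_eq[of "\<lambda>A. of_int k * xi (- \<delta>) (?Y A)" _ "\<lambda>A. xi (\<delta> - \<alpha>) (Nd eps (?Y A))"])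
        (intro specI | subst xi_Nd_eps[OF e k(1) no L_Y0], assumption, simp add: False)+
    then have "of_int k * ?y = of_int k * 0" by (simp add: N0)
    then show ?thesis by (rule sign_cancel[OF k1])
  next
    case True
    note no = ratio_3_not_roots[OF True]
    have "rstr \<Phi> eps (- \<delta>) = 1" using True no ed by (intro rstr_eq_1[OF e md]) auto
    then have k2: "\<bar>k\<bar> = 2" using k(2) by simp
    have "rstr \<Phi> \<delta> (\<alpha> - \<delta>) = 2"
    proof (rule rstr_eqI[OF \<delta>(1)])
      have v: "\<alpha> - \<delta> - of_nat i *\<^sub>R \<delta> = \<alpha> - (of_nat i + 1) *\<^sub>R \<delta>" for i :: nat
        by (simp add: algebra_simps)
      show "\<alpha> - \<delta> - of_nat 2 *\<^sub>R \<delta> \<in> \<Phi>"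
        unfolding v using True by simp
      show "\<alpha> - \<delta> - of_nat i *\<^sub>R \<delta> \<notin> \<Phi>" if "2 < i" for i
        unfolding v using that by (intro no(2)) simp
    qed
    then have m3: "\<bar>m\<bar> = 3" using m(2) by simp
    let ?q = "xi (\<delta> - \<alpha>) (Nd eps (Xr (\<alpha> - 3 *\<^sub>R \<delta>)))"
    have "of_int k * ?y + ?q * xi (\<alpha> - 3 *\<^sub>R \<delta>) Y0 = xi (\<delta> - \<alpha>) (Nd eps Y0)"
      by (rule S_eq[of "\<lambda>A. of_int k * xi (- \<delta>) (?Y A) + xi (\<delta> - \<alpha>) (Nd eps (Xr (\<alpha> - 3 *\<^sub>R \<delta>))) * xi (\<alpha> - 3 *\<^sub>R \<delta>) (?Y A)"
            _ "\<lambda>A. xi (\<delta> - \<alpha>) (Nd eps (?Y A))"])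
        (intro specI | subst xi_Nd_eps[OF e k(1) no(1) L_Y0], assumption, simp add: True Xr_complex)+
    then have ky: "of_int k * ?y = 0" by (simp add: N0 y3[OF True])
    \<comment> \<open>The annihilators 3 and 2 are coprime: their difference is 1.\<close>
    have "of_int (m * sgn m - k * sgn k) * ?y = 0"
      using ky my by (simp add: algebra_simps) (simp flip: mult.assoc add: mult.commute[of "of_int (sgn _)"])
    also have "m * sgn m - k * sgn k = 1" using k2 m3 by (simp add: abs_sgn)
    finally show ?thesis by simp
  qed
qed

end

context long_point
begin

text \<open>The coefficient at \<alpha> - 3 d that \<open>Y0_coeff_zero\<close> asks for belongs to
  the degree 1 root 3 d - \<alpha>. Twice this root minus \<alpha> is longer than \<alpha>, so the
  simpler criterion applies to it.\<close>

lemma Y0_degree_minus_one_zero: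
  assumes comm: "\<And>g. g \<in> \<Phi> \<Longrightarrow> cn g \<alpha> \<ge> 0 \<Longrightarrow> comm g"
    and d: "d \<in> \<Phi>" "cn d \<alpha> = 1"
  shows "c0 = 1" "xi (- d) Y0 = 0"
proof -
  have pair: "degree_one_pair \<Phi> X \<alpha> \<eta> z" if "\<eta> \<in> \<Phi>" "cn \<eta> \<alpha> = 1" for \<eta>
    using that alpha cn_alpha grade_1_roots[OF that] by unfold_locales (auto intro!: comm)
  interpret D: degree_one_pair \<Phi> X \<alpha> d z by (rule pair[OF d])
  show "c0 = 1" by (rule D.c0_eq_1)
  show "xi (- d) Y0 = 0"
  proof (rule D.Y0_coeff_zero)
    show "comm D.eps" if "D.eps \<in> \<Phi>" using that D.cn_eps by (intro comm) auto
    assume r: "\<alpha> - 3 *\<^sub>R d \<in> \<Phi>"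
    then have n: "3 *\<^sub>R d - \<alpha> \<in> \<Phi>" "cn (3 *\<^sub>R d - \<alpha>) \<alpha> = 1"
      using neg_root_iff[of "\<alpha> - 3 *\<^sub>R d"] d cn_alpha by auto
    interpret N: degree_one_pair \<Phi> X \<alpha> "3 *\<^sub>R d - \<alpha>" z by (rule pair[OF n])
    have "2 *\<^sub>R (3 *\<^sub>R d - \<alpha>) - \<alpha> \<notin> \<Phi>"
    proof
      assume h: "2 *\<^sub>R (3 *\<^sub>R d - \<alpha>) - \<alpha> \<in> \<Phi>"
      have v: "2 *\<^sub>R (3 *\<^sub>R d - \<alpha>) - \<alpha> = 3 *\<^sub>R \<alpha> - 6 *\<^sub>R (\<alpha> - d)"
        using scaleR_left_diff_distrib[of 6 3 \<alpha>] scaleR_left_distrib[of 2 1 \<alpha>] by (simp add: algebra_simps)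
      have "(2 *\<^sub>R (3 *\<^sub>R d - \<alpha>) - \<alpha>) \<bullet> (2 *\<^sub>R (3 *\<^sub>R d - \<alpha>) - \<alpha>) = 9 * (\<alpha> \<bullet> \<alpha>) - 36 * (\<alpha> \<bullet> d) + 36 * (d \<bullet> d)"
        by (simp add: inner_diff_left inner_diff_right inner_commute algebra_simps)
      then show False
        using alpha_max[OF h] D.ratio_3[OF r] D.inner_alpha_delta inner_pos[OF d(1)] by simp
    qed
    from N.Y0_coeff_zero_if_no_root[OF this] show "xi (\<alpha> - 3 *\<^sub>R d) Y0 = 0" by simp
  qed
qed

end

lemma prod_list_inverse:
  fixes f g :: "'a \<Rightarrow> 'b::monoid_mult"
  assumes "\<And>x. x \<in> set xs \<Longrightarrow> f x * g x = 1"
  shows "prod_list (map f xs) * prod_list (map g (rev xs)) = 1"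
  using assms
proof (induction xs)
  case (Cons x xs)
  have "prod_list (map f (x # xs)) * prod_list (map g (rev (x # xs)))
      = f x * (prod_list (map f xs) * prod_list (map g (rev xs))) * g x" by (simp add: mult.assoc)
  then show ?case using Cons by simp
qed simp

section \<open>Conjugates of long root elements\<close>

lemma conj_br:
  fixes A :: "(complex, 'n::finite) sqm"
  assumes b: "B * A = 1"
  shows "A * br Y W * B = br (A * Y * B) (A * W * B)"
proof -
  have "A * Y * B * (A * W * B) = A * Y * (B * A) * W * B" for Y W by (simp add: mult.assoc)
  then show ?thesis unfolding b by (simp add: br_def algebra_simps)
qed

context long_root
begin

text \<open>Extremal elements of a Lie algebra: the square of ad Y maps the algebra into the line of
  Y. The condition is invariant under conjugation, so it holds for every conjugate of
  \<open>X (- \<alpha>)\<close> by \<open>EC\<close>.\<close>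

definition extremal :: "(complex, 'n) sqm \<Rightarrow> bool" where
  "extremal Y \<longleftrightarrow> Y \<in> L \<and> (\<forall>W\<in>L. \<exists>k. br Y (br Y W) = k \<odot> Y)"

lemma extremal_X: "extremal (X (- \<alpha>))"
  unfolding extremal_def
proof (intro conjI ballI)
  have ma: "- \<alpha> \<in> \<Phi>" using alpha by simp
  show "X (- \<alpha>) \<in> L" by (rule L_X[OF ma])
  fix W assume "W \<in> L"
  then show "\<exists>k. br (X (- \<alpha>)) (br (X (- \<alpha>)) W) = k \<odot> X (- \<alpha>)"
  proof (induction W rule: L_induct)
    case (X g)
    let ?B = "br (X (- \<alpha>)) (br (X (- \<alpha>)) (X g))"
    define \<mu> where "\<mu> = - \<alpha> + (- \<alpha> + g)"
    have B: "?B \<in> L" "?B \<in> Wt \<mu>"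
      unfolding \<mu>_def by (intro L_br_X L_X ma X, intro Wt_br_X Wt_X ma X)
    show ?case
    proof (cases "g = \<alpha>")
      case True
      then have "\<mu> = - \<alpha>" by (simp add: \<mu>_def)
      then show ?thesis using L_Wt_root[OF B] ma by simp
    next
      case False
      then have "cn g \<alpha> \<le> 1" using X by (elim grade_cases) auto
      then have "cn \<mu> \<alpha> < -2" using cn_alpha by (simp add: \<mu>_def)
      then have "\<mu> \<notin> \<Phi>" "\<mu> \<noteq> 0" using grade_ge[of \<mu>] by auto
      then have "?B = 0" by (rule L_Wt_zero[OF B])
      then show ?thesis by (intro exI[of _ 0]) simp
    qed
  next
    case (H g)
    then show ?case by (intro exI[of _ 0]) (simp add: br_X_H alpha)
  next
    case (add Y Z)
    then obtain k l where "br (X (- \<alpha>)) (br (X (- \<alpha>)) Y) = k \<odot> X (- \<alpha>)"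
      "br (X (- \<alpha>)) (br (X (- \<alpha>)) Z) = l \<odot> X (- \<alpha>)" by blast
    then show ?case by (intro exI[of _ "k + l"]) (simp add: br_simps sm_simps)
  next
    case (sm c Y)
    then obtain k where "br (X (- \<alpha>)) (br (X (- \<alpha>)) Y) = k \<odot> X (- \<alpha>)"
      by blast
    then show ?case by (intro exI[of _ "c * k"]) simp
  qed
qed

lemma adj_adj_EC: "A \<in> EC \<Longrightarrow> adj (adj A) = A"
  by (metis EC_adj_EC EC_inverse left_right_inverse_unique)

lemma extremal_conj:
  assumes "A \<in> EC" "extremal Y"
  shows "extremal (A * Y * adj A)"
  unfolding extremal_def
proof (intro conjI ballI)
  show "A * Y * adj A \<in> L" using assms EC_conj_L by (simp add: extremal_def)
  fix W assume W: "W \<in> L"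
  let ?W = "adj A * W * A"
  have "adj A * W * adj (adj A) \<in> L" by (intro EC_conj_L EC_adj_EC assms W)
  then have "?W \<in> L" by (simp add: adj_adj_EC assms)
  then obtain k where k: "br Y (br Y ?W) = k \<odot> Y" using assms(2) unfolding extremal_def by blast
  have "A * ?W * adj A = A * adj A * W * (A * adj A)" by (simp add: mult.assoc)
  then have "W = A * ?W * adj A" by (simp add: EC_inverse assms)
  then have "br (A * Y * adj A) (br (A * Y * adj A) W) = A * br Y (br Y ?W) * adj A"
    using conj_br[OF EC_inverse(2)[OF assms(1)]] by metis
  then show "\<exists>k. br (A * Y * adj A) (br (A * Y * adj A) W) = k \<odot> (A * Y * adj A)"
    by (auto simp: k)
qed

definition normal_form :: "complex \<Rightarrow> complex \<Rightarrow> (complex, 'n) sqm" where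
  "normal_form c b = xx \<alpha> b * (c \<odot> X (- \<alpha>)) * xx \<alpha> (- b)"

lemma conj_complex:
  assumes "g \<in> \<Phi>" "Y \<in> L"
  shows "xx g t * Y * xx g (- t) = Y + t \<odot> br (X g) Y + t\<^sup>2 \<odot> adp (X g) 2 Y + t ^ 3 \<odot> adp (X g) 3 Y"
  using L_conj[OF assms, of t] assms(1) by (simp add: xx_complex eval_nat_numeral algebra_simps)

lemma normal_form_eq: "normal_form c b = c \<odot> X (- \<alpha>) + (b * c) \<odot> H \<alpha> - (b\<^sup>2 * c) \<odot> X \<alpha>"
proof -
  have "X (- \<alpha>) \<in> L" using L_X alpha by simp
  then have "normal_form c b = c \<odot> (X (- \<alpha>) + b \<odot> br (X \<alpha>) (X (- \<alpha>)) + b\<^sup>2 \<odot> adp (X \<alpha>) 2 (X (- \<alpha>))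
      + b ^ 3 \<odot> adp (X \<alpha>) 3 (X (- \<alpha>)))"
    unfolding normal_form_def by (simp flip: conj_complex[OF alpha])
  then show ?thesis by (simp add: adp_X_neg[OF alpha] br_X_neg sm_simps mult_ac)
qed

text \<open>The hypotheses reduce [Y, X \<alpha>] to -c H \<alpha>. A second bracket with Y
  multiplies each root coefficient by c times its degree and has no Cartan part. It also equals k Y;
  degree -2 gives k = -2 c, and comparing the rest leaves nothing but the leading term.\<close>

lemma extremal_normal_form_0:
  assumes "extremal Y" "xi (- \<alpha>) Y = c" "c \<noteq> 0"
    and deg: "\<And>g. g \<in> \<Phi> \<Longrightarrow> cn g \<alpha> = -1 \<Longrightarrow> xi g Y = 0"
    and tau: "xi \<alpha> (br Y (X \<alpha>)) = 0"
  shows "Y = c \<odot> X (- \<alpha>)"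
proof -
  have YL: "Y \<in> L" using assms(1) by (simp add: extremal_def)
  have ma: "- \<alpha> \<in> \<Phi>" "\<alpha> \<noteq> - \<alpha>"
    using alpha cn_alpha cn_minus[of \<alpha> \<alpha>] by force+
  obtain b where b: "Y = (\<Sum>g\<in>\<Phi>. xi g Y \<odot> X g) + (\<Sum>g\<in>\<Phi>. b g \<odot> H g)"
    using L_expand[OF YL] by blast
  define h where "h = (\<Sum>g\<in>\<Phi>. b g \<odot> H g)"
  have hX: "br h (X g) = (\<Sum>\<eta>\<in>\<Phi>. b \<eta> * of_real (cn g \<eta>)) \<odot> X g" if "g \<in> \<Phi>" for g
    using that by (simp add: h_def br_sum_left br_H_X sm_sum_left)
  have hH: "br h (H \<alpha>) = 0" by (simp add: h_def br_sum_left br_H_H alpha)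
  have xh: "xi g h = 0" if "g \<in> \<Phi>" for g using that by (simp add: h_def xi_sum xi_H)
  have term0: "xi g Y \<odot> br (X g) (X \<alpha>) = (if g = - \<alpha> then - (c \<odot> H \<alpha>) else 0)" if g: "g \<in> \<Phi>" for g
  proof (cases "cn g \<alpha> \<ge> 0")
    case True
    have "cn (g + \<alpha>) \<alpha> \<ge> 2" using True cn_alpha by simp
    moreover have "g + \<alpha> \<noteq> \<alpha>" using g by auto
    ultimately have "g + \<alpha> \<notin> \<Phi>" "g + \<alpha> \<noteq> 0"
      using grade_2[of "g + \<alpha>"] by force+
    moreover have "g \<noteq> - \<alpha>" using True cn_alpha by auto
    ultimately show ?thesis using XX_zero[OF g alpha] by simp
  next
    case False
    then consider "g = - \<alpha>" | "cn g \<alpha> = -1" using long_cn[OF long g] cn_alpha by force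
    then show ?thesis using cn_alpha deg[OF g] assms(2) by cases (auto simp: br_X_neg')
  qed
  have "br Y (X \<alpha>) = (\<Sum>g\<in>\<Phi>. xi g Y \<odot> br (X g) (X \<alpha>)) + br h (X \<alpha>)"
    by (subst b) (simp add: br_simps br_sum_left h_def)
  also have "(\<Sum>g\<in>\<Phi>. xi g Y \<odot> br (X g) (X \<alpha>)) = - (c \<odot> H \<alpha>)"
    using ma(1) finite_roots by (simp add: term0 cong: sum.cong)
  finally have P0: "br Y (X \<alpha>) = - (c \<odot> H \<alpha>) + br h (X \<alpha>)" .
  then have "br h (X \<alpha>) = 0" using tau by (simp add: hX alpha xi_X xi_H)
  with P0 have P: "br Y (X \<alpha>) = - (c \<odot> H \<alpha>)" by simp
  have "br (H \<alpha>) Y = (\<Sum>g\<in>\<Phi>. (xi g Y * of_real (cn g \<alpha>)) \<odot> X g)"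
  proof -
    have "br (H \<alpha>) h = 0" using hH br_swap[of "H \<alpha>" h] by simp
    then show ?thesis by (subst b) (simp add: br_simps br_sum_right br_H_X alpha flip: h_def)
  qed
  moreover have "br Y (H \<alpha>) = - br (H \<alpha>) Y" by (rule br_swap)
  ultimately have PP: "br Y (br Y (X \<alpha>)) = (\<Sum>g\<in>\<Phi>. (c * xi g Y * of_real (cn g \<alpha>)) \<odot> X g)"
    unfolding P by (simp add: sm_sum_right mult.assoc)
  obtain k where k: "br Y (br Y (X \<alpha>)) = k \<odot> Y"
    using assms(1) L_X[OF alpha] unfolding extremal_def by blast
  have eq: "c * xi g Y * of_real (cn g \<alpha>) = k * xi g Y" if "g \<in> \<Phi>" for g
  proof -
    have "xi g (\<Sum>\<eta>\<in>\<Phi>. (c * xi \<eta> Y * of_real (cn \<eta> \<alpha>)) \<odot> X \<eta>)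
        = (\<Sum>\<eta>\<in>\<Phi>. if \<eta> = g then c * xi \<eta> Y * of_real (cn \<eta> \<alpha>) else 0)"
      unfolding xi_sum by (rule sum.cong) (use that in \<open>auto simp: xi_X\<close>)
    also have "\<dots> = c * xi g Y * of_real (cn g \<alpha>)" using that finite_roots by simp
    finally have "xi g (\<Sum>\<eta>\<in>\<Phi>. (c * xi \<eta> Y * of_real (cn \<eta> \<alpha>)) \<odot> X \<eta>) = c * xi g Y * of_real (cn g \<alpha>)" .
    then show ?thesis using arg_cong[OF k, of "xi g"] unfolding PP xi_sm by (simp only:)
  qed
  have "(c * -2) * c = k * c" using eq[OF ma(1)] assms(2) cn_alpha by (simp add: mult_ac)
  then have "c * -2 = k" using assms(3) mult_right_cancel by blast
  then have km: "k = -2 * c" by (simp add: mult.commute)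
  have "xi g Y = (if g = - \<alpha> then c else 0)" if "g \<in> \<Phi>" for g
  proof (cases "g = - \<alpha>")
    case False
    then have "cn g \<alpha> \<noteq> -2" using that cn_alpha by (elim grade_cases) auto
    then have "complex_of_real (cn g \<alpha>) \<noteq> -2"
      by (metis of_real_eq_iff of_real_minus of_real_numeral)
    moreover have "c * (of_real (cn g \<alpha>) + 2) * xi g Y = 0"
      using eq[OF that] km by (simp add: algebra_simps)
    ultimately show ?thesis using False assms(3) by (simp add: add_eq_0_iff2)
  qed (simp add: assms(2))
  then have s: "(\<Sum>g\<in>\<Phi>. xi g Y \<odot> X g) = c \<odot> X (- \<alpha>)"
    using ma(1) finite_roots by (simp add: if_distrib[of "\<lambda>c. c \<odot> _"] cong: sum.cong if_cong)
  have "(\<Sum>g\<in>\<Phi>. (c * xi g Y * of_real (cn g \<alpha>)) \<odot> X g) = (\<Sum>g\<in>\<Phi>. k \<odot> (xi g Y \<odot> X g))"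
    by (rule sum.cong) (simp_all add: eq)
  then have "k \<odot> Y = k \<odot> (\<Sum>g\<in>\<Phi>. xi g Y \<odot> X g)"
    using k PP by (simp add: sm_sum_right)
  then show ?thesis unfolding s using sm_cancel[of k Y] km assms(3) by simp
qed

text \<open>Conjugation by x_\<alpha>(-b) reduces to the previous case. Inside the proof b has the
  denominator 2 c, but in the statement it is read off at a root of degree 1, where
  [H \<alpha>, X g0] = X g0 and no 2 occurs; this form specializes in characteristic 2 as
  well.\<close>

lemma extremal_normal_form:
  assumes "extremal Y" "xi (- \<alpha>) Y = c" "c \<noteq> 0"
    and deg: "\<And>g. g \<in> \<Phi> \<Longrightarrow> cn g \<alpha> = -1 \<Longrightarrow> xi g Y = 0"
    and g0: "g0 \<in> \<Phi>" "cn g0 \<alpha> = 1"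
  shows "Y = normal_form c (xi g0 (br Y (X g0)) / c)"
proof -
  have YL: "Y \<in> L" using assms(1) by (simp add: extremal_def)
  have ma: "- \<alpha> \<in> \<Phi>" using alpha by simp
  define b where "b = xi \<alpha> (br Y (X \<alpha>)) / (2 * c)"
  let ?Y = "xx \<alpha> (- b) * Y * xx \<alpha> b"
  have adjx: "adj (xx \<alpha> (- b)) = xx \<alpha> b"
    using left_right_inverse_unique[OF EC_inverse(1)[OF EC_xx[OF alpha, of "- b"]] xx_inverse(1)[OF alpha, of b]]
    by simp
  have e: "extremal ?Y" using extremal_conj[OF EC_xx[OF alpha] assms(1), of "- b"] by (simp add: adjx)
  have Yc: "?Y = Y + (- b) \<odot> br (X \<alpha>) Y + (- b)\<^sup>2 \<odot> adp (X \<alpha>) 2 Y + (- b) ^ 3 \<odot> adp (X \<alpha>) 3 Y"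
    using conj_complex[OF alpha YL, of "- b"] by simp
  have F0: "br (X \<alpha>) Y \<in> F \<alpha> 0" "adp (X \<alpha>) 2 Y \<in> F \<alpha> 0" "adp (X \<alpha>) 3 Y \<in> F \<alpha> 0"
    using cn_alpha by (auto intro!: F_br[OF alpha L_F[OF YL]] F_adp[OF alpha L_F[OF YL]])
  have x1: "xi g ?Y = xi g Y" if "g \<in> \<Phi>" "cn g \<alpha> < 0" for g
    unfolding Yc using F0[THEN xi_F, OF that] by simp
  have "?Y = c \<odot> X (- \<alpha>)"
  proof (rule extremal_normal_form_0[OF e _ assms(3)])
    show "xi (- \<alpha>) ?Y = c" using x1[OF ma] cn_alpha assms(2) by simp
    show "xi g ?Y = 0" if "g \<in> \<Phi>" "cn g \<alpha> = -1" for g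
      using x1[of g] deg that by simp
    have brx: "br ?Y (X \<alpha>) = xx \<alpha> (- b) * br Y (X \<alpha>) * xx \<alpha> b"
    proof -
      have "cexp (X \<alpha>) (- b) * X \<alpha> = X \<alpha> * cexp (X \<alpha>) (- b)"
        using cexp_mult_right[OF nilp_X[OF alpha], of 1 "X \<alpha>" "- b"] by simp
      then have "xx \<alpha> (- b) * X \<alpha> * xx \<alpha> b = X \<alpha> * (xx \<alpha> (- b) * xx \<alpha> b)"
        by (simp add: xx_complex alpha mult.assoc)
      then have fix_X: "xx \<alpha> (- b) * X \<alpha> * xx \<alpha> b = X \<alpha>"
        using xx_inverse(2)[OF alpha, of b] by simp
      show ?thesis using conj_br[OF xx_inverse(1)[OF alpha, of b], of Y "X \<alpha>"] fix_X by simp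
    qed
    let ?W = "br Y (X \<alpha>)"
    have WL: "?W \<in> L" by (rule L_br_X_right[OF alpha YL])
    have WF: "?W \<in> F \<alpha> 0" by (subst br_swap) (use F_sm[OF F0(1), of "-1"] in simp)
    have "xi \<alpha> (br (X \<alpha>) ?W) = 2 * c"
    proof -
      obtain Y' where Y': "Y' \<in> F \<alpha> (-1)" "Y = c \<odot> X (- \<alpha>) + Y'"
        using L_split[OF YL] assms(2) by blast
      have "br (X \<alpha>) (br (X \<alpha>) Y') \<in> F \<alpha> 3"
        using cn_alpha by (intro F_br[OF alpha F_br[OF alpha Y'(1)]]) auto
      then have "br (X \<alpha>) (br (X \<alpha>) Y') = 0" by (rule F_above) simp
      then have "br (X \<alpha>) (br (X \<alpha>) Y) = - ((2 * c) \<odot> X \<alpha>)"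
        by (subst Y'(2)) (simp add: br_simps br_X_neg br_X_H alpha cn_alpha mult.commute)
      then show ?thesis by (subst br_swap[of Y]) (simp add: xi_X alpha)
    qed
    moreover have "adp (X \<alpha>) 2 ?W \<in> F \<alpha> 3" "adp (X \<alpha>) 3 ?W \<in> F \<alpha> 3"
      using cn_alpha by (auto intro!: F_adp[OF alpha WF])
    then have "adp (X \<alpha>) 2 ?W = 0" "adp (X \<alpha>) 3 ?W = 0" by (auto intro: F_above)
    ultimately show "xi \<alpha> (br ?Y (X \<alpha>)) = 0"
      unfolding brx using conj_complex[OF alpha WL, of "- b"] assms(3) by (simp add: b_def)
  qed
  then have "xx \<alpha> b * ?Y * xx \<alpha> (- b) = normal_form c b"
    by (simp add: normal_form_def)
  moreover have "xx \<alpha> b * ?Y * xx \<alpha> (- b) = (xx \<alpha> b * xx \<alpha> (- b)) * Y * (xx \<alpha> b * xx \<alpha> (- b))"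
    by (simp add: mult.assoc)
  ultimately have Yb: "Y = normal_form c b" by (simp add: xx_inverse[OF alpha])
  have "xi g0 (br Y (X g0)) = b * c"
  proof -
    have "xi g0 (br (X (- \<alpha>)) (X g0)) = 0" "xi g0 (br (X \<alpha>) (X g0)) = 0"
      using xi_Wt[OF g0(1) Wt_br_X[OF _ Wt_X[OF g0(1)]]] alpha root_nz[OF alpha] by auto
    then show ?thesis unfolding Yb normal_form_eq by (simp add: br_simps br_H_X alpha g0 xi_X)
  qed
  then show ?thesis using Yb assms(3) by simp
qed

section \<open>Clearing the terms of degree -1\<close>

definition deg1 :: "'e list" where
  "deg1 = (SOME xs. set xs = {g \<in> \<Phi>. cn g \<alpha> = 1} \<and> distinct xs)"

lemma deg1: "set deg1 = {g \<in> \<Phi>. cn g \<alpha> = 1}" "distinct deg1"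
proof -
  have "\<exists>xs. set xs = {g \<in> \<Phi>. cn g \<alpha> = 1} \<and> distinct xs"
    using finite_distinct_list[of "{g \<in> \<Phi>. cn g \<alpha> = 1}"] finite_roots by simp
  from someI_ex[OF this] show "set deg1 = {g \<in> \<Phi>. cn g \<alpha> = 1}" "distinct deg1"
    unfolding deg1_def by auto
qed

definition Up :: "('e \<Rightarrow> 'a::comm_ring_1) \<Rightarrow> 'e list \<Rightarrow> ('a, 'n) sqm" where
  "Up s xs = prod_list (map (\<lambda>g. xx g (s g)) xs)"

definition Um :: "('e \<Rightarrow> 'a::comm_ring_1) \<Rightarrow> 'e list \<Rightarrow> ('a, 'n) sqm" where
  "Um s xs = prod_list (map (\<lambda>g. xx g (- s g)) (rev xs))"

lemma Up_zero: "(\<And>g. g \<in> set xs \<Longrightarrow> s g = 0) \<Longrightarrow> Up s xs = 1"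
  and Um_zero: "(\<And>g. g \<in> set xs \<Longrightarrow> s g = 0) \<Longrightarrow> Um s xs = 1"
  unfolding Up_def Um_def by (induction xs) auto

lemma Up_Um: "set xs \<subseteq> \<Phi> \<Longrightarrow> Up s xs * Um s xs = 1"
  unfolding Up_def Um_def by (intro prod_list_inverse xx_inverse(1)) auto

lemma Um_Up: "set xs \<subseteq> \<Phi> \<Longrightarrow> Um s xs * Up s xs = 1"
  unfolding Up_def Um_def
  using prod_list_inverse[of "rev xs" "\<lambda>g. xx g (- s g)" "\<lambda>g. xx g (s g)"] xx_inverse(2) by auto

lemma Up_EC: "set xs \<subseteq> \<Phi> \<Longrightarrow> Up s xs \<in> EC"
  unfolding Up_def by (induction xs) (auto intro: EC_one EC_mult EC_xx)

lemma Um_EC: "set xs \<subseteq> \<Phi> \<Longrightarrow> Um s xs \<in> EC"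
  unfolding Um_def by (induction xs) (auto intro: EC_one EC_mult EC_xx)

text \<open>The factor of g carries the leading term to the weight g - \<alpha> and all other terms
  of \<open>Y\<close> to degree at least 0, so each coefficient of degree -1 is changed by its own
  factor only.\<close>

lemma Um_conj_coeffs:
  assumes "set xs \<subseteq> {g \<in> \<Phi>. cn g \<alpha> = 1}" "distinct xs" "Y \<in> L"
  shows "Um s xs * Y * Up s xs \<in> L \<and> xi (- \<alpha>) (Um s xs * Y * Up s xs) = xi (- \<alpha>) Y \<and>
    (\<forall>\<eta>\<in>\<Phi>. cn \<eta> \<alpha> = 1 \<longrightarrow> xi (\<eta> - \<alpha>) (Um s xs * Y * Up s xs)
      = xi (\<eta> - \<alpha>) Y - (if \<eta> \<in> set xs then s \<eta> * of_int (kap \<eta>) * xi (- \<alpha>) Y else 0))"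
  using assms
proof (induction xs arbitrary: Y)
  case Nil
  then show ?case by (simp add: Um_def Up_def)
next
  case (Cons g xs)
  have g: "g \<in> \<Phi>" "cn g \<alpha> = 1" using Cons.prems by auto
  have ma: "- \<alpha> \<in> \<Phi>" using alpha by simp
  let ?Y = "xx g (- s g) * Y * xx g (s g)"
  have Yc: "?Y = Y + (- s g) \<odot> br (X g) Y + (- s g)\<^sup>2 \<odot> adp (X g) 2 Y + (- s g) ^ 3 \<odot> adp (X g) 3 Y"
    using conj_complex[OF g(1) Cons.prems(3), of "- s g"] by simp
  have YL: "?Y \<in> L" unfolding Yc by (intro L_add L_sm L_br_X L_adp g Cons.prems)
  have F: "br (X g) Y \<in> F \<alpha> (-1)" "adp (X g) 2 Y \<in> F \<alpha> 0" "adp (X g) 3 Y \<in> F \<alpha> 0"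
    using g(2) by (auto intro!: F_br[OF g(1) L_F[OF Cons.prems(3)]] F_adp[OF g(1) L_F[OF Cons.prems(3)]])
  have x1: "xi (- \<alpha>) ?Y = xi (- \<alpha>) Y"
    unfolding Yc using F(1)[THEN xi_F, OF ma] F(2,3)[THEN xi_F, OF ma] cn_alpha by simp
  have x2: "xi (\<eta> - \<alpha>) ?Y = xi (\<eta> - \<alpha>) Y - (if \<eta> = g then s \<eta> * of_int (kap \<eta>) * xi (- \<alpha>) Y else 0)"
    if e: "\<eta> \<in> \<Phi>" "cn \<eta> \<alpha> = 1" for \<eta>
  proof -
    note ne = grade_1_roots[OF e]
    have "xi (\<eta> - \<alpha>) (br (X g) Y) = (if \<eta> = g then of_int (kap \<eta>) * xi (- \<alpha>) Y else 0)"
    proof (cases "\<eta> = g")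
      case True
      then show ?thesis using xi_br_delta[OF e Cons.prems(3)] by simp
    next
      case False
      obtain Y' where Y': "Y' \<in> F \<alpha> (-1)" "Y = xi (- \<alpha>) Y \<odot> X (- \<alpha>) + Y'"
        using L_split[OF Cons.prems(3)] by blast
      have "br (X g) Y' \<in> F \<alpha> 0" using g(2) by (intro F_br[OF g(1) Y'(1)]) auto
      then have z: "xi (\<eta> - \<alpha>) (br (X g) Y') = 0" using ne by (intro xi_F) auto
      have "xi (\<eta> - \<alpha>) (br (X g) (X (- \<alpha>))) = 0"
        using False grade_1_roots[OF g] ne by (simp add: kap[OF g] xi_X)
      then have "xi (\<eta> - \<alpha>) (br (X g) Y) = 0"
        using z by (subst Y'(2)) (simp add: br_simps)
      then show ?thesis using False by simp
    qed
    then show ?thesis unfolding Yc using F(2,3)[THEN xi_F, OF ne(1)] ne by simp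
  qed
  have split: "Um s (g # xs) * Y * Up s (g # xs) = Um s xs * ?Y * Up s xs"
    by (simp add: Um_def Up_def mult.assoc)
  show ?case unfolding split using Cons.IH[OF _ _ YL] Cons.prems x1 x2 by auto
qed

text \<open>The parameter that clears the coefficient at g - \<alpha>; the sign \<open>kap g\<close>
  is its own inverse.\<close>

definition scoef :: "('a::comm_ring_1, 'n) sqm \<Rightarrow> 'a \<Rightarrow> 'e \<Rightarrow> 'a" where
  "scoef Y c' g = of_int (kap g) * xi (g - \<alpha>) Y * c'"

text \<open>The parameter \<open>c'\<close> stands for the inverse of the leading coefficient.\<close>

definition bcoef :: "'e \<Rightarrow> ('a::comm_ring_1, 'n) sqm \<Rightarrow> 'a \<Rightarrow> 'a" where
  "bcoef g0 Y c' = xi g0 (br (Um (scoef Y c') deg1 * Y * Up (scoef Y c') deg1) (Xr g0)) * c'"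

definition Vp :: "'e \<Rightarrow> ('a::comm_ring_1, 'n) sqm \<Rightarrow> 'a \<Rightarrow> ('a, 'n) sqm" where
  "Vp g0 Y c' = Up (scoef Y c') deg1 * xx \<alpha> (bcoef g0 Y c')"

definition Vm :: "'e \<Rightarrow> ('a::comm_ring_1, 'n) sqm \<Rightarrow> 'a \<Rightarrow> ('a, 'n) sqm" where
  "Vm g0 Y c' = xx \<alpha> (- bcoef g0 Y c') * Um (scoef Y c') deg1"

lemma deg1_sub: "set deg1 \<subseteq> \<Phi>"
  using deg1 by auto

lemma Vp_Vm: "Vp g0 Y c' * Vm g0 Y c' = 1"
proof -
  let ?s = "scoef Y c'"
  have "Vp g0 Y c' * Vm g0 Y c' = Up ?s deg1 * (xx \<alpha> (bcoef g0 Y c') * xx \<alpha> (- bcoef g0 Y c')) * Um ?s deg1"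
    by (simp add: Vp_def Vm_def mult.assoc)
  then show ?thesis by (simp add: xx_inverse alpha Up_Um deg1_sub)
qed

lemma Vm_Vp: "Vm g0 Y c' * Vp g0 Y c' = 1"
proof -
  let ?s = "scoef Y c'"
  have "Vm g0 Y c' * Vp g0 Y c' = xx \<alpha> (- bcoef g0 Y c') * (Um ?s deg1 * Up ?s deg1) * xx \<alpha> (bcoef g0 Y c')"
    by (simp add: Vp_def Vm_def mult.assoc)
  then show ?thesis by (simp add: xx_inverse alpha Um_Up deg1_sub)
qed

lemma Vm_EC: "Vm g0 Y c' \<in> EC" and Vp_EC: "Vp g0 Y c' \<in> EC"
  unfolding Vm_def Vp_def by (intro EC_mult EC_xx Um_EC Up_EC deg1_sub alpha)+

text \<open>The conjugating element is explicit, with parameters that are integer polynomials in the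
  entries of \<open>Y\<close> and the inverse of its leading coefficient. Mere existence could not
  be specialized.\<close>

lemma extremal_eq_conj:
  assumes "extremal Y" "xi (- \<alpha>) Y \<noteq> 0" "g0 \<in> \<Phi>" "cn g0 \<alpha> = 1"
  shows "Y = xi (- \<alpha>) Y \<odot> (Vp g0 Y (inverse (xi (- \<alpha>) Y)) * X (- \<alpha>) * Vm g0 Y (inverse (xi (- \<alpha>) Y)))"
proof -
  have YL: "Y \<in> L" using assms(1) by (simp add: extremal_def)
  define c where "c = xi (- \<alpha>) Y"
  define s where "s = scoef Y (inverse c)"
  let ?Y = "Um s deg1 * Y * Up s deg1"
  have co: "xi (- \<alpha>) ?Y = c" "\<And>\<eta>. \<eta> \<in> \<Phi> \<Longrightarrow> cn \<eta> \<alpha> = 1 \<Longrightarrow> xi (\<eta> - \<alpha>) ?Y = xi (\<eta> - \<alpha>) Y - s \<eta> * of_int (kap \<eta>) * c"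
    using Um_conj_coeffs[OF _ deg1(2) YL, of s] by (auto simp: deg1(1) c_def)
  have "adj (Um s deg1) = Up s deg1"
    by (rule left_right_inverse_unique[OF EC_inverse(1)[OF Um_EC[OF deg1_sub]] Up_Um[OF deg1_sub]])
  then have e: "extremal ?Y" using extremal_conj[OF Um_EC[OF deg1_sub] assms(1), of s] by simp
  have deg: "xi g ?Y = 0" if "g \<in> \<Phi>" "cn g \<alpha> = -1" for g
  proof -
    have "rfl \<alpha> g = g + \<alpha>" using that by (simp add: rfl_def)
    then have n: "g + \<alpha> \<in> \<Phi>" "cn (g + \<alpha>) \<alpha> = 1"
      using rfl_root[OF that(1) alpha] that cn_alpha by simp_all
    have kk: "of_int (kap (g + \<alpha>)) * of_int (kap (g + \<alpha>)) = (1 :: complex)"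
      using kap(2)[OF n] by (metis of_int_1 of_int_mult)
    have "s (g + \<alpha>) * of_int (kap (g + \<alpha>)) * c = (of_int (kap (g + \<alpha>)) * of_int (kap (g + \<alpha>))) * xi g Y"
      using assms(2) by (simp add: s_def scoef_def c_def)
    then show ?thesis using co(2)[OF n] kk by simp
  qed
  define b where "b = bcoef g0 Y (inverse c)"
  have bq: "xi g0 (br ?Y (X g0)) / c = b"
    by (simp add: b_def bcoef_def s_def Xr_complex[OF assms(3)] divide_inverse)
  have "?Y = normal_form c b" unfolding bq[symmetric] using assms(2)
    by (intro extremal_normal_form[OF e co(1) _ deg assms(3,4)]) (simp_all add: c_def)
  then have "Up s deg1 * ?Y * Um s deg1 = Up s deg1 * normal_form c b * Um s deg1" by simp
  moreover have "Up s deg1 * ?Y * Um s deg1 = (Up s deg1 * Um s deg1) * Y * (Up s deg1 * Um s deg1)"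
    by (simp add: mult.assoc)
  ultimately have "Y = Up s deg1 * normal_form c b * Um s deg1" by (simp add: Up_Um deg1_sub)
  also have "\<dots> = c \<odot> (Up s deg1 * xx \<alpha> b * X (- \<alpha>) * (xx \<alpha> (- b) * Um s deg1))"
    by (simp add: normal_form_def mult.assoc)
  also have "Up s deg1 * xx \<alpha> b = Vp g0 Y (inverse c)" by (simp add: Vp_def s_def b_def)
  also have "xx \<alpha> (- b) * Um s deg1 = Vm g0 Y (inverse c)" by (simp add: Vm_def s_def b_def)
  finally show ?thesis by (simp only: c_def)
qed

text \<open>Divided powers need a statement of their own, since over a ring they are not determined
  by the matrix of the root vector.\<close>

lemma conj_dpow:
  assumes "V' * V = 1" "A' * A = 1" "A * N * A' = c \<odot> (V * N * V')"
  shows "A * dpow N k * A' = c ^ k \<odot> (V * dpow N k * V')"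
proof -
  have "A * N ^ k * A' = c ^ k \<odot> (V * N ^ k * V')"
  proof (induction k)
    case 0
    have "A * A' = 1" "V * V' = 1"
      using assms(1,2) matrix_left_right_inverse[of "rep A" "rep A'"] matrix_left_right_inverse[of "rep V" "rep V'"]
      by (simp_all add: times_sqm_def one_sqm_def mk_inject)
    then show ?case by simp
  next
    case (Suc k)
    have "A * N ^ Suc k * A' = (A * N * A') * (A * N ^ k * A')"
      using assms(2) by (simp add: mult.assoc) (metis mult.assoc mult_1_left)
    also have "\<dots> = c ^ Suc k \<odot> (V * N * (V' * V) * N ^ k * V')"
      unfolding Suc.IH assms(3) by (simp add: mult.assoc mult.commute[of c])
    also have "\<dots> = c ^ Suc k \<odot> (V * N ^ Suc k * V')"
      using assms(1) by (simp add: mult.assoc)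
    finally show ?case .
  qed
  then show ?thesis by (simp add: dpow_def)
qed

lemma EC_conj_dpow:
  assumes "A \<in> EC" "xi (- \<alpha>) (A * X (- \<alpha>) * adj A) = c" "c \<noteq> 0" "g0 \<in> \<Phi>" "cn g0 \<alpha> = 1"
  shows "A * dpow (X (- \<alpha>)) k * adj A = c ^ k \<odot>
    (Vp g0 (A * X (- \<alpha>) * adj A) (inverse c) * dpow (X (- \<alpha>)) k * Vm g0 (A * X (- \<alpha>) * adj A) (inverse c))"
  using extremal_eq_conj[OF extremal_conj[OF assms(1) extremal_X] _ assms(4,5)] assms(2,3)
  by (intro conj_dpow Vm_Vp EC_inverse assms) auto

end

context long_point
begin

lemma SM_Up: "(\<And>g. g \<in> set xs \<Longrightarrow> regular_spec EC z (\<lambda>A. s A g) (r g)) \<Longrightarrow> SM (\<lambda>A. Up (s A) xs) (Up r xs)"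
  unfolding Up_def by (induction xs) (auto intro!: specI)

lemma SM_Um: "(\<And>g. g \<in> set xs \<Longrightarrow> regular_spec EC z (\<lambda>A. s A g) (r g)) \<Longrightarrow> SM (\<lambda>A. Um (s A) xs) (Um r xs)"
  unfolding Um_def by (induction xs) (auto intro!: specI)

lemma S_scoef [specI]: "SM Y M \<Longrightarrow> regular_spec EC z c r \<Longrightarrow> regular_spec EC z (\<lambda>A. scoef (Y A) (c A) g) (scoef M r g)"
  unfolding scoef_def by (intro specI)

lemma S_bcoef [specI]: "SM Y M \<Longrightarrow> regular_spec EC z c r \<Longrightarrow> regular_spec EC z (\<lambda>A. bcoef g0 (Y A) (c A)) (bcoef g0 M r)"
  unfolding bcoef_def by (intro specI SM_Up SM_Um)

lemma SM_Vp [specI]: "SM Y M \<Longrightarrow> regular_spec EC z c r \<Longrightarrow> SM (\<lambda>A. Vp g0 (Y A) (c A)) (Vp g0 M r)"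
  unfolding Vp_def by (intro specI SM_Up)

lemma SM_Vm [specI]: "SM Y M \<Longrightarrow> regular_spec EC z c r \<Longrightarrow> SM (\<lambda>A. Vm g0 (Y A) (c A)) (Vm g0 M r)"
  unfolding Vm_def by (intro specI SM_Um)

text \<open>Where the leading coefficient vanishes on the complex group, the formula may fail. Both
  sides are therefore multiplied by this coefficient, which has the value 1 at
  \<open>z\<close>.\<close>

lemma Z_XR_minus_alpha:
  assumes "c0 = 1" "g0 \<in> \<Phi>" "cn g0 \<alpha> = 1"
  shows "Z (XR (- \<alpha>) k) = Vp g0 Y0 1 * XR (- \<alpha>) k * Vm g0 Y0 1"
proof -
  let ?Y = "\<lambda>A. A * Xr (- \<alpha>) * adj A"
  let ?c = "\<lambda>A. xi (- \<alpha>) (?Y A)"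
  have c: "regular_spec EC z ?c 1" unfolding assms(1)[symmetric] by (intro specI)
  have i: "regular_spec EC z (\<lambda>A. inverse (?c A)) 1" by (rule regular_spec_inverse[OF c])
  have p: "regular_spec EC z (\<lambda>A. ?c A ^ k) 1" using S_power[OF c, of k] by simp
  have "(1 :: 'r) \<odot> Z (XR (- \<alpha>) k) = 1 \<odot> ((1 :: 'r) \<odot> (Vp g0 Y0 1 * XR (- \<alpha>) k * Vm g0 Y0 1))"
  proof (rule SM_eq)
    show "SM (\<lambda>A. ?c A \<odot> (A * XR (- \<alpha>) k * adj A)) (1 \<odot> Z (XR (- \<alpha>) k))"
      by (intro SM_sm c SM_Z SM_XR)
    show "SM (\<lambda>A. ?c A \<odot> (?c A ^ k \<odot> (Vp g0 (?Y A) (inverse (?c A)) * XR (- \<alpha>) k * Vm g0 (?Y A) (inverse (?c A)))))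
      (1 \<odot> ((1 :: 'r) \<odot> (Vp g0 Y0 1 * XR (- \<alpha>) k * Vm g0 Y0 1)))"
      by (intro SM_sm c p SM_mult SM_XR SM_Vp SM_Vm SM_Y0 i)
    fix A assume A: "A \<in> EC"
    show "?c A \<odot> (A * XR (- \<alpha>) k * adj A) =
      ?c A \<odot> (?c A ^ k \<odot> (Vp g0 (?Y A) (inverse (?c A)) * XR (- \<alpha>) k * Vm g0 (?Y A) (inverse (?c A))))"
    proof (cases "?c A = 0")
      case False
      then show ?thesis
        using EC_conj_dpow[OF A refl _ assms(2,3), of k] alpha by (simp add: XR_complex)
    qed simp
  qed
  then show ?thesis by simp
qed

text \<open>Without terms of degree -1 all parameters at roots of degree 1 are 0, and the
  conjugating element shrinks to x_\<alpha>(t). One t serves all divided powers, so z acts in this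
  way on x_-\<alpha>(s) for every s.\<close>

lemma Z_XR_like_root_element:
  assumes comm: "\<And>\<gamma>. \<gamma> \<in> \<Phi> \<Longrightarrow> cn \<gamma> \<alpha> \<ge> 0 \<Longrightarrow> comm \<gamma>" and "DIM('e) > 1"
  shows "\<exists>t. \<forall>k. Z (XR (- \<alpha>) k) = xx \<alpha> t * XR (- \<alpha>) k * xx \<alpha> (- t)"
proof -
  obtain \<gamma> where g: "\<gamma> \<in> \<Phi>" "cn \<gamma> \<alpha> = 1"
  proof -
    obtain \<beta> where b: "\<beta> \<in> \<Phi>" "\<beta> \<noteq> \<alpha>" "\<beta> \<noteq> - \<alpha>" "\<beta> \<bullet> \<alpha> \<noteq> 0"
      using exists_neighbour[OF alpha assms(2)] by blast
    then have "cn \<beta> \<alpha> = 1 \<or> cn (- \<beta>) \<alpha> = 1"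
      using long_cn[OF long b(1-3)] cn_sgn(3)[OF alpha, of \<beta>] by auto
    then show ?thesis using that[of \<beta>] that[of "- \<beta>"] b(1) by auto
  qed
  have c1: "c0 = 1" by (rule Y0_degree_minus_one_zero(1)[OF comm g])
  have s0: "scoef Y0 1 \<eta> = 0" if "\<eta> \<in> set deg1" for \<eta>
  proof -
    have e: "\<eta> \<in> \<Phi>" "cn \<eta> \<alpha> = 1" using that deg1 by auto
    note n = grade_1_roots[OF e]
    from Y0_degree_minus_one_zero(2)[OF comm n(2,4)] show ?thesis by (simp add: scoef_def)
  qed
  show ?thesis using Z_XR_minus_alpha[OF c1 g]
    by (intro exI[of _ "bcoef \<gamma> Y0 1"]) (simp add: Vp_def Vm_def Up_zero Um_zero s0)
qed

end

section \<open>Relations between root elements over a ring\<close>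

text \<open>The binomial theorem, which loses its binomial coefficients for divided powers.\<close>

lemma dpow_add_commute:
  assumes "A * B = B * A"
  shows "dpow (A + B) k = (\<Sum>i\<le>k. dpow A i * dpow B (k - i))"
proof (induction k)
  case (Suc k)
  have c: "dpow A i * B = B * dpow A i" for i
  proof -
    have "A ^ i * B = B * A ^ i"
      using assms by (induction i) (simp_all add: mult.assoc, metis mult.assoc)
    then show ?thesis by (simp add: dpow_def)
  qed
  let ?f = "\<lambda>i. dpow A i * dpow B (Suc k - i)"
  have "of_nat (Suc k) \<odot> dpow (A + B) (Suc k) = (A + B) * dpow (A + B) k" by (rule dpow_Suc)
  also have "\<dots> = (\<Sum>i\<le>k. A * dpow A i * dpow B (k - i)) + (\<Sum>i\<le>k. dpow A i * (B * dpow B (k - i)))"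
    unfolding Suc.IH distrib_right sum_distrib_left sum.distrib[symmetric]
    by (simp add: c mult.assoc[symmetric])
  also have "(\<Sum>i\<le>k. A * dpow A i * dpow B (k - i)) = (\<Sum>i\<le>k. of_nat (Suc i) \<odot> ?f (Suc i))"
    by (rule sum.cong) (simp_all add: dpow_Suc[symmetric] del: of_nat_Suc)
  also have "\<dots> = (\<Sum>i\<le>Suc k. of_nat i \<odot> ?f i)"
    by (subst sum.atMost_Suc_shift) simp
  also have "(\<Sum>i\<le>k. dpow A i * (B * dpow B (k - i))) = (\<Sum>i\<le>k. of_nat (Suc k - i) \<odot> ?f i)"
    by (rule sum.cong) (simp_all add: dpow_Suc[symmetric] Suc_diff_le del: of_nat_Suc)
  also have "\<dots> = (\<Sum>i\<le>Suc k. of_nat (Suc k - i) \<odot> ?f i)" by simp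
  also have "(\<Sum>i\<le>Suc k. of_nat i \<odot> ?f i) + (\<Sum>i\<le>Suc k. of_nat (Suc k - i) \<odot> ?f i)
      = (\<Sum>i\<le>Suc k. of_nat (Suc k) \<odot> ?f i)"
    by (subst sum.distrib[symmetric], rule sum.cong)
      (simp_all flip: sm_add_left of_nat_add del: of_nat_Suc)
  also have "\<dots> = of_nat (Suc k) \<odot> (\<Sum>i\<le>Suc k. ?f i)"
    by (simp only: sm_sum_right)
  finally show ?case by (rule sm_cancel[rotated]) (simp del: of_nat_Suc)
qed simp

lemma nilp_if_dpow_zero: "dpow N k = 0 \<Longrightarrow> nilp N"
  unfolding nilp_def dpow_def
  using sm_cancel[of "1 / fact k" "N ^ k" 0] power_eq_0_if_ge_card by auto

lemma nilp_add_commute: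
  fixes A B :: "(complex, 'n::finite) sqm"
  assumes "A * B = B * A" "nilp A" "nilp B"
  shows "nilp (A + B)"
proof (rule nilp_if_dpow_zero)
  have "dpow A i * dpow B (2 * CARD('n) - i) = 0" for i
    using dpow_nilp[OF assms(2), of i] dpow_nilp[OF assms(3), of "2 * CARD('n) - i"]
    by (cases "i \<ge> CARD('n)") auto
  then show "dpow (A + B) (2 * CARD('n)) = 0" unfolding dpow_add_commute[OF assms(1)] by simp
qed

lemma cexp_add_commute:
  fixes A B :: "(complex, 'n::finite) sqm"
  assumes "A * B = B * A" "nilp A" "nilp B"
  shows "cexp (A + B) t = cexp A t * cexp B t"
proof -
  let ?K = "2 * CARD('n)"
  have "cexp A t * cexp B t = (\<Sum>k<?K. t ^ k \<odot> dpow A k) * (\<Sum>k<?K. t ^ k \<odot> dpow B k)"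
    using assms by (simp add: cexp_eq_sum[of _ ?K])
  also have "\<dots> = (\<Sum>k<?K. \<Sum>i\<le>k. (t ^ i \<odot> dpow A i) * (t ^ (k - i) \<odot> dpow B (k - i)))"
  proof (rule sum_mult_triangle)
    fix i j assume "?K \<le> i + j"
    then have "CARD('n) \<le> i \<or> CARD('n) \<le> j" by linarith
    then show "(t ^ i \<odot> dpow A i) * (t ^ j \<odot> dpow B j) = 0"
      using dpow_nilp[OF assms(2)] dpow_nilp[OF assms(3)] by auto
  qed
  also have "\<dots> = (\<Sum>k<?K. t ^ k \<odot> dpow (A + B) k)"
    unfolding dpow_add_commute[OF assms(1)] sm_sum_right
    by (intro sum.cong refl) (simp flip: power_add)
  also have "\<dots> = cexp (A + B) t"
    using nilp_add_commute[OF assms] by (simp add: cexp_eq_sum[of _ ?K])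
  finally show ?thesis by simp
qed

lemma cexp_sm: "cexp (c \<odot> N) t = cexp N (c * t)"
  unfolding cexp_def dpow_def
proof (rule sum.cong[OF refl])
  fix k
  have "(c \<odot> N) ^ k = c ^ k \<odot> N ^ k" by (induction k) (simp_all add: mult.commute)
  then show "t ^ k \<odot> ((1 / fact k) \<odot> (c \<odot> N) ^ k) = (c * t) ^ k \<odot> ((1 / fact k) \<odot> N ^ k)"
    by (simp add: power_mult_distrib mult.commute)
qed

lemma nilp_sm: "nilp N \<Longrightarrow> nilp (c \<odot> N)"
proof -
  have "(c \<odot> N) ^ k = c ^ k \<odot> N ^ k" for k by (induction k) (simp_all add: mult.commute)
  then show "nilp N \<Longrightarrow> nilp (c \<odot> N)" by (simp add: nilp_def)
qed

lemma cexp_conj_eq: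
  assumes "A * A' = 1" "A' * A = 1" "A * N * A' = M"
  shows "A * cexp N t * A' = cexp M t"
proof -
  have "A * N ^ k * A' = M ^ k" for k
  proof (induction k)
    case (Suc k)
    have "A * N ^ Suc k * A' = A * N * (A' * A) * N ^ k * A'" using assms by (simp add: mult.assoc)
    also have "\<dots> = M * (A * N ^ k * A')"
      unfolding assms(3)[symmetric] by (simp add: mult.assoc)
    finally show ?case by (simp add: Suc.IH)
  qed (simp add: assms)
  then show ?thesis unfolding cexp_def dpow_def by (simp add: sum_distrib_left sum_distrib_right)
qed

text \<open>Specializing to the ring of integers detects that a complex constant is an
  integer.\<close>

lemma tspec_int_const:
  assumes "tspec (0 :: int) (\<lambda>_. c) v"
  shows "c = of_int v"
proof -
  obtain p where p: "\<forall>t. c = ipoly p t" "v = ipoly p 0"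
    using assms unfolding tspec_def by blast
  then have "c = poly (map_poly of_int p) 0" by blast
  then show ?thesis using p(2) by (simp add: poly_0_coeff_0 coeff_map_poly)
qed

context chev
begin

section \<open>Weyl elements\<close>

definition ww :: "'e \<Rightarrow> ('a::comm_ring_1, 'n) sqm" where
  "ww b = xx b 1 * xx (- b) (-1) * xx b 1"

definition wi :: "'e \<Rightarrow> ('a::comm_ring_1, 'n) sqm" where
  "wi b = xx b (-1) * xx (- b) 1 * xx b (-1)"

lemma triple_inverse:
  fixes a b c :: "'a::monoid_mult"
  assumes "a * a' = 1" "b * b' = 1" "c * c' = 1"
  shows "a * b * c * (c' * b' * a') = 1"
proof -
  have "a * b * c * (c' * b' * a') = a * (b * (c * c') * b') * a'" by (simp add: mult.assoc)
  then show ?thesis by (simp add: assms)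
qed

lemma ww_wi: "b \<in> \<Phi> \<Longrightarrow> ww b * wi b = 1" and wi_ww: "b \<in> \<Phi> \<Longrightarrow> wi b * ww b = 1"
  unfolding ww_def wi_def
  using xx_inverse[of b 1] xx_inverse[of "- b" 1] by (auto intro!: triple_inverse)

text \<open>On the Cartan elements \<open>ww b\<close> acts as the reflection at b acts on
  coroots.\<close>

lemma ww_H:
  assumes b: "b \<in> \<Phi>" and g: "g \<in> \<Phi>"
  shows "ww b * H g * wi b = H g - of_real (cn b g) \<odot> H b"
proof -
  let ?b = "complex_of_real (cn b g)"
  have mb: "- b \<in> \<Phi>" using b by simp
  have xb: "xx b 1 * H g * xx b (-1) = H g - ?b \<odot> X b" "xx b 1 * X b * xx b (-1) = X b"
    "xx b 1 * H b * xx b (-1) = H b - 2 \<odot> X b"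
    using L_conj[OF b L_H[OF g], of 1] L_conj[OF b L_X[OF b], of 1] L_conj[OF b L_H[OF b], of 1] root_nz[OF b]
    by (simp_all add: xx_complex b eval_nat_numeral adp_def br_X_H g)
  have xmb: "xx (- b) (-1) * H g * xx (- b) 1 = H g - ?b \<odot> X (- b)"
    "xx (- b) (-1) * X b * xx (- b) 1 = X b + H b - X (- b)"
    using L_conj[OF mb L_H[OF g], of "-1"] L_conj[OF mb L_X[OF b], of "-1"] adp_X_neg[OF mb]
    by (simp_all add: xx_complex b eval_nat_numeral br_X_neg')
      (simp_all add: adp_def br_X_H g b)
  have "ww b * H g * wi b
      = xx b 1 * (xx (- b) (-1) * (xx b 1 * H g * xx b (-1)) * xx (- b) 1) * xx b (-1)"
    by (simp add: ww_def wi_def mult.assoc)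
  also have "\<dots> = xx b 1 * (xx (- b) (-1) * H g * xx (- b) 1 - ?b \<odot> (xx (- b) (-1) * X b * xx (- b) 1)) * xx b (-1)"
    unfolding xb by (simp add: algebra_simps)
  also have "\<dots> = xx b 1 * (H g - ?b \<odot> X b - ?b \<odot> H b) * xx b (-1)"
    unfolding xmb by (simp add: sm_simps algebra_simps)
  also have "\<dots> = xx b 1 * H g * xx b (-1) - ?b \<odot> (xx b 1 * X b * xx b (-1)) - ?b \<odot> (xx b 1 * H b * xx b (-1))"
    by (simp add: algebra_simps)
  also have "\<dots> = H g - ?b \<odot> H b" unfolding xb by (simp add: sm_simps sm_two)
  finally show ?thesis .
qed

lemma conj_L_complex:
  assumes "g \<in> \<Phi>" "Y \<in> L"
  shows "xx g t * Y * xx g (- t) \<in> L"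
  using L_conj_L[OF assms] by (simp add: xx_complex assms)

lemma ww_L:
  assumes "b \<in> \<Phi>" "Y \<in> L"
  shows "ww b * Y * wi b \<in> L"
proof -
  have "ww b * Y * wi b
      = xx b 1 * (xx (- b) (-1) * (xx b 1 * Y * xx b (-1)) * xx (- b) (- (-1))) * xx b (-1)"
    by (simp add: ww_def wi_def mult.assoc)
  also have "\<dots> \<in> L" using assms by (intro conj_L_complex) auto
  finally show ?thesis .
qed

lemma rfl_rfl: "b \<in> \<Phi> \<Longrightarrow> rfl b (rfl b a) = a"
  using root_nz[of b] by (simp add: rfl_def scaleR_left_diff_distrib algebra_simps)

text \<open>The conjugate has the reflected weight, and root spaces are lines.\<close>

lemma ww_X_complex:
  assumes b: "b \<in> \<Phi>" and a: "a \<in> \<Phi>"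
  shows "\<exists>c :: complex. ww b * X a * wi b = c \<odot> X (rfl b a)"
proof -
  let ?Y = "ww b * X a * wi b"
  have "br (H g) ?Y = of_real (cn (rfl b a) g) \<odot> ?Y" if g: "g \<in> \<Phi>" for g
  proof -
    let ?b = "complex_of_real (cn b g)"
    have Hb: "ww b * H b * wi b = - H b" using ww_H[OF b b] root_nz[OF b] by (simp add: sm_two)
    have "H g = ww b * (H g - ?b \<odot> H b) * wi b"
      using ww_H[OF b g] Hb by (simp add: algebra_simps)
    then have "br (H g) ?Y = br (ww b * (H g - ?b \<odot> H b) * wi b) ?Y" by simp
    also have "\<dots> = ww b * br (H g - ?b \<odot> H b) (X a) * wi b"
      by (rule conj_br[OF wi_ww[OF b], symmetric])
    also have "br (H g - ?b \<odot> H b) (X a) = of_real (cn (rfl b a) g) \<odot> X a"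
      using a b g by (simp add: br_simps br_H_X rfl_def sm_simps mult.commute)
    finally show ?thesis by simp
  qed
  then have "?Y \<in> Wt (rfl b a)" by (simp add: Wt_def)
  then show ?thesis using L_Wt_root[OF ww_L[OF b L_X[OF a]]] rfl_root[OF a b] by blast
qed

lemma wi_X_complex:
  assumes b: "b \<in> \<Phi>" and a: "a \<in> \<Phi>"
  shows "\<exists>c :: complex. wi b * X a * ww b = c \<odot> X (rfl b a)"
proof -
  obtain c :: complex where c: "ww b * X (rfl b a) * wi b = c \<odot> X a"
    using ww_X_complex[OF b rfl_root[OF a b]] rfl_rfl[OF b] by auto
  have "X (rfl b a) = wi b * (ww b * X (rfl b a) * wi b) * ww b"
  proof -
    have "wi b * (ww b * X (rfl b a) * wi b) * ww b = (wi b * ww b) * X (rfl b a) * (wi b * ww b)"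
      by (simp add: mult.assoc)
    then show ?thesis by (simp add: wi_ww[OF b])
  qed
  then have e: "X (rfl b a) = c \<odot> (wi b * X a * ww b)" unfolding c by simp
  then have "c \<noteq> 0" using X_nz[OF rfl_root[OF a b]] by auto
  then have "wi b * X a * ww b = (1 / c) \<odot> X (rfl b a)" unfolding e by simp
  then show ?thesis by blast
qed

text \<open>The scalars belonging to \<open>ww b\<close> and to its inverse are integers, because
  they are coefficients that specialize to the ring of integers, and their product is 1.\<close>

lemma ww_X:
  assumes b: "b \<in> \<Phi>" and a: "a \<in> \<Phi>"
  obtains e :: int where "ww b * X a * wi b = of_int e \<odot> X (rfl b a)" "e * e = 1"
proof -
  interpret T: chev_spcl \<Phi> X "tspec (0 :: int)" UNIV by (rule chev_spcl_tspec)
  have sw: "T.SM (\<lambda>_. ww b) (ww b)" "T.SM (\<lambda>_. wi b) (wi b)"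
    unfolding ww_def wi_def using T.S_of_int[of "-1"] by (auto intro!: specI)
  note r = rfl_root[OF a b]
  obtain c :: complex where c: "ww b * X a * wi b = c \<odot> X (rfl b a)"
    using ww_X_complex[OF b a] by blast
  obtain d :: complex where d: "wi b * X (rfl b a) * ww b = d \<odot> X a"
    using wi_X_complex[OF b r] rfl_rfl[OF b] by auto
  have "tspec (0 :: int) (\<lambda>_. xi (rfl b a) (ww b * Xr a * wi b)) (xi (rfl b a) (ww b * Xr a * wi b))"
    by (intro specI sw)
  from tspec_int_const[OF this] obtain m :: int where m: "c = of_int m"
    by (simp add: Xr_complex a c xi_X r)
  have "tspec (0 :: int) (\<lambda>_. xi a (wi b * Xr (rfl b a) * ww b)) (xi a (wi b * Xr (rfl b a) * ww b))"
    by (intro specI sw)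
  from tspec_int_const[OF this] obtain l :: int where l: "d = of_int l"
    by (simp add: Xr_complex r d xi_X a)
  have "wi b * (ww b * X a * wi b) * ww b = (wi b * ww b) * X a * (wi b * ww b)"
    by (simp add: mult.assoc)
  then have "(c * d) \<odot> X a = X a" unfolding c by (simp add: wi_ww[OF b]) (simp add: d)
  from arg_cong[OF this, of "xi a"] have "c * d = 1" by (simp add: xi_X a)
  then have "complex_of_int (m * l) = of_int 1" unfolding m l by simp
  then have "m * l = 1" by (simp only: of_int_eq_iff)
  then have "m * m = 1" by (metis abs_1 abs_mult abs_mult_self_eq abs_zmult_eq_1 mult_1_left)
  then show ?thesis using that c m by blast
qed

lemma ww_xx:
  assumes b: "b \<in> \<Phi>" and a: "a \<in> \<Phi>"
  obtains e :: int where "\<And>t :: 'r::comm_ring_1. ww b * xx a t * wi b = xx (rfl b a) (of_int e * t)" "e * e = 1"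
proof -
  obtain e :: int where e: "ww b * X a * wi b = of_int e \<odot> X (rfl b a)" "e * e = 1"
    using ww_X[OF assms] .
  have "ww b * xx a t * wi b = xx (rfl b a) (of_int e * t)" for t :: 'r
  proof -
    interpret T: chev_spcl \<Phi> X "tspec t" UNIV by (rule chev_spcl_tspec)
    have sw: "T.SM (\<lambda>_. ww b) (ww b)" "T.SM (\<lambda>_. wi b) (wi b)"
      unfolding ww_def wi_def using T.S_of_int[of "-1"] by (auto intro!: specI)
    show ?thesis
    proof (rule T.SM_eq)
      show "T.SM (\<lambda>t. ww b * xx a t * wi b) (ww b * xx a t * wi b)"
        by (intro specI sw tspec_id)
      show "T.SM (\<lambda>t. xx (rfl b a) (of_int e * t)) (xx (rfl b a) (of_int e * t))"
        by (intro specI tspec_id T.S_of_int)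
      show "ww b * xx a t * wi b = xx (rfl b a) (of_int e * t)" for t :: complex
        using cexp_conj_eq[OF ww_wi[OF b] wi_ww[OF b] e(1), of t] a rfl_root[OF a b]
        by (simp add: xx_complex cexp_sm)
    qed
  qed
  then show ?thesis using that e(2) by blast
qed

lemma xx_commute:
  fixes s t :: "'r::comm_ring_1"
  assumes "g \<in> \<Phi>" "d \<in> \<Phi>" "g + d \<notin> \<Phi>" "g + d \<noteq> 0"
  shows "xx g s * xx d t = (xx d t * xx g s :: ('r, 'n) sqm)"
proof -
  have c: "X g * X d = X d * X g" using XX_zero[OF assms(1,2,4,3)] by (simp add: br_def)
  have d: "dpow (X g) i * dpow (X d) j = dpow (X d) j * dpow (X g) i" for i j
    using power_commuting_commutes[OF power_commuting_commutes[OF c[symmetric], symmetric], of i j]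
    by (simp add: dpow_def mult.commute)
  interpret T: chev_spcl \<Phi> X "tspec (0 :: 'r)" UNIV by (rule chev_spcl_tspec)
  have "XR g i * XR d j = (XR d j * XR g i :: ('r, 'n) sqm)" for i j
    by (rule T.SM_eq[of "\<lambda>_. XR g i * XR d j" _ "\<lambda>_. XR d j * XR g i"])
      (intro specI | simp add: XR_complex assms d)+
  then show ?thesis unfolding xx_def
    by (simp add: sum_product mult.commute) (subst sum.swap, simp add: mult.commute)
qed

section \<open>Commutator relations\<close>

definition cmm :: "('r::comm_ring_1, 'n) sqm \<Rightarrow> ('r, 'n) sqm \<Rightarrow> ('r, 'n) sqm" where
  "cmm a b = a * b * adj a * adj b"

text \<open>x_b(1) conjugates \<open>X a\<close> to the sum of \<open>X a\<close> and a sign times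
  \<open>X (a + b)\<close>. These commute, so the exponential of t times the sum splits into two
  root elements, with parameters linear in t.\<close>

lemma conj_xx_1:
  fixes t :: "'r::comm_ring_1"
  assumes ab: "a \<in> \<Phi>" "b \<in> \<Phi>" "a + b \<in> \<Phi>" "a - b \<notin> \<Phi>" "a + 2 *\<^sub>R b \<notin> \<Phi>" "2 *\<^sub>R a + b \<notin> \<Phi>"
  obtains e :: int where "e * e = 1"
    "\<And>t :: 'r::comm_ring_1. xx b 1 * xx a t * xx b (-1) = xx a t * xx (a + b) (of_int e * t)"
proof -
  have ne: "a \<noteq> b" using ab(3) double_not_root[OF ab(1)] by auto
  have "rstr \<Phi> b a = 0" by (rule rstr_eq_0[OF ab(2,1) ne ab(4)])
  then obtain e :: int where e: "br (X b) (X a) = of_int e \<odot> X (a + b)" "e * e = 1"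
    using structure_constant[of b a] ab(1-3)
    by (metis (no_types, lifting) abs_mult_self_eq add.commute add_0 mult_1_left of_nat_0)
  have nz: "a + 2 *\<^sub>R b \<noteq> 0" "a + (a + b) \<noteq> 0"
  proof -
    show "a + 2 *\<^sub>R b \<noteq> 0"
      using scaleR_root_iff[of b "-2"] ab(1,2) by (auto simp: add_eq_0_iff2)
    have v: "a + (a + b) = b + 2 *\<^sub>R a" by (rule inner_ext, simp add: inner_simps)
    show "a + (a + b) \<noteq> 0"
      unfolding v using scaleR_root_iff[of a "-2"] ab(1,2) by (auto simp: add_eq_0_iff2)
  qed
  have z: "br (X b) (X (a + b)) = 0"
    using XX_zero[OF ab(2,3)] nz ab(5) by (simp add: scaleR_2 add_ac)
  have c: "br (X a) (X (a + b)) = 0"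
    using XX_zero[OF ab(1,3)] nz ab(6) by (simp add: scaleR_2 add_ac)
  have N: "xx b 1 * X a * xx b (-1) = X a + of_int e \<odot> X (a + b)"
    using L_conj[OF ab(2) L_X[OF ab(1)], of 1]
    by (simp add: xx_complex ab(2) eval_nat_numeral adp_def e z)
  have "xx b 1 * xx a t * xx b (-1) = xx a t * xx (a + b) (of_int e * t)" for t :: 'r
  proof -
    interpret T: chev_spcl \<Phi> X "tspec t" UNIV by (rule chev_spcl_tspec)
    show ?thesis
    proof (rule T.SM_eq)
      show "T.SM (\<lambda>t. xx b 1 * xx a t * xx b (-1)) (xx b 1 * xx a t * xx b (-1))"
        using T.S_of_int[of "-1"] by (auto intro!: specI tspec_id)
      show "T.SM (\<lambda>t. xx a t * xx (a + b) (of_int e * t)) (xx a t * xx (a + b) (of_int e * t))"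
        by (intro specI tspec_id T.S_of_int)
      fix t :: complex
      have "xx b 1 * xx a t * xx b (-1) = cexp (X a + of_int e \<odot> X (a + b)) t"
        using cexp_conj_eq[OF xx_inverse[OF ab(2), of 1] N] by (simp add: xx_complex ab)
      also have "\<dots> = cexp (X a) t * cexp (of_int e \<odot> X (a + b)) t"
        by (intro cexp_add_commute nilp_X nilp_sm ab) (use c in \<open>simp add: br_def\<close>)
      finally show "xx b 1 * xx a t * xx b (-1) = xx a t * xx (a + b) (of_int e * t)"
        by (simp add: xx_complex ab cexp_sm)
    qed
  qed
  then show ?thesis using that e(2) by blast
qed

text \<open>Along the string the structure constants have absolute values 1 and 2, and the divided
  square removes the 2. So all three parameters are t up to sign, over every ring.\<close>

lemma conj_xx_2:
  assumes ab: "a \<in> \<Phi>" "b \<in> \<Phi>" "a + b \<in> \<Phi>" "a + 2 *\<^sub>R b \<in> \<Phi>"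
    and no: "a - b \<notin> \<Phi>" "a + 3 *\<^sub>R b \<notin> \<Phi>" "2 *\<^sub>R a + b \<notin> \<Phi>" "2 *\<^sub>R a + 3 *\<^sub>R b \<notin> \<Phi>"
  obtains e e' :: int where "e * e = 1" "e' * e' = 1"
    "\<And>t :: 'r::comm_ring_1. xx b 1 * xx a t * xx b (-1)
      = xx a t * xx (a + b) (of_int e * t) * xx (a + 2 *\<^sub>R b) (of_int e' * t)"
proof -
  let ?a1 = "a + b" and ?a2 = "a + 2 *\<^sub>R b"
  have ne: "a \<noteq> b" using ab(3) double_not_root[OF ab(1)] by auto
  have "rstr \<Phi> b a = 0" by (rule rstr_eq_0[OF ab(2,1) ne no(1)])
  then obtain e :: int where e: "br (X b) (X a) = of_int e \<odot> X ?a1" "e * e = 1"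
    using structure_constant[of b a] ab(1-3)
    by (metis (no_types, lifting) abs_mult_self_eq add.commute add_0 mult_1_left of_nat_0)
  have v: "b + ?a1 = ?a2" "?a1 - b = a" "?a1 - 2 *\<^sub>R b = a - b" "b + ?a2 = a + 3 *\<^sub>R b"
    "a + ?a1 = 2 *\<^sub>R a + b" "?a1 + ?a2 = 2 *\<^sub>R a + 3 *\<^sub>R b" "a + ?a2 = 2 *\<^sub>R ?a1"
    by (rule inner_ext, simp add: inner_simps)+
  have "rstr \<Phi> b ?a1 = 1"
    by (rule rstr_eq_1[OF ab(2,3)]) (simp_all only: v ab no not_False_eq_True)
  then obtain N :: int where N: "br (X b) (X ?a1) = of_int N \<odot> X ?a2" "\<bar>N\<bar> = 2"
    using structure_constant[of b ?a1] ab v(1) by auto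
  define e' where "e' = (if N = 2 then e else - e)"
  have eN: "e * N = 2 * e'" "e' * e' = 1"
  proof -
    have "N = 2 \<or> N = -2" using N(2) by linarith
    then show "e * N = 2 * e'" "e' * e' = 1" using e(2) by (auto simp: e'_def)
  qed
  have nz: "b + ?a2 \<noteq> 0" "a + ?a1 \<noteq> 0" "?a1 + ?a2 \<noteq> 0" "a + ?a2 \<noteq> 0" "2 *\<^sub>R ?a1 \<notin> \<Phi>"
  proof -
    show "b + ?a2 \<noteq> 0"
      unfolding v using scaleR_root_iff[OF ab(2), of "-3"] ab(1) by (auto simp: add_eq_0_iff2)
    show "a + ?a1 \<noteq> 0"
      unfolding v using scaleR_root_iff[OF ab(1), of "-2"] ab(2) by (auto simp: add_eq_0_iff)
    show "?a1 + ?a2 \<noteq> 0"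
    proof
      assume "?a1 + ?a2 = 0"
      then have "?a2 = - ?a1" by (simp add: add_eq_0_iff)
      then have "b = (-2) *\<^sub>R ?a1"
        using v(1) by (metis add_diff_cancel_right' diff_minus_eq_add minus_add_cancel scaleR_2 scaleR_minus_left
            uminus_add_conv_diff add_uminus_conv_diff minus_diff_eq)
      then show False using scaleR_root_iff[OF ab(3), of "-2"] ab(2) by auto
    qed
    show "2 *\<^sub>R ?a1 \<notin> \<Phi>" using scaleR_root_iff[OF ab(3), of 2] by auto
    then show "a + ?a2 \<noteq> 0" unfolding v using root_nz[OF ab(3)] by auto
  qed
  have z: "br (X b) (X ?a2) = 0" "br (X a) (X ?a1) = 0" "br (X ?a1) (X ?a2) = 0" "br (X a) (X ?a2) = 0"
    using XX_zero[OF ab(2,4)] XX_zero[OF ab(1,3)] XX_zero[OF ab(3,4)] XX_zero[OF ab(1,4)] nz no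
    by (simp_all only: v not_False_eq_True)
  have M: "xx b 1 * X a * xx b (-1) = X a + (of_int e \<odot> X ?a1 + of_int e' \<odot> X ?a2)"
  proof -
    have "adp (X b) 2 (X a) = of_int e' \<odot> X ?a2"
    proof -
      have "complex_of_int e * of_int N = 2 * of_int e'"
        using eN(1) by (metis of_int_mult of_int_numeral)
      then show ?thesis by (simp add: adp_def eval_nat_numeral e N(1))
    qed
    moreover have "adp (X b) 3 (X a) = 0" by (simp add: adp_def eval_nat_numeral e N(1) z)
    ultimately show ?thesis using L_conj[OF ab(2) L_X[OF ab(1)], of 1]
      by (simp add: xx_complex ab(2) eval_nat_numeral e add.assoc)
  qed
  have "xx b 1 * xx a t * xx b (-1)
      = xx a t * xx ?a1 (of_int e * t) * xx ?a2 (of_int e' * t)" for t :: 'r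
  proof -
    interpret T: chev_spcl \<Phi> X "tspec t" UNIV by (rule chev_spcl_tspec)
    show ?thesis
    proof (rule T.SM_eq)
      show "T.SM (\<lambda>t. xx b 1 * xx a t * xx b (-1)) (xx b 1 * xx a t * xx b (-1))"
        using T.S_of_int[of "-1"] by (auto intro!: specI tspec_id)
      show "T.SM (\<lambda>t. xx a t * xx ?a1 (of_int e * t) * xx ?a2 (of_int e' * t))
        (xx a t * xx ?a1 (of_int e * t) * xx ?a2 (of_int e' * t))"
        by (intro specI tspec_id T.S_of_int)
      fix t :: complex
      let ?B = "of_int e \<odot> X ?a1" and ?C = "of_int e' \<odot> X ?a2"
      have comm: "?B * ?C = ?C * ?B" "X a * (?B + ?C) = (?B + ?C) * X a"
        using z by (simp_all add: br_def algebra_simps)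
      have nB: "nilp ?B" "nilp ?C" "nilp (X a)" by (intro nilp_sm nilp_X ab)+
      have "xx b 1 * xx a t * xx b (-1) = cexp (X a + (?B + ?C)) t"
        using cexp_conj_eq[OF xx_inverse[OF ab(2), of 1] M] by (simp add: xx_complex ab)
      also have "\<dots> = cexp (X a) t * (cexp ?B t * cexp ?C t)"
        using cexp_add_commute[OF comm(2) nB(3) nilp_add_commute[OF comm(1) nB(1,2)]]
          cexp_add_commute[OF comm(1) nB(1,2)] by simp
      finally show "xx b 1 * xx a t * xx b (-1)
          = xx a t * xx ?a1 (of_int e * t) * xx ?a2 (of_int e' * t)"
        by (simp add: xx_complex ab cexp_sm mult.assoc)
    qed
  qed
  then show ?thesis using that e(2) eN(2) by blast
qed

end

section \<open>Word maps and Diophantine sets\<close>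

lemma word_over_Nil: "word_over n C []"
  and word_over_Cons: "word_over n C ((l, s) # w) \<longleftrightarrow>
    (l = Free_Var \<or> (\<exists>i<n. l = Bound_Var i) \<or> (\<exists>c\<in>C. l = Constant c)) \<and> word_over n C w"
  and word_over_append: "word_over n C (v @ w) \<longleftrightarrow> word_over n C v \<and> word_over n C w"
  by (auto simp: word_over_def)

lemma word_over_mono: "word_over m C w \<Longrightarrow> m \<le> n \<Longrightarrow> word_over n C w"
  by (induction w) (auto simp: word_over_Nil word_over_Cons dest: less_le_trans)

definition word_inverse :: "'g word \<Rightarrow> 'g word" where
  "word_inverse w = rev (map (apsnd Not) w)"

lemma word_over_inverse: "word_over n C (word_inverse w) \<longleftrightarrow> word_over n C w"
  by (simp add: word_over_def word_inverse_def image_image)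

text \<open>For the image of a set, the element described by the old formula becomes one more
  quantified variable, with index n.\<close>

definition bind_free :: "nat \<Rightarrow> 'g word \<Rightarrow> 'g word" where
  "bind_free n = map (apfst (\<lambda>l. if l = Free_Var then Bound_Var n else l))"

lemma word_over_bind_free: "word_over n C w \<Longrightarrow> word_over (Suc n) C (bind_free n w)"
  by (induction w) (auto simp: bind_free_def word_over_Nil word_over_Cons less_Suc_eq)

lemma word_value_bind_free: "word_value G x y (bind_free n w) = word_value G (y n) y w"
proof (induction w)
  case (Cons a w)
  obtain l s where "a = (l, s)" by (cases a)
  then show ?case using Cons by (cases l) (simp_all add: bind_free_def)
qed (simp add: bind_free_def)

lemma word_value_cong:
  "word_over n C w \<Longrightarrow> (\<And>i. i < n \<Longrightarrow> y i = y' i) \<Longrightarrow> word_value G x y w = word_value G x y' w"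
proof (induction w)
  case (Cons a w)
  obtain l s where "a = (l, s)" by (cases a)
  then show ?case using Cons by (auto simp: word_over_Cons)
qed simp

context group
begin

lemma word_value_closed:
  assumes "C \<subseteq> carrier G" "x \<in> carrier G" "\<forall>i<n. y i \<in> carrier G"
  shows "word_over n C w \<Longrightarrow> word_value G x y w \<in> carrier G"
proof (induction w)
  case (Cons a w)
  obtain l s where "a = (l, s)" by (cases a)
  then show ?case using Cons assms by (auto simp: word_over_Cons)
qed simp

lemma word_value_append:
  assumes "C \<subseteq> carrier G" "x \<in> carrier G" "\<forall>i<n. y i \<in> carrier G" "word_over n C w"
  shows "word_over n C v \<Longrightarrow> word_value G x y (v @ w) = word_value G x y v \<otimes> word_value G x y w"
proof (induction v)
  case Nil
  then show ?case using word_value_closed[OF assms] by simp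
next
  case (Cons a v)
  obtain l s where a: "a = (l, s)" by (cases a)
  have "(if s then letter_value x y l else inv letter_value x y l) \<in> carrier G"
    using Cons.prems assms(1,2,3) by (auto simp: word_over_Cons a)
  then show ?case using Cons word_value_closed[OF assms(1,2,3)] assms(4)
    by (simp add: a word_over_Cons m_assoc)
qed

lemma word_value_inverse:
  assumes "C \<subseteq> carrier G" "x \<in> carrier G" "\<forall>i<n. y i \<in> carrier G"
  shows "word_over n C w \<Longrightarrow> word_value G x y (word_inverse w) = inv (word_value G x y w)"
proof (induction w)
  case (Cons a w)
  obtain l s where a: "a = (l, s)" by (cases a)
  have l: "letter_value x y l \<in> carrier G" and w: "word_over n C w"
    using Cons.prems assms(1,2,3) by (auto simp: word_over_Cons a)
  have "word_value G x y (word_inverse (a # w))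
      = word_value G x y (word_inverse w) \<otimes> word_value G x y [(l, \<not> s)]"
  proof -
    have "word_inverse (a # w) = word_inverse w @ [(l, \<not> s)]" by (simp add: word_inverse_def a)
    then show ?thesis
      using word_value_append[OF assms, of "[(l, \<not> s)]" "word_inverse w"] Cons.prems w
      by (simp only:) (simp add: a word_over_Cons word_over_Nil word_over_inverse)
  qed
  also have "\<dots> = inv (word_value G x y (a # w))"
    using Cons.IH[OF w] l word_value_closed[OF assms, of w] w by (simp add: a inv_mult_group)
  finally show ?case .
qed (simp add: word_inverse_def)

definition word_map :: "'a set \<Rightarrow> ('a \<Rightarrow> 'a) \<Rightarrow> bool" where
  "word_map C f \<longleftrightarrow> (\<exists>w. word_over 0 C w \<and> (\<forall>x\<in>carrier G. \<forall>y. word_value G x y w = f x))"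

lemma word_map_id: "word_map C (\<lambda>x. x)"
  unfolding word_map_def
  by (rule exI[of _ "[(Free_Var, True)]"]) (simp add: word_over_Cons word_over_Nil)

lemma word_map_const: "C \<subseteq> carrier G \<Longrightarrow> c \<in> C \<Longrightarrow> word_map C (\<lambda>_. c)"
  unfolding word_map_def
  by (rule exI[of _ "[(Constant c, True)]"]) (auto simp: word_over_Cons word_over_Nil)

lemma word_map_mult:
  assumes "C \<subseteq> carrier G" "word_map C f" "word_map C g"
  shows "word_map C (\<lambda>x. f x \<otimes> g x)"
proof -
  obtain v w where "word_over 0 C v" "\<forall>x\<in>carrier G. \<forall>y. word_value G x y v = f x"
    "word_over 0 C w" "\<forall>x\<in>carrier G. \<forall>y. word_value G x y w = g x"
    using assms(2,3) unfolding word_map_def by blast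
  then show ?thesis unfolding word_map_def using word_value_append[OF assms(1), where n = 0]
    by (intro exI[of _ "v @ w"]) (simp add: word_over_append)
qed

lemma word_map_inv:
  assumes "C \<subseteq> carrier G" "word_map C f"
  shows "word_map C (\<lambda>x. inv (f x))"
proof -
  obtain w where "word_over 0 C w" "\<forall>x\<in>carrier G. \<forall>y. word_value G x y w = f x"
    using assms(2) unfolding word_map_def by blast
  then show ?thesis unfolding word_map_def using word_value_inverse[OF assms(1), where n = 0]
    by (intro exI[of _ "word_inverse w"]) (simp add: word_over_inverse)
qed

lemma diophantine_equations:
  assumes "C \<subseteq> carrier G" "finite fs" "\<And>f. f \<in> fs \<Longrightarrow> word_map C f"
  shows "diophantine_with_constants G C {x \<in> carrier G. \<forall>f\<in>fs. f x = \<one>}"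
proof -
  have "\<forall>f\<in>fs. \<exists>w. word_over 0 C w \<and> (\<forall>x\<in>carrier G. \<forall>y. word_value G x y w = f x)"
    using assms(3) unfolding word_map_def by blast
  then obtain W where W: "\<And>f. f \<in> fs \<Longrightarrow> word_over 0 C (W f)"
    "\<And>f x y. f \<in> fs \<Longrightarrow> x \<in> carrier G \<Longrightarrow> word_value G x y (W f) = f x"
    by metis
  obtain ls where "set ls = fs" using finite_list[OF assms(2)] by blast
  then show ?thesis unfolding diophantine_with_constants_def using W assms(1)
    by (intro conjI exI[of _ 0] exI[of _ "map W ls"]) auto
qed

text \<open>One equation is added: the new free variable equals \<open>f\<close> of the bound
  variable with index n, which satisfies the old equations.\<close>

lemma diophantine_image:
  assumes H: "diophantine_with_constants G C H" and f: "word_map C f"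
  shows "diophantine_with_constants G C (f ` H)"
proof -
  have C: "C \<subseteq> carrier G" using H unfolding diophantine_with_constants_def by simp
  obtain n ws where ws: "\<forall>w\<in>set ws. word_over n C w"
    "H = {x \<in> carrier G. \<exists>y. (\<forall>i<n. y i \<in> carrier G) \<and> (\<forall>w\<in>set ws. word_value G x y w = \<one>)}"
    using H unfolding diophantine_with_constants_def by blast
  obtain w where w: "word_over 0 C w" "\<forall>x\<in>carrier G. \<forall>y. word_value G x y w = f x"
    using f unfolding word_map_def by blast
  have wn: "word_over n C w" using word_over_mono[OF w(1)] by simp
  define u where "u = [(Free_Var, True)] @ word_inverse (bind_free n w)"
  have val: "word_value G x y u = x \<otimes> inv (f (y n))"
    if "x \<in> carrier G" "\<forall>i<Suc n. y i \<in> carrier G" for x y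
    using word_value_append[OF C that, of "word_inverse (bind_free n w)" "[(Free_Var, True)]"]
      word_value_inverse[OF C that, of "bind_free n w"] that w(2)
      word_over_bind_free[OF wn] unfolding u_def
    by (simp only:) (simp add: word_over_inverse word_over_Cons word_over_Nil word_value_bind_free)
  have fc: "f v \<in> carrier G" if "v \<in> carrier G" for v
    using word_value_closed[OF C that, of 0 undefined w] w that by simp
  have "f ` H = {x \<in> carrier G. \<exists>y. (\<forall>i<Suc n. y i \<in> carrier G) \<and>
      (\<forall>a\<in>set (u # map (bind_free n) ws). word_value G x y a = \<one>)}" (is "_ = ?R")
  proof (rule Set.set_eqI, rule iffI)
    fix x assume "x \<in> f ` H"
    then obtain v y where v: "x = f v" "v \<in> carrier G" "\<forall>i<n. y i \<in> carrier G"
      "\<forall>w\<in>set ws. word_value G v y w = \<one>" unfolding ws(2) by blast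
    define y' where "y' = y(n := v)"
    have y'n: "y' n = v" "\<And>i. i < n \<Longrightarrow> y' i = y i" by (simp_all add: y'_def)
    have y: "\<forall>i<Suc n. y' i \<in> carrier G" using v y'n by (auto simp: less_Suc_eq)
    have "word_value G v y' a = \<one>" if "a \<in> set ws" for a
      using word_value_cong[of n C a y' y G v] ws(1) v(4) y'n that by simp
    then show "x \<in> ?R" using val[OF fc[OF v(2)] y] y v(1,2) fc[OF v(2)]
      by (intro CollectI conjI exI[of _ y'])
        (auto simp: word_value_bind_free y'n)
  next
    fix x assume "x \<in> ?R"
    then obtain y where y: "x \<in> carrier G" "\<forall>i<Suc n. y i \<in> carrier G" "word_value G x y u = \<one>"
      "\<forall>w\<in>set ws. word_value G (y n) y w = \<one>" by (auto simp: word_value_bind_free)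
    have "y n \<in> H" unfolding ws(2) using y by (intro CollectI conjI exI[of _ y]) auto
    moreover have "x = f (y n)"
      using val[OF y(1,2)] y(1,2,3) fc[of "y n"] inv_solve_right[of \<one> x "f (y n)"] by simp
    ultimately show "x \<in> f ` H" by blast
  qed
  moreover have "\<forall>a\<in>set (u # map (bind_free n) ws). word_over (Suc n) C a"
    using ws(1) word_over_bind_free[OF wn] word_over_bind_free
    by (auto simp: u_def word_over_Cons word_over_inverse)
  ultimately show ?thesis unfolding diophantine_with_constants_def using C by blast
qed

end

text \<open>Carries the result from the copied matrix type back to the matrices of the
  theorem.\<close>

lemma diophantine_iso:
  assumes "group M" "group N" and f: "f \<in> iso M N" and H: "diophantine_with_constants M C H"
  shows "diophantine_with_constants N (f ` C) (f ` H)"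
proof -
  interpret M: group M by fact
  interpret N: group N by fact
  interpret group_hom M N f using f by (unfold_locales) (simp add: iso_def)
  have b: "bij_betw f (carrier M) (carrier N)" using f by (simp add: iso_def)
  have C: "C \<subseteq> carrier M" using H unfolding diophantine_with_constants_def by simp
  obtain n ws where ws: "\<forall>w\<in>set ws. word_over n C w"
    "H = {x \<in> carrier M. \<exists>y. (\<forall>i<n. y i \<in> carrier M) \<and> (\<forall>w\<in>set ws. word_value M x y w = \<one>\<^bsub>M\<^esub>)}"
    using H unfolding diophantine_with_constants_def by blast
  define tr where "tr = (map (apfst (map_letter f)) :: _ word \<Rightarrow> _ word)"
  have ot: "word_over n (f ` C) (tr w)" if "word_over n C w" for w
    using that by (induction w) (auto simp: tr_def word_over_Nil word_over_Cons, blast)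
  have val: "word_value N (f x) (\<lambda>i. f (y i)) (tr w) = f (word_value M x y w)"
    if x: "x \<in> carrier M" "\<forall>i<n. y i \<in> carrier M" and w: "word_over n C w" for x y w
    using w
  proof (induction w)
    case (Cons a w)
    obtain l s where a: "a = (l, s)" by (cases a)
    have l: "letter_value x y l \<in> carrier M" and w: "word_over n C w"
      using Cons.prems x C by (auto simp: word_over_Cons a)
    have "letter_value (f x) (\<lambda>i. f (y i)) (map_letter f l) = f (letter_value x y l)"
      by (cases l) simp_all
    then show ?case using Cons.IH[OF w] l M.word_value_closed[OF C x w] by (simp add: a tr_def)
  qed (simp add: tr_def)
  have "f ` H = {x \<in> carrier N. \<exists>y. (\<forall>i<n. y i \<in> carrier N) \<and>
      (\<forall>w\<in>set (map tr ws). word_value N x y w = \<one>\<^bsub>N\<^esub>)}" (is "_ = ?R")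
  proof (rule Set.set_eqI, rule iffI)
    fix x assume "x \<in> f ` H"
    then obtain v y where v: "x = f v" "v \<in> carrier M" "\<forall>i<n. y i \<in> carrier M"
      "\<forall>w\<in>set ws. word_value M v y w = \<one>\<^bsub>M\<^esub>" unfolding ws(2) by blast
    then show "x \<in> ?R"
      using val[OF v(2,3)] ws(1) by (auto intro!: exI[of _ "\<lambda>i. f (y i)"])
  next
    fix x assume "x \<in> ?R"
    then obtain y where y: "x \<in> carrier N" "\<forall>i<n. y i \<in> carrier N"
      "\<forall>w\<in>set ws. word_value N x y (tr w) = \<one>\<^bsub>N\<^esub>" by auto
    define g where "g = inv_into (carrier M) f"
    have g: "g u \<in> carrier M" "f (g u) = u" if "u \<in> carrier N" for u
      using that b unfolding g_def by (auto simp: bij_betw_def inv_into_into f_inv_into_f)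
    have "word_value M (g x) (\<lambda>i. g (y i)) w = \<one>\<^bsub>M\<^esub>" if w: "w \<in> set ws" for w
    proof -
      have c: "word_value M (g x) (\<lambda>i. g (y i)) w \<in> carrier M"
        using M.word_value_closed[OF C g(1)[OF y(1)], of n "\<lambda>i. g (y i)" w] y(2) ws(1) g w by auto
      have "f (word_value M (g x) (\<lambda>i. g (y i)) w) = word_value N (f (g x)) (\<lambda>i. f (g (y i))) (tr w)"
        using val[of "g x" "\<lambda>i. g (y i)" w] y g ws(1) w by simp
      also have "\<dots> = word_value N x y (tr w)"
        using word_value_cong[OF ot, of w "\<lambda>i. f (g (y i))" y N x] ws(1) w g y by simp
      finally have "f (word_value M (g x) (\<lambda>i. g (y i)) w) = f \<one>\<^bsub>M\<^esub>"
        using y(3) w by simp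
      then show ?thesis using b c M.one_closed unfolding bij_betw_def by (meson inj_onD)
    qed
    then have "g x \<in> H"
      unfolding ws(2) using g y by (auto intro!: exI[of _ "\<lambda>i. g (y i)"])
    then show "x \<in> f ` H" using g(2)[OF y(1)] by force
  qed
  then show ?thesis unfolding diophantine_with_constants_def using C b ws(1) ot
    by (intro conjI exI[of _ n] exI[of _ "map tr ws"]) (auto simp: bij_betw_def)
qed

section \<open>Large subgroups\<close>

lemma (in spcl) S_eval_entry_poly:
  "SM F M \<Longrightarrow> S (\<lambda>b. eval_entry_poly p (rep (F b))) (eval_entry_poly p (rep M))"
  unfolding eval_entry_poly_ent by (intro S_sum S_mult S_of_int S_prod S_power S_ent)

context chev
begin

text \<open>An equation of the complex group holds for x_g(t) identically in t, hence for t in any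
  ring.\<close>

lemma xx_GP:
  fixes t :: "'r::comm_ring_1"
  assumes "g \<in> \<Phi>"
  shows "xx g t \<in> GP"
proof -
  interpret T: chev_spcl \<Phi> X "tspec t" UNIV by (rule chev_spcl_tspec)
  have sx: "T.SM (\<lambda>t. xx g t) (xx g t)" by (intro specI tspec_id)
  have "det (rep (xx g t)) = 1"
    by (rule T.S_eq[OF T.S_det[OF sx] T.S_1]) (simp add: det_xx_complex assms)
  moreover have "eval_entry_poly p (rep (xx g t)) = 0"
    if "\<forall>A\<in>EC. eval_entry_poly p (rep A) = 0" for p
    by (rule T.S_zero_if[OF T.S_eval_entry_poly[OF sx]]) (use that EC_xx[OF assms] in blast)
  ultimately show ?thesis by (simp add: GP_def points_def)
qed

lemma adj_unique:
  assumes "z \<in> GP" "z * y = 1"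
  shows "adj z = y"
  using left_right_inverse_unique[OF assms(2) points_adj(2)[OF assms(1)]] by simp

lemma adj_xx: "g \<in> \<Phi> \<Longrightarrow> adj (xx g t) = xx g (- t)"
  by (rule adj_unique[OF xx_GP xx_inverse(1)])

end

lemma commutes_mult:
  fixes a b y :: "'a::semigroup_mult"
  shows "y * a = a * y \<Longrightarrow> y * b = b * y \<Longrightarrow> y * (a * b) = a * b * y"
  by (metis mult.assoc)

lemma commutes_cancel_left:
  fixes a b y :: "'a::monoid_mult"
  assumes "a' * a = 1" "y * a = a * y" "y * (a * b) = a * b * y"
  shows "y * b = b * y"
proof -
  have "y * b = a' * a * (y * b)" by (simp add: assms(1))
  also have "\<dots> = a' * (y * a * b)" by (simp add: assms(2) mult.assoc)
  also have "\<dots> = (a' * a) * (b * y)" using assms(3) by (simp add: mult.assoc)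
  finally show ?thesis by (simp add: assms(1))
qed

lemma commutes_cancel_right:
  fixes a b y :: "'a::monoid_mult"
  assumes "b * b' = 1" "y * b = b * y" "y * (a * b) = a * b * y"
  shows "y * a = a * y"
proof -
  have "y * a = y * (a * b) * b'" by (simp add: assms(1) mult.assoc)
  also have "\<dots> = a * (y * b) * b'" unfolding assms(3) by (simp add: assms(2) mult.assoc)
  also have "\<dots> = a * y * (b * b')" by (simp add: mult.assoc)
  finally show ?thesis by (simp add: assms(1))
qed

lemma commutes_inverse:
  fixes a y :: "'a::monoid_mult"
  assumes "a * a' = 1" "a' * a = 1" "y * a = a * y"
  shows "y * a' = a' * y"
  by (rule commutes_cancel_left[OF assms(2,3)]) (simp add: assms(1))

section \<open>Diophantine subsets of a large subgroup\<close>

locale large_group = chev \<Phi> X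
  for \<Phi> :: "'e::euclidean_space set" and X :: "'e \<Rightarrow> (complex, 'n::finite) sqm" +
  fixes G :: "('r::comm_ring_1, 'n) sqm set"
  assumes G_GP: "G \<subseteq> GP"
    and G_mult: "y \<in> G \<Longrightarrow> z \<in> G \<Longrightarrow> y * z \<in> G"
    and G_adj: "z \<in> G \<Longrightarrow> adj z \<in> G"
    and G_xx: "\<gamma> \<in> \<Phi> \<Longrightarrow> xx \<gamma> t \<in> G"
    and rank: "DIM('e) > 1"
begin

definition gm :: "('r, 'n) sqm monoid" where
  "gm = \<lparr>carrier = G, mult = (*), one = 1\<rparr>"

definition consts1 :: "('r, 'n) sqm set" where
  "consts1 = {xx b 1 | b. b \<in> \<Phi>}"

definition dph :: "('r, 'n) sqm set \<Rightarrow> bool" where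
  "dph = diophantine_with_constants gm consts1"

lemma G_inverse: "z \<in> G \<Longrightarrow> z * adj z = 1" "z \<in> G \<Longrightarrow> adj z * z = 1"
  using points_adj G_GP by auto

lemma G_one: "1 \<in> G"
proof -
  obtain g where "g \<in> \<Phi>" using indecomposable unfolding indecomposable_def by blast
  then show ?thesis using G_xx[of g 0] by simp
qed

sublocale gm: group gm
  rewrites "carrier gm = G" and "mult gm = (*)" and "one gm = 1"
proof -
  show "group gm"
    by (rule groupI) (auto simp: gm_def G_mult G_one mult.assoc intro: G_adj G_inverse)
qed (simp_all add: gm_def)

lemma gm_inv: "z \<in> G \<Longrightarrow> inv\<^bsub>gm\<^esub> z = adj z"
  by (rule gm.inv_equality) (auto simp: G_inverse G_adj)

lemma consts1_G: "consts1 \<subseteq> G"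
  by (auto simp: consts1_def G_xx)

abbreviation wm :: "(('r, 'n) sqm \<Rightarrow> ('r, 'n) sqm) \<Rightarrow> bool" where
  "wm \<equiv> gm.word_map consts1"

lemma wm_closed:
  assumes "wm f" "z \<in> G"
  shows "f z \<in> G"
proof -
  obtain w where "word_over 0 consts1 w" "\<forall>x\<in>G. \<forall>y. word_value gm x y w = f x"
    using assms(1) unfolding gm.word_map_def by blast
  then show ?thesis
    using gm.word_value_closed[OF consts1_G assms(2), of 0 undefined w] assms(2) by simp
qed

named_theorems wmI

lemma wm_xx_1 [wmI]: "b \<in> \<Phi> \<Longrightarrow> wm (\<lambda>_. xx b 1)"
  by (rule gm.word_map_const[OF consts1_G]) (auto simp: consts1_def)

lemmas wm_id [wmI] = gm.word_map_id[of consts1]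

lemmas wm_mult [wmI] = gm.word_map_mult[OF consts1_G]

lemma wm_cong: "wm f \<Longrightarrow> (\<And>z. z \<in> G \<Longrightarrow> f z = g z) \<Longrightarrow> wm g"
  unfolding gm.word_map_def by auto

lemma wm_adj [wmI]: "wm f \<Longrightarrow> wm (\<lambda>z. adj (f z))"
  by (rule wm_cong[OF gm.word_map_inv[OF consts1_G]]) (auto dest: wm_closed simp: gm_inv)

lemma wm_xx_m1 [wmI]: "b \<in> \<Phi> \<Longrightarrow> wm (\<lambda>_. xx b (-1))"
  using wm_adj[OF wm_xx_1, of b] by (simp add: adj_xx)

lemma wm_ww [wmI]: "b \<in> \<Phi> \<Longrightarrow> wm (\<lambda>_. ww b)" and wm_wi [wmI]: "b \<in> \<Phi> \<Longrightarrow> wm (\<lambda>_. wi b)"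
  unfolding ww_def wi_def by (intro wmI neg_root; assumption)+

lemma wm_cmm [wmI]: "wm f \<Longrightarrow> wm g \<Longrightarrow> wm (\<lambda>z. cmm (f z) (g z))"
  unfolding cmm_def by (intro wmI)

lemma cmm_eq_1_iff:
  assumes "y \<in> G" "z \<in> G"
  shows "cmm y z = 1 \<longleftrightarrow> y * z = z * y"
proof
  assume 1: "cmm y z = 1"
  have "cmm y z * (z * y) = y * z * adj y * (adj z * z) * y" by (simp add: cmm_def mult.assoc)
  then have "cmm y z * (z * y) = y * z * (adj y * y)" by (simp add: G_inverse assms mult.assoc)
  then show "y * z = z * y" using 1 by (simp add: G_inverse assms)
next
  assume "y * z = z * y"
  then have "cmm y z = z * (y * adj y) * adj z" by (simp add: cmm_def mult.assoc)
  then show "cmm y z = 1" by (simp add: G_inverse assms)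
qed

lemma dph_image: "dph T \<Longrightarrow> wm f \<Longrightarrow> dph (f ` T)"
  unfolding dph_def by (rule gm.diophantine_image)

lemma dph_centralizer:
  assumes "T \<subseteq> \<Phi>"
  shows "dph {z \<in> G. \<forall>g\<in>T. z * xx g 1 = xx g 1 * z}"
proof -
  have "dph {z \<in> G. \<forall>f\<in>(\<lambda>g z. cmm z (xx g 1)) ` T. f z = 1}"
    unfolding dph_def
    by (rule gm.diophantine_equations[OF consts1_G])
      (use assms finite_subset[OF assms finite_roots] in \<open>auto intro!: wmI\<close>)
  moreover have "{z \<in> G. \<forall>f\<in>(\<lambda>g z. cmm z (xx g 1)) ` T. f z = 1} = {z \<in> G. \<forall>g\<in>T. z * xx g 1 = xx g 1 * z}"
    using cmm_eq_1_iff[OF _ G_xx] assms by (intro Collect_cong conj_cong refl) (simp add: subset_iff)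
  ultimately show ?thesis by simp
qed

text \<open>For long a this contains the root subgroup of a, but also every element of
  \<open>G\<close> that commutes with all root elements.\<close>

definition Mset :: "'e \<Rightarrow> ('r, 'n) sqm set" where
  "Mset a = {z \<in> G. \<forall>g\<in>{g \<in> \<Phi>. cn g a \<ge> 0}. z * xx g 1 = xx g 1 * z}"

lemma dph_Mset: "dph (Mset a)"
  unfolding Mset_def by (rule dph_centralizer) auto

lemma xx_Mset:
  assumes "long \<Phi> a"
  shows "xx a t \<in> Mset a"
proof -
  interpret long_root \<Phi> X a by unfold_locales fact
  have "a + g \<notin> \<Phi>" "a + g \<noteq> 0" if "g \<in> \<Phi>" "cn g a \<ge> 0" for g
    using grade_2[of "a + g"] that cn_alpha root_nz[OF that(1)] by (auto simp: add_eq_0_iff)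
  then have "xx a t * xx g 1 = xx g 1 * xx a t" if "g \<in> \<Phi>" "cn g a \<ge> 0" for g
    by (intro xx_commute[OF alpha]) (use that in auto)
  then show ?thesis by (simp add: Mset_def G_xx alpha)
qed

text \<open>The quotient y = x_a(-t) z commutes with every x_-a(s) and with x_\<delta>(1), where
  \<delta> = a + \<beta>, hence with the conjugate of x_-a(1) by x_\<delta>(1). The last two
  conditions on \<beta> make this conjugate a product of x_-a(1), a root element of \<beta> and
  possibly one of a + 2 \<beta>. As y commutes with the outer factors, it commutes with
  x_\<beta>(1).\<close>

lemma Mset_acts_like_root_element:
  assumes "long \<Phi> a" and zM: "z \<in> Mset a"
    and b: "\<beta> \<in> \<Phi>" "cn \<beta> a = -1" "2 *\<^sub>R a + 3 *\<^sub>R \<beta> \<notin> \<Phi>" "a + 3 *\<^sub>R \<beta> \<notin> \<Phi>"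
  shows "\<exists>t. cmm z (xx \<beta> 1) = cmm (xx a t) (xx \<beta> 1)"
proof -
  have zG: "z \<in> G" and zc: "\<And>g. g \<in> \<Phi> \<Longrightarrow> cn g a \<ge> 0 \<Longrightarrow> z * xx g 1 = xx g 1 * z"
    using zM by (auto simp: Mset_def)
  interpret long_point \<Phi> X a z by unfold_locales (use assms(1) zG G_GP in auto)
  obtain t where t: "\<And>k. Z (XR (- a) k) = xx a t * XR (- a) k * xx a (- t)"
    using Z_XR_like_root_element[OF _ rank] zc unfolding comm_def by blast
  define y where "y = xx a (- t) * z"
  have z: "z = xx a t * y" using xx_inverse(1)[OF alpha, of t] by (simp add: y_def flip: mult.assoc)
  have ya: "y * xx (- a) s = xx (- a) s * y" for s
  proof -
    have "z * xx (- a) s * adj z = xx a t * xx (- a) s * xx a (- t)"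
      using t unfolding Z_def xx_def[of "- a"] by (simp add: sum_distrib_left sum_distrib_right)
    then have "xx a (- t) * (z * xx (- a) s * adj z) * z = xx a (- t) * (xx a t * xx (- a) s * xx a (- t)) * z"
      by simp
    moreover have "xx a (- t) * (z * xx (- a) s * adj z) * z = y * xx (- a) s * (adj z * z)"
      by (simp add: y_def mult.assoc)
    moreover have "xx a (- t) * (xx a t * xx (- a) s * xx a (- t)) * z
        = (xx a (- t) * xx a t) * xx (- a) s * y" by (simp add: y_def mult.assoc)
    ultimately show ?thesis using G_inverse[OF zG] xx_inverse(2)[OF alpha, of t] by simp
  qed
  have yg: "y * xx g 1 = xx g 1 * y" if "g \<in> \<Phi>" "cn g a \<ge> 0" for g
  proof -
    have "xx a (- t) * xx g 1 = (xx g 1 * xx a (- t) :: ('r, 'n) sqm)"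
      using xx_Mset[OF assms(1), of "- t"] that by (simp add: Mset_def)
    from commutes_mult[OF this[symmetric] zc[OF that, symmetric]] show ?thesis by (simp add: y_def)
  qed
  \<comment> \<open>Parameter -1 gives the inverse of parameter 1, so the signs from the commutator
    relations do not affect commuting.\<close>
  have sign: "y * xx g (of_int e) = xx g (of_int e) * y \<longleftrightarrow> y * xx g 1 = xx g 1 * y"
    if "g \<in> \<Phi>" "e * e = 1" for g and e :: int
    using commutes_inverse[OF xx_inverse[OF that(1), of 1], of y]
      commutes_inverse[OF xx_inverse(2,1)[OF that(1), of 1], of y] that(2)
    by (auto simp: zmult_eq_1_iff)
  define \<delta> where "\<delta> = a + \<beta>"
  have "a \<bullet> \<beta> < 0" "\<beta> \<noteq> - a"
    using b(2) cn_sgn(1)[OF alpha, of \<beta>] cn_alpha by (auto simp: inner_commute)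
  then have d: "\<delta> \<in> \<Phi>" "cn \<delta> a = 1"
    using sum_root[OF alpha b(1)] b(2) cn_alpha by (simp_all add: \<delta>_def)
  have v: "- a + \<delta> = \<beta>" "- a + 2 *\<^sub>R \<delta> = a + 2 *\<^sub>R \<beta>" "- a + 3 *\<^sub>R \<delta> = 2 *\<^sub>R a + 3 *\<^sub>R \<beta>"
    "2 *\<^sub>R (- a) + 3 *\<^sub>R \<delta> = a + 3 *\<^sub>R \<beta>"
    by (rule inner_ext, simp add: \<delta>_def inner_simps)+
  have no: "- a - \<delta> \<notin> \<Phi>" "2 *\<^sub>R (- a) + \<delta> \<notin> \<Phi>"
    using grade_ge[of "- a - \<delta>"] grade_ge[of "2 *\<^sub>R (- a) + \<delta>"] d cn_alpha by auto
  have yd: "y * xx \<delta> 1 = xx \<delta> 1 * y" "y * xx \<delta> (-1) = xx \<delta> (-1) * y"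
    using yg[OF d(1)] sign[OF d(1), of "-1"] d(2) by simp_all
  have conj: "y * (xx \<delta> 1 * xx (- a) 1 * xx \<delta> (-1)) = (xx \<delta> 1 * xx (- a) 1 * xx \<delta> (-1)) * y"
    by (intro commutes_mult yd ya)
  note xma = xx_inverse(2)[OF minus_alpha, of 1]
  have yb: "y * xx \<beta> 1 = xx \<beta> 1 * y"
  proof (cases "a + 2 *\<^sub>R \<beta> \<in> \<Phi>")
    case True
    obtain e e' :: int where e: "e * e = 1" "e' * e' = 1"
      "\<And>t. xx \<delta> 1 * xx (- a) t * xx \<delta> (-1) = (xx (- a) t * xx \<beta> (of_int e * t) * xx (a + 2 *\<^sub>R \<beta>) (of_int e' * t) :: ('r, 'n) sqm)"
      by (rule conj_xx_2[of "- a" \<delta>, where 'r = 'r, unfolded v, OF minus_alpha d(1) b(1) True no(1) b(3) no(2) b(4)]) blast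
    have c0: "cn (a + 2 *\<^sub>R \<beta>) a \<ge> 0" using b(2) cn_alpha by simp
    have "y * xx (a + 2 *\<^sub>R \<beta>) (of_int e') = xx (a + 2 *\<^sub>R \<beta>) (of_int e') * y"
      using yg[OF True c0] sign[OF True e(2)] by simp
    from commutes_cancel_right[OF xx_inverse(1)[OF True] this conj[unfolded e(3), simplified]]
    have "y * (xx (- a) 1 * xx \<beta> (of_int e)) = xx (- a) 1 * xx \<beta> (of_int e) * y" by simp
    from commutes_cancel_left[OF xma ya this] show ?thesis using sign[OF b(1) e(1)] by simp
  next
    case False
    obtain e :: int where e: "e * e = 1"
      "\<And>t. xx \<delta> 1 * xx (- a) t * xx \<delta> (-1) = (xx (- a) t * xx \<beta> (of_int e * t) :: ('r, 'n) sqm)"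
      by (rule conj_xx_1[of "- a" \<delta>, where 'r = 'r, unfolded v, OF minus_alpha d(1) b(1) no(1) False no(2)]) blast
    have "y * (xx (- a) 1 * xx \<beta> (of_int e)) = xx (- a) 1 * xx \<beta> (of_int e) * y"
      using conj unfolding e(2) by simp
    from commutes_cancel_left[OF xma ya this] show ?thesis using sign[OF b(1) e(1)] by simp
  qed
  have "z * xx \<beta> 1 * adj z = xx a t * xx \<beta> 1 * xx a (- t)"
  proof -
    have "z * xx \<beta> 1 = xx a t * (y * xx \<beta> 1)" unfolding z by (simp add: mult.assoc)
    also have "\<dots> = xx a t * xx \<beta> 1 * xx a (- t) * z"
      unfolding yb by (simp add: y_def mult.assoc)
    finally have "z * xx \<beta> 1 * adj z = xx a t * xx \<beta> 1 * xx a (- t) * (z * adj z)"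
      by (simp add: mult.assoc)
    then show ?thesis using G_inverse[OF zG] by simp
  qed
  then have "cmm z (xx \<beta> 1) = cmm (xx a t) (xx \<beta> 1)" by (simp add: cmm_def adj_xx alpha)
  then show ?thesis ..
qed

text \<open>Words in \<open>[z, x\<^sub>b(1)]\<close> take the same values on \<open>Mset a\<close> as on the root subgroup of \<open>a\<close>.\<close>

lemma dph_from_Mset:
  assumes "long \<Phi> a"
    and b: "b \<in> \<Phi>" "cn b a = -1" "2 *\<^sub>R a + 3 *\<^sub>R b \<notin> \<Phi>" "a + 3 *\<^sub>R b \<notin> \<Phi>"
    and f: "wm (\<lambda>z. f (cmm z (xx b 1)))"
  shows "dph (range (\<lambda>t. f (cmm (xx a t) (xx b 1))))"
proof -
  have "(\<lambda>z. f (cmm z (xx b 1))) ` Mset a = range (\<lambda>t. f (cmm (xx a t) (xx b 1)))"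
  proof (rule Set.set_eqI, rule iffI)
    fix y assume "y \<in> (\<lambda>z. f (cmm z (xx b 1))) ` Mset a"
    then show "y \<in> range (\<lambda>t. f (cmm (xx a t) (xx b 1)))"
      using Mset_acts_like_root_element[OF assms(1) _ b] by fastforce
  next
    fix y assume "y \<in> range (\<lambda>t. f (cmm (xx a t) (xx b 1)))"
    then show "y \<in> (\<lambda>z. f (cmm z (xx b 1))) ` Mset a" using xx_Mset[OF assms(1)] by auto
  qed
  then show ?thesis using dph_image[OF dph_Mset[of a] f] by simp
qed

end

section \<open>Root systems without a component of type \<open>G\<^sub>2\<close>\<close>

text \<open>Multiplication by a sign permutes the ring.\<close>

lemma range_sign:
  fixes e :: int
  assumes "e * e = 1"
  shows "range (\<lambda>t :: 'r::comm_ring_1. f (of_int e * t)) = range f"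
proof -
  have "of_int e * (of_int e * t) = (t :: 'r)" for t
    using assms by (simp flip: mult.assoc of_int_mult)
  then have "f t \<in> range (\<lambda>t. f (of_int e * t))" for t
    using rangeI[of "\<lambda>t. f (of_int e * t)" "of_int e * t"] by simp
  then show ?thesis by auto
qed

context roots
begin

lemma not_root_if_longer: "long \<Phi> a \<Longrightarrow> v \<bullet> v > a \<bullet> a \<Longrightarrow> v \<notin> \<Phi>"
  unfolding long_def by fastforce

lemma cn_eq_iff: "a \<in> \<Phi> \<Longrightarrow> cn b a = c \<longleftrightarrow> 2 * (a \<bullet> b) = c * (a \<bullet> a)"
  using inner_pos[of a] by (auto simp: cartan_number_def field_simps inner_commute)

text \<open>As one Cartan integer is -1, the other is minus the ratio of the squared lengths, and
  the product of the two is below 4.\<close>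

lemma length_ratio:
  assumes l: "long \<Phi> a" and b: "b \<in> \<Phi>" "cn b a = -1"
  shows "cn a b = -1 \<and> a \<bullet> a = b \<bullet> b \<or> cn a b = -2 \<and> a \<bullet> a = 2 * (b \<bullet> b) \<or> cn a b = -3 \<and> a \<bullet> a = 3 * (b \<bullet> b)"
proof -
  have a: "a \<in> \<Phi>" using l by (simp add: long_def)
  have ne: "b \<noteq> a" "b \<noteq> - a" using b(2) root_nz[OF a] by auto
  have p: "2 * (a \<bullet> b) = - (a \<bullet> a)" using b(2) cn_eq_iff[OF a] by simp
  have "cn a b > -4" using cn_prod_less[OF a b(1) ne] b(2) by simp
  moreover have "cn a b < 0" using cn_sgn(1)[OF b(1), of a] p inner_pos[OF a] by simp
  moreover obtain k :: int where k: "cn a b = of_int k"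
    using cn_Ints[OF b(1) a] by (auto elim: Ints_cases)
  ultimately have "k = -1 \<or> k = -2 \<or> k = -3" by (simp add: k) linarith
  moreover have "a \<bullet> a = - of_int k * (b \<bullet> b)"
    using p k cn_eq_iff[OF b(1), of a] by (simp add: inner_commute)
  ultimately show ?thesis using k by auto
qed

text \<open>The B2 plane spanned by a and \<sigma>. The excluded vectors all have squared length 5
  times that of \<sigma>, more than a long root.\<close>

lemma ratio_2_plane:
  assumes l: "long \<Phi> a" and s: "\<sigma> \<in> \<Phi>" "cn \<sigma> a = -1" "a \<bullet> a = 2 * (\<sigma> \<bullet> \<sigma>)"
  shows "a \<in> \<Phi>" "a \<bullet> \<sigma> = - (\<sigma> \<bullet> \<sigma>)" "\<sigma> \<bullet> \<sigma> > 0" "a + \<sigma> \<in> \<Phi>" "a + 2 *\<^sub>R \<sigma> \<in> \<Phi>"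
    "a \<bullet> (a + 2 *\<^sub>R \<sigma>) = 0" "(a + 2 *\<^sub>R \<sigma>) \<bullet> (a + 2 *\<^sub>R \<sigma>) = a \<bullet> a" "rfl \<sigma> a = a + 2 *\<^sub>R \<sigma>"
    "a - \<sigma> \<notin> \<Phi>" "a + 3 *\<^sub>R \<sigma> \<notin> \<Phi>" "2 *\<^sub>R a + \<sigma> \<notin> \<Phi>" "2 *\<^sub>R a + 3 *\<^sub>R \<sigma> \<notin> \<Phi>"
proof -
  show a: "a \<in> \<Phi>" and pos: "\<sigma> \<bullet> \<sigma> > 0"
    using l inner_pos s by (auto simp: long_def)
  show p: "a \<bullet> \<sigma> = - (\<sigma> \<bullet> \<sigma>)" using s cn_eq_iff[OF a] by simp
  have c: "cn a \<sigma> = -2" using cn_eq_iff[OF s(1)] p by (simp add: inner_commute)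
  show r: "rfl \<sigma> a = a + 2 *\<^sub>R \<sigma>" by (simp add: rfl_def c)
  show "a + 2 *\<^sub>R \<sigma> \<in> \<Phi>" using rfl_root[OF a s(1)] by (simp add: r)
  have "\<sigma> \<noteq> - a" using s pos by auto
  then show "a + \<sigma> \<in> \<Phi>" using sum_root[OF a s(1)] p pos by simp
  show "a - \<sigma> \<notin> \<Phi>" "a + 3 *\<^sub>R \<sigma> \<notin> \<Phi>" "2 *\<^sub>R a + \<sigma> \<notin> \<Phi>" "2 *\<^sub>R a + 3 *\<^sub>R \<sigma> \<notin> \<Phi>"
    by (rule not_root_if_longer[OF l], use pos in \<open>simp add: inner_simps p s inner_commute[of \<sigma> a]\<close>)+
  show "a \<bullet> (a + 2 *\<^sub>R \<sigma>) = 0" "(a + 2 *\<^sub>R \<sigma>) \<bullet> (a + 2 *\<^sub>R \<sigma>) = a \<bullet> a"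
    using p s(3) by (simp_all add: inner_simps inner_commute[of \<sigma> a])
qed

lemma nonorthogonal_long:
  assumes l: "long \<Phi> a" and b: "b \<in> \<Phi>" "b \<noteq> a" "b \<noteq> - a" "b \<bullet> a \<noteq> 0"
  shows "cn b a = -1 \<or> cn (- b) a = -1"
  using long_cn[OF l b(1,2,3)] b(4) cn_sgn(3)[of a b] l by (auto simp: long_def)

end

context chev
begin

lemma cmm_eq: "cmm a b = a * (b * adj a * adj b)"
  by (simp add: cmm_def mult.assoc)

lemma cmm_xx_1:
  assumes ab: "a \<in> \<Phi>" "b \<in> \<Phi>" "a + b \<in> \<Phi>" "a - b \<notin> \<Phi>" "a + 2 *\<^sub>R b \<notin> \<Phi>" "2 *\<^sub>R a + b \<notin> \<Phi>"
  obtains e :: int where "e * e = 1"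
    "\<And>t :: 'r::comm_ring_1. xx b 1 * xx a t * xx b (-1) = xx a t * xx (a + b) (of_int e * t)"
    "\<And>t :: 'r. cmm (xx a t) (xx b 1) = xx (a + b) (- of_int e * t)"
proof -
  obtain e :: int where e: "e * e = 1"
    "\<And>t :: 'r. xx b 1 * xx a t * xx b (-1) = xx a t * xx (a + b) (of_int e * t)"
    by (rule conj_xx_1[OF ab, where 'r = 'r]) blast
  have "cmm (xx a t) (xx b 1) = xx (a + b) (- of_int e * t)" for t :: 'r
    using xx_inverse(1)[OF ab(1), of t] by (simp add: cmm_eq adj_xx ab e(2)) (simp flip: mult.assoc)
  with e show ?thesis using that by blast
qed

lemma cmm_xx_2:
  assumes ab: "a \<in> \<Phi>" "b \<in> \<Phi>" "a + b \<in> \<Phi>" "a + 2 *\<^sub>R b \<in> \<Phi>"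
    and no: "a - b \<notin> \<Phi>" "a + 3 *\<^sub>R b \<notin> \<Phi>" "2 *\<^sub>R a + b \<notin> \<Phi>" "2 *\<^sub>R a + 3 *\<^sub>R b \<notin> \<Phi>"
  obtains e e' :: int where "e * e = 1" "e' * e' = 1"
    "\<And>t :: 'r::comm_ring_1. cmm (xx a t) (xx b 1) = xx (a + b) (- of_int e * t) * xx (a + 2 *\<^sub>R b) (- of_int e' * t)"
proof -
  obtain e e' :: int where e: "e * e = 1" "e' * e' = 1"
    "\<And>t :: 'r. xx b 1 * xx a t * xx b (-1)
      = xx a t * xx (a + b) (of_int e * t) * xx (a + 2 *\<^sub>R b) (of_int e' * t)"
    by (rule conj_xx_2[OF ab no, where 'r = 'r]) blast
  have "cmm (xx a t) (xx b 1) = xx (a + b) (- of_int e * t) * xx (a + 2 *\<^sub>R b) (- of_int e' * t)" for t :: 'r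
    using xx_inverse(1)[OF ab(1), of t] by (simp add: cmm_eq adj_xx ab e(3)) (simp flip: mult.assoc)
  with e(1,2) show ?thesis using that by blast
qed

end

context large_group
begin

section \<open>Passing between root subgroups\<close>

definition D :: "'e \<Rightarrow> bool" where
  "D g \<longleftrightarrow> g \<in> \<Phi> \<and> dph (range (xx g))"

lemma G_adj_unique: "z \<in> G \<Longrightarrow> z * y = 1 \<Longrightarrow> adj z = y"
  using adj_unique G_GP by blast

lemma D_sign:
  fixes e :: int
  assumes "g \<in> \<Phi>" "e * e = 1" "dph (range (\<lambda>t. xx g (of_int e * t)))"
  shows "D g"
  using assms range_sign[OF assms(2), of "xx g :: 'r \<Rightarrow> ('r, 'n) sqm"] by (simp add: D_def)

text \<open>Weyl elements are words in the constants, so conjugation by them is a word map.\<close>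

lemma D_rfl:
  assumes "D g" "b \<in> \<Phi>"
  shows "D (rfl b g)"
proof -
  have g: "g \<in> \<Phi>" "dph (range (xx g))" using assms(1) by (simp_all add: D_def)
  obtain e :: int where e: "\<And>t :: 'r. ww b * xx g t * wi b = xx (rfl b g) (of_int e * t)" "e * e = 1"
    by (rule ww_xx[OF assms(2) g(1), where 'r = 'r]) blast
  have "dph ((\<lambda>z. ww b * z * wi b) ` range (xx g))"
    by (rule dph_image[OF g(2)]) (intro wmI assms)
  then show ?thesis using D_sign[OF rfl_root[OF g(1) assms(2)] e(2)] by (simp add: image_image e(1))
qed

lemma D_same_length: "D g \<Longrightarrow> d \<in> \<Phi> \<Longrightarrow> d \<bullet> d = g \<bullet> g \<Longrightarrow> D d"
  using rfl_closed_same_length[of "{g. D g}" g d] D_rfl by (auto simp: D_def)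

text \<open>In the A2 system generated by two long roots at 120 degrees the commutator is a single
  root element, and all roots of this length then follow by reflections.\<close>

lemma D_long:
  assumes l: "long \<Phi> a" "long \<Phi> b" and c: "cn b a = -1" and g: "long \<Phi> g"
  shows "D g"
proof -
  have r: "a \<in> \<Phi>" "b \<in> \<Phi>" and n: "b \<bullet> b = a \<bullet> a"
    using l by (auto simp: long_def intro: antisym)
  have p: "a \<bullet> b = - (a \<bullet> a) / 2" and pos: "a \<bullet> a > 0"
    using c cn_eq_iff[OF r(1)] inner_pos[OF r(1)] by simp_all
  note simps = inner_simps n p inner_commute[of b a]
  have "b \<noteq> - a" using p pos by auto
  then have ab: "a + b \<in> \<Phi>" using sum_root[OF r] p pos by simp
  have no: "2 *\<^sub>R a + 3 *\<^sub>R b \<notin> \<Phi>" "a + 3 *\<^sub>R b \<notin> \<Phi>"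
    "a - b \<notin> \<Phi>" "a + 2 *\<^sub>R b \<notin> \<Phi>" "2 *\<^sub>R a + b \<notin> \<Phi>"
    by (rule not_root_if_longer[OF l(1)], use pos in \<open>simp add: simps\<close>)+
  obtain e :: int where e: "e * e = 1" "\<And>t :: 'r. cmm (xx a t) (xx b 1) = xx (a + b) (- of_int e * t)"
    by (rule cmm_xx_1[OF r ab no(3-5), where 'r = 'r]) blast
  have "dph (range (\<lambda>t. cmm (xx a t) (xx b 1)))"
    by (rule dph_from_Mset[OF l(1) r(2) c no(1,2), of "\<lambda>z. z"]) (intro wmI r)
  then have "D (a + b)" using D_sign[OF ab, of "- e"] e by simp
  then show ?thesis
    by (rule D_same_length) (use g l(1) n in \<open>auto simp: long_def simps intro: antisym\<close>)
qed

context
  fixes \<alpha> \<sigma> :: 'e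
  assumes l: "long \<Phi> \<alpha>" and s: "\<sigma> \<in> \<Phi>" "cn \<sigma> \<alpha> = -1" "\<alpha> \<bullet> \<alpha> = 2 * (\<sigma> \<bullet> \<sigma>)"
begin

lemma cmm_ratio_2:
  obtains e e' :: int where "e * e = 1" "e' * e' = 1"
    "\<And>t :: 'r. cmm (xx \<alpha> t) (xx \<sigma> 1) = xx (\<alpha> + \<sigma>) (- of_int e * t) * xx (\<alpha> + 2 *\<^sub>R \<sigma>) (- of_int e' * t)"
  by (rule cmm_xx_2[OF ratio_2_plane(1)[OF l s] s(1) ratio_2_plane(4,5,9-12)[OF l s], where 'r = 'r]) blast

text \<open>The commutator of x_\<alpha>(t) with x_\<sigma>(1) has factors at \<alpha> + \<sigma>
  and \<alpha> + 2 \<sigma>. The second is, up to inversion, the conjugate of x_\<alpha>(t) by the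
  Weyl element of \<sigma>. It can be cancelled because x_\<alpha>(t) itself, not only its
  commutators, ranges over a Diophantine set here.\<close>

lemma D_short_if_long:
  assumes "D \<alpha>"
  shows "D \<sigma>"
proof -
  note f = ratio_2_plane[OF l s]
  obtain e e' :: int where e: "e * e = 1" "e' * e' = 1"
    "\<And>t :: 'r. cmm (xx \<alpha> t) (xx \<sigma> 1) = xx (\<alpha> + \<sigma>) (- of_int e * t) * xx (\<alpha> + 2 *\<^sub>R \<sigma>) (- of_int e' * t)"
    by (rule cmm_ratio_2) blast
  obtain d :: int where d: "\<And>t :: 'r. ww \<sigma> * xx \<alpha> t * wi \<sigma> = xx (\<alpha> + 2 *\<^sub>R \<sigma>) (of_int d * t)" "d * d = 1"
    by (rule ww_xx[OF s(1) f(1), where 'r = 'r]) (simp add: f(8))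
  have "\<exists>h. wm h \<and> (\<forall>t. h (xx \<alpha> t) = xx (\<alpha> + \<sigma>) (- of_int e * t))"
  proof (cases "d = e'")
    case True
    have "wm (\<lambda>z. cmm z (xx \<sigma> 1) * (ww \<sigma> * z * wi \<sigma>))" by (intro wmI s)
    moreover have "cmm (xx \<alpha> t) (xx \<sigma> 1) * (ww \<sigma> * xx \<alpha> t * wi \<sigma>) = xx (\<alpha> + \<sigma>) (- of_int e * t)" for t :: 'r
      unfolding e(3) d(1) True using xx_inverse(2)[OF f(5), of "of_int e' * t"] by (simp add: mult.assoc)
    ultimately show ?thesis by blast
  next
    case False
    then have "d = - e'" using e(2) d(2) by (auto simp: zmult_eq_1_iff)
    have "wm (\<lambda>z. cmm z (xx \<sigma> 1) * adj (ww \<sigma> * z * wi \<sigma>))"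
      by (intro wmI s)
    moreover have "cmm (xx \<alpha> t) (xx \<sigma> 1) * adj (ww \<sigma> * xx \<alpha> t * wi \<sigma>) = xx (\<alpha> + \<sigma>) (- of_int e * t)" for t :: 'r
      unfolding e(3) d(1) \<open>d = - e'\<close> using xx_inverse(2)[OF f(5), of "of_int e' * t"]
      by (simp add: mult.assoc adj_xx f(5))
    ultimately show ?thesis by blast
  qed
  then obtain h where h: "wm h" "\<And>t. h (xx \<alpha> t) = xx (\<alpha> + \<sigma>) (- of_int e * t)"
    by blast
  have "dph (h ` range (xx \<alpha>))"
    by (rule dph_image[OF _ h(1)]) (use assms in \<open>simp add: D_def\<close>)
  then have "D (\<alpha> + \<sigma>)"
    using D_sign[OF f(4), of "- e"] e(1) by (simp add: image_image h(2))
  then show ?thesis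
    by (rule D_same_length[OF _ s(1)]) (simp add: inner_simps f(2) s(3) inner_commute[of \<sigma> \<alpha>])
qed

text \<open>Only the commutator C(t), with factors at b = \<alpha> + \<sigma> and \<alpha>' =
  \<alpha> + 2 \<sigma>, is available. Since x_\<gamma>(1) commutes with the factor at \<alpha>',
  the commutator of C(t) with it isolates b + \<gamma>. A further commutator with x_-\<gamma>(1)
  leads back to b, and this factor is then divided out of C(t).\<close>

lemma D_orthogonal_long:
  assumes g: "\<gamma> \<in> \<Phi>" "\<gamma> \<bullet> \<gamma> = \<sigma> \<bullet> \<sigma>" "\<gamma> \<bullet> \<alpha> = - (\<sigma> \<bullet> \<sigma>)" "\<gamma> \<bullet> (\<alpha> + 2 *\<^sub>R \<sigma>) = 0"
  shows "D \<alpha>" "D \<sigma>"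
proof -
  note f = ratio_2_plane[OF l s]
  define b where "b = \<alpha> + \<sigma>"
  define \<alpha>' where "\<alpha>' = \<alpha> + 2 *\<^sub>R \<sigma>"
  have b: "b \<in> \<Phi>" and a': "\<alpha>' \<in> \<Phi>"
    using f by (simp_all add: b_def \<alpha>'_def)
  have gs: "\<gamma> \<bullet> \<sigma> = (\<sigma> \<bullet> \<sigma>) / 2"
    using g by (simp add: inner_simps)
  note ips = inner_simps f(2) s(3) g(2,3) gs inner_commute[of \<sigma> \<alpha>] inner_commute[of \<alpha> \<gamma>] inner_commute[of \<sigma> \<gamma>]
  have bg: "b \<bullet> \<gamma> = - (\<sigma> \<bullet> \<sigma>) / 2" by (simp add: b_def ips)
  have "\<gamma> \<noteq> - b"
  proof
    assume "\<gamma> = - b"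
    then have "b \<bullet> \<gamma> = - (\<gamma> \<bullet> \<gamma>)" by simp
    then show False using bg g(2) f(3) by simp
  qed
  then have bgr: "b + \<gamma> \<in> \<Phi>" using sum_root[OF b g(1)] bg f(3) by simp
  have longer: "b - \<gamma> \<notin> \<Phi>" "b + 2 *\<^sub>R \<gamma> \<notin> \<Phi>" "2 *\<^sub>R b + \<gamma> \<notin> \<Phi>" "\<gamma> + \<alpha>' \<notin> \<Phi>"
    by (rule not_root_if_longer[OF l], use f(3) in \<open>simp add: b_def \<alpha>'_def ips\<close>)+
  have nz: "\<gamma> + \<alpha>' \<noteq> 0"
  proof
    assume "\<gamma> + \<alpha>' = 0"
    then have "(\<gamma> + \<alpha>') \<bullet> \<gamma> = 0" by simp
    then show False using g f(3) by (simp add: \<alpha>'_def ips)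
  qed
  obtain e e' :: int where e: "e * e = 1" "e' * e' = 1"
    "\<And>t :: 'r. cmm (xx \<alpha> t) (xx \<sigma> 1) = xx b (- of_int e * t) * xx \<alpha>' (- of_int e' * t)"
    unfolding b_def \<alpha>'_def by (rule cmm_ratio_2) blast
  obtain p :: int where p: "p * p = 1"
    "\<And>t :: 'r. xx \<gamma> 1 * xx b t * xx \<gamma> (-1) = xx b t * xx (b + \<gamma>) (of_int p * t)"
    by (rule cmm_xx_1[OF b g(1) bgr longer(1-3), where 'r = 'r]) blast
  have v: "b + \<gamma> + - \<gamma> = b" "b + \<gamma> - - \<gamma> = b + 2 *\<^sub>R \<gamma>" "b + \<gamma> + 2 *\<^sub>R (- \<gamma>) = b - \<gamma>"
    "2 *\<^sub>R (b + \<gamma>) + - \<gamma> = 2 *\<^sub>R b + \<gamma>"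
    by (rule inner_ext, simp add: inner_simps)+
  obtain q :: int where q: "q * q = 1"
    "\<And>t :: 'r. cmm (xx (b + \<gamma>) t) (xx (- \<gamma>) 1) = xx b (- of_int q * t)"
    by (rule cmm_xx_1[of "b + \<gamma>" "- \<gamma>", where 'r = 'r, unfolded v,
          OF bgr neg_root[OF g(1)] b longer(2,1,3)]) blast
  define C where "C t = cmm (xx \<alpha> t) (xx \<sigma> 1 :: ('r, 'n) sqm)" for t
  have CG: "C t \<in> G" for t unfolding C_def cmm_def using G_mult G_adj G_xx f(1) s(1) by simp
  have adjC: "adj (C t) = xx \<alpha>' (of_int e' * t) * xx b (of_int e * t)" for t
  proof (rule G_adj_unique[OF CG])
    have "C t * (xx \<alpha>' (of_int e' * t) * xx b (of_int e * t))
        = xx b (- (of_int e * t)) * (xx \<alpha>' (- (of_int e' * t)) * xx \<alpha>' (of_int e' * t)) * xx b (of_int e * t)"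
      by (simp add: C_def e(3) mult.assoc)
    then show "C t * (xx \<alpha>' (of_int e' * t) * xx b (of_int e * t)) = 1"
      using xx_inverse(2)[OF a', of "of_int e' * t"] xx_inverse(2)[OF b, of "of_int e * t"] by simp
  qed
  have R: "cmm (C t) (xx \<gamma> 1) = xx (b + \<gamma>) (of_int (p * e) * t)" for t
  proof -
    have "xx \<gamma> 1 * adj (C t) * adj (xx \<gamma> 1)
        = xx \<gamma> 1 * xx \<alpha>' (of_int e' * t) * (xx b (of_int e * t) * xx \<gamma> (-1))"
      by (simp add: adjC adj_xx g(1) mult.assoc)
    also have "\<dots> = xx \<alpha>' (of_int e' * t) * (xx \<gamma> 1 * xx b (of_int e * t) * xx \<gamma> (-1))"
      unfolding xx_commute[OF g(1) a' longer(4) nz] by (simp add: mult.assoc)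
    also have "\<dots> = adj (C t) * xx (b + \<gamma>) (of_int (p * e) * t)"
      by (simp only: p(2)) (simp add: adjC mult.assoc)
    finally show ?thesis using G_inverse(1)[OF CG] by (simp add: cmm_eq flip: mult.assoc)
  qed
  have "dph (range (\<lambda>t. cmm (C t) (xx \<gamma> 1)))"
    unfolding C_def by (rule dph_from_Mset[OF l s(1,2) f(12,10)]) (intro wmI s g)
  then have "D (b + \<gamma>)"
    using D_sign[OF bgr, of "p * e"] e(1) p(1) by (simp add: R mult.assoc mult.left_commute)
  then show "D \<sigma>" by (rule D_same_length[OF _ s(1)]) (simp add: b_def ips)
  have Q: "cmm (cmm (C t) (xx \<gamma> 1)) (xx (- \<gamma>) 1) = xx b (- of_int (q * p) * (of_int e * t))" for t
    unfolding R q(2) by (simp add: mult.assoc)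
  have Ct: "C t = xx b (- (of_int e * t)) * xx \<alpha>' (- of_int e' * t)" for t
    by (simp add: C_def e(3))
  \<comment> \<open>The recovered element at b equals the factor of C(t) or its inverse, depending
    on the sign q p.\<close>
  have "\<exists>h. wm (\<lambda>z. h (cmm z (xx \<sigma> 1))) \<and> (\<forall>t. h (C t) = xx \<alpha>' (- of_int e' * t))"
  proof (cases "q * p = 1")
    case True
    have "wm (\<lambda>z. adj (cmm (cmm (cmm z (xx \<sigma> 1)) (xx \<gamma> 1)) (xx (- \<gamma>) 1)) * cmm z (xx \<sigma> 1))"
      by (intro wmI s g neg_root)
    moreover have "adj (cmm (cmm (C t) (xx \<gamma> 1)) (xx (- \<gamma>) 1)) * C t = xx \<alpha>' (- of_int e' * t)" for t
      unfolding Q True using xx_inverse(1)[OF b, of "of_int e * t"]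
      by (simp add: adj_xx b Ct flip: mult.assoc)
    ultimately show ?thesis
      by (intro exI[of _ "\<lambda>z. adj (cmm (cmm z (xx \<gamma> 1)) (xx (- \<gamma>) 1)) * z"]) blast
  next
    case False
    then have m: "q * p = -1" using q(1) p(1) by (auto simp: zmult_eq_1_iff)
    have "wm (\<lambda>z. cmm (cmm (cmm z (xx \<sigma> 1)) (xx \<gamma> 1)) (xx (- \<gamma>) 1) * cmm z (xx \<sigma> 1))"
      by (intro wmI s g neg_root)
    moreover have "cmm (cmm (C t) (xx \<gamma> 1)) (xx (- \<gamma>) 1) * C t = xx \<alpha>' (- of_int e' * t)" for t
      unfolding Q m using xx_inverse(1)[OF b, of "of_int e * t"] by (simp add: Ct flip: mult.assoc)
    ultimately show ?thesis
      by (intro exI[of _ "\<lambda>z. cmm (cmm z (xx \<gamma> 1)) (xx (- \<gamma>) 1) * z"]) blast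
  qed
  then obtain h where h: "wm (\<lambda>z. h (cmm z (xx \<sigma> 1)))" "\<And>t. h (C t) = xx \<alpha>' (- of_int e' * t)"
    by blast
  have "dph (range (\<lambda>t. h (C t)))"
    unfolding C_def by (rule dph_from_Mset[OF l s(1,2) f(12,10) h(1)])
  then have "D \<alpha>'" using D_sign[OF a', of "- e'"] e(2) by (simp add: h(2))
  then show "D \<alpha>" by (rule D_same_length[OF _ f(1)]) (simp add: \<alpha>'_def ips)
qed

end

text \<open>Long roots are closed under reflections, so every root is non-orthogonal to some long
  root. With the ratio 3 excluded, a shorter root spans a B2 plane with it.\<close>

lemma D_if_D_long:
  assumes no3: "\<And>\<alpha> \<sigma>. \<alpha> \<in> \<Phi> \<Longrightarrow> \<sigma> \<in> \<Phi> \<Longrightarrow> cn \<alpha> \<sigma> \<noteq> -3"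
    and D: "\<And>g. long \<Phi> g \<Longrightarrow> D g" and g: "g \<in> \<Phi>"
  shows "D g"
proof (cases "long \<Phi> g")
  case False
  obtain \<alpha>0 where a0: "long \<Phi> \<alpha>0" using exists_long g by blast
  have "\<exists>\<delta>\<in>{\<delta> \<in> \<Phi>. long \<Phi> \<delta>}. \<delta> \<bullet> g \<noteq> 0"
    by (rule rfl_closed_not_orthogonal) (use a0 g rfl_inner rfl_root in \<open>auto simp: long_def\<close>)
  then obtain \<delta> where d: "long \<Phi> \<delta>" "\<delta> \<bullet> g \<noteq> 0" by blast
  have dr: "\<delta> \<in> \<Phi>" and dm: "long \<Phi> (- \<delta>)"
    using d(1) by (auto simp: long_def)
  have ne: "g \<noteq> \<delta>" "g \<noteq> - \<delta>" using False d(1) dm by auto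
  obtain \<epsilon> where e: "long \<Phi> \<epsilon>" "cn g \<epsilon> = -1"
  proof (cases "cn g \<delta> = -1")
    case False
    then have "cn (- g) \<delta> = -1"
      using nonorthogonal_long[OF d(1) g ne] d(2) by (auto simp: inner_commute)
    then have "cn g (- \<delta>) = -1" by simp
    then show ?thesis using dm that by blast
  qed (use d(1) that in blast)
  have "\<epsilon> \<bullet> \<epsilon> \<noteq> g \<bullet> g"
    using False e(1) g by (auto simp: long_def)
  then have "\<epsilon> \<bullet> \<epsilon> = 2 * (g \<bullet> g)"
    using length_ratio[OF e(1) g e(2)] no3[of \<epsilon> g] g e(1) by (auto simp: long_def)
  then show ?thesis using D_short_if_long[OF e(1) g e(2)] D[OF e(1)] by blast
qed (use D in blast)

end

context irreducible_roots
begin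

context
  fixes \<alpha> \<sigma> :: 'a
  assumes l: "long \<Phi> \<alpha>" and s: "\<sigma> \<in> \<Phi>" "cn \<sigma> \<alpha> = -1" "\<alpha> \<bullet> \<alpha> = 2 * (\<sigma> \<bullet> \<sigma>)"
begin

text \<open>The orthogonal long roots \<alpha> and \<alpha> + 2 \<sigma> give the axes, scaled to
  length 2. In these coordinates every root has integers x, y with x^2 + y^2 \<le> 4, and the
  vectors with just one nonzero coordinate equal to 1 or -1 are halves of roots.\<close>

lemma C2_if_plane:
  assumes sub: "\<Phi> \<subseteq> span {\<alpha>, \<sigma>}"
  shows "root_system_iso \<Phi> C2"
proof -
  note f = ratio_2_plane[OF l s]
  define \<alpha>' where "\<alpha>' = \<alpha> + 2 *\<^sub>R \<sigma>"
  define a where "a = \<alpha> \<bullet> \<alpha>"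
  have a: "a > 0" "\<alpha>' \<bullet> \<alpha>' = a" "\<alpha> \<bullet> \<alpha>' = 0" "\<alpha>' \<bullet> \<alpha> = 0" "\<alpha> \<bullet> \<alpha> = a"
    using f s(3) unfolding a_def \<alpha>'_def by (auto simp: inner_commute)
  have a': "\<alpha>' \<in> \<Phi>" using f by (simp add: \<alpha>'_def)
  have sg: "\<sigma> = (1/2) *\<^sub>R \<alpha>' - (1/2) *\<^sub>R \<alpha>"
    by (simp add: \<alpha>'_def scaleR_add_right)
  define q where "q v = (2 / a * (v \<bullet> \<alpha>), 2 / a * (v \<bullet> \<alpha>'))" for v
  define r where "r p = (fst p / 2) *\<^sub>R \<alpha> + (snd p / 2) *\<^sub>R \<alpha>'" for p
  have q_r: "q (r p) = p" for p using a by (simp add: q_def r_def inner_simps prod_eq_iff)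
  have lin: "linear q" unfolding q_def by (rule linearI) (simp_all add: inner_simps algebra_simps)
  have linr: "linear r"
    unfolding r_def by (rule linearI) (simp_all add: algebra_simps add_divide_distrib)
  have r_q: "r (q v) = v" for v
  proof -
    have "v \<in> span {\<alpha>, \<sigma>}"
      using span_roots span_minimal[OF sub subspace_span] by auto
    then obtain c where "v - c *\<^sub>R \<alpha> \<in> span {\<sigma>}"
      unfolding span_insert[of \<alpha>] by blast
    then obtain d where "v - c *\<^sub>R \<alpha> = d *\<^sub>R \<sigma>"
      unfolding span_singleton by blast
    then have v: "v = c *\<^sub>R \<alpha> + d *\<^sub>R \<sigma>"
      by (metis add.commute diff_add_cancel)
    have "v = r (2 * c - d, d)"
      unfolding v r_def by (subst sg) (simp add: scaleR_diff_right scaleR_diff_left diff_divide_distrib)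
    then show ?thesis using q_r[of "(2 * c - d, d)"] by simp
  qed
  have bij: "bij q" by (rule o_bij[of r]) (auto simp: q_r r_q)
  have inner: "q v \<bullet> q w = 4 / a * (v \<bullet> w)" for v w
  proof -
    have "v \<bullet> w = r (q v) \<bullet> r (q w)" by (simp add: r_q)
    also have "\<dots> = a / 4 * (q v \<bullet> q w)"
      unfolding r_def by (simp add: inner_add_left inner_add_right a inner_prod_def algebra_simps)
    finally show ?thesis using a(1) by (simp add: field_simps)
  qed
  have cnq: "cn (q v) (q w) = cn v w" for v w using a(1) by (simp add: cartan_number_def inner)
  have qa: "q \<alpha> = (2, 0)" "q \<alpha>' = (0, 2)" using a by (simp_all add: q_def)
  have "q ` \<Phi> = C2"
  proof
    have "q \<sigma> = (-1, 1)"
      by (subst sg) (simp add: linear_diff[OF lin] linear_scale[OF lin] qa)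
    then have "C2 = q ` {\<alpha>, - \<alpha>, \<alpha>', - \<alpha>', \<alpha> + \<sigma>, - \<sigma>, \<sigma>, - (\<alpha> + \<sigma>)}"
      unfolding C2_def image_insert linear_neg[OF lin] linear_add[OF lin] qa by simp
    moreover have "{\<alpha>, - \<alpha>, \<alpha>', - \<alpha>', \<alpha> + \<sigma>, - \<sigma>, \<sigma>, - (\<alpha> + \<sigma>)} \<subseteq> \<Phi>"
      using f(1,4) s(1) a' neg_root_iff[of "\<alpha> + \<sigma>"] by (simp del: minus_add_distrib)
    ultimately show "C2 \<subseteq> q ` \<Phi>" by (metis image_mono)
    show "q ` \<Phi> \<subseteq> C2"
    proof
      fix p assume "p \<in> q ` \<Phi>"
      then obtain \<gamma> where g: "\<gamma> \<in> \<Phi>" "p = q \<gamma>" by blast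
      obtain x y :: int where xy: "cn \<gamma> \<alpha> = of_int x" "cn \<gamma> \<alpha>' = of_int y"
        using cn_Ints[OF f(1) g(1)] cn_Ints[OF a' g(1)] by (metis Ints_cases)
      have p: "p = (of_int x, of_int y)" using a xy by (simp add: g(2) q_def cartan_number_def)
      have gr: "\<gamma> = r (of_int x, of_int y)" using r_q[of \<gamma>] p g(2) by simp
      have "4 / a * (\<gamma> \<bullet> \<gamma>) = of_int (x * x + y * y)"
        using inner[of \<gamma> \<gamma>] p g(2) by (simp add: inner_prod_def)
      moreover have "4 / a * (\<gamma> \<bullet> \<gamma>) \<le> 4"
        using l g(1) a(1) by (simp add: long_def field_simps a_def)
      ultimately have xy4: "x * x + y * y \<le> 4" by linarith
      have "\<bar>x\<bar> \<le> 2" "\<bar>y\<bar> \<le> 2"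
      proof -
        have "x * x \<le> 4" "y * y \<le> 4" using xy4 by (smt (verit) zero_le_square)+
        then show "\<bar>x\<bar> \<le> 2" "\<bar>y\<bar> \<le> 2"
          using abs_le_square_iff[of x 2] abs_le_square_iff[of y 2] by (simp_all add: power2_eq_square)
      qed
      then have cases: "x = -2 \<or> x = -1 \<or> x = 0 \<or> x = 1 \<or> x = 2" "y = -2 \<or> y = -1 \<or> y = 0 \<or> y = 1 \<or> y = 2"
        by auto
      have "(x, y) \<noteq> (0, 0)" using gr root_nz[OF g(1)] by (auto simp: r_def)
      moreover have "(x, y) \<noteq> (1, 0)" "(x, y) \<noteq> (-1, 0)" "(x, y) \<noteq> (0, 1)" "(x, y) \<noteq> (0, -1)"
        using gr g(1) scaleR_root_iff[OF f(1), of "1/2"] scaleR_root_iff[OF f(1), of "-1/2"]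
          scaleR_root_iff[OF a', of "1/2"] scaleR_root_iff[OF a', of "-1/2"] by (auto simp: r_def)
      ultimately show "p \<in> C2" using cases xy4 unfolding p C2_def by (elim disjE) simp_all
    qed
  qed
  then show ?thesis unfolding root_system_iso_def using lin bij cnq by blast
qed

text \<open>Otherwise the roots in the plane would be orthogonal to the others, and by
  indecomposability there would be no others.\<close>

lemma root_outside_plane:
  assumes "\<not> root_system_iso \<Phi> C2"
  shows "\<exists>d\<in>\<Phi>. d \<notin> span {\<alpha>, \<sigma>} \<and> (d \<bullet> \<alpha> \<noteq> 0 \<or> d \<bullet> (\<alpha> + 2 *\<^sub>R \<sigma>) \<noteq> 0)"
proof (rule ccontr)
  assume "\<not> ?thesis"
  then have out: "d \<bullet> \<alpha> = 0" "d \<bullet> (\<alpha> + 2 *\<^sub>R \<sigma>) = 0" if "d \<in> \<Phi>" "d \<notin> span {\<alpha>, \<sigma>}" for d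
    using that by blast+
  have "{d \<in> \<Phi>. d \<notin> span {\<alpha>, \<sigma>}} = {}"
  proof (rule no_orthogonal_split)
    show "\<Phi> = {d \<in> \<Phi>. d \<in> span {\<alpha>, \<sigma>}} \<union> {d \<in> \<Phi>. d \<notin> span {\<alpha>, \<sigma>}}"
      by blast
    show "{d \<in> \<Phi>. d \<in> span {\<alpha>, \<sigma>}} \<noteq> {}"
      using s(1) span_base[of \<sigma> "{\<alpha>, \<sigma>}"] by blast
    fix v w assume v: "v \<in> {d \<in> \<Phi>. d \<in> span {\<alpha>, \<sigma>}}" and w: "w \<in> {d \<in> \<Phi>. d \<notin> span {\<alpha>, \<sigma>}}"
    have "w \<bullet> \<alpha> = 0" "w \<bullet> \<sigma> = 0"
      using out[of w] w by (auto simp: inner_simps)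
    then have "orthogonal w u" if "u \<in> {\<alpha>, \<sigma>}" for u
      using that by (auto simp: orthogonal_def)
    then show "v \<bullet> w = 0"
      using orthogonal_to_span[of v "{\<alpha>, \<sigma>}" w] v by (simp add: orthogonal_def inner_commute)
  qed
  then have "\<Phi> \<subseteq> span {\<alpha>, \<sigma>}" by auto
  then show False using C2_if_plane assms by blast
qed

end

end

context large_group
begin

text \<open>The situation of type C, where distinct long roots that are not opposite are orthogonal.
  A root outside the plane that is not orthogonal to a long root \<epsilon> of the plane serves, up
  to sign, as the auxiliary root of \<open>D_orthogonal_long\<close>.\<close>

lemma D_if_orthogonal_long_roots:
  assumes no3: "\<And>a \<sigma>. a \<in> \<Phi> \<Longrightarrow> \<sigma> \<in> \<Phi> \<Longrightarrow> cn a \<sigma> \<noteq> -3"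
    and noC2: "\<not> root_system_iso \<Phi> C2"
    and orth: "\<And>a b. long \<Phi> a \<Longrightarrow> long \<Phi> b \<Longrightarrow> cn b a \<noteq> -1"
    and l: "long \<Phi> a"
  shows "D a"
proof -
  have a: "a \<in> \<Phi>" using l by (simp add: long_def)
  have ratio: "\<epsilon> \<bullet> \<epsilon> = 2 * (b \<bullet> b)" if c: "long \<Phi> \<epsilon>" "b \<in> \<Phi>" "cn b \<epsilon> = -1" for \<epsilon> b
  proof -
    have e: "\<epsilon> \<in> \<Phi>" using c(1) by (simp add: long_def)
    have "\<epsilon> \<bullet> \<epsilon> \<noteq> b \<bullet> b"
      using orth[OF c(1), of b] c by (auto simp: long_def)
    then show ?thesis using length_ratio[OF c] no3[OF e c(2)] by auto
  qed
  obtain \<sigma> where s: "\<sigma> \<in> \<Phi>" "cn \<sigma> a = -1"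
  proof -
    obtain b where "b \<in> \<Phi>" "b \<noteq> a" "b \<noteq> - a" "b \<bullet> a \<noteq> 0"
      by (rule exists_neighbour[OF a rank])
    then show ?thesis using nonorthogonal_long[OF l, of b] that[of b] that[of "- b"] by auto
  qed
  note r = ratio[OF l s]
  note f = ratio_2_plane[OF l s r]
  obtain \<delta> where d: "\<delta> \<in> \<Phi>" "\<delta> \<notin> span {a, \<sigma>}" "\<delta> \<bullet> a \<noteq> 0 \<or> \<delta> \<bullet> (a + 2 *\<^sub>R \<sigma>) \<noteq> 0"
    using root_outside_plane[OF l s r noC2] by blast
  have key: "D \<epsilon>" if e: "long \<Phi> \<epsilon>" "\<tau> \<in> \<Phi>" "cn \<tau> \<epsilon> = -1" "\<epsilon> \<in> span {a, \<sigma>}" "\<tau> \<in> span {a, \<sigma>}" "\<delta> \<bullet> \<epsilon> \<noteq> 0" for \<epsilon> \<tau>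
  proof -
    note re = ratio[OF e(1-3)]
    note fe = ratio_2_plane[OF e(1-3) re]
    define \<epsilon>' where "\<epsilon>' = \<epsilon> + 2 *\<^sub>R \<tau>"
    have le': "long \<Phi> \<epsilon>'" using e(1) fe(5,7) by (simp add: long_def \<epsilon>'_def)
    have sp': "\<epsilon>' \<in> span {a, \<sigma>}"
      unfolding \<epsilon>'_def by (intro span_add span_scale e)
    obtain \<gamma> where g: "\<gamma> \<in> \<Phi>" "cn \<gamma> \<epsilon> = -1" "\<gamma> \<notin> span {a, \<sigma>}"
    proof -
      have "\<delta> \<noteq> \<epsilon>" "\<delta> \<noteq> - \<epsilon>" "- \<delta> \<notin> span {a, \<sigma>}"
        using d(2) e(4) span_neg[of "- \<delta>"] span_neg[of \<epsilon>] by auto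
      then show ?thesis
        using nonorthogonal_long[OF e(1) d(1) _ _ e(6)] that[of \<delta>] that[of "- \<delta>"] d by auto
    qed
    have rg: "\<epsilon> \<bullet> \<epsilon> = 2 * (\<gamma> \<bullet> \<gamma>)"
      by (rule ratio[OF e(1) g(1,2)])
    have ge: "\<gamma> \<bullet> \<epsilon> = - (\<gamma> \<bullet> \<gamma>)"
      using cn_eq_iff[OF fe(1)] g(2) rg by (simp add: inner_commute)
    have "\<gamma> \<bullet> \<epsilon>' = 0"
    proof (rule ccontr)
      assume nz: "\<gamma> \<bullet> \<epsilon>' \<noteq> 0"
      have "\<gamma> \<noteq> \<epsilon>'" "\<gamma> \<noteq> - \<epsilon>'"
        using g(3) sp' span_neg by auto
      then have "cn \<gamma> \<epsilon>' = -1 \<or> cn (- \<gamma>) \<epsilon>' = -1"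
        using nonorthogonal_long[OF le' g(1) _ _ nz] by simp
      moreover have "\<epsilon>' \<in> \<Phi>" using le' by (simp add: long_def)
      ultimately obtain k :: real where k: "k * k = 1" "\<gamma> \<bullet> \<epsilon>' = - k * (\<gamma> \<bullet> \<gamma>)"
        using cn_eq_iff[of \<epsilon>' \<gamma> "-1"] cn_eq_iff[of \<epsilon>' "- \<gamma>" "-1"] fe(7) rg
        by (cases "cn \<gamma> \<epsilon>' = -1") (auto simp: \<epsilon>'_def[symmetric] inner_commute intro: that[of 1] that[of "-1"])
      \<comment> \<open>The component of \<gamma> orthogonal to the plane: were \<gamma>
        non-orthogonal to both axes, its projection onto the plane would already have full
        length.\<close>
      define w where "w = \<gamma> + (1/2) *\<^sub>R \<epsilon> + (k/2) *\<^sub>R \<epsilon>'"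
      have "\<epsilon>' \<bullet> \<epsilon>' = 2 * (\<gamma> \<bullet> \<gamma>)" "\<epsilon> \<bullet> \<epsilon>' = 0"
        using fe(6,7) rg by (simp_all add: \<epsilon>'_def[symmetric])
      then have "w \<bullet> w = (\<gamma> \<bullet> \<gamma>) * (1 - 1/2) - (k * k) * (\<gamma> \<bullet> \<gamma>) / 2"
        unfolding w_def
        by (simp add: inner_simps rg ge k(2) inner_commute[of \<epsilon> \<gamma>] inner_commute[of \<epsilon>' \<gamma>]
            inner_commute[of \<epsilon>' \<epsilon>] algebra_simps)
      then have "w = 0" by (simp add: k(1))
      moreover have "\<gamma> = w - ((1/2) *\<^sub>R \<epsilon> + (k/2) *\<^sub>R \<epsilon>')"
        by (simp add: w_def)
      ultimately have "\<gamma> \<in> span {a, \<sigma>}"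
        using span_diff[OF span_0 span_add[OF span_scale[OF e(4)] span_scale[OF sp']]] by metis
      then show False using g(3) by blast
    qed
    then show ?thesis
      using D_orthogonal_long(1)[OF e(1-3) re g(1)] ge rg re by (simp add: \<epsilon>'_def)
  qed
  show ?thesis
  proof (cases "\<delta> \<bullet> a = 0")
    case False
    then show ?thesis by (intro key[OF l s]) (auto intro: span_base)
  next
    case True
    \<comment> \<open>The other long root of the plane takes the place of a, with -\<sigma> as its
      short neighbour.\<close>
    have e: "long \<Phi> (a + 2 *\<^sub>R \<sigma>)" using l f(5,7) by (simp add: long_def)
    have c: "cn (- \<sigma>) (a + 2 *\<^sub>R \<sigma>) = -1"
      using cn_eq_iff[OF f(5), of "- \<sigma>" "-1"] f(2,7) r by (simp add: inner_simps)
    have "a \<in> span {a, \<sigma>}" "\<sigma> \<in> span {a, \<sigma>}"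
      by (simp_all add: span_base)
    then have "D (a + 2 *\<^sub>R \<sigma>)"
      using key[OF e neg_root[OF s(1)] c span_add[OF _ span_scale] span_neg] d(3) True by blast
    then show ?thesis by (rule D_same_length[OF _ a]) (simp add: f(7))
  qed
qed

theorem dph_root_subgroup_not_G2:
  assumes no3: "\<And>a \<sigma>. a \<in> \<Phi> \<Longrightarrow> \<sigma> \<in> \<Phi> \<Longrightarrow> cn a \<sigma> \<noteq> -3"
    and noC2: "\<not> root_system_iso \<Phi> C2" and "\<gamma> \<in> \<Phi>"
  shows "D \<gamma>"
proof (rule D_if_D_long[OF no3 _ assms(3)])
  fix \<gamma> assume g: "long \<Phi> \<gamma>"
  show "D \<gamma>"
  proof (cases "\<exists>a b. long \<Phi> a \<and> long \<Phi> b \<and> cn b a = -1")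
    case True
    then show ?thesis using D_long g by blast
  next
    case False
    then show ?thesis by (intro D_if_orthogonal_long_roots[OF no3 noC2 _ g]) auto
  qed
qed

end

section \<open>The root system \<open>G\<^sub>2\<close>\<close>

context irreducible_roots
begin

text \<open>A longest root has 1, 2 or 3 times the squared length of any root. As a has 3 times the
  squared length of \<sigma>, the factor for a can only be 1.\<close>

lemma long_if_cn_minus_3:
  assumes "a \<in> \<Phi>" "\<sigma> \<in> \<Phi>" "cn a \<sigma> = -3"
  shows "long \<Phi> a" "cn \<sigma> a = -1" "a \<bullet> a = 3 * (\<sigma> \<bullet> \<sigma>)"
proof -
  have p: "2 * (a \<bullet> \<sigma>) = -3 * (\<sigma> \<bullet> \<sigma>)"
    using cn_eq_iff[OF assms(2)] assms(3) by (simp add: inner_commute)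
  have pos: "\<sigma> \<bullet> \<sigma> > 0" "a \<bullet> a > 0" using inner_pos assms by blast+
  have ne: "\<sigma> \<noteq> a" "\<sigma> \<noteq> - a" using assms(3) root_nz[OF assms(1)] by auto
  have "cn \<sigma> a > -2" using cn_prod_less[OF assms(1,2) ne] assms(3) by simp
  moreover have "cn \<sigma> a < 0"
    using cn_sgn(1)[OF assms(1), of \<sigma>] p pos by (simp add: inner_commute[of \<sigma> a])
  moreover obtain k :: int where k: "cn \<sigma> a = of_int k"
    using cn_Ints[OF assms(1,2)] by (auto elim: Ints_cases)
  ultimately have "k = -1" by linarith
  then show c: "cn \<sigma> a = -1" by (simp add: k)
  then show a: "a \<bullet> a = 3 * (\<sigma> \<bullet> \<sigma>)"
    using cn_eq_iff[OF assms(1)] p by simp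
  obtain \<mu> where mu: "long \<Phi> \<mu>" using exists_long assms(1) by blast
  then have m: "\<mu> \<in> \<Phi>" by (simp add: long_def)
  have ratio: "\<mu> \<bullet> \<mu> = g \<bullet> g \<or> \<mu> \<bullet> \<mu> = 2 * (g \<bullet> g) \<or> \<mu> \<bullet> \<mu> = 3 * (g \<bullet> g)" if g: "g \<in> \<Phi>" for g
  proof -
    have "\<exists>\<delta>\<in>{\<delta> \<in> \<Phi>. \<delta> \<bullet> \<delta> = g \<bullet> g}. \<delta> \<bullet> \<mu> \<noteq> 0"
      by (rule rfl_closed_not_orthogonal) (use g m rfl_inner rfl_root in auto)
    then obtain \<delta> where d: "\<delta> \<in> \<Phi>" "\<delta> \<bullet> \<delta> = g \<bullet> g" "\<delta> \<bullet> \<mu> \<noteq> 0"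
      by blast
    show ?thesis
    proof (cases "\<delta> = \<mu> \<or> \<delta> = - \<mu>")
      case False
      then have "cn \<delta> \<mu> = -1 \<or> cn (- \<delta>) \<mu> = -1"
        using nonorthogonal_long[OF mu d(1) _ _ d(3)] by simp
      then show ?thesis
        using length_ratio[OF mu d(1)] length_ratio[OF mu neg_root[OF d(1)]] d(2) by auto
    qed (use d(2) in auto)
  qed
  have "\<mu> \<bullet> \<mu> = a \<bullet> a"
    using ratio[OF assms(1)] ratio[OF assms(2)] a pos by auto
  then show "long \<Phi> a" using mu assms(1) by (simp add: long_def)
qed

end

locale g2 = chev \<Phi> X
  for \<Phi> :: "'e::euclidean_space set" and X :: "'e \<Rightarrow> (complex, 'n::finite) sqm" +
  fixes l s :: 'e
  assumes l: "l \<in> \<Phi>" and s: "s \<in> \<Phi>" and cn_l_s: "cn l s = -3"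
begin

definition R :: "int \<Rightarrow> int \<Rightarrow> 'e" where
  "R i j = of_int i *\<^sub>R l + of_int j *\<^sub>R s"

definition g2_coords :: "(int \<times> int) set" where
  "g2_coords = {(0, 1), (1, 0), (1, 1), (1, 2), (1, 3), (2, 3),
    (0, -1), (-1, 0), (-1, -1), (-1, -2), (-1, -3), (-2, -3)}"

lemmas ls_facts = long_if_cn_minus_3[OF l s cn_l_s]

lemma R_add [simp]: "R i j + R k m = R (i + k) (j + m)"
  and R_diff [simp]: "R i j - R k m = R (i - k) (j - m)"
  and R_neg [simp]: "- R i j = R (- i) (- j)"
  and R_scale: "of_int c *\<^sub>R R i j = R (c * i) (c * j)"
  by (simp_all add: R_def algebra_simps)

lemma l_R: "l = R 1 0" and s_R: "s = R 0 1"
  by (simp_all add: R_def)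

lemma inner_R: "R i j \<bullet> R k m = (s \<bullet> s) / 2 * of_int (6 * (i * k) - 3 * (i * m + j * k) + 2 * (j * m))"
proof -
  have "l \<bullet> s = - 3 / 2 * (s \<bullet> s)"
    using cn_eq_iff[OF s, of l "-3"] cn_l_s by (simp add: inner_commute)
  then show ?thesis
    using ls_facts(3) by (simp add: R_def inner_simps inner_commute[of s l] field_simps)
qed

lemma s_pos: "s \<bullet> s > 0"
  by (rule inner_pos[OF s])

lemma cn_R: "cn (R i j) (R k m) =
    of_int (6 * (i * k) - 3 * (i * m + j * k) + 2 * (j * m)) / of_int (3 * (k * k) - 3 * (k * m) + m * m)"
proof -
  have "R k m \<bullet> R k m = (s \<bullet> s) * of_int (3 * (k * k) - 3 * (k * m) + m * m)"
    unfolding inner_R by (simp add: field_simps)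
  then show ?thesis
    unfolding cartan_number_def inner_R using s_pos by (simp del: of_int_add of_int_diff of_int_mult)
qed

lemma R_eq_zero: "R i j = 0 \<longleftrightarrow> i = 0 \<and> j = 0"
proof
  assume "R i j = 0"
  then have "R i j \<bullet> R i j = 0" by simp
  then have "6 * (i * i) - 3 * (i * j + j * i) + 2 * (j * j) = 0"
    unfolding inner_R using s_pos by (simp only: mult_eq_0_iff of_int_eq_0_iff) simp
  then have "3 * (2 * i - j)\<^sup>2 + j\<^sup>2 = 0" by (simp add: power2_eq_square algebra_simps)
  then have "(2 * i - j)\<^sup>2 = 0" "j\<^sup>2 = 0"
    using zero_le_power2[of "2 * i - j"] zero_le_power2[of j] by linarith+
  then show "i = 0 \<and> j = 0" by simp
qed (simp add: R_def)

lemma R_eq [simp]: "R i j = R k m \<longleftrightarrow> i = k \<and> j = m"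
  using R_eq_zero[of "i - k" "j - m"] by (simp flip: R_diff)

lemma R_root: "(i, j) \<in> g2_coords \<Longrightarrow> R i j \<in> \<Phi>"
proof -
  have r: "R 1 0 \<in> \<Phi>" "R 0 1 \<in> \<Phi>"
    using l s by (simp_all add: l_R[symmetric] s_R[symmetric])
  have rf: "rfl (R k m) (R i j) \<in> \<Phi>" if "R k m \<in> \<Phi>" "R i j \<in> \<Phi>" for i j k m
    by (rule rfl_root[OF that(2,1)])
  have sc: "numeral n *\<^sub>R R i j = R (numeral n * i) (numeral n * j)" for n i j
    using R_scale[of "numeral n"] by simp
  have "R 1 3 \<in> \<Phi>" "R 1 1 \<in> \<Phi>"
    using rf[OF r(2,1)] rf[OF r] by (simp_all add: rfl_def cn_R sc)
  moreover from this have "R 1 2 \<in> \<Phi>" "R 2 3 \<in> \<Phi>"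
    using rf[OF r(2), of 1 1] rf[OF r(1), of 1 3] by (simp_all add: rfl_def cn_R)
  ultimately have "R 0 1 \<in> \<Phi>" "R 1 0 \<in> \<Phi>" "R 1 1 \<in> \<Phi>" "R 1 2 \<in> \<Phi>" "R 1 3 \<in> \<Phi>" "R 2 3 \<in> \<Phi>"
    using r by simp_all
  moreover from this[THEN neg_root] have "R 0 (-1) \<in> \<Phi>" "R (-1) 0 \<in> \<Phi>" "R (-1) (-1) \<in> \<Phi>"
    "R (-1) (-2) \<in> \<Phi>" "R (-1) (-3) \<in> \<Phi>" "R (-2) (-3) \<in> \<Phi>"
    by simp_all
  ultimately show "(i, j) \<in> g2_coords \<Longrightarrow> R i j \<in> \<Phi>"
    by (auto simp: g2_coords_def)
qed

lemma R_image: "(i, j) \<in> g2_coords \<Longrightarrow> R i j \<in> case_prod R ` g2_coords"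
  by (rule image_eqI[of _ _ "(i, j)"]) simp_all

lemma long_R:
  assumes "(k, m) \<in> {(1, 0), (1, 3), (2, 3), (-1, 0), (-1, -3), (-2, -3)}"
  shows "long \<Phi> (R k m)"
proof -
  have "R k m \<bullet> R k m = l \<bullet> l" unfolding inner_R ls_facts(3) using assms by auto
  moreover have "R k m \<in> \<Phi>"
    by (rule R_root) (use assms in \<open>auto simp: g2_coords_def\<close>)
  ultimately show ?thesis using ls_facts(1) by (simp add: long_def)
qed

text \<open>A root that is not orthogonal to the plane of \<open>G\<^sub>2\<close> projects onto one of its short roots
  \<open>\<tau>\<close>, and then integrality forces it to be \<open>\<tau>\<close>.\<close>

lemma root_in_plane_or_orthogonal:
  assumes d: "d \<in> \<Phi>" "d \<notin> case_prod R ` g2_coords"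
  shows "d \<bullet> R i j = 0"
proof -
  define a where "a = (s \<bullet> s) * 3 / 2"
  have a: "a > 0" using s_pos by (simp add: a_def)
  have ex: "\<exists>x :: int. \<bar>x\<bar> \<le> 1 \<and> d \<bullet> R k m = of_int x * a"
    if km: "(k, m) \<in> {(1, 0), (1, 3), (2, 3)}" for k m
  proof -
    have L: "long \<Phi> (R k m)" using km by (intro long_R) auto
    have ne: "d \<noteq> R k m" "d \<noteq> - R k m"
      using d(2) km by (auto simp: g2_coords_def image_iff)
    have n: "R k m \<bullet> R k m = 2 * a" unfolding inner_R a_def using km by auto
    have c: "cn d (R k m) = of_int x \<Longrightarrow> d \<bullet> R k m = of_int x * a" for x :: int
      using a by (simp add: cartan_number_def n field_simps)
    consider "cn d (R k m) = -1" | "cn d (R k m) = 0" | "cn d (R k m) = 1"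
      using long_cn[OF L d(1) ne] by blast
    then show ?thesis
    proof cases
      case 1
      then show ?thesis using c[of "-1"] by (intro exI[of _ "-1"]) simp
    next
      case 2
      then show ?thesis using c[of 0] by (intro exI[of _ 0]) simp
    next
      case 3
      then show ?thesis using c[of 1] by (intro exI[of _ 1]) simp
    qed
  qed
  obtain x where x: "\<bar>x\<bar> \<le> 1" "d \<bullet> R 1 0 = of_int x * a"
    using ex[of 1 0] by auto
  obtain y where y: "\<bar>y\<bar> \<le> 1" "d \<bullet> R 1 3 = of_int y * a"
    using ex[of 1 3] by auto
  obtain w where w: "\<bar>w\<bar> \<le> 1" "d \<bullet> R 2 3 = of_int w * a"
    using ex[of 2 3] by auto
  have "d \<bullet> R 2 3 = d \<bullet> R 1 0 + d \<bullet> R 1 3" by (simp flip: inner_add_right)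
  then have "of_int w * a = of_int (x + y) * a" unfolding x y w by (simp add: algebra_simps)
  then have "w = x + y" using a by simp
  have ds: "d \<bullet> s = of_int (y - x) * a / 3"
  proof -
    have "R 1 3 - R 1 0 = 3 *\<^sub>R s" unfolding R_def by simp
    then have "3 * (d \<bullet> s) = d \<bullet> R 1 3 - d \<bullet> R 1 0"
      by (metis inner_diff_right inner_scaleR_right)
    then show ?thesis unfolding x y by (simp add: algebra_simps)
  qed
  have dR: "d \<bullet> R p q = (of_int p * of_int x + of_int q * of_int (y - x) / 3) * a" for p q
  proof -
    have "d \<bullet> l = of_int x * a" using x(2) by (simp add: R_def)
    then show ?thesis by (simp add: R_def inner_simps ds algebra_simps)
  qed
  have "x = 0 \<and> y = 0"
  proof (rule ccontr)
    assume nz: "\<not> (x = 0 \<and> y = 0)"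
    then have xy: "(x, y) \<in> {(1, -1), (-1, 1), (1, 0), (-1, 0), (0, 1), (0, -1)}"
    proof -
      have "x = -1 \<or> x = 0 \<or> x = 1" "y = -1 \<or> y = 0 \<or> y = 1"
        using x(1) y(1) by linarith+
      then show ?thesis using nz w(1) unfolding \<open>w = x + y\<close> by (elim disjE) simp_all
    qed
    \<comment> \<open>The projection of d onto the plane: this vector has inner products x a and y a
      with \<open>R 1 0\<close> and \<open>R 1 3\<close>.\<close>
    define \<tau> where "\<tau> = R (x + y) (x + 2 * y)"
    have t: "\<tau> \<in> \<Phi>" "\<tau> \<in> case_prod R ` g2_coords" "- \<tau> \<in> case_prod R ` g2_coords"
    proof -
      have "(x + y, x + 2 * y) \<in> g2_coords" "(- (x + y), - (x + 2 * y)) \<in> g2_coords"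
        using xy by (elim insertE emptyE; simp add: g2_coords_def)+
      then show "\<tau> \<in> \<Phi>" "\<tau> \<in> case_prod R ` g2_coords" "- \<tau> \<in> case_prod R ` g2_coords"
        unfolding \<tau>_def R_neg using R_root R_image by blast+
    qed
    have tt: "\<tau> \<bullet> \<tau> = s \<bullet> s"
    proof -
      have n: "6 * ((x + y) * (x + y)) - 3 * ((x + y) * (x + 2 * y) + (x + 2 * y) * (x + y)) + 2 * ((x + 2 * y) * (x + 2 * y)) = 2"
        using xy by (elim insertE emptyE) simp_all
      show ?thesis unfolding \<tau>_def inner_R n by simp
    qed
    have dt: "d \<bullet> \<tau> = s \<bullet> s"
    proof -
      have n: "3 * ((x + y) * x) + (x + 2 * y) * (y - x) = 2"
        using xy by (elim insertE emptyE) simp_all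
      have "d \<bullet> \<tau> = of_int (3 * ((x + y) * x) + (x + 2 * y) * (y - x)) * a / 3"
        unfolding \<tau>_def dR by (simp add: algebra_simps add_divide_distrib diff_divide_distrib)
      then show ?thesis unfolding n by (simp add: a_def)
    qed
    have ne: "d \<noteq> \<tau>" "d \<noteq> - \<tau>" using t d(2) by auto
    have c2: "cn d \<tau> = 2" using s_pos by (simp add: cartan_number_def dt tt)
    obtain k :: int where k: "cn \<tau> d = of_int k"
      using cn_Ints[OF d(1) t(1)] by (auto elim: Ints_cases)
    have "cn \<tau> d < 2" using cn_prod_less[OF t(1) d(1) ne] c2 by simp
    moreover have "cn \<tau> d > 0"
      using cn_sgn(2)[OF d(1), of \<tau>] dt s_pos by (simp add: inner_commute)
    ultimately have "k = 1" using k by linarith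
    then have dd: "d \<bullet> d = 2 * (s \<bullet> s)"
      using cn_eq_iff[OF d(1), of \<tau> 1] k dt by simp
    \<comment> \<open>With d . d = 2 (s . s), a root whose inner product with d is a or -a has
      Cartan integer 3/2 in absolute value against d.\<close>
    obtain p q where pq: "R p q \<in> \<Phi>" "\<bar>d \<bullet> R p q\<bar> = a"
    proof (cases "x = 0")
      case True
      with xy have "\<bar>y\<bar> = 1" by (elim insertE emptyE) simp_all
      then have "\<bar>d \<bullet> R 1 3\<bar> = a"
        using a unfolding y(2) by (simp add: abs_mult flip: of_int_abs)
      then show ?thesis using that[of 1 3] R_root[of 1 3] by (simp add: g2_coords_def)
    next
      case False
      with xy have "\<bar>x\<bar> = 1" by (elim insertE emptyE) simp_all
      then have "\<bar>d \<bullet> R 1 0\<bar> = a"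
        using a unfolding x(2) by (simp add: abs_mult flip: of_int_abs)
      then show ?thesis using that[of 1 0] R_root[of 1 0] by (simp add: g2_coords_def)
    qed
    have "\<bar>cn (R p q) d\<bar> = 3 / 2"
      using pq(2) s_pos by (simp add: cartan_number_def dd a_def inner_commute abs_mult)
    moreover obtain m :: int where "cn (R p q) d = of_int m"
      using cn_Ints[OF d(1) pq(1)] by (auto elim: Ints_cases)
    ultimately have "2 * \<bar>m\<bar> = 3" by linarith
    then show False by presburger
  qed
  then show ?thesis by (simp add: dR)
qed

lemma roots_eq: "\<Phi> = case_prod R ` g2_coords"
proof -
  have sub: "case_prod R ` g2_coords \<subseteq> \<Phi>" using R_root by auto
  have "\<Phi> - case_prod R ` g2_coords = {}"
  proof (rule no_orthogonal_split)
    show "\<Phi> = case_prod R ` g2_coords \<union> (\<Phi> - case_prod R ` g2_coords)"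
      using sub by blast
    show "case_prod R ` g2_coords \<noteq> {}" by (simp add: g2_coords_def)
  next
    fix u v assume "u \<in> case_prod R ` g2_coords" "v \<in> \<Phi> - case_prod R ` g2_coords"
    then show "u \<bullet> v = 0"
      using root_in_plane_or_orthogonal[of v] by (auto simp: inner_commute)
  qed
  then show ?thesis using sub by blast
qed

lemma R_root_iff [simp]: "R i j \<in> \<Phi> \<longleftrightarrow> (i, j) \<in> g2_coords"
  unfolding roots_eq by (force simp: image_iff)

end

section \<open>Products of root elements with regular parameters\<close>

context chev
begin

lemma xi_br_Xr_zero:
  assumes a: "g \<in> \<Phi>" "d \<in> \<Phi>" "\<kappa> \<in> \<Phi>" "g + d \<noteq> \<kappa>"
  shows "xi \<kappa> (br (Xr g) (Xr d) :: ('r::comm_ring_1, 'n) sqm) = 0"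
proof -
  interpret T: chev_spcl \<Phi> X "tspec (0 :: 'r)" UNIV by (rule chev_spcl_tspec)
  show ?thesis
  proof (rule T.S_zero_if)
    show "tspec (0 :: 'r) (\<lambda>_. xi \<kappa> (br (Xr g) (Xr d) :: (complex, 'n) sqm)) (xi \<kappa> (br (Xr g) (Xr d) :: ('r, 'n) sqm))"
      by (intro specI)
    show "xi \<kappa> (br (Xr g) (Xr d) :: (complex, 'n) sqm) = 0"
      using xi_Wt[OF a(3) Wt_br_X[OF a(1) Wt_X[OF a(2)]] a(4)] by (simp add: Xr_complex a)
  qed
qed

lemma adj_mult_EC: "A \<in> EC \<Longrightarrow> B \<in> EC \<Longrightarrow> adj (A * B) = adj B * adj A"
proof -
  assume a: "A \<in> EC" "B \<in> EC"
  have "A * B * (adj B * adj A) = A * (B * adj B) * adj A" by (simp add: mult.assoc)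
  then have "A * B * (adj B * adj A) = 1" using EC_inverse(1) a by simp
  then show ?thesis using left_right_inverse_unique[OF _ EC_inverse(2)[OF EC_mult[OF a]]] by metis
qed

section \<open>Elements acting on root vectors by scalars\<close>

definition scales :: "(complex, 'n) sqm \<Rightarrow> (complex, 'n) sqm \<Rightarrow> complex \<Rightarrow> bool" where
  "scales M Y c \<longleftrightarrow> M * Y * adj M = c \<odot> Y"

lemma scales_mult:
  assumes "M \<in> EC" "N \<in> EC" "scales M Y c" "scales N Y d"
  shows "scales (M * N) Y (c * d)"
proof -
  have "M * N * Y * adj (M * N) = M * (N * Y * adj N) * adj M"
    using assms by (simp add: adj_mult_EC mult.assoc)
  also have "\<dots> = (c * d) \<odot> Y" using assms(3,4) by (simp add: scales_def mult.commute)
  finally show ?thesis by (simp add: scales_def)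
qed

lemma scales_xx:
  assumes "g \<in> \<Phi>" "d \<in> \<Phi>" "g + d \<notin> \<Phi>" "g + d \<noteq> 0"
  shows "scales (xx g t) (X d) 1"
proof -
  have "br (X g) (X d) = 0" by (rule XX_zero[OF assms(1,2,4,3)])
  then have "xx g t * X d * xx g (- t) = X d"
    using L_conj[OF assms(1) L_X[OF assms(2)], of t] by (simp add: xx_complex assms(1) eval_nat_numeral adp_def)
  then show ?thesis by (simp add: scales_def adj_xx assms(1))
qed

lemma scales_nonzero:
  assumes "M \<in> EC" "b \<in> \<Phi>" "scales M (X b) c"
  shows "c \<noteq> 0"
proof
  assume "c = 0"
  then have "adj M * (M * X b * adj M) * M = 0" using assms(3) by (simp add: scales_def)
  moreover have "adj M * (M * X b * adj M) * M = (adj M * M) * X b * (adj M * M)"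
    by (simp add: mult.assoc)
  ultimately show False using EC_inverse(2)[OF assms(1)] X_nz[OF assms(2)] by simp
qed

lemma scales_br:
  assumes "M \<in> EC" "scales M Y c" "scales M W d"
  shows "scales M (br Y W) (c * d)"
  using conj_br[OF EC_inverse(2)[OF assms(1)], of Y W] assms(2,3)
  by (simp add: scales_def br_simps mult.commute)

lemma scales_sm_cancel: "scales M (k \<odot> Y) c \<Longrightarrow> k \<noteq> 0 \<Longrightarrow> scales M Y c"
  using sm_cancel[of k "M * Y * adj M" "c \<odot> Y"] by (simp add: scales_def mult.commute)

lemma scales_add_roots:
  assumes "M \<in> EC" "b \<in> \<Phi>" "g \<in> \<Phi>" "b + g \<in> \<Phi>" "scales M (X b) c" "scales M (X g) d"
  shows "scales M (X (b + g)) (c * d)"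
proof -
  obtain N :: int where N: "br (X b) (X g) = of_int N \<odot> X (b + g)" "\<bar>N\<bar> = int (rstr \<Phi> b g) + 1"
    using structure_constant[OF assms(2-4)] .
  then show ?thesis using scales_br[OF assms(1,5,6)] scales_sm_cancel[of M "of_int N"] by auto
qed

text \<open>\<open>H b\<close> is scaled by c d, and the relation [H b, X b] = 2 X b then forces c d
  = 1.\<close>

lemma scales_opposite:
  assumes "M \<in> EC" "b \<in> \<Phi>" "scales M (X b) c" "scales M (X (- b)) d"
  shows "c * d = 1" "scales M (H b) 1"
proof -
  have h: "scales M (H b) (c * d)" unfolding H_def by (rule scales_br[OF assms(1,3,4)])
  have "br (H b) (X b) = 2 \<odot> X b" using br_H_X[OF assms(2,2)] root_nz[OF assms(2)] by simp
  then have "scales M (X b) (c * d * c)"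
    using scales_br[OF assms(1) h assms(3)] scales_sm_cancel[of M 2] by simp
  then have "c \<odot> X b = (c * d * c) \<odot> X b" using assms(3) by (simp add: scales_def)
  from arg_cong[OF this, of "xi b"] show "c * d = 1"
    using scales_nonzero[OF assms(1-3)] by (simp add: xi_X assms(2))
  then show "scales M (H b) 1" using h by simp
qed

lemma xi_br_H: "\<eta> \<in> \<Phi> \<Longrightarrow> \<kappa> \<in> \<Phi> \<Longrightarrow> Y \<in> L \<Longrightarrow> xi \<kappa> (br (H \<eta>) Y) = of_real (cn \<kappa> \<eta>) * xi \<kappa> Y"
proof -
  assume e: "\<eta> \<in> \<Phi>" "\<kappa> \<in> \<Phi>"
  assume "Y \<in> L"
  then show ?thesis
    by (induction Y rule: L_induct)
      (auto simp: br_H_X br_H_H e xi_X xi_H br_simps algebra_simps)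
qed

lemma xi_zero_if_weight:
  assumes "\<eta> \<in> \<Phi>" "\<kappa> \<in> \<Phi>" "Y \<in> L" "br (H \<eta>) Y = of_real d \<odot> Y" "cn \<kappa> \<eta> \<noteq> d"
  shows "xi \<kappa> Y = 0"
proof -
  have "xi \<kappa> (of_real d \<odot> Y) = of_real (cn \<kappa> \<eta>) * xi \<kappa> Y"
    using xi_br_H[OF assms(1-3)] unfolding assms(4) .
  then show ?thesis using assms(5) by auto
qed

lemma weight_conj:
  assumes "M \<in> EC" "scales M (H \<eta>) 1" "br (H \<eta>) Y = d \<odot> Y"
  shows "br (H \<eta>) (M * Y * adj M) = d \<odot> (M * Y * adj M)"
  using conj_br[OF EC_inverse(2)[OF assms(1)], of "H \<eta>" Y] assms(2,3) by (simp add: scales_def)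

lemma tor_eigen:
  assumes "g \<in> \<Phi>" "t \<noteq> 0" "H g * M = of_int j \<odot> M"
  shows "tor g t * M = t powi j \<odot> M"
proof -
  have "tor g t * M = (\<Sum>m\<in>mrange. t powi m \<odot> (Qm g m * M))"
    unfolding sum_Qm[OF assms(1,2), symmetric] by (simp add: sum_distrib_right)
  also have "\<dots> = (\<Sum>m\<in>mrange. t powi j \<odot> (Qm g m * M))"
    by (rule sum.cong) (simp_all add: Qm_eigen[OF assms(1,3)])
  also have "\<dots> = t powi j \<odot> ((\<Sum>m\<in>mrange. Qm g m) * M)"
    by (simp add: sum_distrib_right sm_sum_right)
  finally show ?thesis by (simp add: sum_Qm_1[OF assms(1)])
qed

text \<open>The torus element \<open>tor\<close> as a word in root elements, written with
  \<open>inverse u\<close> so that its parameters specialize when u has the value 1.\<close>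

definition tr :: "'e \<Rightarrow> complex \<Rightarrow> (complex, 'n) sqm" where
  "tr g u = xx g u * xx (- g) (- inverse u) * xx g u * wi g"

lemma tr_EC: "g \<in> \<Phi> \<Longrightarrow> tr g u \<in> EC"
  unfolding tr_def wi_def by (intro EC_mult EC_xx neg_root)

lemma scales_tr:
  assumes g: "g \<in> \<Phi>" and b: "b \<in> \<Phi>" and u: "u \<noteq> 0" and j: "cn b g = of_int j"
  shows "scales (tr g u) (X b) (u powi j)"
proof -
  have t: "tr g u = tor g u"
    unfolding tr_def tor_def wi_def by (simp add: xx_complex g divide_inverse)
  have "tor g u * (X b * Qm g k) = u powi j \<odot> (u powi k \<odot> (X b * Qm g k))" for k
  proof -
    have "H g * X b = X b * H g + of_int j \<odot> X b"
      using br_H_X[OF g b] j by (simp add: br_def algebra_simps)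
    then have "H g * (X b * Qm g k) = (X b * H g + of_int j \<odot> X b) * Qm g k"
      by (simp flip: mult.assoc)
    also have "\<dots> = of_int (k + j) \<odot> (X b * Qm g k)"
      by (simp add: algebra_simps H_Qm[OF g] sm_simps)
    finally show ?thesis
      using tor_eigen[OF g u, of "X b * Qm g k" "k + j"] u by (simp add: power_int_add mult.commute)
  qed
  then have "(\<Sum>k\<in>mrange. tor g u * (X b * Qm g k)) = u powi j \<odot> (X b * (\<Sum>k\<in>mrange. u powi k \<odot> Qm g k))"
    by (simp add: sm_sum_right sum_distrib_left)
  moreover have "(\<Sum>k\<in>mrange. tor g u * (X b * Qm g k)) = tor g u * X b"
    by (simp flip: sum_distrib_left add: sum_Qm_1[OF g])
  ultimately have "tr g u * X b * adj (tr g u) = u powi j \<odot> (X b * (tr g u * adj (tr g u)))"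
    unfolding sum_Qm[OF g u] t[symmetric] by (simp add: mult.assoc)
  then show ?thesis using EC_inverse(1)[OF tr_EC[OF g]] by (simp add: scales_def)
qed

end

context long_root
begin

definition ef :: "(complex, 'n) sqm \<Rightarrow> complex" where
  "ef M = xi (- \<alpha>) (M * X (- \<alpha>) * adj M)"

text \<open>One step of Gaussian elimination: the factor that brings the conjugate of
  \<open>X (- \<alpha>)\<close> by \<open>M\<close> back to a multiple of
  \<open>X (- \<alpha>)\<close>.\<close>

definition est :: "'e \<Rightarrow> (complex, 'n) sqm \<Rightarrow> (complex, 'n) sqm" where
  "est g0 M = Vm g0 (M * X (- \<alpha>) * adj M) (inverse (ef M))"

lemma est_EC: "est g0 M \<in> EC"
  unfolding est_def by (rule Vm_EC)

lemma est_scales: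
  assumes "M \<in> EC" "ef M \<noteq> 0" "g0 \<in> \<Phi>" "cn g0 \<alpha> = 1"
  shows "scales (est g0 M * M) (X (- \<alpha>)) (ef M)"
proof -
  define Y where "Y = M * X (- \<alpha>) * adj M"
  define V where "V = Vp g0 Y (inverse (ef M))"
  have V: "V * est g0 M = 1" "est g0 M * V = 1"
    unfolding V_def est_def Y_def by (simp_all add: Vp_Vm Vm_Vp)
  then have adj: "adj (est g0 M) = V"
    using left_right_inverse_unique[OF EC_inverse(1)[OF est_EC]] by metis
  have "Y = ef M \<odot> (V * X (- \<alpha>) * est g0 M)"
    unfolding V_def est_def using extremal_eq_conj[OF extremal_conj[OF assms(1) extremal_X] _ assms(3,4)] assms(2)
    by (simp add: Y_def ef_def)
  then have "est g0 M * Y * V = ef M \<odot> ((est g0 M * V) * X (- \<alpha>) * (est g0 M * V))"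
    by (simp add: mult.assoc)
  then have "est g0 M * Y * V = ef M \<odot> X (- \<alpha>)" by (simp add: V)
  then show ?thesis
    unfolding scales_def adj_mult_EC[OF est_EC assms(1)] adj by (simp add: Y_def mult.assoc)
qed

lemma scales_Um:
  assumes "set xs \<subseteq> \<Phi>" "\<And>g. g \<in> set xs \<Longrightarrow> g + d \<notin> \<Phi> \<and> g + d \<noteq> 0" "d \<in> \<Phi>"
  shows "scales (Um c xs) (X d) 1"
  using assms(1,2)
proof (induction xs)
  case Nil
  have "adj 1 = (1 :: (complex, 'n) sqm)" using EC_inverse(1)[OF EC_one] by simp
  then show ?case by (simp add: scales_def Um_def)
next
  case (Cons g xs)
  have e: "Um c (g # xs) = Um c xs * xx g (- c g)" by (simp add: Um_def)
  have "scales (Um c xs * xx g (- c g)) (X d) (1 * 1)"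
    by (rule scales_mult[OF Um_EC EC_xx Cons.IH scales_xx]) (use Cons.prems assms(3) in auto)
  then show ?case unfolding e by simp
qed

text \<open>All factors of the step have positive degree and so fix the vector of highest degree.
  Hence a step for \<alpha> preserves what an earlier step for -\<alpha> achieved.\<close>

lemma est_scales_alpha: "scales (est g0 M) (X \<alpha>) 1"
proof -
  have "scales (est g0 M) (X \<alpha>) (1 * 1)" unfolding est_def Vm_def
  proof (rule scales_mult[OF EC_xx[OF alpha] Um_EC[OF deg1_sub] scales_xx[OF alpha alpha] scales_Um[OF deg1_sub _ alpha]])
    show "\<alpha> + \<alpha> \<notin> \<Phi>" "\<alpha> + \<alpha> \<noteq> 0"
      using double_not_root[OF alpha] root_nz[OF alpha] by (auto simp flip: scaleR_2)
    show "g + \<alpha> \<notin> \<Phi> \<and> g + \<alpha> \<noteq> 0" if "g \<in> set deg1" for g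
    proof -
      have "cn (g + \<alpha>) \<alpha> = 3" using that deg1(1) cn_alpha by simp
      then show ?thesis
        using grade_le[of "g + \<alpha>"] by (intro conjI notI) (simp_all del: cn_add)
    qed
  qed
  then show ?thesis by simp
qed

lemma Um_single:
  assumes "distinct xs" "\<eta> \<in> set xs" "\<And>g. g \<in> set xs \<Longrightarrow> g \<noteq> \<eta> \<Longrightarrow> c g = 0"
  shows "Um c xs = xx \<eta> (- c \<eta>)"
  using assms
proof (induction xs)
  case (Cons g xs)
  have e: "Um c (g # xs) = Um c xs * xx g (- c g)" by (simp add: Um_def)
  show ?case
  proof (cases "g = \<eta>")
    case True
    have "c d = 0" if "d \<in> set xs" for d
      using Cons.prems True that by (metis distinct.simps(2) list.set_intros(2))
    then have "Um c xs = 1" by (rule Um_zero)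
    then show ?thesis using e True by simp
  next
    case False
    then show ?thesis unfolding e using Cons by simp
  qed
qed simp

text \<open>If \<open>M\<close> fixes \<open>H \<eta>\<close>, weights for \<open>H \<eta>\<close> leave only one factor of the elimination step.\<close>

lemma est_single:
  assumes M: "M \<in> EC" "scales M (H \<eta>) 1" and e: "\<eta> \<in> \<Phi>" "cn \<alpha> \<eta> \<noteq> 0"
    and g: "g1 \<in> \<Phi>" "cn g1 \<alpha> = 1" "cn g1 \<eta> = 0"
    and unique: "\<And>g. g \<in> \<Phi> \<Longrightarrow> cn g \<alpha> = 1 \<Longrightarrow> cn g \<eta> = 0 \<Longrightarrow> g = g1"
    and g0: "g0 \<in> \<Phi>"
  shows "\<exists>c. est g0 M = xx g1 c"
proof -
  define Y where "Y = M * X (- \<alpha>) * adj M"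
  have YL: "Y \<in> L" unfolding Y_def using EC_conj_L[OF M(1) L_X[OF neg_root[OF alpha]]] .
  define d where "d = - cn \<alpha> \<eta>"
  have "br (H \<eta>) (X (- \<alpha>)) = of_real d \<odot> X (- \<alpha>)"
    using br_H_X[OF e(1) neg_root[OF alpha]] by (simp add: d_def)
  then have wY: "br (H \<eta>) Y = of_real d \<odot> Y" unfolding Y_def by (rule weight_conj[OF M])
  let ?c = "scoef Y (inverse (ef M))"
  have c0: "?c g = 0" if "g \<in> set deg1" "g \<noteq> g1" for g
  proof -
    have gr: "g \<in> \<Phi>" "cn g \<alpha> = 1" using that deg1(1) by auto
    then have "cn (g - \<alpha>) \<eta> \<noteq> d" using unique that(2) by (auto simp: d_def)
    then show ?thesis
      using xi_zero_if_weight[OF e(1) grade_1_roots(1)[OF gr] YL wY] by (simp add: scoef_def)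
  qed
  have in1: "g1 \<in> set deg1" using g deg1(1) by simp
  have Um: "Um ?c deg1 = xx g1 (- ?c g1)" by (rule Um_single[OF deg1(2) in1 c0])
  have Up: "Up ?c deg1 = adj (xx g1 (- ?c g1))"
    using left_right_inverse_unique[OF EC_inverse(1)[OF Um_EC[OF deg1_sub]] Up_Um[OF deg1_sub], of ?c] Um by simp
  define W where "W = xx g1 (- ?c g1) * Y * adj (xx g1 (- ?c g1))"
  have x1: "xx g1 t \<in> EC" for t :: complex by (rule EC_xx[OF g(1)])
  have WL: "W \<in> L" unfolding W_def by (rule EC_conj_L[OF x1 YL])
  have "scales (xx g1 t) (H \<eta>) 1" for t
  proof -
    have "br (X g1) (H \<eta>) = 0" using br_X_H[OF e(1) g(1)] g(3) by simp
    then have "xx g1 t * H \<eta> * xx g1 (- t) = H \<eta>"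
      using L_conj[OF g(1) L_H[OF e(1)], of t] by (simp add: xx_complex g(1) eval_nat_numeral adp_def)
    then show ?thesis by (simp add: scales_def adj_xx g(1))
  qed
  from weight_conj[OF x1 this wY] have wW: "br (H \<eta>) W = of_real d \<odot> W" unfolding W_def .
  have "br (H \<eta>) (br W (X g0)) = of_real (d + cn g0 \<eta>) \<odot> br W (X g0)"
    by (subst br_jacobi) (simp add: wW br_H_X e(1) g0 br_simps sm_simps)
  then have "xi g0 (br W (X g0)) = 0"
    by (rule xi_zero_if_weight[OF e(1) g0 L_br_X_right[OF g0 WL]]) (use e(2) in \<open>simp add: d_def\<close>)
  then have "bcoef g0 Y (inverse (ef M)) = 0"
    unfolding bcoef_def Um Up W_def[symmetric] by (simp add: Xr_complex g0)
  then have "est g0 M = xx g1 (- ?c g1)" unfolding est_def Y_def[symmetric] Vm_def Um by simp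
  then show ?thesis ..
qed

end

section \<open>Words in root elements with regular parameters\<close>

locale chev_spcl_inv = chev_spcl \<Phi> X S B
  for \<Phi> :: "'e::euclidean_space set" and X :: "'e \<Rightarrow> (complex, 'n::finite) sqm"
    and S :: "('b \<Rightarrow> complex) \<Rightarrow> 'r::comm_ring_1 \<Rightarrow> bool" and B :: "'b set" +
  assumes S_inverse: "S f 1 \<Longrightarrow> S (\<lambda>b. inverse (f b)) 1"
begin

text \<open>Stronger than \<open>SM\<close>: the matrices are products of root elements whose
  parameters specialize, so they remain in \<open>EC\<close> and can be differentiated factor by
  factor.\<close>

inductive SE :: "('b \<Rightarrow> (complex, 'n) sqm) \<Rightarrow> ('r, 'n) sqm \<Rightarrow> bool" where
  SE_one: "SE (\<lambda>_. 1) 1"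
| SE_xx: "g \<in> \<Phi> \<Longrightarrow> S f r \<Longrightarrow> SE (\<lambda>b. xx g (f b)) (xx g r)"
| SE_mult: "SE A M \<Longrightarrow> SE A' M' \<Longrightarrow> SE (\<lambda>b. A b * A' b) (M * M')"

lemma SE_SM: "SE A M \<Longrightarrow> SM A M"
  by (induction rule: SE.induct) (auto intro: specI)

lemma SE_EC: "SE A M \<Longrightarrow> A b \<in> EC"
  by (induction rule: SE.induct) (auto intro: EC_one EC_xx EC_mult)

text \<open>At parameter 1 the word becomes \<open>ww g * wi g\<close>.\<close>

lemma SE_tr:
  assumes "g \<in> \<Phi>" "S f 1"
  shows "SE (\<lambda>b. tr g (f b)) 1"
proof -
  have "SE (\<lambda>b. tr g (f b)) (xx g 1 * xx (- g) (- 1) * xx g 1 * (xx g (- 1) * xx (- g) 1 * xx g (- 1)))"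
    unfolding tr_def wi_def
    using S_of_int[of "-1"] S_1 assms by (intro SE_mult SE_xx neg_root S_minus S_inverse) simp_all
  moreover have "(ww g :: ('r, 'n) sqm) * wi g = 1" by (rule ww_wi[OF assms(1)])
  ultimately show ?thesis by (simp add: ww_def wi_def)
qed

end

locale long_root_spcl = long_root \<Phi> X \<alpha> + chev_spcl_inv \<Phi> X S B
  for \<Phi> :: "'e::euclidean_space set" and X :: "'e \<Rightarrow> (complex, 'n::finite) sqm" and \<alpha> :: 'e
    and S :: "('b \<Rightarrow> complex) \<Rightarrow> 'r::comm_ring_1 \<Rightarrow> bool" and B :: "'b set"
begin

lemma SE_Um:
  "set xs \<subseteq> \<Phi> \<Longrightarrow> (\<And>g. g \<in> set xs \<Longrightarrow> S (\<lambda>b. f b g) (r g)) \<Longrightarrow> SE (\<lambda>b. Um (f b) xs) (Um r xs)"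
proof (induction xs)
  case (Cons g xs)
  have e: "Um f (g # xs) = Um f xs * xx g (- f g)" for f :: "'e \<Rightarrow> 'c::comm_ring_1"
    by (simp add: Um_def)
  show ?case unfolding e using Cons by (intro SE_mult SE_xx S_minus) auto
qed (simp add: Um_def SE_one)

lemma SM_Up_general:
  "(\<And>g. g \<in> set xs \<Longrightarrow> S (\<lambda>b. f b g) (r g)) \<Longrightarrow> SM (\<lambda>b. Up (f b) xs) (Up r xs)"
  unfolding Up_def by (induction xs) (auto intro!: specI)

text \<open>At \<open>c\<close> the elimination parameters are evaluated on the vector
  \<open>Xr (- \<alpha>)\<close> itself, which has leading coefficient 1 and nothing to
  eliminate.\<close>

lemma est_spec:
  assumes A: "SM A c" and c: "c * Xr (- \<alpha>) * adj c = Xr (- \<alpha>)" and g0: "g0 \<in> \<Phi>"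
  shows "SE (\<lambda>b. est g0 (A b)) 1" "S (\<lambda>b. ef (A b)) 1"
proof -
  let ?Y = "\<lambda>b. A b * Xr (- \<alpha>) * adj (A b)"
  have Y: "SM ?Y (Xr (- \<alpha>))" by (subst c[symmetric]) (intro specI A)
  have "S (\<lambda>b. xi (- \<alpha>) (?Y b)) (xi (- \<alpha>) (Xr (- \<alpha>)))"
    by (intro specI Y)
  then show ef: "S (\<lambda>b. ef (A b)) 1" by (simp add: ef_def Xr_complex alpha xi_Xr)
  note i = S_inverse[OF ef]
  have sc: "S (\<lambda>b. scoef (?Y b) (inverse (ef (A b))) g) 0" if "g \<in> set deg1" for g
  proof -
    have "S (\<lambda>b. scoef (?Y b) (inverse (ef (A b))) g) (scoef (Xr (- \<alpha>)) 1 g)"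
      unfolding scoef_def by (intro specI Y i S_of_int)
    moreover have "g \<in> \<Phi>" "cn g \<alpha> = 1" using that deg1(1) by auto
    ultimately show ?thesis
      using grade_1_roots(1)[of g] root_nz[of g] by (simp add: scoef_def xi_Xr alpha)
  qed
  have U1: "Um (\<lambda>_. 0) deg1 = (1 :: ('r, 'n) sqm)" "Up (\<lambda>_. 0) deg1 = (1 :: ('r, 'n) sqm)"
    by (simp add: Um_zero) (simp add: Up_def map_replicate_const)
  have Um: "SE (\<lambda>b. Um (scoef (?Y b) (inverse (ef (A b)))) deg1) 1"
    using SE_Um[OF deg1_sub, of "\<lambda>b. scoef (?Y b) (inverse (ef (A b)))" "\<lambda>_. 0"] sc U1 by simp
  have Up: "SM (\<lambda>b. Up (scoef (?Y b) (inverse (ef (A b)))) deg1) 1"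
    using SM_Up_general[of deg1 "\<lambda>b. scoef (?Y b) (inverse (ef (A b)))" "\<lambda>_. 0"] sc U1 by simp
  have "S (\<lambda>b. bcoef g0 (?Y b) (inverse (ef (A b)))) (xi g0 (br (1 * Xr (- \<alpha>) * 1) (Xr g0)) * 1)"
    unfolding bcoef_def by (intro specI Y i Up SE_SM[OF Um])
  moreover have "- \<alpha> + g0 \<noteq> g0" using root_nz[OF alpha] by simp
  ultimately have b: "S (\<lambda>b. bcoef g0 (?Y b) (inverse (ef (A b)))) 0"
    using xi_br_Xr_zero[OF neg_root[OF alpha] g0 g0, where 'r = 'r] by simp
  have "SE (\<lambda>b. est g0 (A b)) (xx \<alpha> (- 0) * 1)"
    unfolding est_def Vm_def Xr_complex[OF neg_root[OF alpha], symmetric]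
    by (intro SE_mult SE_xx alpha Um S_minus b)
  then show "SE (\<lambda>b. est g0 (A b)) 1" by simp
qed

end

section \<open>Elimination in \<open>G\<^sub>2\<close>\<close>

context chev
begin

lemma adj_one_complex: "adj 1 = (1 :: (complex, 'n) sqm)"
  using EC_inverse(1)[OF EC_one] by simp

text \<open>Commuting with all root vectors implies commuting with all \<open>H \<eta>\<close>, so
  there are no root components. The Cartan part acts by 0 on every root vector, and
  \<open>coroot_relation\<close> makes it 0.\<close>

lemma L_central:
  assumes "Y \<in> L" "\<And>\<beta>. \<beta> \<in> \<Phi> \<Longrightarrow> br Y (X \<beta>) = 0"
  shows "Y = 0"
proof -
  have HY: "br (H \<eta>) Y = 0" if "\<eta> \<in> \<Phi>" for \<eta>
  proof -
    have "br Y (H \<eta>) = 0" unfolding H_def by (subst br_jacobi) (simp add: assms(2) that)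
    then show ?thesis using br_swap[of "H \<eta>" Y] by simp
  qed
  have "xi \<kappa> Y = 0" if "\<kappa> \<in> \<Phi>" for \<kappa>
    using xi_br_H[OF that that assms(1)] HY[OF that] root_nz[OF that] by simp
  then obtain b where b: "Y = (\<Sum>g\<in>\<Phi>. b g \<odot> H g)"
    using L_expand[OF assms(1)] by auto
  have "(\<Sum>g\<in>\<Phi>. b g * of_real (cn \<beta> g)) = 0" if "\<beta> \<in> \<Phi>" for \<beta>
  proof -
    have "br Y (X \<beta>) = (\<Sum>g\<in>\<Phi>. b g * of_real (cn \<beta> g)) \<odot> X \<beta>"
      unfolding b by (simp add: br_sum_left br_simps br_H_X that sm_sum_left)
    then show ?thesis using assms(2)[OF that] X_nz[OF that] sm_cancel[of _ "X \<beta>" 0] by force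
  qed
  then show ?thesis unfolding b H_def by (rule coroot_relation)
qed

end

context g2
begin

declare g2_coords_def [simp]

sublocale P1: long_root \<Phi> X "R 1 3" by unfold_locales (rule long_R, simp)

sublocale P2: long_root \<Phi> X "R (-1) (-3)" by unfold_locales (rule long_R, simp)

sublocale Q1: long_root \<Phi> X "R 2 3" by unfold_locales (rule long_R, simp)

sublocale Q2: long_root \<Phi> X "R (-2) (-3)" by unfold_locales (rule long_R, simp)

text \<open>The steps \<open>F1\<close> to \<open>F4\<close> treat the vectors of -(l + 3 s), l + 3
  s, -(2 l + 3 s) and 2 l + 3 s in this order; \<open>F5\<close> corrects the remaining torus
  part.\<close>

definition F1 where "F1 M = P1.est (R 0 1) M"
definition M1 where "M1 M = F1 M * M"
definition F2 where "F2 M = P2.est (R 0 (-1)) (M1 M)"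
definition M2 where "M2 M = F2 M * M1 M"
definition F3 where "F3 M = Q1.est (R 1 1) (M2 M)"
definition M3 where "M3 M = F3 M * M2 M"
definition F4 where "F4 M = Q2.est (R (-1) (-1)) (M3 M)"
definition M4 where "M4 M = F4 M * M3 M"

definition cf :: "'e \<Rightarrow> (complex, 'n) sqm \<Rightarrow> complex" where
  "cf b M = xi b (M4 M * X b * adj (M4 M))"

text \<open>The exponents in \<open>tl\<close> and \<open>ts\<close> are the entries of the inverse
  of the Cartan matrix of G2. Its determinant is 1, so the correcting torus element needs no
  radicals.\<close>

definition tl :: "(complex, 'n) sqm \<Rightarrow> complex" where
  "tl M = cf (R 1 0) M ^ 2 * cf (R 0 1) M ^ 3"

definition ts :: "(complex, 'n) sqm \<Rightarrow> complex" where
  "ts M = cf (R 1 0) M * cf (R 0 1) M ^ 2"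

definition F5 where "F5 M = tr (R 1 0) (inverse (tl M)) * tr (R 0 1) (inverse (ts M))"

definition elim :: "(complex, 'n) sqm \<Rightarrow> (complex, 'n) sqm" where
  "elim M = F5 M * M4 M"

definition good :: "(complex, 'n) sqm \<Rightarrow> bool" where
  "good M \<longleftrightarrow> P1.ef M \<noteq> 0 \<and> P2.ef (M1 M) \<noteq> 0 \<and> Q1.ef (M2 M) \<noteq> 0 \<and> Q2.ef (M3 M) \<noteq> 0"

lemma root_cases:
  assumes "b \<in> \<Phi>"
  obtains i j where "(i, j) \<in> g2_coords" "b = R i j"
  using assms unfolding roots_eq by (auto simp del: g2_coords_def)

lemma F_EC: "F1 M \<in> EC" "F2 M \<in> EC" "F3 M \<in> EC" "F4 M \<in> EC" "F5 M \<in> EC"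
  unfolding F1_def F2_def F3_def F4_def F5_def
  by (simp_all add: P1.est_EC P2.est_EC Q1.est_EC Q2.est_EC EC_mult tr_EC)

lemma M_EC: "M \<in> EC \<Longrightarrow> M1 M \<in> EC" "M \<in> EC \<Longrightarrow> M2 M \<in> EC" "M \<in> EC \<Longrightarrow> M3 M \<in> EC" "M \<in> EC \<Longrightarrow> M4 M \<in> EC"
  "M \<in> EC \<Longrightarrow> elim M \<in> EC"
  unfolding M1_def M2_def M3_def M4_def elim_def by (simp_all add: EC_mult F_EC)

text \<open>After two steps the vectors of l + 3 s and its negative are scaled, so the Cartan
  element of this root is fixed. Its weights reduce each later step to one factor, at a short root
  orthogonal to l + 3 s, which leaves the earlier scalings intact.\<close>

lemma scales_M4_long:
  assumes M: "M \<in> EC" "good M"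
  obtains a b c d where "scales (M4 M) (X (R 1 3)) a" "scales (M4 M) (X (R (-1) (-3))) b"
    "scales (M4 M) (X (R 2 3)) c" "scales (M4 M) (X (R (-2) (-3))) d"
proof -
  note E = M_EC[OF M(1)]
  have g: "P1.ef M \<noteq> 0" "P2.ef (M1 M) \<noteq> 0" "Q1.ef (M2 M) \<noteq> 0" "Q2.ef (M3 M) \<noteq> 0"
    using M(2) by (simp_all add: good_def)
  obtain a where s1: "scales (M1 M) (X (R (-1) (-3))) a"
    using P1.est_scales[OF M(1) g(1), of "R 0 1"] by (simp add: cn_R M1_def F1_def)
  have "scales (M2 M) (X (R (-1) (-3))) (1 * a)"
    unfolding M2_def by (rule scales_mult[OF F_EC(2) E(1) _ s1]) (simp add: F2_def P2.est_scales_alpha)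
  then have s2: "scales (M2 M) (X (R (-1) (-3))) a" by simp
  obtain b where s2': "scales (M2 M) (X (R 1 3)) b"
    using P2.est_scales[OF E(1) g(2), of "R 0 (-1)"] by (simp add: cn_R M2_def F2_def)
  have h2: "scales (M2 M) (H (R 1 3)) 1"
    by (rule scales_opposite(2)[OF E(2) _ s2']) (use s2 in simp_all)
  have "\<exists>c. F3 M = xx (R 1 1) c" unfolding F3_def
  proof (rule Q1.est_single[OF E(2) h2])
    show "g = R 1 1" if T: "g \<in> \<Phi>" "cn g (R 2 3) = 1" "cn g (R 1 3) = 0" for g
    proof -
      obtain i j where ij: "(i, j) \<in> g2_coords" "g = R i j" by (rule root_cases[OF T(1)])
      show ?thesis
        using ij(1) T(2,3) unfolding ij(2) cn_R g2_coords_def by (elim insertE emptyE) simp_all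
    qed
  qed (simp_all add: cn_R)
  then obtain u where u: "F3 M = xx (R 1 1) u" by blast
  have f3: "scales (F3 M) (X (R 1 3)) 1" "scales (F3 M) (X (R (-1) (-3))) 1"
    unfolding u by (rule scales_xx; simp add: R_eq_zero)+
  obtain c where s3: "scales (M3 M) (X (R (-2) (-3))) c"
    using Q1.est_scales[OF E(2) g(3), of "R 1 1"] by (simp add: cn_R M3_def F3_def)
  have s3': "scales (M3 M) (X (R (-1) (-3))) a" "scales (M3 M) (X (R 1 3)) b"
    unfolding M3_def using scales_mult[OF F_EC(3) E(2) f3(2) s2] scales_mult[OF F_EC(3) E(2) f3(1) s2'] by simp_all
  have h3: "scales (M3 M) (H (R 1 3)) 1"
    by (rule scales_opposite(2)[OF E(3) _ s3'(2)]) (use s3' in simp_all)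
  have "\<exists>c. F4 M = xx (R (-1) (-1)) c" unfolding F4_def
  proof (rule Q2.est_single[OF E(3) h3])
    show "g = R (-1) (-1)" if T: "g \<in> \<Phi>" "cn g (R (-2) (-3)) = 1" "cn g (R 1 3) = 0" for g
    proof -
      obtain i j where ij: "(i, j) \<in> g2_coords" "g = R i j" by (rule root_cases[OF T(1)])
      show ?thesis
        using ij(1) T(2,3) unfolding ij(2) cn_R g2_coords_def by (elim insertE emptyE) simp_all
    qed
  qed (simp_all add: cn_R)
  then obtain v where v: "F4 M = xx (R (-1) (-1)) v" by blast
  have f4: "scales (F4 M) (X (R 1 3)) 1" "scales (F4 M) (X (R (-1) (-3))) 1" "scales (F4 M) (X (R (-2) (-3))) 1"
    unfolding v by (rule scales_xx; simp add: R_eq_zero)+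
  obtain d where s4: "scales (M4 M) (X (R 2 3)) d"
    using Q2.est_scales[OF E(3) g(4), of "R (-1) (-1)"] by (simp add: cn_R M4_def F4_def)
  show ?thesis
    by (rule that[of b a d c])
      (use s4 scales_mult[OF F_EC(4) E(3) f4(1) s3'(2)] scales_mult[OF F_EC(4) E(3) f4(2) s3'(1)]
        scales_mult[OF F_EC(4) E(3) f4(3) s3] in \<open>simp_all add: M4_def\<close>)
qed

text \<open>The two fixed Cartan elements have weights that separate the roots from each other and
  from 0.\<close>

lemma scales_M4:
  assumes M: "M \<in> EC" "good M" and b: "b \<in> \<Phi>"
  shows "scales (M4 M) (X b) (cf b M)"
proof -
  have E: "M4 M \<in> EC" by (rule M_EC(4)[OF M(1)])
  obtain a1 a2 a3 a4 where a: "scales (M4 M) (X (R 1 3)) a1" "scales (M4 M) (X (R (-1) (-3))) a2"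
    "scales (M4 M) (X (R 2 3)) a3" "scales (M4 M) (X (R (-2) (-3))) a4"
    by (rule scales_M4_long[OF M])
  have h: "scales (M4 M) (H (R 1 3)) 1" "scales (M4 M) (H (R 2 3)) 1"
    using scales_opposite(2)[OF E _ a(1)] scales_opposite(2)[OF E _ a(3)] a(2,4) by simp_all
  define V where "V = M4 M * X b * adj (M4 M)"
  have VL: "V \<in> L" unfolding V_def by (rule EC_conj_L[OF E L_X[OF b]])
  have w: "br (H (R 1 3)) V = of_real (cn b (R 1 3)) \<odot> V" "br (H (R 2 3)) V = of_real (cn b (R 2 3)) \<odot> V"
    unfolding V_def by (rule weight_conj[OF E]; simp add: h br_H_X b)+
  have x: "xi g V = 0" if g: "g \<in> \<Phi>" "g \<noteq> b" for g
  proof -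
    obtain i j where ij: "(i, j) \<in> g2_coords" "g = R i j" by (rule root_cases[OF g(1)])
    obtain k m where km: "(k, m) \<in> g2_coords" "b = R k m" by (rule root_cases[OF b])
    have "cn g (R 1 3) \<noteq> cn b (R 1 3) \<or> cn g (R 2 3) \<noteq> cn b (R 2 3)"
      using ij(1) km(1) g(2) unfolding ij(2) km(2) cn_R g2_coords_def by (elim insertE emptyE) simp_all
    then show ?thesis
      using xi_zero_if_weight[OF _ g(1) VL w(1)] xi_zero_if_weight[OF _ g(1) VL w(2)] by auto
  qed
  obtain b' where V: "V = (\<Sum>g\<in>\<Phi>. xi g V \<odot> X g) + (\<Sum>g\<in>\<Phi>. b' g \<odot> H g)"
    using L_expand[OF VL] by blast
  define W where "W = (\<Sum>g\<in>\<Phi>. b' g \<odot> H g)"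
  have "(\<Sum>g\<in>\<Phi>. xi g V \<odot> X g) = (\<Sum>g\<in>\<Phi>. if g = b then xi b V \<odot> X b else 0)"
    by (rule sum.cong) (auto simp: x)
  then have VW: "V = xi b V \<odot> X b + W" using V b finite_roots by (simp add: W_def)
  have W0: "of_real (cn b \<eta>) \<odot> W = 0" if e: "\<eta> \<in> \<Phi>" "br (H \<eta>) V = of_real (cn b \<eta>) \<odot> V" for \<eta>
  proof -
    have "br (H \<eta>) W = 0" unfolding W_def by (simp add: br_sum_right br_simps br_H_H e)
    then have "br (H \<eta>) V = xi b V \<odot> (of_real (cn b \<eta>) \<odot> X b)"
      by (subst VW) (simp add: br_simps br_H_X e b)
    moreover have "of_real (cn b \<eta>) \<odot> V = xi b V \<odot> (of_real (cn b \<eta>) \<odot> X b) + of_real (cn b \<eta>) \<odot> W"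
      by (subst VW) (simp add: sm_simps mult.commute)
    ultimately show ?thesis using e(2) by simp
  qed
  have "cn b (R 1 3) \<noteq> 0 \<or> cn b (R 2 3) \<noteq> 0"
  proof -
    obtain k m where km: "(k, m) \<in> g2_coords" "b = R k m" by (rule root_cases[OF b])
    show ?thesis using km(1) unfolding km(2) cn_R g2_coords_def by (elim insertE emptyE) simp_all
  qed
  then have "W = 0"
    using W0[OF _ w(1)] W0[OF _ w(2)] sm_cancel[of "complex_of_real (cn b (R 1 3))" W 0]
      sm_cancel[of "complex_of_real (cn b (R 2 3))" W 0] by auto
  then show ?thesis using VW by (simp add: scales_def cf_def V_def)
qed

text \<open>The choice of \<open>tl\<close> and \<open>ts\<close> makes the scalars at l and s equal
  to 1. Brackets give the other positive roots, and opposite roots have inverse scalars.\<close>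

theorem scales_elim:
  assumes M: "M \<in> EC" "good M" and b: "b \<in> \<Phi>"
  shows "scales (elim M) (X b) 1"
proof -
  have E: "M4 M \<in> EC" "elim M \<in> EC" using M_EC[OF M(1)] by simp_all
  define a where "a = cf (R 1 0) M"
  define c where "c = cf (R 0 1) M"
  have nz: "a \<noteq> 0" "c \<noteq> 0"
    using scales_nonzero[OF E(1) _ scales_M4[OF M]] by (simp_all add: a_def c_def)
  have t: "tl M = a ^ 2 * c ^ 3" "ts M = a * c ^ 2" by (simp_all add: tl_def ts_def a_def c_def)
  have tn: "inverse (tl M) \<noteq> 0" "inverse (ts M) \<noteq> 0" using nz by (simp_all add: t)
  have F5: "scales (elim M) (X g) (inverse (tl M) powi i * inverse (ts M) powi j * cf g M)"
    if "g \<in> \<Phi>" "cn g (R 1 0) = of_int i" "cn g (R 0 1) = of_int j" for g i j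
    unfolding elim_def F5_def
    by (intro scales_mult scales_tr scales_M4 M EC_mult tr_EC E that tn) simp_all
  have el: "scales (elim M) (X (R 1 0)) 1"
  proof -
    have "inverse (tl M) powi 2 * inverse (ts M) powi (-3) * cf (R 1 0) M = 1"
      using nz by (simp add: t a_def[symmetric] power_int_minus field_simps eval_nat_numeral)
    then show ?thesis using F5[of "R 1 0" 2 "-3"] by (simp add: cn_R)
  qed
  have es: "scales (elim M) (X (R 0 1)) 1"
  proof -
    have "inverse (tl M) powi (-1) * inverse (ts M) powi 2 * cf (R 0 1) M = 1"
      using nz by (simp add: t c_def[symmetric] power_int_minus field_simps eval_nat_numeral)
    then show ?thesis using F5[of "R 0 1" "-1" 2] by (simp add: cn_R)
  qed
  have add: "scales (elim M) (X (R (i + k) (j + m))) 1"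
    if "scales (elim M) (X (R i j)) 1" "scales (elim M) (X (R k m)) 1"
      "R i j \<in> \<Phi>" "R k m \<in> \<Phi>" "R (i + k) (j + m) \<in> \<Phi>" for i j k m
    using scales_add_roots[OF E(2) that(3,4) _ that(1,2)] that(5) by simp
  have e1: "scales (elim M) (X (R 1 1)) 1" using add[OF el es] by simp
  have e2: "scales (elim M) (X (R 1 2)) 1" using add[OF e1 es] by simp
  have e3: "scales (elim M) (X (R 1 3)) 1" using add[OF e2 es] by simp
  have e4: "scales (elim M) (X (R 2 3)) 1" using add[OF el e3] by simp
  have neg: "scales (elim M) (X (- g)) 1" if g: "g \<in> \<Phi>" "scales (elim M) (X g) 1" for g
  proof -
    obtain i j where "cn g (R 1 0) = of_int i" "cn g (R 0 1) = of_int j"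
      using cn_Ints[OF _ g(1), of "R 1 0"] cn_Ints[OF _ g(1), of "R 0 1"]
      by (auto elim!: Ints_cases)
    then obtain d where "scales (elim M) (X (- g)) d"
      using F5[OF neg_root[OF g(1)], of "- i" "- j"] by simp
    with scales_opposite(1)[OF E(2) g this] show ?thesis by simp
  qed
  have ns: "scales (elim M) (X (R 0 (-1))) 1" "scales (elim M) (X (R (-1) 0)) 1" "scales (elim M) (X (R (-1) (-1))) 1"
    "scales (elim M) (X (R (-1) (-2))) 1" "scales (elim M) (X (R (-1) (-3))) 1" "scales (elim M) (X (R (-2) (-3))) 1"
    using neg[OF _ es] neg[OF _ el] neg[OF _ e1] neg[OF _ e2] neg[OF _ e3] neg[OF _ e4] by simp_all
  obtain k m where km: "(k, m) \<in> g2_coords" "b = R k m" by (rule root_cases[OF b])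
  show ?thesis
    using km(1) unfolding km(2) g2_coords_def by (elim insertE emptyE) (simp_all add: el es e1 e2 e3 e4 ns)
qed

end

locale g2_spcl = g2 \<Phi> X l s + chev_spcl_inv \<Phi> X S B
  for \<Phi> :: "'e::euclidean_space set" and X :: "'e \<Rightarrow> (complex, 'n::finite) sqm" and l s :: 'e
    and S :: "('b \<Rightarrow> complex) \<Rightarrow> 'r::comm_ring_1 \<Rightarrow> bool" and B :: "'b set"
begin

text \<open>As \<open>c\<close> fixes all root vectors, every factor of the elimination specializes
  to 1, and so does the word by which A is multiplied.\<close>

lemma elim_spec:
  assumes A: "SM A c" and c: "\<And>\<beta>. \<beta> \<in> \<Phi> \<Longrightarrow> c * Xr \<beta> * adj c = Xr \<beta>"
  shows "\<exists>E. SE E 1 \<and> (\<forall>b. elim (A b) = E b * A b)"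
    "S (\<lambda>b. P1.ef (A b)) 1" "S (\<lambda>b. P2.ef (M1 (A b))) 1" "S (\<lambda>b. Q1.ef (M2 (A b))) 1" "S (\<lambda>b. Q2.ef (M3 (A b))) 1"
proof -
  interpret P1: long_root_spcl \<Phi> X "R 1 3" S B by unfold_locales
  interpret P2: long_root_spcl \<Phi> X "R (-1) (-3)" S B by unfold_locales
  interpret Q1: long_root_spcl \<Phi> X "R 2 3" S B by unfold_locales
  interpret Q2: long_root_spcl \<Phi> X "R (-2) (-3)" S B by unfold_locales
  have mult: "SM (\<lambda>b. F (A b) * G (A b)) c" if "SE (\<lambda>b. F (A b)) 1" "SM (\<lambda>b. G (A b)) c"
    for F G :: "(complex, 'n) sqm \<Rightarrow> (complex, 'n) sqm"
    using SM_mult[OF SE_SM[OF that(1)] that(2)] by simp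
  have 1: "SE (\<lambda>b. F1 (A b)) 1" "S (\<lambda>b. P1.ef (A b)) 1"
    unfolding F1_def using P1.est_spec[OF A, of "R 0 1"] c[of "R (-1) (-3)"] by simp_all
  have m1: "SM (\<lambda>b. M1 (A b)) c" unfolding M1_def by (rule mult[OF 1(1) A])
  have 2: "SE (\<lambda>b. F2 (A b)) 1" "S (\<lambda>b. P2.ef (M1 (A b))) 1"
    unfolding F2_def using P2.est_spec[OF m1, of "R 0 (-1)"] c[of "R 1 3"] by simp_all
  have m2: "SM (\<lambda>b. M2 (A b)) c" unfolding M2_def by (rule mult[OF 2(1) m1])
  have 3: "SE (\<lambda>b. F3 (A b)) 1" "S (\<lambda>b. Q1.ef (M2 (A b))) 1"
    unfolding F3_def using Q1.est_spec[OF m2, of "R 1 1"] c[of "R (-2) (-3)"] by simp_all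
  have m3: "SM (\<lambda>b. M3 (A b)) c" unfolding M3_def by (rule mult[OF 3(1) m2])
  have 4: "SE (\<lambda>b. F4 (A b)) 1" "S (\<lambda>b. Q2.ef (M3 (A b))) 1"
    unfolding F4_def using Q2.est_spec[OF m3, of "R (-1) (-1)"] c[of "R 2 3"] by simp_all
  have m4: "SM (\<lambda>b. M4 (A b)) c" unfolding M4_def by (rule mult[OF 4(1) m3])
  have cf: "S (\<lambda>b. cf \<beta> (A b)) 1" if b: "\<beta> \<in> \<Phi>" for \<beta>
  proof -
    have "S (\<lambda>b. xi \<beta> (M4 (A b) * Xr \<beta> * adj (M4 (A b)))) (xi \<beta> (c * Xr \<beta> * adj c))"
      by (intro specI m4)
    then show ?thesis by (simp add: c b xi_Xr cf_def Xr_complex)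
  qed
  have pw: "S (\<lambda>b. f b ^ k) 1" if "S f 1" for f k using S_power[OF that, of k] by simp
  have t: "S (\<lambda>b. tl (A b)) 1" "S (\<lambda>b. ts (A b)) 1" unfolding tl_def ts_def
    using S_mult[OF pw[OF cf[of "R 1 0"], of 2] pw[OF cf[of "R 0 1"], of 3]]
      S_mult[OF cf[of "R 1 0"] pw[OF cf[of "R 0 1"], of 2]] by simp_all
  have 5: "SE (\<lambda>b. F5 (A b)) 1" unfolding F5_def
    using SE_mult[OF SE_tr[OF _ S_inverse[OF t(1)], of "R 1 0"] SE_tr[OF _ S_inverse[OF t(2)], of "R 0 1"]] by simp
  show "\<exists>E. SE E 1 \<and> (\<forall>b. elim (A b) = E b * A b)"
    using SE_mult[OF 5 SE_mult[OF 4(1) SE_mult[OF 3(1) SE_mult[OF 2(1) 1(1)]]]]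
    by (intro exI[of _ "\<lambda>b. F5 (A b) * (F4 (A b) * (F3 (A b) * (F2 (A b) * F1 (A b))))"])
      (simp add: elim_def M4_def M3_def M2_def M1_def mult.assoc)
  show "S (\<lambda>b. P1.ef (A b)) 1" "S (\<lambda>b. P2.ef (M1 (A b))) 1" "S (\<lambda>b. Q1.ef (M2 (A b))) 1" "S (\<lambda>b. Q2.ef (M3 (A b))) 1"
    by (fact 1 2 3 4)+
qed

end

section \<open>Curves in the elementary group\<close>

text \<open>Specialization to the starting point 0 of a curve, for parameters that may have
  denominators.\<close>

definition germ :: "(complex \<Rightarrow> complex) \<Rightarrow> complex \<Rightarrow> bool" where
  "germ f r \<longleftrightarrow> f analytic_on {0} \<and> f 0 = r"

lemma spcl_germ: "spcl germ UNIV"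
  by unfold_locales (auto simp: germ_def intro: analytic_on_add analytic_on_mult)

lemma germ_inverse: "germ f 1 \<Longrightarrow> germ (\<lambda>s. inverse (f s)) 1"
  by (auto simp: germ_def intro: analytic_on_inverse)

lemma germ_id: "germ (\<lambda>s. s * t) 0"
  by (auto simp: germ_def intro!: analytic_intros)

lemma germ_nonzero: "germ f 1 \<Longrightarrow> \<exists>e>0. \<forall>s\<in>ball 0 e. f s \<noteq> 0"
proof -
  assume g: "germ f 1"
  then have "isCont f 0" "f 0 \<noteq> 0"
    by (auto simp: germ_def analytic_on_imp_differentiable_at field_differentiable_imp_continuous_at)
  from continuous_at_avoid[OF this] show ?thesis by (auto simp: dist_commute)
qed

text \<open>Specialization to the end point 1, for polynomial parameters. The germ at 0 shows what
  happens near the start, and polynomials carry an identity from there to the end.\<close>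

definition curve :: "(complex \<Rightarrow> complex) \<Rightarrow> complex \<Rightarrow> bool" where
  "curve f r \<longleftrightarrow> (\<exists>p. f = poly p) \<and> r = f 1"

lemma spcl_curve: "spcl curve UNIV"
proof
  show "curve (\<lambda>_. of_int k) (of_int k)" for k
    unfolding curve_def by (auto intro!: exI[of _ "[:of_int k:]"])
  show "curve (\<lambda>b. f b + g b) (r + s)" if T: "curve f r" "curve g s" for f g r s
  proof -
    obtain p q where "f = poly p" "g = poly q" "r = f 1" "s = g 1"
      using T unfolding curve_def by blast
    then show ?thesis unfolding curve_def by (intro conjI exI[of _ "p + q"]) auto
  qed
  show "curve (\<lambda>b. f b * g b) (r * s)" if T: "curve f r" "curve g s" for f g r s
  proof -
    obtain p q where "f = poly p" "g = poly q" "r = f 1" "s = g 1"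
      using T unfolding curve_def by blast
    then show ?thesis unfolding curve_def by (intro conjI exI[of _ "p * q"]) auto
  qed
  show "r = 0" if "curve f r" "\<And>b. b \<in> UNIV \<Longrightarrow> f b = 0" for f r
    using that unfolding curve_def by simp
qed

lemma curve_id: "curve (\<lambda>s. s * t) t"
  unfolding curve_def by (auto intro!: exI[of _ "[:0, t:]"])

lemma poly_zero_if_zero_on_ball:
  fixes p :: "complex poly"
  assumes "e > 0" "\<And>s. s \<in> ball 0 e \<Longrightarrow> poly p s = 0"
  shows "p = 0"
proof (rule ccontr)
  assume "p \<noteq> 0"
  then have "finite {s. poly p s = 0}" by (rule poly_roots_finite)
  then have "finite (ball (0 :: complex) e)" by (rule rev_finite_subset) (use assms(2) in auto)
  then show False using uncountable_ball[OF assms(1)] countable_finite by blast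
qed

lemma dpow_derivative:
  fixes N :: "(complex, 'n::finite) sqm"
  assumes "nilp N"
  shows "((\<lambda>t. ent (cexp N t) i j) has_field_derivative ent (N * cexp N t) i j) (at t)"
proof -
  have "(\<Sum>k<CARD('n). (of_nat k * t ^ (k - 1)) \<odot> dpow N k)
      = (\<Sum>k<Suc CARD('n). (of_nat k * t ^ (k - 1)) \<odot> dpow N k)"
    using dpow_nilp[OF assms, of "CARD('n)"] by simp
  also have "\<dots> = (\<Sum>k<CARD('n). (of_nat (Suc k) * t ^ k) \<odot> dpow N (Suc k))"
    by (subst sum.lessThan_Suc_shift) simp
  also have "\<dots> = (\<Sum>k<CARD('n). t ^ k \<odot> (N * dpow N k))"
    unfolding dpow_Suc[symmetric] by (simp add: mult.commute del: of_nat_Suc)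
  also have "\<dots> = N * cexp N t" by (simp add: cexp_def sum_distrib_left)
  finally have "ent (N * cexp N t) i j = ent (\<Sum>k<CARD('n). (of_nat k * t ^ (k - 1)) \<odot> dpow N k) i j"
    by simp
  then have e: "ent (N * cexp N t) i j = (\<Sum>k<CARD('n). of_nat k * t ^ (k - 1) * ent (dpow N k) i j)"
    by (simp add: ent_sum)
  have c: "(\<lambda>t. ent (cexp N t) i j) = (\<lambda>t. \<Sum>k<CARD('n). t ^ k * ent (dpow N k) i j)"
    by (simp add: cexp_def ent_sum)
  show ?thesis unfolding e c by (rule DERIV_sum) (auto intro!: derivative_eq_intros)
qed

context chev
begin

text \<open>Near 0 the logarithmic derivative, the derivative times the inverse, lies in the Lie
  algebra.\<close>

definition ldiff :: "(complex \<Rightarrow> (complex, 'n) sqm) \<Rightarrow> bool" where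
  "ldiff A \<longleftrightarrow> (\<exists>e>0. \<forall>s\<in>ball 0 e. \<exists>Y\<in>L. \<forall>i j.
     ((\<lambda>s. ent (A s) i j) has_field_derivative ent (Y * A s) i j) (at s))"

lemma chev_spcl_inv_germ: "chev_spcl_inv \<Phi> X germ UNIV"
  by (intro chev_spcl_inv.intro chev_spcl.intro chev_axioms spcl_germ)
    (unfold_locales, rule germ_inverse)


text \<open>The logarithmic derivative of a product is Y + A Y' A^-1, and conjugation by
  \<open>EC\<close> preserves \<open>L\<close>.\<close>

lemma SE_germ_ldiff:
  assumes "chev_spcl_inv.SE \<Phi> X germ A M"
  shows "ldiff A"
proof -
  interpret I: chev_spcl_inv \<Phi> X germ UNIV by (rule chev_spcl_inv_germ)
  show ?thesis using assms
  proof (induction rule: I.SE.induct)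
    case SE_one
    have "\<exists>Y\<in>L. \<forall>i j. ((\<lambda>s. ent (1 :: (complex, 'n) sqm) i j) has_field_derivative ent (Y * 1) i j) (at s)" for s :: complex
      by (rule bexI[OF _ L_zero]) simp
    then show ?case unfolding ldiff_def by (intro exI[of _ 1]) simp
  next
    case (SE_xx g f r)
    obtain e where e: "e > 0" "f holomorphic_on ball 0 e"
      using SE_xx(2) by (auto simp: germ_def analytic_at_ball)
    have "\<exists>Y\<in>L. \<forall>i j. ((\<lambda>s. ent (xx g (f s)) i j) has_field_derivative ent (Y * xx g (f s)) i j) (at s)"
      if "s \<in> ball 0 e" for s
    proof -
      have f: "(f has_field_derivative deriv f s) (at s)"
        using e(2) that by (simp add: holomorphic_derivI)
      show ?thesis
      proof (intro bexI[of _ "deriv f s \<odot> X g"] allI)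
        fix i j
        have "((\<lambda>s. ent (cexp (X g) (f s)) i j) has_field_derivative
            ent (X g * cexp (X g) (f s)) i j * deriv f s) (at s)"
          by (rule DERIV_chain2[OF dpow_derivative[OF nilp_X[OF SE_xx(1)]] f])
        then show "((\<lambda>s. ent (xx g (f s)) i j) has_field_derivative ent (deriv f s \<odot> X g * xx g (f s)) i j) (at s)"
          by (simp add: xx_complex SE_xx(1) mult.commute)
      qed (use SE_xx(1) L_sm L_X in blast)
    qed
    then show ?case unfolding ldiff_def using e(1) by blast
  next
    case (SE_mult A M A' M')
    obtain e where e: "e > 0" "\<And>s. s \<in> ball 0 e \<Longrightarrow> \<exists>Y\<in>L. \<forall>i j.
      ((\<lambda>s. ent (A s) i j) has_field_derivative ent (Y * A s) i j) (at s)"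
      using SE_mult(3) unfolding ldiff_def by blast
    obtain e' where e': "e' > 0" "\<And>s. s \<in> ball 0 e' \<Longrightarrow> \<exists>Y\<in>L. \<forall>i j.
      ((\<lambda>s. ent (A' s) i j) has_field_derivative ent (Y * A' s) i j) (at s)"
      using SE_mult(4) unfolding ldiff_def by blast
    have "\<exists>Y\<in>L. \<forall>i j. ((\<lambda>s. ent (A s * A' s) i j) has_field_derivative ent (Y * (A s * A' s)) i j) (at s)"
      if s: "s \<in> ball 0 (min e e')" for s
    proof -
      obtain Y Y' where Y: "Y \<in> L" "\<And>i j. ((\<lambda>s. ent (A s) i j) has_field_derivative ent (Y * A s) i j) (at s)"
        and Y': "Y' \<in> L" "\<And>i j. ((\<lambda>s. ent (A' s) i j) has_field_derivative ent (Y' * A' s) i j) (at s)"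
        using e(2)[of s] e'(2)[of s] s by auto
      have AE: "A s \<in> EC" by (rule I.SE_EC[OF SE_mult(1)])
      have "(Y + A s * Y' * adj (A s)) * (A s * A' s) = Y * A s * A' s + A s * Y' * (adj (A s) * A s) * A' s"
        by (simp add: algebra_simps)
      then have d: "(Y + A s * Y' * adj (A s)) * (A s * A' s) = Y * A s * A' s + A s * (Y' * A' s)"
        by (simp add: EC_inverse(2)[OF AE] mult.assoc)
      show ?thesis
      proof (intro bexI[of _ "Y + A s * Y' * adj (A s)"] allI)
        fix i j
        have "((\<lambda>s. \<Sum>k\<in>UNIV. ent (A s) i k * ent (A' s) k j) has_field_derivative
            (\<Sum>k\<in>UNIV. ent (Y * A s) i k * ent (A' s) k j + ent (Y' * A' s) k j * ent (A s) i k)) (at s)"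
          by (intro DERIV_sum DERIV_mult Y Y')
        then show "((\<lambda>s. ent (A s * A' s) i j) has_field_derivative
            ent ((Y + A s * Y' * adj (A s)) * (A s * A' s)) i j) (at s)"
          unfolding d ent_add ent_mult[of "A _" "A' _"] ent_mult[of "Y * A s" "A' s"] ent_mult[of "A s" "Y' * A' s"]
          by (simp add: sum.distrib mult.commute)
      qed (intro L_add Y EC_conj_L[OF AE] Y')
    qed
    then show ?case unfolding ldiff_def using e(1) e'(1) by (intro exI[of _ "min e e'"]) auto
  qed
qed

text \<open>The logarithmic derivative of a curve of elements centralizing \<open>L\<close> lies in the centre of \<open>L\<close>.\<close>

lemma central_curve_constant:
  assumes A: "ldiff A" "\<And>s. A s \<in> EC" and e: "e > 0" "\<And>s b. s \<in> ball 0 e \<Longrightarrow> b \<in> \<Phi> \<Longrightarrow> scales (A s) (X b) 1"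
  obtains e' where "e' > 0" "\<And>s. s \<in> ball 0 e' \<Longrightarrow> A s = A 0"
proof -
  obtain d where d: "d > 0" "\<And>s. s \<in> ball 0 d \<Longrightarrow> \<exists>Y\<in>L. \<forall>i j.
      ((\<lambda>s. ent (A s) i j) has_field_derivative ent (Y * A s) i j) (at s)"
    using A(1) unfolding ldiff_def by blast
  let ?e = "min d e"
  have com: "A s * X b = X b * A s" if "s \<in> ball 0 e" "b \<in> \<Phi>" for s b
  proof -
    have "A s * X b * adj (A s) * A s = X b * A s" using e(2)[OF that] by (simp add: scales_def)
    then show ?thesis by (simp add: mult.assoc EC_inverse(2)[OF A(2)])
  qed
  have der: "((\<lambda>s. ent (A s) i j) has_field_derivative 0) (at s)" if s: "s \<in> ball 0 ?e" for s i j
  proof -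
    obtain Y where Y: "Y \<in> L" "\<And>i j. ((\<lambda>s. ent (A s) i j) has_field_derivative ent (Y * A s) i j) (at s)"
      using d(2)[of s] s by auto
    have "br Y (X b) = 0" if b: "b \<in> \<Phi>" for b
    proof -
      \<comment> \<open>The derivative of A(s) X b - X b A(s), which vanishes on the whole
        ball.\<close>
      have "ent (Y * A s * X b - X b * (Y * A s)) i j = 0" for i j
      proof -
        let ?f = "\<lambda>s. \<Sum>k\<in>UNIV. ent (A s) i k * ent (X b) k j - ent (X b) i k * ent (A s) k j"
        have f: "?f s = ent (A s * X b - X b * A s) i j" for s by (simp add: ent_mult sum_subtractf)
        have "(?f has_field_derivative (\<Sum>k\<in>UNIV. ent (Y * A s) i k * ent (X b) k j - ent (X b) i k * ent (Y * A s) k j)) (at s)"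
          by (auto intro!: derivative_eq_intros Y(2) simp: sum_subtractf mult.commute)
        moreover have "(?f has_field_derivative 0) (at s)"
        proof (rule has_field_derivative_transform_within_open[of "\<lambda>_. 0"])
          show "open (ball 0 ?e)" "s \<in> ball 0 ?e" using s by auto
          show "0 = ?f u" if "u \<in> ball 0 ?e" for u
            unfolding f using com[OF _ b, of u] that by simp
        qed simp
        ultimately have "(\<Sum>k\<in>UNIV. ent (Y * A s) i k * ent (X b) k j - ent (X b) i k * ent (Y * A s) k j) = 0"
          by (rule DERIV_unique)
        then show ?thesis
          by (simp add: ent_mult[of "Y * A s"] ent_mult[of _ "Y * A s"] sum_subtractf)
      qed
      then have "Y * A s * X b - X b * (Y * A s) = 0" by (intro sqm_eqI) simp
      then have "Y * (A s * X b) - X b * Y * A s = 0" by (simp add: mult.assoc)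
      then have "br Y (X b) * A s = 0" using com[OF _ b, of s] s by (simp add: br_def algebra_simps)
      then have "br Y (X b) * (A s * adj (A s)) = 0" by (simp flip: mult.assoc)
      then show ?thesis by (simp add: EC_inverse(1)[OF A(2)])
    qed
    then have "Y = 0" by (rule L_central[OF Y(1)])
    then show ?thesis using Y(2) by simp
  qed
  have const: "A s = A 0" if s: "s \<in> ball 0 ?e" for s
  proof (rule sqm_eqI)
    fix i j
    obtain c where c: "\<forall>s\<in>ball 0 ?e. ent (A s) i j = c"
      using has_field_derivative_zero_constant[OF convex_ball, of 0 ?e "\<lambda>s. ent (A s) i j"]
        has_field_derivative_at_within[OF der] by blast
    moreover have "0 \<in> ball (0 :: complex) ?e" using d(1) e(1) by simp
    ultimately show "ent (A s) i j = ent (A 0) i j" using s by metis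
  qed
  show ?thesis
  proof (rule that[of ?e])
    show "?e > 0" using d(1) e(1) by simp
  qed (rule const)
qed

text \<open>Multiplying all parameters of a word by s joins 1 to \<open>A\<close>.\<close>

lemma EC_curve:
  assumes "A \<in> EC"
  shows "\<exists>C. C 1 = A \<and> chev_spcl_inv.SE \<Phi> X germ C 1 \<and> spcl.SM curve C A"
proof -
  interpret I: chev_spcl_inv \<Phi> X germ UNIV by (rule chev_spcl_inv_germ)
  interpret K: chev_spcl \<Phi> X curve UNIV by (intro chev_spcl.intro chev_axioms spcl_curve)
  show ?thesis using assms
  proof (induction A rule: EC_induct)
    case one
    show ?case by (intro exI[of _ "\<lambda>_. 1"] conjI refl I.SE_one K.SM_1)
  next
    case (mult g t A)
    then obtain C where C: "C 1 = A" "I.SE C 1" "K.SM C A" by blast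
    have "I.SE (\<lambda>s. xx g (s * t) * C s) (xx g 0 * 1)"
      by (intro I.SE_mult I.SE_xx mult C germ_id)
    moreover have "K.SM (\<lambda>s. xx g (s * t) * C s) (xx g t * A)"
      by (intro K.SM_mult K.SM_xx curve_id C)
    ultimately show ?case by (intro exI[of _ "\<lambda>s. xx g (s * t) * C s"]) (simp add: C)
  qed
qed

end

context g2
begin

text \<open>The leading coefficients have the value 1 at 0 and so do not vanish nearby; there
  \<open>elim (C s)\<close> fixes all root vectors and hence is constant.\<close>

lemma elim_curve:
  assumes "chev_spcl_inv.SE \<Phi> X germ C 1"
  shows "\<exists>e>0. \<forall>s\<in>ball 0 e. elim (C s) = 1"
proof -
  interpret I: chev_spcl_inv \<Phi> X germ UNIV by (rule chev_spcl_inv_germ)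
  interpret I: g2_spcl \<Phi> X l s germ UNIV ..
  note C = I.SE_SM[OF assms]
  have c: "1 * Xr b * adj 1 = (Xr b :: (complex, 'n) sqm)" for b by (simp add: adj_one_complex)
  note sp = I.elim_spec[OF C c]
  obtain E where E: "I.SE E 1" "\<And>s. elim (C s) = E s * C s" using sp(1) by blast
  have SE: "I.SE (\<lambda>s. elim (C s)) 1" unfolding E(2) using I.SE_mult[OF E(1) assms] by simp
  obtain e1 where e1: "e1 > 0" "\<forall>s\<in>ball 0 e1. P1.ef (C s) \<noteq> 0"
    using germ_nonzero[OF sp(2)] by blast
  obtain e2 where e2: "e2 > 0" "\<forall>s\<in>ball 0 e2. P2.ef (M1 (C s)) \<noteq> 0"
    using germ_nonzero[OF sp(3)] by blast
  obtain e3 where e3: "e3 > 0" "\<forall>s\<in>ball 0 e3. Q1.ef (M2 (C s)) \<noteq> 0"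
    using germ_nonzero[OF sp(4)] by blast
  obtain e4 where e4: "e4 > 0" "\<forall>s\<in>ball 0 e4. Q2.ef (M3 (C s)) \<noteq> 0"
    using germ_nonzero[OF sp(5)] by blast
  define e where "e = min (min e1 e2) (min e3 e4)"
  have e: "e > 0" "\<And>s. s \<in> ball 0 e \<Longrightarrow> good (C s)"
    using e1 e2 e3 e4 by (auto simp: e_def good_def)
  have sc: "scales (elim (C s)) (X b) 1" if "s \<in> ball 0 e" "b \<in> \<Phi>" for s b
    by (rule scales_elim[OF I.SE_EC[OF assms] e(2)[OF that(1)] that(2)])
  have C0: "elim (C 0) = 1"
  proof (rule sqm_eqI)
    fix i j
    have "germ (\<lambda>s. ent (elim (C s)) i j) (ent 1 i j)" by (rule I.S_ent[OF I.SE_SM[OF SE]])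
    then show "ent (elim (C 0)) i j = ent 1 i j" by (simp add: germ_def)
  qed
  show ?thesis
  proof (rule central_curve_constant[OF SE_germ_ldiff[OF SE] I.SE_EC[OF SE] e(1) sc])
    fix e' :: real assume "e' > 0" "\<And>s. s \<in> ball 0 e' \<Longrightarrow> elim (C s) = elim (C 0)"
    then show ?thesis unfolding C0 by blast
  qed
qed

text \<open>\<open>elim\<close> is regular at \<open>c\<close> with value \<open>c\<close>. An entry
  of \<open>elim\<close> minus that of 1 has a numerator that vanishes on an initial piece of every
  curve from \<open>EC_curve\<close>; it is polynomial along the curve, so it vanishes at the end
  point, thus on \<open>EC\<close>, and finally at \<open>c\<close>.\<close>

theorem centralizer_trivial:
  fixes c :: "('r::comm_ring_1, 'n) sqm"
  assumes c: "c \<in> GP" and fixed: "\<And>b. b \<in> \<Phi> \<Longrightarrow> c * Xr b * adj c = Xr b"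
  shows "c = 1"
proof -
  interpret J: chev_spcl \<Phi> X "regular_spec EC c" EC by (rule chev_spcl_points[OF c])
  interpret J: chev_spcl_inv \<Phi> X "regular_spec EC c" EC
    by unfold_locales (rule regular_spec_inverse)
  interpret J: g2_spcl \<Phi> X l s "regular_spec EC c" EC ..
  interpret K: chev_spcl \<Phi> X curve UNIV by (intro chev_spcl.intro chev_axioms spcl_curve)
  have id: "J.SM (\<lambda>A. A) c" by (rule SM_id_points[OF c])
  obtain E where E: "J.SE E 1" "\<And>A. elim A = E A * A"
    using J.elim_spec(1)[OF id fixed] by blast
  have SMe: "J.SM elim c" using J.SM_mult[OF J.SE_SM[OF E(1)] id] by (simp flip: E(2))
  show ?thesis
  proof (rule sqm_eqI)
    fix i j
    let ?e = "\<lambda>p A. eval_entry_poly p (rep A)"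
    obtain p q where pq: "\<And>A. A \<in> EC \<Longrightarrow> ent (elim A) i j * ?e q A = ?e p A" "?e q c = 1" "?e p c = ent c i j"
      using J.S_ent[OF SMe, of i j] unfolding regular_spec_def by blast
    define k :: int where "k = (if i = j then 1 else 0)"
    have k: "ent (1 :: ('z::comm_ring_1, 'n) sqm) i j = of_int k" by (simp add: k_def ent_one)
    define d where "d = p + Poly_Mapping.single 0 (- k) * q"
    have ed: "?e d A = ?e p A - of_int k * ?e q A" for A :: "('z::comm_ring_1, 'n) sqm"
      by (simp add: d_def eval_entry_poly_add eval_entry_poly_mult eval_entry_poly_single mon_val_0)
    have "?e d A = 0" if A: "A \<in> EC" for A
    proof -
      obtain C where C: "C 1 = A" "chev_spcl_inv.SE \<Phi> X germ C 1" "K.SM C A"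
        using EC_curve[OF A] by blast
      obtain e where e: "e > 0" "\<forall>s\<in>ball 0 e. elim (C s) = 1"
        using elim_curve[OF C(2)] by blast
      have "curve (\<lambda>s. ?e d (C s)) (?e d A)" by (rule K.S_eval_entry_poly[OF C(3)])
      then obtain P where P: "\<And>s. ?e d (C s) = poly P s" unfolding curve_def by metis
      have "poly P s = 0" if s: "s \<in> ball 0 e" for s
      proof -
        have "C s \<in> EC" by (rule chev_spcl_inv.SE_EC[OF chev_spcl_inv_germ C(2)])
        from pq(1)[OF this] e(2) s show ?thesis by (simp add: ed k flip: P)
      qed
      then have "P = 0" by (rule poly_zero_if_zero_on_ball[OF e(1)])
      then show ?thesis using P[of 1] C(1) by simp
    qed
    then have "?e d c = 0" using c unfolding GP_def points_def by blast
    then show "ent c i j = ent 1 i j" using pq(2,3) by (simp add: ed k)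
  qed
qed

end

section \<open>Root subgroups for \<open>G\<^sub>2\<close>\<close>

context chev
begin

lemma br_Hr_Xr:
  assumes "\<eta> \<in> \<Phi>" "g \<in> \<Phi>" "cn g \<eta> = of_int k"
  shows "br (Hr \<eta>) (Xr g) = of_int k \<odot> (Xr g :: ('r::comm_ring_1, 'n) sqm)"
proof -
  interpret T: chev_spcl \<Phi> X "tspec (0 :: 'r)" UNIV by (rule chev_spcl_tspec)
  show ?thesis
    by (rule T.SM_eq[of "\<lambda>_. br (Hr \<eta>) (Xr g)" _ "\<lambda>_. of_int k \<odot> Xr g"])
      ((intro specI T.S_of_int)+ | simp add: Xr_complex Hr_complex br_H_X assms)+
qed

lemma br_Hr_Hr:
  assumes "\<eta> \<in> \<Phi>" "g \<in> \<Phi>"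
  shows "br (Hr \<eta>) (Hr g) = (0 :: ('r::comm_ring_1, 'n) sqm)"
proof -
  interpret T: chev_spcl \<Phi> X "tspec (0 :: 'r)" UNIV by (rule chev_spcl_tspec)
  show ?thesis
    by (rule T.SM_zero_if[of "\<lambda>_. br (Hr \<eta>) (Hr g)"])
      ((intro specI)+ | simp add: Hr_complex br_H_H assms)+
qed

lemma conj_Xr_fixed:
  fixes t :: "'r::comm_ring_1"
  assumes "g \<in> \<Phi>" "d \<in> \<Phi>" "g + d \<notin> \<Phi>" "g + d \<noteq> 0"
  shows "xx g t * Xr d * xx g (- t) = (Xr d :: ('r, 'n) sqm)"
proof -
  interpret T: chev_spcl \<Phi> X "tspec t" UNIV by (rule chev_spcl_tspec)
  show ?thesis
  proof (rule T.SM_eq)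
    show "T.SM (\<lambda>t. xx g t * Xr d * xx g (- t)) (xx g t * Xr d * xx g (- t))"
      by (intro specI tspec_id)
    show "T.SM (\<lambda>_. Xr d) (Xr d)" by (intro specI)
    show "xx g t * Xr d * xx g (- t) = Xr d" for t :: complex
      using scales_xx[OF assms, of t] by (simp add: scales_def adj_xx Xr_complex assms)
  qed
qed

lemma conj_Xr_opposite:
  fixes t :: "'r::comm_ring_1"
  assumes "g \<in> \<Phi>"
  shows "xx g t * Xr (- g) * xx g (- t) = Xr (- g) + t \<odot> Hr g - (t * t) \<odot> (Xr g :: ('r, 'n) sqm)"
proof -
  interpret T: chev_spcl \<Phi> X "tspec t" UNIV by (rule chev_spcl_tspec)
  show ?thesis
  proof (rule T.SM_eq)
    show "T.SM (\<lambda>t. xx g t * Xr (- g) * xx g (- t)) (xx g t * Xr (- g) * xx g (- t))"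
      by (intro specI tspec_id)
    show "T.SM (\<lambda>t. Xr (- g) + t \<odot> Hr g - (t * t) \<odot> Xr g) (Xr (- g) + t \<odot> Hr g - (t * t) \<odot> Xr g)"
      by (intro specI tspec_id)
    fix t :: complex
    have "xx g t * X (- g) * xx g (- t) = X (- g) + t \<odot> br (X g) (X (- g))
        + t\<^sup>2 \<odot> adp (X g) 2 (X (- g)) + t ^ 3 \<odot> adp (X g) 3 (X (- g))"
      using L_conj[OF assms L_X[OF neg_root[OF assms]], of t] assms
      by (simp add: xx_complex eval_nat_numeral algebra_simps)
    then show "xx g t * Xr (- g) * xx g (- t) = Xr (- g) + t \<odot> Hr g - (t * t) \<odot> Xr g"
      unfolding adp_X_neg[OF assms] by (simp add: br_X_neg Xr_complex Hr_complex assms power2_eq_square)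
  qed
qed

text \<open>The coefficient of \<open>X (b + 2d)\<close> is a unit, which makes this relation useful in
  characteristic 2, where the bracket of \<open>X d\<close> and \<open>X (b + d)\<close> vanishes.\<close>

lemma Nd_string_3:
  assumes r: "d \<in> \<Phi>" "b \<in> \<Phi>" "b + d \<in> \<Phi>" "b + 2 *\<^sub>R d \<in> \<Phi>" "b + 3 *\<^sub>R d \<in> \<Phi>"
    and no: "b - d \<notin> \<Phi>"
  obtains k m n :: int where "m * m = 1"
    "Nd d (Xr b) = of_int k \<odot> Xr (b + d) + of_int m \<odot> Xr (b + 2 *\<^sub>R d) + of_int n \<odot> (Xr (b + 3 *\<^sub>R d) :: ('r::comm_ring_1, 'n) sqm)"
proof -
  have v: "d + b = b + d" "d + (b + d) = b + 2 *\<^sub>R d" "d + (b + 2 *\<^sub>R d) = b + 3 *\<^sub>R d"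
    "b + d - d = b" "b + d - 2 *\<^sub>R d = b - d"
    "b + 2 *\<^sub>R d - of_nat 2 *\<^sub>R d = b"
    by (rule inner_ext, simp add: inner_simps)+
  obtain k :: int where k': "br (X d) (X b) = of_int k \<odot> X (d + b)" "k * k = 1"
    by (rule unit_constant[OF r(1,2) r(3)[folded v(1)] no])
  note k = k'[unfolded v(1)]
  have "rstr \<Phi> d (b + d) = 1"
    by (rule rstr_eq_1[OF r(1,3)]) (simp_all only: v r no not_False_eq_True)
  then obtain p :: int where p: "br (X d) (X (b + d)) = of_int p \<odot> X (b + 2 *\<^sub>R d)" "\<bar>p\<bar> = 2"
    using structure_constant[of d "b + d"] r v(2) by auto
  have ne: "b \<noteq> d" using r(3) double_not_root[OF r(1)] by auto
  have "rstr \<Phi> d (b + 2 *\<^sub>R d) = 2"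
  proof (rule rstr_eqI[OF r(1)])
    show "b + 2 *\<^sub>R d - of_nat 2 *\<^sub>R d \<in> \<Phi>" unfolding v by (rule r)
    fix i :: nat assume i: "2 < i"
    define j where "j = i - 2"
    have j: "i = j + 2" "j \<ge> 1" using i by (simp_all add: j_def)
    have e: "b + 2 *\<^sub>R d - of_nat i *\<^sub>R d = b - of_nat j *\<^sub>R d"
      unfolding j(1) by (simp add: algebra_simps)
    show "b + 2 *\<^sub>R d - of_nat i *\<^sub>R d \<notin> \<Phi>"
      unfolding e by (rule string_unbroken[OF r(1,2) ne no j(2)])
  qed
  then obtain q :: int where q: "br (X d) (X (b + 2 *\<^sub>R d)) = of_int q \<odot> X (b + 3 *\<^sub>R d)" "\<bar>q\<bar> = 3"
    using structure_constant[of d "b + 2 *\<^sub>R d"] r v(3) by auto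
  define m where "m = (if p = 2 then k else - k)"
  have m: "m * m = 1" "k * p = 2 * m"
  proof -
    have "p = 2 \<or> p = -2" using p(2) by linarith
    then show "m * m = 1" "k * p = 2 * m" using k(2) by (auto simp: m_def)
  qed
  define n where "n = (if q = 3 then m else - m)"
  have n: "m * q = 3 * n"
  proof -
    have "q = 3 \<or> q = -3" using q(2) by linarith
    then show ?thesis by (auto simp: n_def)
  qed
  have m': "complex_of_int k * of_int p = 2 * of_int m"
    using m(2) by (metis of_int_mult of_int_numeral)
  have n': "complex_of_int m * of_int q = 3 * of_int n"
    using n by (metis of_int_mult of_int_numeral)
  have a2: "adp (X d) 2 (X b) = of_int m \<odot> X (b + 2 *\<^sub>R d)"
  proof -
    have "2 \<odot> adp (X d) 2 (X b) = br (X d) (br (X d) (X b))"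
      by (simp add: adp_def eval_nat_numeral)
    also have "\<dots> = 2 \<odot> (of_int m \<odot> X (b + 2 *\<^sub>R d))" by (simp add: k p m')
    finally show ?thesis by (rule sm_cancel[rotated]) simp
  qed
  have a3: "adp (X d) 3 (X b) = of_int n \<odot> X (b + 3 *\<^sub>R d)"
  proof -
    have "3 \<odot> adp (X d) 3 (X b) = br (X d) (adp (X d) 2 (X b))"
      using adp_Suc'[of "X d" 2 "X b"] by (simp add: eval_nat_numeral)
    also have "\<dots> = 3 \<odot> (of_int n \<odot> X (b + 3 *\<^sub>R d))" by (simp add: a2 q n')
    finally show ?thesis by (rule sm_cancel[rotated]) simp
  qed
  interpret T: chev_spcl \<Phi> X "tspec (0 :: 'r)" UNIV by (rule chev_spcl_tspec)
  have "Nd d (Xr b) = of_int k \<odot> Xr (b + d) + of_int m \<odot> Xr (b + 2 *\<^sub>R d) + of_int n \<odot> (Xr (b + 3 *\<^sub>R d) :: ('r, 'n) sqm)"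
  proof (rule T.SM_eq)
    show "T.SM (\<lambda>_. Nd d (Xr b)) (Nd d (Xr b))"
      unfolding Nd_def using T.S_of_int[of "-1"] by (auto intro!: specI)
    show "T.SM (\<lambda>_. of_int k \<odot> Xr (b + d) + of_int m \<odot> Xr (b + 2 *\<^sub>R d) + of_int n \<odot> Xr (b + 3 *\<^sub>R d))
      (of_int k \<odot> Xr (b + d) + of_int m \<odot> Xr (b + 2 *\<^sub>R d) + of_int n \<odot> Xr (b + 3 *\<^sub>R d))"
      by (intro specI T.S_of_int)
    show "Nd d (Xr b) = of_int k \<odot> Xr (b + d) + of_int m \<odot> Xr (b + 2 *\<^sub>R d) + of_int n \<odot> (Xr (b + 3 *\<^sub>R d) :: (complex, 'n) sqm)"
      by (simp add: Nd_complex L_X Xr_complex r k a2 a3)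
  qed
  with m(1) show ?thesis using that by blast
qed

end

context point
begin

lemma xi_br_Hr_Z:
  assumes "\<eta> \<in> \<Phi>" "g \<in> \<Phi>" "\<kappa> \<in> \<Phi>" "cn \<kappa> \<eta> = of_int k"
  shows "xi \<kappa> (br (Hr \<eta>) (Z (Xr g))) = of_int k * xi \<kappa> (Z (Xr g))"
proof (rule S_eq)
  show "regular_spec EC z (\<lambda>A. xi \<kappa> (br (Hr \<eta>) (A * Xr g * adj A))) (xi \<kappa> (br (Hr \<eta>) (Z (Xr g))))"
    by (intro specI)
  show "regular_spec EC z (\<lambda>A. of_int k * xi \<kappa> (A * Xr g * adj A)) (of_int k * xi \<kappa> (Z (Xr g)))"
    by (intro specI S_of_int)
  show "xi \<kappa> (br (Hr \<eta>) (A * Xr g * adj A)) = of_int k * xi \<kappa> (A * Xr g * adj A)" if "A \<in> EC" for A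
    using xi_br_H[OF assms(1,3) L_Xr_conj[OF that assms(2)]] assms by (simp add: Hr_complex)
qed

lemma Z_minus: "Z (- Y) = - Z Y" and Z_zero: "Z 0 = 0"
  by (simp_all add: Z_def)

definition fixed :: "'e \<Rightarrow> bool" where
  "fixed g \<longleftrightarrow> Z (Xr g) = Xr g"

lemma unit_sm_cancel: "(m :: int) * m = 1 \<Longrightarrow> of_int m \<odot> A = of_int m \<odot> B \<Longrightarrow> A = (B :: ('r, 'n) sqm)"
  by (metis of_int_1 of_int_mult sm_one sm_sm)

text \<open>Works only where the structure constant is a sign. For a constant divisible by 2,
  \<open>fixed_string_3\<close> takes over.\<close>

lemma fixed_sum:
  assumes "g \<in> \<Phi>" "d \<in> \<Phi>" "g + d \<in> \<Phi>" "d - g \<notin> \<Phi>" "fixed g" "fixed d"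
  shows "fixed (g + d)"
proof -
  obtain N :: int where N: "br (X g) (X d) = of_int N \<odot> X (g + d)" "N * N = 1"
    by (rule unit_constant[OF assms(1-4)])
  have b: "br (Xr g) (Xr d) = of_int N \<odot> (Xr (g + d) :: ('r, 'n) sqm)"
    by (rule br_Xr_transfer[OF assms(1-3) N(1)])
  have "of_int N \<odot> Z (Xr (g + d)) = of_int N \<odot> Xr (g + d)"
    using Z_br[of "Xr g" "Xr d"] assms(5,6) unfolding b fixed_def by (simp add: Z_sm b)
  then show ?thesis unfolding fixed_def by (rule unit_sm_cancel[OF N(2)])
qed

lemma fixed_string_3:
  assumes r: "d \<in> \<Phi>" "b \<in> \<Phi>" "b + d \<in> \<Phi>" "b + 2 *\<^sub>R d \<in> \<Phi>" "b + 3 *\<^sub>R d \<in> \<Phi>" "b - d \<notin> \<Phi>"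
    and c: "comm d" and f: "fixed b" "fixed (b + d)" "fixed (b + 3 *\<^sub>R d)"
  shows "fixed (b + 2 *\<^sub>R d)"
proof -
  obtain k m n :: int where m: "m * m = 1"
    and N: "Nd d (Xr b) = of_int k \<odot> Xr (b + d) + of_int m \<odot> Xr (b + 2 *\<^sub>R d) + of_int n \<odot> (Xr (b + 3 *\<^sub>R d) :: ('r, 'n) sqm)"
    by (rule Nd_string_3[OF r, where 'r = 'r]) blast
  have "Z (Nd d (Xr b)) = Nd d (Xr b)"
    using Z_Nd[OF r(1) c, of "Xr b"] f(1) by (simp add: fixed_def)
  then have "of_int m \<odot> Z (Xr (b + 2 *\<^sub>R d)) = of_int m \<odot> Xr (b + 2 *\<^sub>R d)"
    unfolding N using f(2,3) by (simp add: Z_add Z_sm fixed_def)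
  then show ?thesis unfolding fixed_def by (rule unit_sm_cancel[OF m])
qed

end

section \<open>The centralizer of five root elements in G2\<close>

locale g2_group = g2 \<Phi> X l s + large_group \<Phi> X G
  for \<Phi> :: "'e::euclidean_space set" and X :: "'e \<Rightarrow> (complex, 'n::finite) sqm" and l s :: 'e
    and G :: "('r::comm_ring_1, 'n) sqm set"
begin

text \<open>No sum of \<open>R 0 1\<close> with one of these roots is a root or 0, so their root
  elements commute with the root subgroup of \<open>R 0 1\<close>. The four long ones provide a
  complementary pair of degree 1 for each of the gradings by \<open>R 1 3\<close> and by
  \<open>R (-1) 0\<close>.\<close>

definition cset :: "'e set" where
  "cset = {R 0 1, R 1 3, R (-1) 0, R 2 3, R (-2) (-3)}"

context
  fixes z :: "('r, 'n) sqm"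
  assumes zG: "z \<in> G" and zc: "\<And>\<gamma>. \<gamma> \<in> cset \<Longrightarrow> z * xx \<gamma> 1 = xx \<gamma> 1 * z"
begin

interpretation pz: point \<Phi> X z by unfold_locales (use zG G_GP in auto)

lemma pz_comm: "g \<in> cset \<Longrightarrow> pz.comm g"
  using zc by (simp add: pz.comm_def)

interpretation a: degree_one_pair \<Phi> X "R 1 3" "R 2 3" z
  by unfold_locales (simp_all add: cn_R pz_comm cset_def)

interpretation a': degree_one_pair \<Phi> X "R 1 3" "R (-1) 0" z
  by unfold_locales (simp_all add: cn_R pz_comm cset_def)

interpretation m: long_root \<Phi> X "R (-1) 0" by unfold_locales (rule long_R, simp)

interpretation b: degree_one_pair \<Phi> X "R (-1) 0" "R (-2) (-3)" z
  by unfold_locales (simp_all add: cn_R pz_comm cset_def)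

interpretation b': degree_one_pair \<Phi> X "R (-1) 0" "R 1 3" z
  by unfold_locales (simp_all add: cn_R pz_comm cset_def)

interpretation c: degree_one_point \<Phi> X "R 1 3" "R 0 1" z
  by unfold_locales (simp_all add: cn_R pz_comm cset_def)

interpretation d: degree_one_point \<Phi> X "R (-1) 0" "R 0 1" z
  by unfold_locales (simp_all add: cn_R pz_comm cset_def)

text \<open>For \<open>R 0 1\<close> the two gradings leave multiples of different root vectors
  undetermined, so both multiples are 0; the long roots are covered by the complementary
  pairs.\<close>

lemma fixed_cset: "g \<in> cset \<Longrightarrow> pz.fixed g"
proof -
  obtain e where e: "pz.Z (Xr (R 0 1)) = Xr (R 0 1) + e \<odot> Xr (R 1 3)"
    using c.Z_delta a.c0_eq_1 by auto
  obtain e' where e': "pz.Z (Xr (R 0 1)) = Xr (R 0 1) + e' \<odot> Xr (R (-1) 0)"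
    using d.Z_delta b.c0_eq_1 by auto
  have "e \<odot> Xr (R 1 3) = e' \<odot> (Xr (R (-1) 0) :: ('r, 'n) sqm)" using e e' by simp
  from arg_cong[OF this, of "xi (R 1 3)"] have "e = 0" by (simp add: xi_Xr)
  then have "pz.fixed (R 0 1)" using e by (simp add: pz.fixed_def)
  moreover have "pz.fixed (R 2 3)" "pz.fixed (R (-1) 0)" "pz.fixed (R (-2) (-3))" "pz.fixed (R 1 3)"
    using a.Z_delta_eq a'.Z_delta_eq b.Z_delta_eq b'.Z_delta_eq by (simp_all add: pz.fixed_def)
  ultimately show "g \<in> cset \<Longrightarrow> pz.fixed g" by (auto simp: cset_def)
qed

text \<open>The vectors of \<open>R 2 3\<close> and its negative are fixed, hence so is their
  bracket, and conjugation by z preserves its weights.\<close>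

lemma Hr_Y0: "br (Hr (R 2 3)) a.Y0 = - a.Y0"
proof -
  have "pz.Z (Hr (R 2 3)) = Hr (R 2 3)"
    unfolding Hr_def pz.Z_br using fixed_cset[of "R 2 3"] fixed_cset[of "R (-2) (-3)"]
    by (simp add: pz.fixed_def cset_def)
  moreover have "br (Hr (R 2 3)) (Xr (- R 1 3)) = of_int (-1) \<odot> (Xr (- R 1 3) :: ('r, 'n) sqm)"
    by (rule br_Hr_Xr) (simp_all add: cn_R)
  ultimately show ?thesis
    unfolding a.Y0_def using pz.Z_br[of "Hr (R 2 3)" "Xr (- R 1 3)"] by (simp add: pz.Z_minus)
qed

lemma Y0_coefficients: "xi (R (-2) (-3)) a.Y0 = 0" "xi (R 0 (-1)) a.Y0 = 0" "xi (R 1 0) a.Y0 = 0"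
proof -
  have w: "(of_int k + 1) * xi \<kappa> a.Y0 = 0" if "\<kappa> \<in> \<Phi>" "cn \<kappa> (R 2 3) = of_int k" for \<kappa> k
  proof -
    have "of_int k * xi \<kappa> a.Y0 = - xi \<kappa> a.Y0"
      using pz.xi_br_Hr_Z[OF _ _ that, of "- R 1 3"] Hr_Y0 unfolding a.Y0_def by simp
    then show ?thesis by (simp add: distrib_right)
  qed
  show "xi (R (-2) (-3)) a.Y0 = 0" using w[of "R (-2) (-3)" "-2"] by (simp add: cn_R)
  show "xi (R 0 (-1)) a.Y0 = 0" using w[of "R 0 (-1)" 0] by (simp add: cn_R)
  \<comment> \<open>For \<open>R 1 0\<close> the weight argument yields only twice the coefficient,
    which says nothing in characteristic 2; a bracket with the fixed vector of
    \<open>R (-2) (-3)\<close> has a sign as its constant.\<close>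
  obtain N :: int where N: "br (X (R 1 0)) (X (R (-2) (-3))) = of_int N \<odot> X (R 1 0 + R (-2) (-3))" "N * N = 1"
    by (rule unit_constant[of "R 1 0" "R (-2) (-3)"]) simp_all
  have "br (Xr (- R 1 3)) (Xr (R (-2) (-3))) = (0 :: ('r, 'n) sqm)"
    by (rule br_Xr_zero) (simp_all add: R_eq_zero)
  then have "br a.Y0 (Xr (R (-2) (-3))) = 0"
    using pz.Z_br[of "Xr (- R 1 3)" "Xr (R (-2) (-3))"] fixed_cset[of "R (-2) (-3)"]
    unfolding a.Y0_def by (simp add: pz.fixed_def cset_def pz.Z_zero)
  moreover have "xi (R (-1) (-3)) (br a.Y0 (Xr (R (-2) (-3)))) = of_int N * xi (R 1 0) a.Y0"
    unfolding a.Y0_def by (rule pz.xi_br_Z) (use N(1) in simp_all)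
  ultimately have N0: "of_int N * xi (R 1 0) a.Y0 = 0" by simp
  have "N = 1 \<or> N = -1" using N(2) by (auto simp: zmult_eq_1_iff)
  then show "xi (R 1 0) a.Y0 = 0" using N0 by auto
qed

text \<open>The coefficients already known to vanish leave x_s(t) x_(l + 3 s)(b) as the element
  conjugating \<open>Xr (- R 1 3)\<close> to \<open>Y0\<close>. The quotient x_s(-t) z still fixes
  the vectors of \<open>cset\<close>; the weights of \<open>Hr (R 2 3)\<close> force b = 0, and the
  fixed vectors then produce all root vectors.\<close>

lemma centralizer_cset: "\<exists>t. z = xx (R 0 1) t"
proof -
  define t where "t = P1.scoef a.Y0 1 (R 0 1)"
  define b where "b = P1.bcoef (R 0 1) a.Y0 1"
  have sc: "P1.scoef a.Y0 1 g = 0" if "g \<in> set P1.deg1" "g \<noteq> R 0 1" for g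
  proof -
    have g: "g \<in> \<Phi>" "cn g (R 1 3) = 1" using that P1.deg1(1) by auto
    obtain i j where ij: "(i, j) \<in> g2_coords" "g = R i j" by (rule root_cases[OF g(1)])
    have "(i, j) \<in> {(2, 3), (1, 2), (-1, 0)}"
      using ij(1) g(2) that(2) unfolding ij(2) cn_R g2_coords_def by (elim insertE emptyE) simp_all
    then show ?thesis
      unfolding P1.scoef_def ij(2) using Y0_coefficients by (elim insertE emptyE) simp_all
  qed
  have d1: "R 0 1 \<in> set P1.deg1" using P1.deg1(1) by (simp add: cn_R)
  have Um: "P1.Um (P1.scoef a.Y0 1) P1.deg1 = xx (R 0 1) (- t)"
    unfolding t_def by (rule P1.Um_single[OF P1.deg1(2) d1 sc])
  have xi01: "xx (R 0 1) (- t) * xx (R 0 1) t = 1" "xx (R 0 1) t * xx (R 0 1) (- t) = (1 :: ('r, 'n) sqm)"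
    by (rule xx_inverse; simp)+
  have Vm: "P1.Vm (R 0 1) a.Y0 1 = xx (R 1 3) (- b) * xx (R 0 1) (- t)"
    unfolding P1.Vm_def Um b_def ..
  have "P1.Vm (R 0 1) a.Y0 1 * (xx (R 0 1) t * xx (R 1 3) b) = 1"
  proof -
    have "P1.Vm (R 0 1) a.Y0 1 * (xx (R 0 1) t * xx (R 1 3) b)
        = xx (R 1 3) (- b) * (xx (R 0 1) (- t) * xx (R 0 1) t) * xx (R 1 3) b"
      unfolding Vm by (simp add: mult.assoc)
    then show ?thesis using xx_inverse(2)[of "R 1 3" b] by (simp add: xi01)
  qed
  then have Vp: "P1.Vp (R 0 1) a.Y0 1 = xx (R 0 1) t * xx (R 1 3) b"
    using left_right_inverse_unique[OF _ P1.Vp_Vm] by metis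
  have Y0: "a.Y0 = xx (R 0 1) t * (xx (R 1 3) b * Xr (- R 1 3) * xx (R 1 3) (- b)) * xx (R 0 1) (- t)"
    using a.Z_XR_minus_alpha[OF a.c0_eq_1, of "R 0 1" "Suc 0"] unfolding a.Y0_def[symmetric] Vp Vm
    by (simp add: cn_R mult.assoc)
  define y where "y = xx (R 0 1) (- t) * z"
  have yG: "y \<in> G" unfolding y_def by (intro G_mult G_xx zG) simp
  interpret py: point \<Phi> X y by unfold_locales (use yG G_GP in auto)
  have adjy: "adj y = adj z * xx (R 0 1) t"
  proof (rule G_adj_unique[OF yG])
    have "y * (adj z * xx (R 0 1) t) = xx (R 0 1) (- t) * (z * adj z) * xx (R 0 1) t"
      by (simp add: y_def mult.assoc)
    then show "y * (adj z * xx (R 0 1) t) = 1" using G_inverse(1)[OF zG] xi01 by simp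
  qed
  define K where "K V = xx (R 0 1) (- t) * V * xx (R 0 1) t" for V :: "('r, 'n) sqm"
  have ZK: "py.Z V = K (pz.Z V)" for V
    unfolding py.Z_def pz.Z_def K_def adjy by (simp add: y_def mult.assoc)
  have Kfix: "K (Xr g) = Xr g" if "g \<in> \<Phi>" "R 0 1 + g \<notin> \<Phi>" "R 0 1 + g \<noteq> 0" for g
    using conj_Xr_fixed[of "R 0 1" g "- t"] that by (simp add: K_def)
  have Kbr: "K (br V W) = br (K V) (K W)" for V W
  proof -
    have "K V * K W = K (V * W)" for V W
    proof -
      have "K V * K W = xx (R 0 1) (- t) * V * (xx (R 0 1) t * xx (R 0 1) (- t)) * W * xx (R 0 1) t"
        by (simp add: K_def mult.assoc)
      then show ?thesis by (simp add: xi01 K_def mult.assoc)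
    qed
    moreover have "K (V - W) = K V - K W" for V W by (simp add: K_def algebra_simps)
    ultimately show ?thesis by (simp add: br_def)
  qed
  have Kc: "K (Xr g) = Xr g" if "g \<in> cset" for g
    by (rule Kfix) (use that in \<open>auto simp: cset_def R_eq_zero\<close>)
  have fy: "py.fixed g" if "g \<in> cset" for g
    using fixed_cset[OF that] Kc[OF that] by (simp add: py.fixed_def pz.fixed_def ZK)
  let ?W = "xx (R 1 3) b * Xr (- R 1 3) * xx (R 1 3) (- b)"
  have "K (xx (R 0 1) t * V * xx (R 0 1) (- t)) = V" for V
  proof -
    have "K (xx (R 0 1) t * V * xx (R 0 1) (- t))
        = (xx (R 0 1) (- t) * xx (R 0 1) t) * V * (xx (R 0 1) (- t) * xx (R 0 1) t)"
      by (simp add: K_def mult.assoc)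
    then show ?thesis by (simp add: xi01)
  qed
  then have KY0: "K a.Y0 = ?W" unfolding Y0 .
  have KH: "K (Hr (R 2 3)) = Hr (R 2 3)" unfolding Hr_def Kbr using Kc by (simp add: cset_def)
  have Km: "K (- V) = - K V" for V by (simp add: K_def)
  have "br (Hr (R 2 3)) ?W = K (br (Hr (R 2 3)) a.Y0)" by (simp only: Kbr KH KY0)
  also have "\<dots> = - ?W" by (simp only: Hr_Y0 Km KY0)
  finally have bW: "br (Hr (R 2 3)) ?W = - ?W" .
  have W: "?W = Xr (- R 1 3) + b \<odot> Hr (R 1 3) - (b * b) \<odot> Xr (R 1 3)"
    by (rule conj_Xr_opposite) simp
  moreover have "br (Hr (R 2 3)) (Xr (- R 1 3)) = of_int (-1) \<odot> (Xr (- R 1 3) :: ('r, 'n) sqm)"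
    "br (Hr (R 2 3)) (Xr (R 1 3)) = of_int 1 \<odot> (Xr (R 1 3) :: ('r, 'n) sqm)"
    by (rule br_Hr_Xr; simp add: cn_R)+
  moreover have "br (Hr (R 2 3)) (Hr (R 1 3)) = (0 :: ('r, 'n) sqm)" by (rule br_Hr_Hr) simp_all
  \<comment> \<open>The three terms of \<open>?W\<close> have weights -1, 0 and 1, whereas
    \<open>bW\<close> demands -1. The bracket with \<open>Xr (R 0 1)\<close> that follows extracts b
    without a division by 2.\<close>
  ultimately have "b \<odot> Hr (R 1 3) = (b * b) \<odot> Xr (R 1 3) + (b * b) \<odot> (Xr (R 1 3) :: ('r, 'n) sqm)"
    using bW unfolding W by (simp add: br_add_right br_diff_right algebra_simps)
  then have "br (b \<odot> Hr (R 1 3)) (Xr (R 0 1)) = br ((b * b) \<odot> Xr (R 1 3) + (b * b) \<odot> Xr (R 1 3)) (Xr (R 0 1) :: ('r, 'n) sqm)"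
    by simp
  moreover have "br (Hr (R 1 3)) (Xr (R 0 1)) = of_int 1 \<odot> (Xr (R 0 1) :: ('r, 'n) sqm)"
    by (rule br_Hr_Xr) (simp_all add: cn_R)
  moreover have "br (Xr (R 1 3)) (Xr (R 0 1)) = (0 :: ('r, 'n) sqm)"
    by (rule br_Xr_zero) (simp_all add: R_eq_zero)
  ultimately have "b \<odot> Xr (R 0 1) = (0 :: ('r, 'n) sqm)" by (simp add: br_add_left)
  from arg_cong[OF this, of "xi (R 0 1)"] have "b = 0" by (simp add: xi_Xr)
  then have "?W = Xr (- R 1 3)" by simp
  then have f13: "py.fixed (R (-1) (-3))"
    unfolding py.fixed_def ZK using KY0 by (simp add: a.Y0_def)
  have cy: "py.comm (R 0 1)"
  proof -
    have "xx (R 0 1) (- t) * xx (R 0 1) 1 = xx (R 0 1) 1 * (xx (R 0 1) (- t) :: ('r, 'n) sqm)"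
      by (rule xx_commute) (simp_all add: R_eq_zero)
    then show ?thesis
      unfolding py.comm_def using commutes_mult[OF _ zc[symmetric], of "R 0 1" "xx (R 0 1) (- t)"]
      by (simp add: y_def cset_def)
  qed
  have sum: "py.fixed (R (i + k) (j + m))" if "py.fixed (R i j)" "py.fixed (R k m)"
    "R i j \<in> \<Phi>" "R k m \<in> \<Phi>" "R (i + k) (j + m) \<in> \<Phi>" "R (k - i) (m - j) \<notin> \<Phi>" for i j k m
    using py.fixed_sum[OF that(3,4) _ _ that(1,2)] that(5,6) by simp
  have s1: "2 *\<^sub>R R 0 1 = R 0 2" "3 *\<^sub>R R 0 1 = R 0 3" by (simp_all add: R_def)
  note fc = fy[of "R 0 1"] fy[of "R 1 3"] fy[of "R (-1) 0"] fy[of "R 2 3"] fy[of "R (-2) (-3)"]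
  have f10: "py.fixed (R 1 0)" using sum[of 2 3 "-1" "-3"] fc f13 by (simp add: cset_def)
  have f12': "py.fixed (R (-1) (-2))" using sum[of 0 1 "-1" "-3"] fc f13 by (simp add: cset_def)
  have f11: "py.fixed (R 1 1)" using sum[of 0 1 1 0] fc f10 by (simp add: cset_def)
  \<comment> \<open>The bracket of \<open>Xr (R 0 1)\<close> and \<open>Xr (R 1 1)\<close> has the
    constant 2 up to sign, so the relation along the whole string is needed.\<close>
  have f12: "py.fixed (R 1 2)"
    using py.fixed_string_3[of "R 0 1" "R 1 0"] cy f10 f11 fc by (simp add: s1 cset_def)
  have f11': "py.fixed (R (-1) (-1))"
    using py.fixed_string_3[of "R 0 1" "R (-1) (-3)"] cy f13 f12' fc by (simp add: s1 cset_def)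
  have f01': "py.fixed (R 0 (-1))" using sum[of 1 0 "-1" "-1"] f10 f11' by simp
  have "py.fixed \<beta>" if b: "\<beta> \<in> \<Phi>" for \<beta>
  proof -
    obtain i j where ij: "(i, j) \<in> g2_coords" "\<beta> = R i j" by (rule root_cases[OF b])
    show ?thesis using ij(1) fc unfolding ij(2) g2_coords_def cset_def
      by (elim insertE emptyE) (simp_all add: f10 f12' f11 f12 f11' f01' f13)
  qed
  then have y1: "y = 1"
    using centralizer_trivial[of y] yG G_GP unfolding py.fixed_def py.Z_def by blast
  have "z = xx (R 0 1) t * xx (R 0 1) (- t) * z" by (simp add: xi01)
  also have "\<dots> = xx (R 0 1) t * y" by (simp add: y_def mult.assoc)
  finally show ?thesis using y1 by auto
qed

end

theorem dph_root_subgroup_G2: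
  assumes "g \<in> \<Phi>"
  shows "D g"
proof -
  have c: "cset \<subseteq> \<Phi>" by (auto simp: cset_def)
  have "{z \<in> G. \<forall>g\<in>cset. z * xx g 1 = xx g 1 * z} = range (xx (R 0 1))"
  proof (rule Set.set_eqI, rule iffI)
    fix z assume "z \<in> {z \<in> G. \<forall>g\<in>cset. z * xx g 1 = xx g 1 * z}"
    then show "z \<in> range (xx (R 0 1))" using centralizer_cset[of z] by auto
  next
    fix z :: "('r, 'n) sqm" assume "z \<in> range (xx (R 0 1))"
    then obtain t where t: "z = xx (R 0 1) t" by blast
    have "xx (R 0 1) t * xx g 1 = xx g 1 * xx (R 0 1) t" if "g \<in> cset" for g
      by (rule xx_commute) (use that in \<open>auto simp: cset_def R_eq_zero\<close>)
    then show "z \<in> {z \<in> G. \<forall>g\<in>cset. z * xx g 1 = xx g 1 * z}"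
      by (simp add: t G_xx)
  qed
  then have s: "D (R 0 1)" using dph_centralizer[OF c] by (simp add: D_def)
  \<comment> \<open>The long roots of G2 form an A2 system, to which the commutator argument
    applies.\<close>
  have l: "D (R 1 0)"
    by (rule D_long[OF long_R[of 1 3] long_R[of 1 0] _ long_R[of 1 0]]) (simp_all add: cn_R)
  obtain i j where ij: "(i, j) \<in> g2_coords" "g = R i j" by (rule root_cases[OF assms])
  have "g \<bullet> g = R 0 1 \<bullet> R 0 1 \<or> g \<bullet> g = R 1 0 \<bullet> R 1 0"
    using ij(1) unfolding ij(2) inner_R g2_coords_def by (elim insertE emptyE) simp_all
  then show ?thesis using D_same_length[OF s assms] D_same_length[OF l assms] by blast
qed

end

context large_group
begin

theorem dph_root_subgroup:
  assumes "\<not> root_system_iso \<Phi> C2" "g \<in> \<Phi>"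
  shows "dph (range (xx g))"
proof (cases "\<exists>a\<in>\<Phi>. \<exists>\<sigma>\<in>\<Phi>. cn a \<sigma> = -3")
  case True
  then obtain a \<sigma> where "a \<in> \<Phi>" "\<sigma> \<in> \<Phi>" "cn a \<sigma> = -3"
    by blast
  then interpret g2_group \<Phi> X a \<sigma> G by unfold_locales
  show ?thesis using dph_root_subgroup_G2[OF assms(2)] by (simp add: D_def)
next
  case False
  then show ?thesis using dph_root_subgroup_not_G2[OF _ assms] by (auto simp: D_def)
qed

end

section \<open>Chevalley groups over a commutative ring\<close>

text \<open>Stated for a bare record, so that it applies before \<open>SL\<close> or the Chevalley
  group is known to be a group.\<close>

lemma m_inv_matrix:
  fixes M :: "('r::comm_ring_1^'n^'n) monoid"
  assumes "mult M = (**)" "one M = mat 1" "B \<in> carrier M" "A ** B = mat 1" "B ** A = mat 1"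
  shows "inv\<^bsub>M\<^esub> A = B"
  unfolding m_inv_def assms(1,2)
proof (rule the_equality)
  fix C assume C: "C \<in> carrier M \<and> A ** C = mat 1 \<and> C ** A = mat 1"
  have "C = C ** (A ** B)" using assms(4) by simp
  also have "\<dots> = C ** A ** B" by (rule matrix_mul_assoc)
  finally show "C = B" using C by simp
qed (use assms in simp)

lemma rep_dpow: "rep (dpow (mk N) k) = divided_power N k"
proof -
  have "rep (mk N ^ k) = (((**) N) ^^ k) (mat 1)"
    by (induction k) (simp_all add: one_sqm_def times_sqm_def)
  then show ?thesis by (simp add: dpow_def sm_def divided_power_def map_matrix_def vec_eq_iff)
qed

context roots
begin

lemma cn_coroot: "cn b a = b \<bullet> coroot a"
  by (simp add: cartan_number_def coroot_def)

text \<open>Simple coroots are nonzero multiples of the simple roots.\<close>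

lemma coroots_independent:
  assumes simple: "simple_roots \<Phi> \<Delta>" and "(\<Sum>d\<in>\<Delta>. e d *\<^sub>R coroot d) = 0" "d \<in> \<Delta>"
  shows "e d = 0"
proof -
  have ind: "independent \<Delta>" and sub: "\<Delta> \<subseteq> \<Phi>"
    using simple by (simp_all add: simple_roots_def)
  then have fin: "finite \<Delta>" using finite_roots finite_subset by blast
  have "(\<Sum>d\<in>\<Delta>. (e d * (2 / (d \<bullet> d))) *\<^sub>R d) = 0"
    using assms(2) by (simp add: coroot_def)
  from independentD[OF ind fin subset_refl this assms(3)]
  have "e d * (2 / (d \<bullet> d)) = 0" .
  then show ?thesis using root_nz[of d] sub assms(3) by auto
qed

lemma orthogonal_roots_zero:
  assumes "\<And>b. b \<in> \<Phi> \<Longrightarrow> b \<bullet> v = 0"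
  shows "v = 0"
proof -
  have "v \<in> span \<Phi>" using span_roots by simp
  then have "orthogonal v v"
    by (rule orthogonal_to_span) (use assms in \<open>auto simp: orthogonal_def inner_commute\<close>)
  then show ?thesis by (simp add: orthogonal_def)
qed

end

section \<open>From the faithful representation to matrices\<close>

locale chev_rep = complex_lie_algebra scale bracket
  for scale :: "complex \<Rightarrow> 'l::ab_group_add \<Rightarrow> 'l" and bracket :: "'l \<Rightarrow> 'l \<Rightarrow> 'l" +
  fixes \<Phi> \<Delta> :: "'e::euclidean_space set" and h x :: "'e \<Rightarrow> 'l" and \<pi> :: "'l \<Rightarrow> complex^'n^'n"
  assumes root_system: "root_system \<Phi>" and indecomposable: "indecomposable \<Phi>"
    and simple: "simple_roots \<Phi> \<Delta>"
    and basis: "chevalley_basis \<Phi> \<Delta> h x"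
    and faithful: "faithful_representation \<pi>"
    and admissible: "admissible_coordinates \<Phi> (\<pi> \<circ> x)"
begin

sublocale irreducible_roots \<Phi> by unfold_locales (fact root_system indecomposable)+

definition p :: "'l \<Rightarrow> (complex, 'n) sqm" where
  "p u = mk (\<pi> u)"

lemma p_add: "p (u + v) = p u + p v"
  and p_scale: "p (scale c u) = c \<odot> p u"
  and p_bracket: "p (bracket u v) = br (p u) (p v)"
  and p_inj: "p u = p v \<longleftrightarrow> u = v"
  using faithful unfolding faithful_representation_def
  by (auto simp: p_def plus_sqm_def minus_sqm_def times_sqm_def br_def sm_def map_matrix_def mk_inject inj_def)

lemma p_zero: "p 0 = 0"
  using p_add[of 0 0] by simp

lemma p_sum: "p (sum f S) = (\<Sum>i\<in>S. p (f i))"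
  by (induction S rule: infinite_finite_induct) (auto simp: p_add p_zero)

lemma basis_facts:
  shows "0 \<notin> x ` \<Phi>"
    and "\<And>d a. d \<in> \<Delta> \<Longrightarrow> a \<in> \<Phi> \<Longrightarrow> bracket (h d) (x a) = scale (of_real (cn a d)) (x a)"
    and "\<And>a. a \<in> \<Phi> \<Longrightarrow> \<exists>c :: 'e \<Rightarrow> int. coroot a = (\<Sum>d\<in>\<Delta>. of_int (c d) *\<^sub>R coroot d) \<and>
        bracket (x a) (x (- a)) = (\<Sum>d\<in>\<Delta>. scale (of_int (c d)) (h d))"
    and "\<And>a b. a \<in> \<Phi> \<Longrightarrow> b \<in> \<Phi> \<Longrightarrow> a + b \<noteq> 0 \<Longrightarrow> a + b \<notin> \<Phi> \<Longrightarrow> bracket (x a) (x b) = 0"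
    and "\<And>a b. a \<in> \<Phi> \<Longrightarrow> b \<in> \<Phi> \<Longrightarrow> a + b \<in> \<Phi> \<Longrightarrow>
      bracket (x a) (x b) = scale (of_nat (rstr \<Phi> a b + 1)) (x (a + b)) \<or>
      bracket (x a) (x b) = scale (- of_nat (rstr \<Phi> a b + 1)) (x (a + b))"
  using basis dependent_zero[of "h ` \<Delta> \<union> x ` \<Phi>"] unfolding chevalley_basis_def rstr_def Let_def by blast+

text \<open>The combination of coroots is orthogonal to all roots, hence 0, and so are its
  coefficients in the simple coroots. The brackets have the same coefficients in the elements
  \<open>h d\<close>. Coroots live in a real space, so real and imaginary parts are treated
  separately.\<close>

lemma p_coroot_relation:
  fixes b :: "'e \<Rightarrow> complex"
  assumes "\<And>\<beta>. \<beta> \<in> \<Phi> \<Longrightarrow> (\<Sum>g\<in>\<Phi>. b g * of_real (cn \<beta> g)) = 0"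
  shows "(\<Sum>g\<in>\<Phi>. b g \<odot> br (p (x g)) (p (x (- g)))) = 0"
proof -
  obtain c :: "'e \<Rightarrow> 'e \<Rightarrow> int" where c: "\<And>\<alpha>. \<alpha> \<in> \<Phi> \<Longrightarrow> coroot \<alpha> = (\<Sum>d\<in>\<Delta>. of_int (c \<alpha> d) *\<^sub>R coroot d)"
    "\<And>\<alpha>. \<alpha> \<in> \<Phi> \<Longrightarrow> bracket (x \<alpha>) (x (- \<alpha>)) = (\<Sum>d\<in>\<Delta>. scale (of_int (c \<alpha> d)) (h d))"
    using bchoice[of \<Phi> "\<lambda>\<alpha> c. coroot \<alpha> = (\<Sum>d\<in>\<Delta>. of_int (c d) *\<^sub>R coroot d) \<and>
        bracket (x \<alpha>) (x (- \<alpha>)) = (\<Sum>d\<in>\<Delta>. scale (of_int (c d)) (h d))"] basis_facts(3) by blast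
  have part: "(\<Sum>g\<in>\<Phi>. a g * of_int (c g d)) = 0"
    if a: "\<And>\<beta>. \<beta> \<in> \<Phi> \<Longrightarrow> (\<Sum>g\<in>\<Phi>. a g * cn \<beta> g) = 0" and d: "d \<in> \<Delta>" for a :: "'e \<Rightarrow> real" and d
  proof (rule coroots_independent[OF simple _ d])
    show "(\<Sum>d\<in>\<Delta>. (\<Sum>g\<in>\<Phi>. a g * of_int (c g d)) *\<^sub>R coroot d) = 0"
    proof (rule orthogonal_roots_zero)
      fix \<beta> assume b: "\<beta> \<in> \<Phi>"
      have "\<beta> \<bullet> (\<Sum>d\<in>\<Delta>. (\<Sum>g\<in>\<Phi>. a g * of_int (c g d)) *\<^sub>R coroot d)
          = (\<Sum>d\<in>\<Delta>. \<Sum>g\<in>\<Phi>. a g * (of_int (c g d) * (\<beta> \<bullet> coroot d)))"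
        by (simp add: inner_sum_right sum_distrib_right mult.assoc)
      also have "\<dots> = (\<Sum>g\<in>\<Phi>. a g * (\<beta> \<bullet> (\<Sum>d\<in>\<Delta>. of_int (c g d) *\<^sub>R coroot d)))"
        by (subst sum.swap) (simp add: inner_sum_right sum_distrib_left)
      also have "\<dots> = (\<Sum>g\<in>\<Phi>. a g * cn \<beta> g)"
        by (rule sum.cong) (simp_all add: cn_coroot c(1)[symmetric])
      finally show "\<beta> \<bullet> (\<Sum>d\<in>\<Delta>. (\<Sum>g\<in>\<Phi>. a g * of_int (c g d)) *\<^sub>R coroot d) = 0"
        using a[OF b] by simp
    qed
  qed
  have zero: "(\<Sum>g\<in>\<Phi>. b g * of_int (c g d)) = 0" if d: "d \<in> \<Delta>" for d
  proof (rule complex_eqI)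
    have "(\<Sum>g\<in>\<Phi>. Re (b g) * cn \<beta> g) = 0" "(\<Sum>g\<in>\<Phi>. Im (b g) * cn \<beta> g) = 0" if "\<beta> \<in> \<Phi>" for \<beta>
      using arg_cong[OF assms[OF that], of Re] arg_cong[OF assms[OF that], of Im] by simp_all
    from part[OF this(1) d] part[OF this(2) d]
    show "Re (\<Sum>g\<in>\<Phi>. b g * of_int (c g d)) = Re 0" "Im (\<Sum>g\<in>\<Phi>. b g * of_int (c g d)) = Im 0"
      by simp_all
  qed
  have "(\<Sum>g\<in>\<Phi>. b g \<odot> br (p (x g)) (p (x (- g)))) = (\<Sum>g\<in>\<Phi>. \<Sum>d\<in>\<Delta>. (b g * of_int (c g d)) \<odot> p (h d))"
    by (rule sum.cong) (simp_all add: c(2) p_sum p_scale sm_sum_right flip: p_bracket)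
  also have "\<dots> = (\<Sum>d\<in>\<Delta>. (\<Sum>g\<in>\<Phi>. b g * of_int (c g d)) \<odot> p (h d))"
    by (subst sum.swap) (simp add: sm_sum_left)
  also have "\<dots> = 0" by (simp add: zero)
  finally show ?thesis .
qed

lemma p_HX:
  assumes a: "a \<in> \<Phi>" and b: "b \<in> \<Phi>"
  shows "br (br (p (x a)) (p (x (- a)))) (p (x b)) = of_real (cn b a) \<odot> p (x b)"
proof -
  obtain c :: "'e \<Rightarrow> int" where c: "coroot a = (\<Sum>d\<in>\<Delta>. of_int (c d) *\<^sub>R coroot d)"
    "bracket (x a) (x (- a)) = (\<Sum>d\<in>\<Delta>. scale (of_int (c d)) (h d))"
    using basis_facts(3)[OF a] by blast
  have "br (p (h d)) (p (x b)) = of_real (cn b d) \<odot> p (x b)" if "d \<in> \<Delta>" for d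
    using basis_facts(2)[OF that b] by (simp add: p_scale flip: p_bracket)
  then have "br (br (p (x a)) (p (x (- a)))) (p (x b)) = (\<Sum>d\<in>\<Delta>. (of_int (c d) * of_real (cn b d)) \<odot> p (x b))"
    unfolding p_bracket[symmetric, of "x a"] c(2) p_sum p_scale br_sum_left
    by (intro sum.cong refl) simp
  also have "\<dots> = of_real (\<Sum>d\<in>\<Delta>. of_int (c d) * cn b d) \<odot> p (x b)"
    by (simp flip: sm_sum_left)
  also have "(\<Sum>d\<in>\<Delta>. of_int (c d) * cn b d) = cn b a"
    unfolding cn_coroot c(1) by (simp add: inner_sum_right)
  finally show ?thesis .
qed

sublocale chev \<Phi> "\<lambda>\<gamma>. p (x \<gamma>)"
proof
  show "p (x \<alpha>) \<noteq> 0" if "\<alpha> \<in> \<Phi>" for \<alpha>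
    using basis_facts(1) that p_inj[of "x \<alpha>" 0] by (auto simp: p_zero)
  show "br (p (x \<alpha>)) (p (x \<beta>)) = 0" if "\<alpha> \<in> \<Phi>" "\<beta> \<in> \<Phi>" "\<alpha> + \<beta> \<noteq> 0" "\<alpha> + \<beta> \<notin> \<Phi>" for \<alpha> \<beta>
    using basis_facts(4)[OF that] by (simp add: p_zero flip: p_bracket)
  show "br (p (x \<alpha>)) (p (x \<beta>)) = of_nat (rstr \<Phi> \<alpha> \<beta> + 1) \<odot> p (x (\<alpha> + \<beta>)) \<or>
      br (p (x \<alpha>)) (p (x \<beta>)) = (- of_nat (rstr \<Phi> \<alpha> \<beta> + 1)) \<odot> p (x (\<alpha> + \<beta>))"
    if "\<alpha> \<in> \<Phi>" "\<beta> \<in> \<Phi>" "\<alpha> + \<beta> \<in> \<Phi>" for \<alpha> \<beta>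
    using basis_facts(5)[OF that] unfolding p_bracket[symmetric] p_scale[symmetric] p_inj .
  show "zint (dpow (p (x \<alpha>)) k)" if "\<alpha> \<in> \<Phi>" for \<alpha> k
    using admissible that unfolding zint_def ent_def p_def rep_dpow admissible_coordinates_def by simp
qed (fact p_HX p_coroot_relation)+

lemma rep_xx: "rep (xx g t) = exp_matrix (\<pi> (x g)) t"
proof -
  have "ent (xx g t) i j = exp_matrix (\<pi> (x g)) t $ i $ j" for i j
    unfolding xx_def XR_def exp_matrix_def
    by (simp add: ent_sum fl_def mp_def map_matrix_def p_def mult.commute)
      (simp add: ent_def rep_dpow)
  then show ?thesis by (simp add: ent_def vec_eq_iff)
qed

text \<open>\<open>EC\<close> is defined without inverses, but the inverse of a root element is the
  one with the negated parameter.\<close>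

lemma elementary_complex: "(elementary_subgroup \<Phi> (\<pi> \<circ> x) :: (complex^'n^'n) set) = rep ` EC"
proof (rule Set.set_eqI, rule iffI)
  fix A :: "complex^'n^'n"
  have gen: "rep (xx \<gamma> t) \<in> generate SL (\<Union>a\<in>\<Phi>. root_subgroup (\<pi> \<circ> x) a)" if "\<gamma> \<in> \<Phi>" for \<gamma> and t :: complex
    by (rule generate.incl) (use that in \<open>auto simp: root_subgroup_def rep_xx\<close>)
  {
    assume "A \<in> elementary_subgroup \<Phi> (\<pi> \<circ> x)"
    then show "A \<in> rep ` EC" unfolding elementary_subgroup_def
    proof (induction rule: generate.induct)
      case one
      then show ?case using EC_one by (force simp: SL_def one_sqm_def)
    next
      case (incl A)
      then show ?case using EC_xx by (auto simp: root_subgroup_def simp flip: rep_xx)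
    next
      case (inv A)
      then obtain \<gamma> t where g: "\<gamma> \<in> \<Phi>" "A = rep (xx \<gamma> t)"
        by (auto simp: root_subgroup_def simp flip: rep_xx)
      have "inv\<^bsub>SL\<^esub> A = rep (xx \<gamma> (- t))"
      proof (rule m_inv_matrix)
        have e: "rep (xx \<gamma> u * xx \<gamma> v) = rep (xx \<gamma> u) ** rep (xx \<gamma> v)" for u v :: complex
          by (simp add: times_sqm_def)
        show "A ** rep (xx \<gamma> (- t)) = mat 1" "rep (xx \<gamma> (- t)) ** A = mat 1"
          unfolding g(2) e[symmetric] by (simp_all add: xx_inverse g(1)) (simp_all add: one_sqm_def)
      qed (simp_all add: SL_def det_xx_complex g(1))
      then show ?case using EC_xx[OF g(1)] by auto
    next
      case (eng A B)
      then obtain A' B' where "A = rep A'" "B = rep B'" "A' \<in> EC" "B' \<in> EC" by blast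
      then show ?case using EC_mult[of A' B'] by (force simp: SL_def times_sqm_def)
    qed
  next
    assume "A \<in> rep ` EC"
    then obtain A' where A: "A = rep A'" "A' \<in> EC" by blast
    have "rep A' \<in> generate SL (\<Union>a\<in>\<Phi>. root_subgroup (\<pi> \<circ> x) a)"
      using A(2)
    proof (induction rule: EC_induct)
      case one
      show ?case using generate.one[of SL] by (simp add: SL_def one_sqm_def)
    next
      case (mult \<gamma> t A)
      have "rep (xx \<gamma> t * A) = mult SL (rep (xx \<gamma> t)) (rep A)"
        by (simp add: SL_def times_sqm_def)
      then show ?case using generate.eng[OF gen[OF mult(1)] mult(3)] by simp
    qed
    then show "A \<in> elementary_subgroup \<Phi> (\<pi> \<circ> x)"
      by (simp add: A(1) elementary_subgroup_def)
  }
qed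

lemma carrier_chevalley_group: "A \<in> carrier (chevalley_group \<Phi> (\<pi> \<circ> x)) \<longleftrightarrow> mk A \<in> GP"
  unfolding chevalley_group_def chevalley_equations_def elementary_complex GP_def points_def
  by (auto simp: SL_def)

lemma chevalley_group_simps: "mult (chevalley_group \<Phi> (\<pi> \<circ> x)) = (**)" "one (chevalley_group \<Phi> (\<pi> \<circ> x)) = mat 1"
  by (simp_all add: chevalley_group_def SL_def)

lemma inv_chevalley_group:
  assumes "A \<in> carrier (chevalley_group \<Phi> (\<pi> \<circ> x))"
  shows "inv\<^bsub>chevalley_group \<Phi> (\<pi> \<circ> x)\<^esub> A = rep (adj (mk A))"
proof -
  have z: "mk A \<in> GP" using assms by (simp add: carrier_chevalley_group)
  have "rep (mk A * adj (mk A)) = mat 1" "rep (adj (mk A) * mk A) = mat 1"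
    unfolding points_adj(1,2)[OF z] by (simp_all add: one_sqm_def)
  then show ?thesis
    by (intro m_inv_matrix)
      (simp_all add: chevalley_group_simps carrier_chevalley_group points_adj(3)[OF z] times_sqm_def)
qed

theorem root_subgroup_diophantine:
  assumes large: "large_subgroup (G :: ('r::comm_ring_1^'n^'n) set) \<Phi> (\<pi> \<circ> x)"
    and rank: "DIM('e) > 1" and noC2: "\<not> root_system_iso \<Phi> C2" and a: "a \<in> \<Phi>"
  shows "diophantine_with_constants ((chevalley_group \<Phi> (\<pi> \<circ> x))\<lparr>carrier := G\<rparr>)
    {exp_matrix ((\<pi> \<circ> x) b) 1 | b. b \<in> \<Phi>} (root_subgroup (\<pi> \<circ> x) a)"
proof -
  let ?M = "chevalley_group \<Phi> (\<pi> \<circ> x) :: ('r^'n^'n) monoid"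
  have sub: "subgroup G ?M" and el: "elementary_subgroup \<Phi> (\<pi> \<circ> x) \<subseteq> G"
    using large by (simp_all add: large_subgroup_def)
  have mkG: "z \<in> mk ` G \<longleftrightarrow> rep z \<in> G" for z
    by (metis image_iff mk_rep rep_mk)
  interpret large_group \<Phi> "\<lambda>g. p (x g)" "mk ` G"
  proof
    show "mk ` G \<subseteq> GP"
      using subgroup.subset[OF sub] by (auto simp flip: carrier_chevalley_group)
    show "y * z \<in> mk ` G" if "y \<in> mk ` G" "z \<in> mk ` G" for y z
      using subgroup.m_closed[OF sub, of "rep y" "rep z"] that unfolding mkG
      by (simp add: chevalley_group_simps times_sqm_def)
    show "adj z \<in> mk ` G" if "z \<in> mk ` G" for z
    proof -
      have "rep z \<in> G" using that by (simp add: mkG)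
      then have "rep z \<in> carrier ?M" "inv\<^bsub>?M\<^esub> (rep z) \<in> G"
        using subgroup.subset[OF sub] subgroup.m_inv_closed[OF sub] by auto
      then show ?thesis by (simp add: mkG inv_chevalley_group)
    qed
    show "xx g t \<in> mk ` G" if "g \<in> \<Phi>" for g t
    proof -
      have "rep (xx g t) \<in> elementary_subgroup \<Phi> (\<pi> \<circ> x)"
        unfolding elementary_subgroup_def
        by (rule generate.incl) (use that in \<open>auto simp: root_subgroup_def rep_xx\<close>)
      then show ?thesis using el by (auto simp: mkG)
    qed
  qed (fact rank)
  have iso: "rep \<in> iso gm (?M\<lparr>carrier := G\<rparr>)"
    unfolding iso_def hom_def bij_betw_def
    by (auto simp: gm_def chevalley_group_simps times_sqm_def inj_on_def rep_inject image_image)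
  \<comment> \<open>Inverses are inherited along the isomorphism, so only the monoid laws are
    checked directly.\<close>
  have "monoid (?M\<lparr>carrier := G\<rparr>)"
    using subgroup.m_closed[OF sub] subgroup.one_closed[OF sub]
    by (intro monoidI) (simp_all add: chevalley_group_simps matrix_mul_assoc)
  then have grp: "group (?M\<lparr>carrier := G\<rparr>)"
    using gm.iso_imp_group[of "?M\<lparr>carrier := G\<rparr>"] iso by (auto simp: is_iso_def)
  have "diophantine_with_constants (?M\<lparr>carrier := G\<rparr>) (rep ` consts1) (rep ` range (xx a))"
    by (rule diophantine_iso[OF gm.group_axioms grp iso dph_root_subgroup[OF noC2 a, unfolded dph_def]])
  moreover have "rep ` consts1 = {exp_matrix ((\<pi> \<circ> x) b) 1 | b. b \<in> \<Phi>}"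
    unfolding consts1_def by (simp add: Setcompr_eq_image image_image rep_xx)
  moreover have "(rep ` range (xx a) :: ('r^'n^'n) set) = root_subgroup (\<pi> \<circ> x) a"
    unfolding root_subgroup_def image_image rep_xx o_apply ..
  ultimately show ?thesis by simp
qed

end

theorem proposition3:
  fixes \<Phi> \<Delta> :: "'e::euclidean_space set"
    and scale :: "complex \<Rightarrow> 'l::ab_group_add \<Rightarrow> 'l"
    and bracket :: "'l \<Rightarrow> 'l \<Rightarrow> 'l"
    and h x :: "'e \<Rightarrow> 'l"
    and \<pi> :: "'l \<Rightarrow> complex^'n^'n"
    and G :: "('r::comm_ring_1^'n^'n) set"
    and \<alpha> :: 'e
  assumes "root_system \<Phi>" and "indecomposable \<Phi>" and "DIM('e) > 1"
    and "\<not> root_system_iso \<Phi> C2"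
    and "simple_roots \<Phi> \<Delta>"
    and "complex_lie_algebra scale bracket"
    and "complex_lie_algebra.semisimple scale bracket"
    and "complex_lie_algebra.chevalley_basis scale bracket \<Phi> \<Delta> h x"
    and "complex_lie_algebra.faithful_representation scale bracket \<pi>"
    and "admissible_coordinates \<Phi> (\<pi> \<circ> x)"
    and "large_subgroup G \<Phi> (\<pi> \<circ> x)"
    and "\<alpha> \<in> \<Phi>"
  shows "diophantine_with_constants ((chevalley_group \<Phi> (\<pi> \<circ> x))\<lparr>carrier := G\<rparr>)
           {exp_matrix ((\<pi> \<circ> x) \<beta>) 1 | \<beta>. \<beta> \<in> \<Phi>} (root_subgroup (\<pi> \<circ> x) \<alpha>)"
proof -
  interpret chev_rep scale bracket \<Phi> \<Delta> h x \<pi>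
    by (intro chev_rep.intro chev_rep_axioms.intro assms)
  show ?thesis by (rule root_subgroup_diophantine[OF assms(11,3,4,12)])
qed

end
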